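(* Let $A$ be a positively graded commutative DG $A_0$-algebra (i.e. a DG $R$-algebra with $R=A_0$) such that $(A_0,\mathfrak m_0)$ is a local noetherian ring, and assume that $A$ is homologically finite as an $A_0$-complex and that $A$ is a local noetherian DG $A_0$-algebra. (a) Given a (finite) sequence $\mathbf x$ in $\mathfrak m_0$, the following conditions are equivalent: (i) $\mathbf x$ is a system of parameters for the $A_0$-complex $A$; (ii) $\mathbf x$ is a system of parameters for $\operatorname{H}_0(A)$; (iii) $\mathbf x$ is a length system of parameters for the $A_0$-complex $A$. (b) One has $\operatorname{ldim}_{A_0}(A)=\dim_{A_0}(A)=\dim(\operatorname{H}_0(A))$. (c) If $A$ is generated over $A_0$ in odd degrees or if $A$ is bounded, then $\operatorname{DGdim}(A)=\operatorname{ldim}_{A_0}(A)=\dim_{A_0}(A)=\dim(\operatorname{H}_0(A))$.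
   Context: All base rings $R$ are commutative noetherian with identity. An $R$-complex is a chain complex of $R$-modules indexed homologically (the differential lowers degree by 1). Elements of complexes are homogeneous, and $|x|=i$ means $x\in X_i$. **DG algebras.** A positively graded commutative differential graded $R$-algebra (DG $R$-algebra for short) is an $R$-complex $A$ with an $R$-bilinear product $(a,b)\mapsto ab$ that is associative, distributive, unital (with $1\in A_0$), graded commutative ($ba=(-1)^{|a||b|}ab\in A_{|a|+|b|}$, and $a^2=0$ when $|a|$ is odd), positively graded ($A_i=0$ for $i<0$), and satisfies the Leibniz rule $\partial^A(ab)=\partial^A(a)b+(-1)^{|a|}a\,\partial^A(b)$. The underlying graded algebra is $A^{\natural}=\bigoplus_{i\ge 0}A_i$. $A$ is noetherian if $\operatorname{H}_0(A)$ is noetherian and each $\operatorname{H}_i(A)$ is a finitely generated $\operatorname{H}_0(A)$-module. $A$ is local if it is noetherian, $R$ is local with maximal ideal $\mathfrak m$, and $\operatorname{H}_0(A)$ is a local ring whose maximal ideal contains $\mathfrak m\operatorname{H}_0(A)$. $A$ is bounded if $A_i=0$ for all $i\gg 0$. $A$ is generated over $A_0$ in odd degrees if $A^{\natural}$ is generated as an $A_0$-algebra by elements of odd degree. A DG ideal of $A$ is a subcomplex $I\subseteq A$ closed under multiplication by elements of $A$ (so $I^\natural$ is a graded ideal of $A^\natural$ and $\partial^A(I)\subseteq I$). It is prime if $I^\natural=\bigoplus_i I_i$ is a prime ideal of $A^\natural$. The DG Krull dimension $\operatorname{DGdim}(A)$ is the supremum of lengths of chains of DG prime ideals of $A$. **Dimension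 and parameters for complexes.** For an $R$-complex $X$: $\inf(X)=\inf\{i\in\mathbb Z\mid \operatorname{H}_i(X)\ne0\}$; $X$ is homologically finite if $\coprod_{i}\operatorname{H}_i(X)$ is finitely generated over $R$; $\operatorname{Supp}_R(X)=\bigcup_i\operatorname{Supp}_R(\operatorname{H}_i(X))$; and $\dim_R(X)=\sup\{\dim(R/\mathfrak p)-\inf(X_{\mathfrak p})\mid \mathfrak p\in\operatorname{Supp}_R(X)\}$. If $\inf(X)>-\infty$, a prime $\mathfrak p\in\operatorname{Spec}(R)$ is an anchor prime for $X$ if $\dim_{R_{\mathfrak p}}(X_{\mathfrak p})=-\inf(X_{\mathfrak p})$; the set of anchor primes is $\operatorname{Anc}_R(X)$. $K^R(\mathbf x)$ is the Koszul complex on a sequence $\mathbf x$ in $R$. Let $(R,\mathfrak m)$ be local and $X$ a homologically finite $R$-complex. A system of parameters for $X$ is a sequence $\mathbf x=x_1,\dots,x_d\in\mathfrak m$ such that $\mathfrak m\in\operatorname{Anc}_R(K^R(\mathbf x)\otimes_R X)$ and $d=\dim_R(X)+\inf(X)$. A length sequence for $X$ is a sequence $\mathbf x=x_1,\dots,x_d\in\mathfrak m$ such that each $\operatorname{H}_i(K^R(\mathbf x)\otimes_R X)$ has finite length over $R$. If $m$ is the length of the shortest length sequence for $X$, then $\operatorname{ldim}_R(X)=m-\inf(X)$, and a length system of parameters for $X$ is a length sequence $x_1,\dots,x_m$ for $X$ with $m=\operatorname{ldim}_R(X)+\inf(X)$ (i.e. one of shortest possible length). A system of parameters for $\operatorname{H}_0(A)$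 has the usual meaning for the finitely generated $A_0$-module $\operatorname{H}_0(A)=A_0/\operatorname{im}(\partial_1^A)$: a sequence in $\mathfrak m_0$ of length $\dim(\operatorname{H}_0(A))$ such that $\operatorname{H}_0(A)/(\mathbf x)\operatorname{H}_0(A)$ has finite length. *)

theory Defs
  imports "HOL-Algebra.Module" "HOL-Algebra.QuotRing" "HOL-Algebra.Ring_Divisibility"
    "HOL-Algebra.Generated_Rings" "HOL-Library.Extended_Real"
begin

section \<open>Rings and modules\<close>

text \<open>The supremum of the \<open>n\<close> for which there is a strict chain
  \<open>C 0 \<subset> C 1 \<subset> \<dots> \<subset> C n\<close> in the family \<open>F\<close>; it is \<open>-\<infinity>\<close> if \<open>F\<close> is empty.\<close>

definition sup_chain_length :: "'a set set \<Rightarrow> ereal" where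
  "sup_chain_length F =
     Sup {ereal (real n) | n. \<exists>C. (\<forall>i\<le>n. C i \<in> F) \<and> (\<forall>i<n. C i \<subset> C (Suc i))}"

definition krull_dim :: "('r, 'x) ring_scheme \<Rightarrow> ereal" where
  "krull_dim R = sup_chain_length {P. primeideal P R}"

definition local_ring :: "('r, 'x) ring_scheme \<Rightarrow> 'r set \<Rightarrow> bool" where
  "local_ring R \<mm> \<longleftrightarrow> cring R \<and> {I. maximalideal I R} = {\<mm>}"

text \<open>The library's module records extend ring records. The multiplication and unit of such a
  record play no role for a module and are left unspecified.\<close>

definition module_record ::
  "'m set \<Rightarrow> ('m \<Rightarrow> 'm \<Rightarrow> 'm) \<Rightarrow> 'm \<Rightarrow> ('r \<Rightarrow> 'm \<Rightarrow> 'm) \<Rightarrow> ('r, 'm) module" where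
  "module_record C pl z sm =
     \<lparr>carrier = C, monoid.mult = undefined, monoid.one = undefined,
      ring.zero = z, ring.add = pl, smult = sm\<rparr>"

definition gen_submodule ::
  "('r, 'x) ring_scheme \<Rightarrow> ('r, 'm, 'y) module_scheme \<Rightarrow> 'm set \<Rightarrow> 'm set" where
  "gen_submodule R M S = \<Inter>{N. submodule N R M \<and> S \<subseteq> N}"

definition fg_module ::
  "('r, 'x) ring_scheme \<Rightarrow> ('r, 'm, 'y) module_scheme \<Rightarrow> bool" where
  "fg_module R M \<longleftrightarrow> (\<exists>S \<subseteq> carrier M. finite S \<and> gen_submodule R M S = carrier M)"

definition module_length ::
  "('r, 'x) ring_scheme \<Rightarrow> ('r, 'm, 'y) module_scheme \<Rightarrow> ereal" where
  "module_length R M = sup_chain_length {N. submodule N R M}"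

definition finite_length ::
  "('r, 'x) ring_scheme \<Rightarrow> ('r, 'm, 'y) module_scheme \<Rightarrow> bool" where
  "finite_length R M \<longleftrightarrow> module_length R M < \<infinity>"

definition module_quot ::
  "('r, 'm, 'y) module_scheme \<Rightarrow> 'm set \<Rightarrow> ('r, 'm set) module" where
  "module_quot M N = module_record (a_rcosets\<^bsub>M\<^esub> N) (set_add M) N
     (\<lambda>r T. \<Union>x\<in>T. N +>\<^bsub>M\<^esub> (r \<odot>\<^bsub>M\<^esub> x))"

definition annihilator ::
  "('r, 'x) ring_scheme \<Rightarrow> ('r, 'm, 'y) module_scheme \<Rightarrow> 'r set" where
  "annihilator R M = {r \<in> carrier R. \<forall>x\<in>carrier M. r \<odot>\<^bsub>M\<^esub> x = \<zero>\<^bsub>M\<^esub>}"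

definition module_dim ::
  "('r, 'x) ring_scheme \<Rightarrow> ('r, 'm, 'y) module_scheme \<Rightarrow> ereal" where
  "module_dim R M = krull_dim (R Quot annihilator R M)"

text \<open>Systems of parameters of a finitely generated module over a local ring \<open>(R, \<mm>)\<close>.\<close>

definition module_sop ::
  "('r, 'x) ring_scheme \<Rightarrow> 'r set \<Rightarrow> ('r, 'm, 'y) module_scheme \<Rightarrow> 'r list \<Rightarrow> bool" where
  "module_sop R \<mm> M xs \<longleftrightarrow>
     set xs \<subseteq> \<mm> \<and>
     ereal (real (length xs)) = module_dim R M \<and>
     finite_length R
       (module_quot M (gen_submodule R M {x \<odot>\<^bsub>M\<^esub> y | x y. x \<in> set xs \<and> y \<in> carrier M}))"

text \<open>External direct sum: families of finite support.\<close>

definition direct_sum :: "('i \<Rightarrow> ('r, 'm) module) \<Rightarrow> ('r, 'i \<Rightarrow> 'm) module" where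
  "direct_sum M = module_record
     {f. (\<forall>i. f i \<in> carrier (M i)) \<and> finite {i. f i \<noteq> \<zero>\<^bsub>M i\<^esub>}}
     (\<lambda>f g i. f i \<oplus>\<^bsub>M i\<^esub> g i) (\<lambda>i. \<zero>\<^bsub>M i\<^esub>) (\<lambda>r f i. r \<odot>\<^bsub>M i\<^esub> f i)"

text \<open>The free module on the set \<open>B\<close>: functions of finite support contained in \<open>B\<close>.\<close>

definition free_module :: "('r, 'x) ring_scheme \<Rightarrow> 'b set \<Rightarrow> ('r, 'b \<Rightarrow> 'r) module" where
  "free_module R B = module_record
     {f. (\<forall>b. f b \<in> carrier R) \<and> finite {b. f b \<noteq> \<zero>\<^bsub>R\<^esub>} \<and> {b. f b \<noteq> \<zero>\<^bsub>R\<^esub>} \<subseteq> B}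
     (\<lambda>f g b. f b \<oplus>\<^bsub>R\<^esub> g b) (\<lambda>b. \<zero>\<^bsub>R\<^esub>) (\<lambda>r f b. r \<otimes>\<^bsub>R\<^esub> f b)"

definition basis_vec :: "('r, 'x) ring_scheme \<Rightarrow> 'b \<Rightarrow> 'b \<Rightarrow> 'r" where
  "basis_vec R b = (\<lambda>c. if c = b then \<one>\<^bsub>R\<^esub> else \<zero>\<^bsub>R\<^esub>)"

text \<open>\<open>signed M k x\<close> is \<open>(-1)\<^sup>k x\<close>, computed in the additive group of \<open>M\<close>.\<close>

definition signed :: "('m, 'x) ring_scheme \<Rightarrow> int \<Rightarrow> 'm \<Rightarrow> 'm" where
  "signed M k x = (if even k then x else \<ominus>\<^bsub>M\<^esub> x)"


subsection \<open>Tensor products\<close>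

text \<open>\<open>M \<otimes> N\<close> is the quotient of the free module on \<open>M \<times> N\<close> by the bilinearity relations.\<close>

definition tensor_free ::
  "('r, 'x) ring_scheme \<Rightarrow> ('r, 'm) module \<Rightarrow> ('r, 'n) module \<Rightarrow> ('r, 'm \<times> 'n \<Rightarrow> 'r) module" where
  "tensor_free R M N = free_module R (carrier M \<times> carrier N)"

definition tensor_relations ::
  "('r, 'x) ring_scheme \<Rightarrow> ('r, 'm) module \<Rightarrow> ('r, 'n) module \<Rightarrow> ('m \<times> 'n \<Rightarrow> 'r) set" where
  "tensor_relations R M N = (let F = tensor_free R M N; e = basis_vec R in
     gen_submodule R F
      ({e (m \<oplus>\<^bsub>M\<^esub> m', n) \<ominus>\<^bsub>F\<^esub> (e (m, n) \<oplus>\<^bsub>F\<^esub> e (m', n)) | m m' n.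
          m \<in> carrier M \<and> m' \<in> carrier M \<and> n \<in> carrier N} \<union>
       {e (m, n \<oplus>\<^bsub>N\<^esub> n') \<ominus>\<^bsub>F\<^esub> (e (m, n) \<oplus>\<^bsub>F\<^esub> e (m, n')) | m n n'.
          m \<in> carrier M \<and> n \<in> carrier N \<and> n' \<in> carrier N} \<union>
       {e (r \<odot>\<^bsub>M\<^esub> m, n) \<ominus>\<^bsub>F\<^esub> (r \<odot>\<^bsub>F\<^esub> e (m, n)) | r m n.
          r \<in> carrier R \<and> m \<in> carrier M \<and> n \<in> carrier N} \<union>
       {e (m, r \<odot>\<^bsub>N\<^esub> n) \<ominus>\<^bsub>F\<^esub> (r \<odot>\<^bsub>F\<^esub> e (m, n)) | r m n.
          r \<in> carrier R \<and> m \<in> carrier M \<and> n \<in> carrier N}))"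

definition tensor_prod ::
  "('r, 'x) ring_scheme \<Rightarrow> ('r, 'm) module \<Rightarrow> ('r, 'n) module \<Rightarrow> ('r, ('m \<times> 'n \<Rightarrow> 'r) set) module" where
  "tensor_prod R M N = module_quot (tensor_free R M N) (tensor_relations R M N)"

definition pure_tensor ::
  "('r, 'x) ring_scheme \<Rightarrow> ('r, 'm) module \<Rightarrow> ('r, 'n) module \<Rightarrow> 'm \<Rightarrow> 'n \<Rightarrow> ('m \<times> 'n \<Rightarrow> 'r) set" where
  "pure_tensor R M N m n =
     tensor_relations R M N +>\<^bsub>tensor_free R M N\<^esub> basis_vec R (m, n)"

text \<open>The linear map out of a tensor product induced by a bilinear map \<open>h\<close> to \<open>P\<close>. It is evaluated
  on a representative; bilinearity makes the value independent of the choice.\<close>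

definition tensor_lift ::
  "('r, 'x) ring_scheme \<Rightarrow> ('r, 'p) module \<Rightarrow> ('m \<Rightarrow> 'n \<Rightarrow> 'p) \<Rightarrow> ('m \<times> 'n \<Rightarrow> 'r) set \<Rightarrow> 'p" where
  "tensor_lift R P h T = (let \<phi> = (SOME \<phi>. \<phi> \<in> T) in
     (\<Oplus>\<^bsub>P\<^esub> p \<in> {p. \<phi> p \<noteq> \<zero>\<^bsub>R\<^esub>}. \<phi> p \<odot>\<^bsub>P\<^esub> h (fst p) (snd p)))"

text \<open>\<open>f \<otimes> g\<close> for homomorphisms \<open>f\<close> to \<open>M'\<close> and \<open>g\<close> to \<open>N'\<close>.\<close>

definition tensor_map ::
  "('r, 'x) ring_scheme \<Rightarrow> ('r, 'p) module \<Rightarrow> ('r, 'q) module \<Rightarrow> ('m \<Rightarrow> 'p) \<Rightarrow> ('n \<Rightarrow> 'q) \<Rightarrow>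
     ('m \<times> 'n \<Rightarrow> 'r) set \<Rightarrow> ('p \<times> 'q \<Rightarrow> 'r) set" where
  "tensor_map R M' N' f g =
     tensor_lift R (tensor_prod R M' N') (\<lambda>m n. pure_tensor R M' N' (f m) (g n))"


subsection \<open>Localization\<close>

text \<open>The fraction \<open>m/s\<close>, as an equivalence class of pairs.\<close>

definition fraction ::
  "'r set \<Rightarrow> ('r, 'm) module \<Rightarrow> 'm \<Rightarrow> 'r \<Rightarrow> ('m \<times> 'r) set" where
  "fraction S M m s =
     {(n, t). n \<in> carrier M \<and> t \<in> S \<and> (\<exists>u\<in>S. u \<odot>\<^bsub>M\<^esub> (t \<odot>\<^bsub>M\<^esub> m) = u \<odot>\<^bsub>M\<^esub> (s \<odot>\<^bsub>M\<^esub> n))}"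

definition loc_module ::
  "('r, 'x) ring_scheme \<Rightarrow> 'r set \<Rightarrow> ('r, 'm) module \<Rightarrow> (('r \<times> 'r) set, ('m \<times> 'r) set) module" where
  "loc_module R S M = module_record
     {fraction S M m s | m s. m \<in> carrier M \<and> s \<in> S}
     (\<lambda>T U. \<Union>(m, s)\<in>T. \<Union>(n, t)\<in>U. fraction S M (t \<odot>\<^bsub>M\<^esub> m \<oplus>\<^bsub>M\<^esub> s \<odot>\<^bsub>M\<^esub> n) (s \<otimes>\<^bsub>R\<^esub> t))
     (fraction S M \<zero>\<^bsub>M\<^esub> \<one>\<^bsub>R\<^esub>)
     (\<lambda>V T. \<Union>(r, u)\<in>V. \<Union>(m, s)\<in>T. fraction S M (r \<odot>\<^bsub>M\<^esub> m) (u \<otimes>\<^bsub>R\<^esub> s))"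

definition self_module :: "('r, 'x) ring_scheme \<Rightarrow> ('r, 'r) module" where
  "self_module R = module_record (carrier R) (ring.add R) \<zero>\<^bsub>R\<^esub> (monoid.mult R)"

definition loc_ring ::
  "('r, 'x) ring_scheme \<Rightarrow> 'r set \<Rightarrow> (('r \<times> 'r) set) ring" where
  "loc_ring R S = (let L = loc_module R S (self_module R) in
     \<lparr>carrier = carrier L, monoid.mult = smult L,
      monoid.one = fraction S (self_module R) \<one>\<^bsub>R\<^esub> \<one>\<^bsub>R\<^esub>,
      ring.zero = ring.zero L, ring.add = ring.add L\<rparr>)"

definition ring_at :: "('r, 'x) ring_scheme \<Rightarrow> 'r set \<Rightarrow> (('r \<times> 'r) set) ring" where
  "ring_at R \<pp> = loc_ring R (carrier R - \<pp>)"

definition module_at ::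
  "('r, 'x) ring_scheme \<Rightarrow> 'r set \<Rightarrow> ('r, 'm) module \<Rightarrow> (('r \<times> 'r) set, ('m \<times> 'r) set) module" where
  "module_at R \<pp> M = loc_module R (carrier R - \<pp>) M"

definition module_supp :: "('r, 'x) ring_scheme \<Rightarrow> ('r, 'm) module \<Rightarrow> 'r set set" where
  "module_supp R M =
     {\<pp>. primeideal \<pp> R \<and> carrier (module_at R \<pp> M) \<noteq> {\<zero>\<^bsub>module_at R \<pp> M\<^esub>}}"


section \<open>Complexes\<close>

text \<open>\<open>obj X i\<close> is the module in degree \<open>i\<close>, and \<open>bd X i\<close> maps it to \<open>obj X (i - 1)\<close>.\<close>

record ('r, 'm) cplx =
  obj :: "int \<Rightarrow> ('r, 'm) module"
  bd :: "int \<Rightarrow> 'm \<Rightarrow> 'm"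

definition cycles :: "('r, 'm) cplx \<Rightarrow> int \<Rightarrow> 'm set" where
  "cycles X i = {x \<in> carrier (obj X i). bd X i x = \<zero>\<^bsub>obj X (i - 1)\<^esub>}"

definition boundaries :: "('r, 'm) cplx \<Rightarrow> int \<Rightarrow> 'm set" where
  "boundaries X i = bd X (i + 1) ` carrier (obj X (i + 1))"

definition homology :: "('r, 'm) cplx \<Rightarrow> int \<Rightarrow> ('r, 'm set) module" where
  "homology X i = module_quot ((obj X i)\<lparr>carrier := cycles X i\<rparr>) (boundaries X i)"

definition homologically_finite :: "('r, 'x) ring_scheme \<Rightarrow> ('r, 'm) cplx \<Rightarrow> bool" where
  "homologically_finite R X \<longleftrightarrow> fg_module R (direct_sum (homology X))"

definition cinf :: "('r, 'm) cplx \<Rightarrow> ereal" where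
  "cinf X = Inf {ereal (of_int i) | i. carrier (homology X i) \<noteq> {\<zero>\<^bsub>homology X i\<^esub>}}"

definition csupp :: "('r, 'x) ring_scheme \<Rightarrow> ('r, 'm) cplx \<Rightarrow> 'r set set" where
  "csupp R X = (\<Union>i. module_supp R (homology X i))"

definition cplx_at ::
  "('r, 'x) ring_scheme \<Rightarrow> 'r set \<Rightarrow> ('r, 'm) cplx \<Rightarrow> (('r \<times> 'r) set, ('m \<times> 'r) set) cplx" where
  "cplx_at R \<pp> X =
     \<lparr>obj = (\<lambda>i. module_at R \<pp> (obj X i)),
      bd = (\<lambda>i T. \<Union>(m, s)\<in>T. fraction (carrier R - \<pp>) (obj X (i - 1)) (bd X i m) s)\<rparr>"

text \<open>No difference \<open>\<infinity> - \<infinity>\<close> arises: \<open>cinf (cplx_at R \<pp> X) < \<infinity>\<close> for \<open>\<pp>\<close> in the support.\<close>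

definition cdim :: "('r, 'x) ring_scheme \<Rightarrow> ('r, 'm) cplx \<Rightarrow> ereal" where
  "cdim R X = Sup {krull_dim (R Quot \<pp>) - cinf (cplx_at R \<pp> X) | \<pp>. \<pp> \<in> csupp R X}"

definition anchor_primes :: "('r, 'x) ring_scheme \<Rightarrow> ('r, 'm) cplx \<Rightarrow> 'r set set" where
  "anchor_primes R X =
     {\<pp>. primeideal \<pp> R \<and> cinf X > -\<infinity> \<and>
         cdim (ring_at R \<pp>) (cplx_at R \<pp> X) = - cinf (cplx_at R \<pp> X)}"

text \<open>In the component of degree \<open>n\<close>, \<open>z i\<close> lies in \<open>X\<^sub>i \<otimes> Y\<^sub>n\<^sub>-\<^sub>i\<close>; the differential is
  \<open>x \<otimes> y \<mapsto> \<partial>x \<otimes> y + (-1)\<^sup>|\<^sup>x\<^sup>| x \<otimes> \<partial>y\<close>.\<close>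

definition tensor_cplx ::
  "('r, 'x) ring_scheme \<Rightarrow> ('r, 'm) cplx \<Rightarrow> ('r, 'n) cplx \<Rightarrow>
     ('r, int \<Rightarrow> ('m \<times> 'n \<Rightarrow> 'r) set) cplx" where
  "tensor_cplx R X Y =
     \<lparr>obj = (\<lambda>n. direct_sum (\<lambda>i. tensor_prod R (obj X i) (obj Y (n - i)))),
      bd = (\<lambda>n z i. let M = obj X i; N = obj Y (n - 1 - i); T = tensor_prod R M N in
              tensor_map R M N (bd X (i + 1)) id (z (i + 1)) \<oplus>\<^bsub>T\<^esub>
              signed T i (tensor_map R M N id (bd Y (n - i)) (z i)))\<rparr>"

text \<open>The Koszul complex on \<open>x\<^sub>0, \<dots>, x\<^sub>d\<^sub>-\<^sub>1\<close> is the exterior algebra on \<open>e\<^sub>0, \<dots>, e\<^sub>d\<^sub>-\<^sub>1\<close> with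
  \<open>\<partial> e\<^sub>i = x\<^sub>i\<close>. In degree \<open>n\<close> it is free on the subsets \<open>I\<close> with \<open>n\<close> elements, where \<open>I\<close> stands for
  the increasing wedge product of the \<open>e\<^sub>i\<close>, \<open>i \<in> I\<close>. The coefficient at \<open>J\<close> of the boundary collects
  the contributions of the sets \<open>insert i J\<close>.\<close>

definition koszul :: "('r, 'x) ring_scheme \<Rightarrow> 'r list \<Rightarrow> ('r, nat set \<Rightarrow> 'r) cplx" where
  "koszul R xs =
     \<lparr>obj = (\<lambda>n. free_module R {I. I \<subseteq> {..<length xs} \<and> int (card I) = n}),
      bd = (\<lambda>n f J. \<Oplus>\<^bsub>R\<^esub> i \<in> {..<length xs} - J.
              signed R (int (card {j\<in>J. j < i})) (xs ! i \<otimes>\<^bsub>R\<^esub> f (insert i J)))\<rparr>"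

definition koszul_on ::
  "('r, 'x) ring_scheme \<Rightarrow> 'r list \<Rightarrow> ('r, 'm) cplx \<Rightarrow>
     ('r, int \<Rightarrow> ((nat set \<Rightarrow> 'r) \<times> 'm \<Rightarrow> 'r) set) cplx" where
  "koszul_on R xs X = tensor_cplx R (koszul R xs) X"

text \<open>The remaining notions are meant for a homologically finite complex over a local
  ring \<open>(R, \<mm>)\<close>.\<close>

definition sop :: "('r, 'x) ring_scheme \<Rightarrow> 'r set \<Rightarrow> ('r, 'm) cplx \<Rightarrow> 'r list \<Rightarrow> bool" where
  "sop R \<mm> X xs \<longleftrightarrow>
     set xs \<subseteq> \<mm> \<and>
     \<mm> \<in> anchor_primes R (koszul_on R xs X) \<and>
     ereal (real (length xs)) = cdim R X + cinf X"

definition length_seq :: "('r, 'x) ring_scheme \<Rightarrow> 'r set \<Rightarrow> ('r, 'm) cplx \<Rightarrow> 'r list \<Rightarrow> bool" where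
  "length_seq R \<mm> X xs \<longleftrightarrow>
     set xs \<subseteq> \<mm> \<and> (\<forall>i. finite_length R (homology (koszul_on R xs X) i))"

definition ldim :: "('r, 'x) ring_scheme \<Rightarrow> 'r set \<Rightarrow> ('r, 'm) cplx \<Rightarrow> ereal" where
  "ldim R \<mm> X = Inf {ereal (real (length xs)) | xs. length_seq R \<mm> X xs} - cinf X"

definition length_sop :: "('r, 'x) ring_scheme \<Rightarrow> 'r set \<Rightarrow> ('r, 'm) cplx \<Rightarrow> 'r list \<Rightarrow> bool" where
  "length_sop R \<mm> X xs \<longleftrightarrow>
     length_seq R \<mm> X xs \<and> ereal (real (length xs)) = ldim R \<mm> X + cinf X"


section \<open>DG algebras\<close>

text \<open>A DG algebra is represented by its underlying graded algebra \<open>A\<^sup>\<natural>\<close>, internally graded by the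
  subsets \<open>homog A i\<close>, with a differential defined on all of \<open>A\<^sup>\<natural>\<close>.\<close>

record ('r, 'a) dg_alg = "('r, 'a) module" +
  homog :: "int \<Rightarrow> 'a set"
  dgd :: "'a \<Rightarrow> 'a"

locale dg_algebra = module R A + A?: ring A
  for R :: "('r, 'x) ring_scheme" and A :: "('r, 'a, 'y) dg_alg_scheme" +
  assumes smult_mult_left:
      "\<lbrakk>r \<in> carrier R; a \<in> carrier A; b \<in> carrier A\<rbrakk> \<Longrightarrow>
         (r \<odot>\<^bsub>A\<^esub> a) \<otimes>\<^bsub>A\<^esub> b = r \<odot>\<^bsub>A\<^esub> (a \<otimes>\<^bsub>A\<^esub> b)"
    and smult_mult_right:
      "\<lbrakk>r \<in> carrier R; a \<in> carrier A; b \<in> carrier A\<rbrakk> \<Longrightarrow>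
         a \<otimes>\<^bsub>A\<^esub> (r \<odot>\<^bsub>A\<^esub> b) = r \<odot>\<^bsub>A\<^esub> (a \<otimes>\<^bsub>A\<^esub> b)"
    and homog_submodule: "submodule (homog A i) R A"
    and homog_span:
      "a \<in> carrier A \<Longrightarrow>
         \<exists>J f. finite J \<and> (\<forall>i\<in>J. f i \<in> homog A i) \<and> a = (\<Oplus>\<^bsub>A\<^esub> i \<in> J. f i)"
    and homog_independent:
      "\<lbrakk>finite J; \<forall>i\<in>J. f i \<in> homog A i; (\<Oplus>\<^bsub>A\<^esub> i \<in> J. f i) = \<zero>\<^bsub>A\<^esub>; i \<in> J\<rbrakk> \<Longrightarrow>
         f i = \<zero>\<^bsub>A\<^esub>"
    and homog_neg: "i < 0 \<Longrightarrow> homog A i = {\<zero>\<^bsub>A\<^esub>}"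
    and homog_one: "\<one>\<^bsub>A\<^esub> \<in> homog A 0"
    and homog_mult: "\<lbrakk>a \<in> homog A i; b \<in> homog A j\<rbrakk> \<Longrightarrow> a \<otimes>\<^bsub>A\<^esub> b \<in> homog A (i + j)"
    and graded_comm:
      "\<lbrakk>a \<in> homog A i; b \<in> homog A j\<rbrakk> \<Longrightarrow> b \<otimes>\<^bsub>A\<^esub> a = signed A (i * j) (a \<otimes>\<^bsub>A\<^esub> b)"
    and odd_square: "\<lbrakk>odd i; a \<in> homog A i\<rbrakk> \<Longrightarrow> a \<otimes>\<^bsub>A\<^esub> a = \<zero>\<^bsub>A\<^esub>"
    and d_add:
      "\<lbrakk>a \<in> carrier A; b \<in> carrier A\<rbrakk> \<Longrightarrow> dgd A (a \<oplus>\<^bsub>A\<^esub> b) = dgd A a \<oplus>\<^bsub>A\<^esub> dgd A b"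
    and d_smult:
      "\<lbrakk>r \<in> carrier R; a \<in> carrier A\<rbrakk> \<Longrightarrow> dgd A (r \<odot>\<^bsub>A\<^esub> a) = r \<odot>\<^bsub>A\<^esub> dgd A a"
    and d_homog: "a \<in> homog A i \<Longrightarrow> dgd A a \<in> homog A (i - 1)"
    and d_d: "a \<in> carrier A \<Longrightarrow> dgd A (dgd A a) = \<zero>\<^bsub>A\<^esub>"
    and leibniz:
      "\<lbrakk>a \<in> homog A i; b \<in> homog A j\<rbrakk> \<Longrightarrow>
         dgd A (a \<otimes>\<^bsub>A\<^esub> b) = dgd A a \<otimes>\<^bsub>A\<^esub> b \<oplus>\<^bsub>A\<^esub> signed A i (a \<otimes>\<^bsub>A\<^esub> dgd A b)"

definition deg0_ring :: "('r, 'a, 'y) dg_alg_scheme \<Rightarrow> 'a ring" where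
  "deg0_ring A =
     \<lparr>carrier = homog A 0, monoid.mult = monoid.mult A,
      monoid.one = \<one>\<^bsub>A\<^esub>, ring.zero = \<zero>\<^bsub>A\<^esub>, ring.add = ring.add A\<rparr>"

definition dg_cplx :: "('r, 'a, 'y) dg_alg_scheme \<Rightarrow> ('r, 'a) cplx" where
  "dg_cplx A =
     \<lparr>obj = (\<lambda>i. module_record (homog A i) (ring.add A) \<zero>\<^bsub>A\<^esub> (smult A)), bd = (\<lambda>i. dgd A)\<rparr>"

text \<open>\<open>H\<^sub>0(A)\<close> as a ring; every element of degree 0 is a cycle.\<close>

definition dg_H0 :: "('r, 'a, 'y) dg_alg_scheme \<Rightarrow> 'a set ring" where
  "dg_H0 A = deg0_ring A Quot (dgd A ` homog A 1)"

text \<open>\<open>H\<^sub>i(A)\<close> as a module over \<open>H\<^sub>0(A)\<close>.\<close>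

definition dg_homology :: "('r, 'a, 'y) dg_alg_scheme \<Rightarrow> int \<Rightarrow> ('a set, 'a set) module" where
  "dg_homology A i = (let H = homology (dg_cplx A) i in
     module_record (carrier H) (ring.add H) \<zero>\<^bsub>H\<^esub>
       (\<lambda>S T. \<Union>a\<in>S. \<Union>z\<in>T. boundaries (dg_cplx A) i +>\<^bsub>A\<^esub> (a \<otimes>\<^bsub>A\<^esub> z)))"

definition dg_noetherian :: "('r, 'a, 'y) dg_alg_scheme \<Rightarrow> bool" where
  "dg_noetherian A \<longleftrightarrow>
     noetherian_ring (dg_H0 A) \<and> (\<forall>i. fg_module (dg_H0 A) (dg_homology A i))"

definition dg_local ::
  "('r, 'x) ring_scheme \<Rightarrow> 'r set \<Rightarrow> ('r, 'a, 'y) dg_alg_scheme \<Rightarrow> bool" where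
  "dg_local R \<mm> A \<longleftrightarrow>
     dg_noetherian A \<and> local_ring R \<mm> \<and>
     (\<exists>\<nn>. local_ring (dg_H0 A) \<nn> \<and>
          genideal (dg_H0 A)
            ((\<lambda>r. (dgd A ` homog A 1) +>\<^bsub>deg0_ring A\<^esub> (r \<odot>\<^bsub>A\<^esub> \<one>\<^bsub>A\<^esub>)) ` \<mm>) \<subseteq> \<nn>)"

definition dg_bounded :: "('r, 'a, 'y) dg_alg_scheme \<Rightarrow> bool" where
  "dg_bounded A \<longleftrightarrow> (\<exists>n. \<forall>i>n. homog A i = {\<zero>\<^bsub>A\<^esub>})"

definition generated_in_odd_degrees :: "('r, 'a, 'y) dg_alg_scheme \<Rightarrow> bool" where
  "generated_in_odd_degrees A \<longleftrightarrow>
     (\<exists>S \<subseteq> \<Union>(homog A ` {i. odd i}). generate_ring A (homog A 0 \<union> S) = carrier A)"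

definition dg_ideal :: "'a set \<Rightarrow> ('r, 'a, 'y) dg_alg_scheme \<Rightarrow> bool" where
  "dg_ideal I A \<longleftrightarrow>
     ideal I A \<and>
     (\<forall>a\<in>I. \<exists>J f. finite J \<and> (\<forall>i\<in>J. f i \<in> I \<inter> homog A i) \<and> a = (\<Oplus>\<^bsub>A\<^esub> i \<in> J. f i)) \<and>
     dgd A ` I \<subseteq> I"

text \<open>The library's \<^const>\<open>primeideal\<close> presupposes a commutative ring, which \<open>A\<^sup>\<natural>\<close> need not be.\<close>

definition dg_prime_ideal :: "'a set \<Rightarrow> ('r, 'a, 'y) dg_alg_scheme \<Rightarrow> bool" where
  "dg_prime_ideal P A \<longleftrightarrow>
     dg_ideal P A \<and> P \<noteq> carrier A \<and>
     (\<forall>a\<in>carrier A. \<forall>b\<in>carrier A. a \<otimes>\<^bsub>A\<^esub> b \<in> P \<longrightarrow> a \<in> P \<or> b \<in> P)"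

definition dg_dim :: "('r, 'a, 'y) dg_alg_scheme \<Rightarrow> ereal" where
  "dg_dim A = sup_chain_length {P. dg_prime_ideal P A}"

end

theory Submission
  imports Defs
begin

text \<open>Put \<open>R = A\<^sub>0\<close> and \<open>J = \<partial>A\<^sub>1\<close>, so that \<open>H\<^sub>0(A) = R/J\<close>. The complex \<open>K(x) \<otimes> A\<close> lives in nonnegative
  degrees, its \<open>H\<^sub>0\<close> is \<open>R/(J + (x))\<close>, and \<open>J + (x)\<close> annihilates all of its homology: multiplication by
  \<open>\<partial>a\<close> is null-homotopic through multiplication by \<open>a\<close>, multiplication by \<open>x\<^sub>k\<close> through exterior
  multiplication by \<open>e\<^sub>k\<close>. Hence its support is the set of primes over \<open>J + (x)\<close>, every localization at
  such a prime has infimum 0, and its dimension is \<open>dim R/(J + (x))\<close>. All three kinds of parameters thus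
  amount to \<open>\<mm>\<close> being the only prime over \<open>J + (x)\<close> with \<open>x\<close> of length \<open>dim R/J\<close>; that the least length
  with the former property is \<open>dim R/J\<close> is Krull's height theorem together with prime avoidance.

  If \<open>A\<close> is bounded or generated in odd degrees, a DG prime contains every element of positive degree,
  since these are nilpotent or sums of products involving elements of square zero. So
  \<open>P \<mapsto> P \<inter> A\<^sub>0\<close> and \<open>p \<mapsto> p \<oplus> A\<^sub>>\<^sub>0\<close> are strictly monotone maps between the DG primes and the primes
  over \<open>J\<close>.\<close>

section \<open>Ideals of commutative rings\<close>

text \<open>Krull's theorem is about localizations, but passing to \<open>R_P\<close> would change
  the ring and its type at every prime. The commutative algebra therefore stays inside
  \<open>R\<close>: an ideal of \<open>R_P\<close> is represented by its contraction, an ideal fixed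
  by \<open>sat P\<close>, and finite length is witnessed by a bounded, strictly monotone rank.
  Genuine localizations occur only where support, dimension and anchor primes are defined by them.
  An anchor prime involves the dimension of a localized complex, whose definition localizes once
  more. This is why the facts used about homology are collected in the locale
  \<open>cyclic_complex\<close>, which is stable under localization. For length parameters the
  obstacle is finite generation of the homology of \<open>K(x) \<otimes> A\<close>: only the
  homology of \<open>A\<close> is known to be finitely generated, not its components, so the usual
  long exact sequences are replaced by an explicit filtration. The tensor product itself is a
  quotient of a very large free module; signs and homotopies are computed in a coordinate model and
  carried over by an isomorphism.\<close>

lemma (in cring) ideal_of_closed:
  assumes "I \<subseteq> carrier R" "\<zero> \<in> I" "\<And>a b. \<lbrakk>a \<in> I; b \<in> I\<rbrakk> \<Longrightarrow> a \<oplus> b \<in> I"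
    and mult: "\<And>a x. \<lbrakk>a \<in> I; x \<in> carrier R\<rbrakk> \<Longrightarrow> x \<otimes> a \<in> I"
  shows "ideal I R"
proof (rule idealI[OF ring_axioms])
  have "\<ominus> a \<in> I" if "a \<in> I" for a
    using mult[OF that, of "\<ominus> \<one>"] that assms(1) by (simp add: l_minus subset_eq)
  then show "subgroup I (add_monoid R)"
    using assms by (intro add.subgroupI) (auto simp: a_inv_def)
  show "x \<otimes> a \<in> I" "a \<otimes> x \<in> I" if "a \<in> I" "x \<in> carrier R" for a x
    using mult[OF that] that assms(1) m_comm[of a x] by auto
qed

lemma (in cring) idealD:
  assumes "ideal I R"
  shows "I \<subseteq> carrier R" "\<zero> \<in> I" "\<And>a b. \<lbrakk>a \<in> I; b \<in> I\<rbrakk> \<Longrightarrow> a \<oplus> b \<in> I"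
    "\<And>a x. \<lbrakk>a \<in> I; x \<in> carrier R\<rbrakk> \<Longrightarrow> x \<otimes> a \<in> I"
    "\<And>a. a \<in> I \<Longrightarrow> \<ominus> a \<in> I"
    "\<And>a b. \<lbrakk>a \<in> I; b \<in> I\<rbrakk> \<Longrightarrow> a \<ominus> b \<in> I"
proof -
  interpret ideal I R by fact
  show sub: "I \<subseteq> carrier R" by (rule a_subset)
  show "\<zero> \<in> I" "\<And>a b. \<lbrakk>a \<in> I; b \<in> I\<rbrakk> \<Longrightarrow> a \<oplus> b \<in> I" "\<And>a. a \<in> I \<Longrightarrow> \<ominus> a \<in> I"
    "\<And>a x. \<lbrakk>a \<in> I; x \<in> carrier R\<rbrakk> \<Longrightarrow> x \<otimes> a \<in> I"
    by (auto intro: I_l_closed)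
  show "\<And>a b. \<lbrakk>a \<in> I; b \<in> I\<rbrakk> \<Longrightarrow> a \<ominus> b \<in> I"
    by (auto simp: a_minus_def)
qed

lemma (in cring) ideal_cancel:
  assumes "ideal I R" "a \<oplus> b \<in> I" "a \<in> I" "b \<in> carrier R"
  shows "b \<in> I"
proof -
  interpret ideal I R by fact
  have "\<ominus> a \<oplus> (a \<oplus> b) = b" using assms a_subset by (auto simp: r_neg1)
  then show ?thesis using assms(2,3) by (metis a_closed a_inv_closed)
qed

lemma (in cring) primeD:
  assumes "primeideal P R"
  shows "ideal P R" "P \<subseteq> carrier R" "\<one> \<notin> P"
    "\<And>a b. \<lbrakk>a \<otimes> b \<in> P; a \<in> carrier R; b \<in> carrier R\<rbrakk> \<Longrightarrow> a \<in> P \<or> b \<in> P"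
    "\<And>a b. \<lbrakk>a \<in> carrier R - P; b \<in> carrier R - P\<rbrakk> \<Longrightarrow> a \<otimes> b \<in> carrier R - P"
proof -
  interpret primeideal P R by fact
  show "ideal P R" "P \<subseteq> carrier R" by (simp_all add: is_ideal a_subset)
  show "\<one> \<notin> P" using one_imp_carrier I_notcarr by blast
  show "\<And>a b. \<lbrakk>a \<otimes> b \<in> P; a \<in> carrier R; b \<in> carrier R\<rbrakk> \<Longrightarrow> a \<in> P \<or> b \<in> P"
    using I_prime by blast
  then show "\<And>a b. \<lbrakk>a \<in> carrier R - P; b \<in> carrier R - P\<rbrakk> \<Longrightarrow> a \<otimes> b \<in> carrier R - P"
    by blast
qed

lemma (in cring) primeideal_of_closed:
  assumes "ideal P R" "\<one> \<notin> P"
    "\<And>a b. \<lbrakk>a \<otimes> b \<in> P; a \<in> carrier R; b \<in> carrier R\<rbrakk> \<Longrightarrow> a \<in> P \<or> b \<in> P"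
  shows "primeideal P R"
  using assms is_cring by (intro primeidealI) auto

lemma (in cring) prime_pow:
  assumes "primeideal P R" "a \<in> carrier R" "a [^] (n::nat) \<in> P"
  shows "a \<in> P"
  using assms(3)
proof (induction n)
  case 0 then show ?case using primeD(3)[OF assms(1)] by simp
next
  case (Suc n) then show ?case using primeD(4)[OF assms(1), of "a [^] n" a] assms(2) by auto
qed

section \<open>Colon ideals, sums with a principal ideal, saturations\<close>

definition (in cring) colon :: "'a set \<Rightarrow> 'a \<Rightarrow> 'a set" where
  "colon I a = {r \<in> carrier R. r \<otimes> a \<in> I}"

definition (in cring) adjoin :: "'a set \<Rightarrow> 'a \<Rightarrow> 'a set" where
  "adjoin I a = {i \<oplus> t \<otimes> a | i t. i \<in> I \<and> t \<in> carrier R}"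

text \<open>The contraction to \<open>R\<close> of the ideal that \<open>I\<close> generates in the
  localization at \<open>P\<close>. Ideals of that localization correspond to the ideals
  \<open>K\<close> with \<open>sat P K \<subseteq> K\<close>.\<close>

definition (in cring) sat :: "'a set \<Rightarrow> 'a set \<Rightarrow> 'a set" where
  "sat P I = {r \<in> carrier R. \<exists>s\<in>carrier R - P. s \<otimes> r \<in> I}"

lemma (in cring) colon_ideal:
  assumes "ideal I R" "a \<in> carrier R"
  shows "ideal (colon I a) R"
  using assms(2) idealD(2-4)[OF assms(1)]
  by (intro ideal_of_closed) (auto simp: colon_def l_distr m_assoc)

lemma (in cring) adjoin_ideal:
  assumes I: "ideal I R" and a: "a \<in> carrier R"
  shows "ideal (adjoin I a) R" "I \<subseteq> adjoin I a" "a \<in> adjoin I a"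
    "\<And>K. \<lbrakk>ideal K R; I \<subseteq> K; a \<in> K\<rbrakk> \<Longrightarrow> adjoin I a \<subseteq> K"
proof -
  note Id = idealD[OF I]
  show "ideal (adjoin I a) R"
  proof (rule ideal_of_closed)
    show "adjoin I a \<subseteq> carrier R" using Id(1) a by (auto simp: adjoin_def)
    have "\<zero> = \<zero> \<oplus> \<zero> \<otimes> a" using a by simp
    then show "\<zero> \<in> adjoin I a" using Id(2) unfolding adjoin_def by blast
  next
    fix x y assume "x \<in> adjoin I a" "y \<in> adjoin I a"
    then obtain i t j u where xy: "x = i \<oplus> t \<otimes> a" "y = j \<oplus> u \<otimes> a"
      "i \<in> I" "t \<in> carrier R" "j \<in> I" "u \<in> carrier R" unfolding adjoin_def by blast
    have "i \<in> carrier R" "j \<in> carrier R" using xy Id(1) by auto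
    then have "x \<oplus> y = (i \<oplus> j) \<oplus> (t \<oplus> u) \<otimes> a"
      unfolding xy(1,2) using xy(4,6) a by algebra
    then show "x \<oplus> y \<in> adjoin I a" using xy Id(3) unfolding adjoin_def by blast
  next
    fix x r assume "x \<in> adjoin I a" and r: "r \<in> carrier R"
    then obtain i t where xy: "x = i \<oplus> t \<otimes> a" "i \<in> I" "t \<in> carrier R"
      unfolding adjoin_def by blast
    have "i \<in> carrier R" using xy Id(1) by auto
    then have "r \<otimes> x = r \<otimes> i \<oplus> (r \<otimes> t) \<otimes> a"
      unfolding xy(1) using xy(3) a r by algebra
    then show "r \<otimes> x \<in> adjoin I a" using xy Id(4) r unfolding adjoin_def by blast
  qed
  have "i = i \<oplus> \<zero> \<otimes> a" if "i \<in> I" for i using that a Id(1) by auto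
  then show "I \<subseteq> adjoin I a" unfolding adjoin_def by blast
  have "a = \<zero> \<oplus> \<one> \<otimes> a" using a by simp
  then show "a \<in> adjoin I a" using Id(2) unfolding adjoin_def by blast
  show "adjoin I a \<subseteq> K" if "ideal K R" "I \<subseteq> K" "a \<in> K" for K
    using that idealD[OF that(1)] by (auto simp: adjoin_def)
qed

lemma (in cring) sat_ideal:
  assumes P: "primeideal P R" and I: "ideal I R"
  shows "ideal (sat P I) R" "I \<subseteq> sat P I" "sat P (sat P I) \<subseteq> sat P I"
proof -
  note Id = idealD[OF I] and Pd = primeD[OF P]
  have one: "\<one> \<in> carrier R - P" using Pd(3) by simp
  show "ideal (sat P I) R"
  proof (rule ideal_of_closed)
    show "sat P I \<subseteq> carrier R" by (auto simp: sat_def)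
    show "\<zero> \<in> sat P I" using one Id(2) by (auto simp: sat_def)
  next
    fix x y assume "x \<in> sat P I" "y \<in> sat P I"
    then obtain s t where st: "s \<in> carrier R - P" "t \<in> carrier R - P" "s \<otimes> x \<in> I" "t \<otimes> y \<in> I"
      "x \<in> carrier R" "y \<in> carrier R" unfolding sat_def by blast
    have "(s \<otimes> t) \<otimes> (x \<oplus> y) = t \<otimes> (s \<otimes> x) \<oplus> s \<otimes> (t \<otimes> y)"
      using st(1,2,5,6) by (elim DiffE) algebra
    then have "(s \<otimes> t) \<otimes> (x \<oplus> y) \<in> I" using st Id(3,4) by auto
    then show "x \<oplus> y \<in> sat P I" using st Pd(5)[OF st(1,2)] unfolding sat_def by auto
  next
    fix x r assume "x \<in> sat P I" and r: "r \<in> carrier R"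
    then obtain s where st: "s \<in> carrier R - P" "s \<otimes> x \<in> I" "x \<in> carrier R"
      unfolding sat_def by blast
    have "s \<otimes> (r \<otimes> x) = r \<otimes> (s \<otimes> x)" using st(1,3) r by (elim DiffE) algebra
    then have "s \<otimes> (r \<otimes> x) \<in> I" using st r Id(4) by auto
    then show "r \<otimes> x \<in> sat P I" using st r unfolding sat_def by auto
  qed
  show "I \<subseteq> sat P I" using one Id(1) by (force simp: sat_def)
  show "sat P (sat P I) \<subseteq> sat P I"
  proof
    fix x assume "x \<in> sat P (sat P I)"
    then obtain s t where st: "s \<in> carrier R - P" "t \<in> carrier R - P" "t \<otimes> (s \<otimes> x) \<in> I" "x \<in> carrier R"
      unfolding sat_def by blast
    then have "(t \<otimes> s) \<otimes> x \<in> I" by (auto simp: m_assoc)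
    then show "x \<in> sat P I" using Pd(5)[OF st(2,1)] st(4) unfolding sat_def by auto
  qed
qed

lemma (in cring) sat_mono: "I \<subseteq> K \<Longrightarrow> sat P I \<subseteq> sat P K"
  by (auto simp: sat_def)

lemma (in cring) adjoin_mono: "I \<subseteq> K \<Longrightarrow> adjoin I a \<subseteq> adjoin K a"
  by (auto simp: adjoin_def)

section \<open>Maximal members and associated primes in noetherian rings\<close>

locale noetherian_cring = noetherian_ring + cring

context noetherian_cring
begin

text \<open>A nonempty chain of ideals in a noetherian ring contains its own union. Zorn's lemma
  therefore applies to every nonempty family of ideals, closed under unions of chains or
  not.\<close>

lemma exists_maximal:
  assumes "F \<noteq> {}" and F: "\<And>I. I \<in> F \<Longrightarrow> ideal I R"
  shows "\<exists>M\<in>F. \<forall>J\<in>F. M \<subseteq> J \<longrightarrow> J = M"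
proof (rule subset_Zorn)
  fix C assume C: "subset.chain F C"
  show "\<exists>U\<in>F. \<forall>X\<in>C. X \<subseteq> U"
  proof (cases "C = {}")
    case True
    then show ?thesis using assms(1) by blast
  next
    case False
    have CF: "C \<subseteq> F" using C unfolding subset.chain_def by (rule conjunct1)
    have "C \<subseteq> {I. ideal I R}" using CF F by blast
    then have "subset.chain {I. ideal I R} C"
      using C unfolding subset.chain_def by simp
    then have "\<Union>C \<in> C" using ideal_chain_is_trivial[OF False] by simp
    then show ?thesis using CF by (meson Union_upper subsetD)
  qed
qed

text \<open>Noetherian induction: the ideals violating \<open>P\<close> would have a maximal member,
  and the step applied to that member refutes it.\<close>

lemma ideal_induct [consumes 1, case_names step]:
  assumes "ideal I R"
    and step: "\<And>I. \<lbrakk>ideal I R; \<And>J. \<lbrakk>ideal J R; I \<subset> J\<rbrakk> \<Longrightarrow> P J\<rbrakk> \<Longrightarrow> P I"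
  shows "P I"
proof (rule ccontr)
  assume "\<not> P I"
  let ?F = "{I. ideal I R \<and> \<not> P I}"
  have "?F \<noteq> {}" using assms(1) \<open>\<not> P I\<close> by blast
  then have "\<exists>M\<in>?F. \<forall>J\<in>?F. M \<subseteq> J \<longrightarrow> J = M"
    by (rule exists_maximal) simp
  then obtain M where M: "M \<in> ?F" and max: "\<forall>J\<in>?F. M \<subseteq> J \<longrightarrow> J = M" by (rule bexE)
  have "P M"
  proof (rule step)
    show "P J" if "ideal J R" "M \<subset> J" for J
      using max that by blast
  qed (use M in simp)
  then show False using M by simp
qed

text \<open>An annihilator \<open>(I : a)\<close> that is maximal among those of nonzero classes is
  prime, so \<open>R/I\<close> has an associated prime.\<close>

lemma exists_prime_colon:
  assumes I: "ideal I R" and ne: "I \<noteq> carrier R"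
  shows "\<exists>a\<in>carrier R - I. primeideal (colon I a) R"
proof -
  note Id = idealD[OF I]
  obtain x where x: "x \<in> carrier R - I" using ne Id(1) by auto
  let ?F = "colon I ` (carrier R - I)"
  have "?F \<noteq> {}" using x by blast
  then have "\<exists>M\<in>?F. \<forall>J\<in>?F. M \<subseteq> J \<longrightarrow> J = M"
    by (rule exists_maximal) (auto intro: colon_ideal[OF I])
  then obtain M where "M \<in> ?F" and max': "\<forall>J\<in>?F. M \<subseteq> J \<longrightarrow> J = M" by (rule bexE)
  then obtain a where a: "a \<in> carrier R - I" "M = colon I a" by auto
  have max: "colon I b = colon I a" if "b \<in> carrier R - I" "colon I a \<subseteq> colon I b" for b
    using max' that a by blast
  have "primeideal (colon I a) R"
  proof (rule primeideal_of_closed)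
    show "ideal (colon I a) R" using colon_ideal[OF I] a by auto
    show "\<one> \<notin> colon I a" using a by (auto simp: colon_def)
    fix b c assume bc: "b \<otimes> c \<in> colon I a" "b \<in> carrier R" "c \<in> carrier R"
    show "b \<in> colon I a \<or> c \<in> colon I a"
    proof (rule ccontr)
      assume n: "\<not> (b \<in> colon I a \<or> c \<in> colon I a)"
      \<comment> \<open>As \<open>c\<close> is not in \<open>(I : a)\<close>, the product
        \<open>c \<otimes> a\<close> is a nonzero class whose annihilator contains that of
        \<open>a\<close>. Maximality makes the two equal, and \<open>b\<close> lies in the
        former.\<close>
      have "colon I a \<subseteq> colon I (c \<otimes> a)"
      proof
        fix r assume "r \<in> colon I a"
        then have r: "r \<in> carrier R" "r \<otimes> a \<in> I" by (auto simp: colon_def)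
        have "r \<otimes> (c \<otimes> a) = c \<otimes> (r \<otimes> a)" using r(1) a(1) bc(3) by (elim DiffE) algebra
        then show "r \<in> colon I (c \<otimes> a)" using r Id(4) bc by (auto simp: colon_def)
      qed
      then have "colon I (c \<otimes> a) = colon I a" using max[of "c \<otimes> a"] n bc a by (auto simp: colon_def)
      moreover have "b \<in> colon I (c \<otimes> a)" using bc a by (auto simp: colon_def m_assoc)
      ultimately show False using n by simp
    qed
  qed
  then show ?thesis using a by blast
qed

end

text \<open>Finite length without composition series: a rank can be assembled by adding a rank on a
  submodule and a rank on a quotient, and it both bounds chains and stops descending
  sequences.\<close>

definition bounded_rank :: "'a set set \<Rightarrow> bool" where
  "bounded_rank F \<longleftrightarrow>
     (\<exists>l b. (\<forall>K\<in>F. l K \<le> (b::nat)) \<and> (\<forall>K\<in>F. \<forall>L\<in>F. K \<subset> L \<longrightarrow> l K < l L))"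

lemma bounded_rankI:
  assumes "\<And>K. K \<in> F \<Longrightarrow> l K \<le> (b::nat)" "\<And>K L. \<lbrakk>K \<in> F; L \<in> F; K \<subset> L\<rbrakk> \<Longrightarrow> l K < l L"
  shows "bounded_rank F"
  using assms unfolding bounded_rank_def by (intro exI[of _ l] exI[of _ b]) simp

lemma bounded_rankE:
  assumes "bounded_rank F"
  obtains l b where "\<forall>K\<in>F. l K \<le> (b::nat)" "\<forall>K\<in>F. \<forall>L\<in>F. K \<subset> L \<longrightarrow> l K < l L"
  using assms unfolding bounded_rank_def by (elim exE conjE)

lemma bounded_rank_dcc:
  assumes "bounded_rank F" "\<And>n. K n \<in> F" "\<And>n::nat. K (Suc n) \<subseteq> K n"
  shows "\<exists>n. K (Suc n) = K n"
proof (rule ccontr)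
  assume n: "\<nexists>n. K (Suc n) = K n"
  from assms(1) obtain l b where l': "\<forall>K\<in>F. l K \<le> (b::nat)" "\<forall>K\<in>F. \<forall>L\<in>F. K \<subset> L \<longrightarrow> l K < l L"
    by (rule bounded_rankE)
  have l: "\<And>K. K \<in> F \<Longrightarrow> l K \<le> (b::nat)" "\<And>K L. \<lbrakk>K \<in> F; L \<in> F; K \<subset> L\<rbrakk> \<Longrightarrow> l K < l L"
    using l' by blast+
  have step: "l (K (Suc n)) < l (K n)" for n using n assms l(2) by (metis psubsetI)
  have "l (K n) + n \<le> l (K 0)" for n
  proof (induction n)
    case (Suc n) then show ?case using step[of n] by simp
  qed simp
  from this[of "Suc (l (K 0))"] show False by simp
qed

lemma bounded_rank_chain:
  assumes "bounded_rank F"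
  shows "sup_chain_length F < \<infinity>"
proof -
  from assms(1) obtain l b where l': "\<forall>K\<in>F. l K \<le> (b::nat)" "\<forall>K\<in>F. \<forall>L\<in>F. K \<subset> L \<longrightarrow> l K < l L"
    by (rule bounded_rankE)
  have l: "\<And>K. K \<in> F \<Longrightarrow> l K \<le> (b::nat)" "\<And>K L. \<lbrakk>K \<in> F; L \<in> F; K \<subset> L\<rbrakk> \<Longrightarrow> l K < l L"
    using l' by blast+
  have bound: "n \<le> b" if C: "\<forall>i\<le>n. C i \<in> F" "\<forall>i<n. C i \<subset> C (Suc i)" for n C
  proof -
    have "i \<le> l (C i)" if "i \<le> n" for i using that
    proof (induction i)
      case (Suc i)
      have "C i \<subset> C (Suc i)" "C i \<in> F" "C (Suc i) \<in> F" using C Suc.prems by simp_all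
      then have "l (C i) < l (C (Suc i))" by (intro l(2))
      then show ?case using Suc by simp
    qed simp
    from this[of n] have "n \<le> l (C n)" by simp
    also have "\<dots> \<le> b" using C(1) by (intro l(1)) simp
    finally show ?thesis .
  qed
  have "sup_chain_length F \<le> ereal (real b)"
    unfolding sup_chain_length_def
  proof (intro Sup_least)
    fix x assume "x \<in> {ereal (real n) |n. \<exists>C. (\<forall>i\<le>n. C i \<in> F) \<and> (\<forall>i<n. C i \<subset> C (Suc i))}"
    then obtain n C where "x = ereal (real n)" "\<forall>i\<le>n. C i \<in> F" "\<forall>i<n. C i \<subset> C (Suc i)" by blast
    then show "x \<le> ereal (real b)" using bound[of n C] by simp
  qed
  then show ?thesis using le_less_trans[of _ "ereal (real b)" \<infinity>] by simp
qed

section \<open>Finite length at a minimal prime and Krull's principal ideal theorem\<close>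

context noetherian_cring
begin

text \<open>\<open>R_P/I_P\<close> has finite length because \<open>P\<close> is minimal over
  \<open>I\<close>. By noetherian induction: the quotient by \<open>sat P I\<close> has an
  associated prime, which must be \<open>P\<close>, so adjoining the element \<open>a\<close> with
  that annihilator adds one simple factor after localization and raises the rank by at most
  one.\<close>

lemma bounded_rank_saturated:
  assumes I: "ideal I R" and P: "primeideal P R"
    and min: "\<And>Q. \<lbrakk>primeideal Q R; I \<subseteq> Q; Q \<subseteq> P\<rbrakk> \<Longrightarrow> Q = P"
  shows "bounded_rank {K. ideal K R \<and> I \<subseteq> K \<and> sat P K \<subseteq> K}"
  using I min
proof (induction I rule: ideal_induct)
  case (step I)
  note Pd = primeD[OF P] and Pi = idealD[OF primeD(1)[OF P]]
  let ?J = "sat P I"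
  note J = sat_ideal[OF P step.hyps]
  note Jd = idealD[OF J(1)]
  show ?case
  proof (cases "?J = carrier R")
    case True
    have eq: "K = carrier R" if "ideal K R" "I \<subseteq> K" "sat P K \<subseteq> K" for K
      using sat_mono[OF that(2), of P] True idealD(1)[OF that(1)] that(3) by auto
    show ?thesis
    proof (rule bounded_rankI[where l = "\<lambda>_. 0" and b = 0])
      fix K L assume "K \<in> {K. ideal K R \<and> I \<subseteq> K \<and> sat P K \<subseteq> K}" "L \<in> {K. ideal K R \<and> I \<subseteq> K \<and> sat P K \<subseteq> K}"
      then have "K = carrier R" "L = carrier R" using eq[of K] eq[of L] by simp_all
      moreover assume "K \<subset> L"
      ultimately show "(0::nat) < 0" by simp
    qed simp
  next
    case False
    obtain a where a: "a \<in> carrier R - ?J" "primeideal (colon ?J a) R"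
      using exists_prime_colon[OF J(1) False] by auto
    \<comment> \<open>A multiplier outside \<open>P\<close> that carries \<open>a\<close> into the
      saturated ideal \<open>?J\<close> would put \<open>a\<close> itself there.\<close>
    have "colon ?J a \<subseteq> P"
    proof
      fix r assume "r \<in> colon ?J a"
      then have r: "r \<in> carrier R" "r \<otimes> a \<in> ?J" by (auto simp: colon_def)
      show "r \<in> P"
      proof (rule ccontr)
        assume "r \<notin> P"
        then have "a \<in> sat P ?J" using r a unfolding sat_def[of P ?J] by blast
        then show False using J(3) a by blast
      qed
    qed
    moreover have "I \<subseteq> colon ?J a"
      using J(2) Jd(4) idealD(1)[OF step.hyps] a m_comm unfolding colon_def by (smt (verit) DiffE mem_Collect_eq subset_eq)
    ultimately have col: "colon ?J a = P" using step.prems a(2) by blast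
    let ?I = "adjoin ?J a"
    note I' = adjoin_ideal[OF J(1), of a]
    have aR: "a \<in> carrier R" using a by simp
    have "I \<subset> ?I" using I'(2,3)[OF aR] J(2) a by blast
    then have "bounded_rank {K. ideal K R \<and> ?I \<subseteq> K \<and> sat P K \<subseteq> K}"
      using step.IH[OF I'(1)[OF aR]] step.prems by blast
    then obtain l b where l': "\<forall>K\<in>{K. ideal K R \<and> ?I \<subseteq> K \<and> sat P K \<subseteq> K}. l K \<le> (b::nat)"
      "\<forall>K\<in>{K. ideal K R \<and> ?I \<subseteq> K \<and> sat P K \<subseteq> K}. \<forall>L\<in>{K. ideal K R \<and> ?I \<subseteq> K \<and> sat P K \<subseteq> K}.
         K \<subset> L \<longrightarrow> l K < l L"
      by (rule bounded_rankE)
    have l: "\<And>K. \<lbrakk>ideal K R; ?I \<subseteq> K; sat P K \<subseteq> K\<rbrakk> \<Longrightarrow> l K \<le> b"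
        "\<And>K L. \<lbrakk>ideal K R; ?I \<subseteq> K; sat P K \<subseteq> K; ideal L R; ?I \<subseteq> L; sat P L \<subseteq> L; K \<subset> L\<rbrakk> \<Longrightarrow> l K < l L"
      using l' by simp_all
    let ?E = "\<lambda>K. sat P (adjoin K a)"
    have E: "ideal (?E K) R" "?I \<subseteq> ?E K" "sat P (?E K) \<subseteq> ?E K"
      if K: "ideal K R" "I \<subseteq> K" "sat P K \<subseteq> K" for K
    proof -
      have JK: "?J \<subseteq> K" using sat_mono[OF K(2)] K(3) by blast
      note A = adjoin_ideal(1)[OF K(1) aR]
      show "ideal (?E K) R" "sat P (?E K) \<subseteq> ?E K" using sat_ideal[OF P A] by auto
      show "?I \<subseteq> ?E K" using sat_ideal(2)[OF P A] adjoin_mono[OF JK] by blast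
    qed
    \<comment> \<open>Locally \<open>?I/?J\<close> is simple, so \<open>K\<close> either contains
      \<open>?I\<close> or meets it in \<open>?J\<close>. The extra 1 records which case holds;
      \<open>?E K\<close>, the local sum of \<open>K\<close> and \<open>(a)\<close>, accounts for
      the rest.\<close>
    let ?l = "\<lambda>K. l (?E K) + (if a \<in> K then 1 else 0)"
    have "?l K \<le> b + 1" if "ideal K R" "I \<subseteq> K" "sat P K \<subseteq> K" for K
      using l(1)[OF E[OF that]] by auto
    moreover have "?l K < ?l L" if K: "ideal K R" "I \<subseteq> K" "sat P K \<subseteq> K"
      and L: "ideal L R" "I \<subseteq> L" "sat P L \<subseteq> L" and KL: "K \<subset> L" for K L
    proof (cases "?E K = ?E L")
      case False
      then have "?E K \<subset> ?E L" using sat_mono[OF adjoin_mono, of K L P a] KL by blast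
      then have "l (?E K) < l (?E L)" using l(2)[OF E[OF K] E[OF L]] by blast
      then show ?thesis using KL by auto
    next
      case True
      \<comment> \<open>If the sums with \<open>(a)\<close> agree, an element of \<open>L\<close>
        outside \<open>K\<close> is, up to a unit of \<open>R_P\<close>, an element of
        \<open>K\<close> plus \<open>t \<otimes> a\<close>. Here \<open>t\<close> is outside
        \<open>P\<close>, because \<open>P\<close> carries \<open>a\<close> into \<open>?J\<close>;
        hence \<open>a\<close> lies in \<open>L\<close> but not in \<open>K\<close>.\<close>
      obtain r where r: "r \<in> L" "r \<notin> K" using KL by auto
      note Kd = idealD[OF K(1)] and Ld = idealD[OF L(1)]
      have "r \<in> ?E L" using r sat_ideal(2)[OF P adjoin_ideal(1)[OF L(1) aR]] adjoin_ideal(2)[OF L(1) aR] by blast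
      then have "r \<in> ?E K" using True by simp
      then obtain s k t where s: "s \<in> carrier R - P" "s \<otimes> r = k \<oplus> t \<otimes> a" "k \<in> K" "t \<in> carrier R"
        unfolding sat_def adjoin_def by blast
      have tP: "t \<notin> P"
      proof
        assume "t \<in> P"
        then have "t \<otimes> a \<in> ?J" using col by (auto simp: colon_def)
        then have "t \<otimes> a \<in> K" using sat_mono[OF K(2), of P] K(3) by blast
        then have "s \<otimes> r \<in> K" using s Kd(3) by simp
        then have "r \<in> sat P K" using s r Ld(1) unfolding sat_def by blast
        then show False using r K(3) by blast
      qed
      have "s \<otimes> r \<in> L" using Ld(4) r s by blast
      then have "t \<otimes> a \<in> L" using ideal_cancel[OF L(1), of k "t \<otimes> a"] s KL aR by auto
      then have "a \<in> sat P L" using tP s aR unfolding sat_def by blast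
      then have aL: "a \<in> L" using L(3) by blast
      have "a \<notin> K"
      proof
        assume "a \<in> K"
        then have "adjoin L a = L" "adjoin K a = K"
          using adjoin_ideal(2,4)[OF K(1) aR] adjoin_ideal(2,4)[OF L(1) aR] K(1) L(1) aL by blast+
        then have "sat P K = sat P L" using True by simp
        then show False using r K(3) sat_ideal(2)[OF P L(1)] by blast
      qed
      then show ?thesis using True aL by simp
    qed
    ultimately show ?thesis
      by (intro bounded_rankI[where l = ?l and b = "b + 1"]) blast+
  qed
qed

text \<open>Nakayama's lemma at \<open>P\<close>, without a generating set for \<open>M\<close>:
  take \<open>L\<close> over \<open>N\<close> maximal such that \<open>M\<close> is not locally
  inside \<open>L\<close>. Enlarging \<open>L\<close> by some \<open>x \<otimes> g\<close> outside
  it must absorb \<open>g\<close> locally, and then \<open>s - t x\<close>, a unit at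
  \<open>P\<close>, carries \<open>g\<close> into \<open>L\<close>.\<close>

lemma saturated_nakayama:
  assumes P: "primeideal P R" and N: "ideal N R" and M: "ideal M R" and x: "x \<in> P"
    and sub: "\<And>r. r \<in> M \<Longrightarrow> \<exists>s\<in>carrier R - P. \<exists>n\<in>N. \<exists>m\<in>M. s \<otimes> r = n \<oplus> x \<otimes> m"
  shows "M \<subseteq> sat P N"
proof (rule ccontr)
  assume nM: "\<not> M \<subseteq> sat P N"
  note Md = idealD[OF M]
  have xR: "x \<in> carrier R" using x primeD(2)[OF P] by auto
  let ?F = "{L. ideal L R \<and> N \<subseteq> L \<and> \<not> M \<subseteq> sat P L}"
  have "?F \<noteq> {}" using N nM by blast
  then have "\<exists>M\<in>?F. \<forall>J\<in>?F. M \<subseteq> J \<longrightarrow> J = M"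
    by (rule exists_maximal) simp
  then obtain L where "L \<in> ?F" and "\<forall>J\<in>?F. L \<subseteq> J \<longrightarrow> J = L" by (rule bexE)
  then have L: "ideal L R" "N \<subseteq> L" "\<not> M \<subseteq> sat P L"
    and max: "\<And>K. \<lbrakk>ideal K R; N \<subseteq> K; \<not> M \<subseteq> sat P K; L \<subseteq> K\<rbrakk> \<Longrightarrow> K = L"
    by simp_all
  note S = sat_ideal[OF P L(1)]
  \<comment> \<open>The saturation fails to contain \<open>M\<close> locally just as
    \<open>L\<close> does, so maximality makes \<open>L\<close> saturated.\<close>
  have satL: "sat P L = L"
    using max[of "sat P L"] S L by blast
  obtain g where g: "g \<in> M" "x \<otimes> g \<notin> L"
  proof (rule ccontr)
    assume "\<not> thesis"
    then have *: "x \<otimes> m \<in> L" if "m \<in> M" for m using that \<open>\<And>g. \<lbrakk>g \<in> M; x \<otimes> g \<notin> L\<rbrakk> \<Longrightarrow> thesis\<close> by blast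
    have "M \<subseteq> sat P L"
    proof
      fix r assume r: "r \<in> M"
      obtain s n m where s: "s \<in> carrier R - P" "n \<in> N" "m \<in> M" "s \<otimes> r = n \<oplus> x \<otimes> m" using sub[OF r] by blast
      then have "s \<otimes> r \<in> L" using *[of m] L(2) idealD(3)[OF L(1)] by auto
      then show "r \<in> sat P L" using s r Md(1) unfolding sat_def by blast
    qed
    then show False using L by simp
  qed
  have gR: "g \<in> carrier R" "x \<otimes> g \<in> carrier R" using g Md(1) xR by auto
  note A = adjoin_ideal[OF L(1) gR(2)]
  have "M \<subseteq> sat P (adjoin L (x \<otimes> g))"
    using max[of "adjoin L (x \<otimes> g)"] A L g by blast
  then obtain s n t where s: "s \<in> carrier R - P" "n \<in> L" "t \<in> carrier R" "s \<otimes> g = n \<oplus> t \<otimes> (x \<otimes> g)"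
    using g unfolding sat_def adjoin_def by blast
  have nR: "n \<in> carrier R" using s idealD(1)[OF L(1)] by blast
  have sR: "s \<in> carrier R" using s by simp
  have "(s \<ominus> t \<otimes> x) \<otimes> g = s \<otimes> g \<ominus> t \<otimes> (x \<otimes> g)" using sR s(3) gR(1) xR by algebra
  also have "\<dots> = n" unfolding s(4) using nR s(3) gR(1) xR by algebra
  finally have "(s \<ominus> t \<otimes> x) \<otimes> g \<in> L" using s by simp
  moreover have "s \<ominus> t \<otimes> x \<in> carrier R - P"
  proof -
    have "t \<otimes> x \<in> P" using idealD(4)[OF primeD(1)[OF P]] x s by auto
    moreover have "s = (s \<ominus> t \<otimes> x) \<oplus> t \<otimes> x" using sR s(3) xR by algebra
    ultimately show ?thesis using s xR idealD(3)[OF primeD(1)[OF P], of "s \<ominus> t \<otimes> x" "t \<otimes> x"] by auto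
  qed
  ultimately have "g \<in> sat P L" using gR unfolding sat_def by blast
  then show False using satL g idealD(4)[OF L(1)] xR by auto
qed

text \<open>Krull's argument with symbolic powers, carried out modulo \<open>Q'\<close>. Instead of
  powers of \<open>Q\<close> it uses the ideals \<open>S n\<close> that \<open>Q'\<close> and the
  power \<open>y^n\<close> of one element generate at \<open>Q\<close>. Finite length modulo
  \<open>x\<close> stops the chain of the \<open>S n + (x)\<close> at \<open>P\<close>, Nakayama
  then stops the chain of the \<open>S n\<close>, and the resulting relation between consecutive
  powers of \<open>y\<close> cannot hold modulo the prime \<open>Q'\<close>.\<close>

lemma principal_ideal_theorem:
  assumes Q': "primeideal Q' R" and Q: "primeideal Q R" and P: "primeideal P R"
    and "Q' \<subset> Q" "Q \<subset> P" and x: "x \<in> P"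
    and min: "\<And>T. \<lbrakk>primeideal T R; Q' \<subseteq> T; x \<in> T; T \<subseteq> P\<rbrakk> \<Longrightarrow> T = P"
  shows False
proof -
  note Q'd = primeD[OF Q'] idealD[OF primeD(1)[OF Q']]
  note Qd = primeD[OF Q] idealD[OF primeD(1)[OF Q]]
  note Pd = primeD[OF P] idealD[OF primeD(1)[OF P]]
  have xR: "x \<in> carrier R" using x Pd by blast
  have xQ: "x \<notin> Q" using min[OF Q] \<open>Q' \<subset> Q\<close> \<open>Q \<subset> P\<close> by blast
  obtain y where y: "y \<in> Q" "y \<notin> Q'" using \<open>Q' \<subset> Q\<close> by blast
  have yR: "y \<in> carrier R" using y Qd by blast
  define B where "B n = adjoin Q' (y [^] n)" for n :: nat
  define S where "S n = sat Q (B n)" for n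
  define K where "K n = sat P (adjoin (S n) x)" for n
  have B: "ideal (B n) R" "Q' \<subseteq> B n" for n
    unfolding B_def using adjoin_ideal[OF Q'd(1)] yR by auto
  have BS: "B (Suc n) \<subseteq> B n" for n
    unfolding B_def using adjoin_ideal(1-3)[OF Q'd(1), of "y [^] n"] yR
    by (intro adjoin_ideal(4)[OF Q'd(1)]) (auto simp: idealD(4) m_comm[of _ y])
  have S: "ideal (S n) R" "B n \<subseteq> S n" "sat Q (S n) \<subseteq> S n" for n
    unfolding S_def using sat_ideal[OF Q B(1)] by auto
  have SS: "S (Suc n) \<subseteq> S n" for n unfolding S_def by (intro sat_mono BS)
  have SP: "sat P (S n) \<subseteq> S n" for n
  proof -
    have "sat P (S n) \<subseteq> sat Q (S n)" using \<open>Q \<subset> P\<close> by (auto simp: sat_def)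
    then show ?thesis using S(3) by blast
  qed
  note A = adjoin_ideal[OF S(1) xR]
  have K: "ideal (K n) R" "adjoin Q' x \<subseteq> K n" "sat P (K n) \<subseteq> K n" "S n \<subseteq> K n" "K (Suc n) \<subseteq> K n" for n
  proof -
    show "ideal (K n) R" "sat P (K n) \<subseteq> K n" unfolding K_def using sat_ideal[OF P A(1)] by auto
    have "Q' \<subseteq> S n" using B(2) S(2) by blast
    then show "adjoin Q' x \<subseteq> K n" unfolding K_def
      using sat_ideal(2)[OF P A(1)] adjoin_mono by blast
    show "S n \<subseteq> K n" unfolding K_def using sat_ideal(2)[OF P A(1)] A(2) by blast
    show "K (Suc n) \<subseteq> K n" unfolding K_def by (intro sat_mono adjoin_mono SS)
  qed
  \<comment> \<open>\<open>P\<close> is minimal over \<open>Q' + (x)\<close>, which is what gives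
    finite length at \<open>P\<close>.\<close>
  have br: "bounded_rank {K. ideal K R \<and> adjoin Q' x \<subseteq> K \<and> sat P K \<subseteq> K}"
  proof (rule bounded_rank_saturated[OF _ P])
    show "ideal (adjoin Q' x) R" using adjoin_ideal[OF Q'd(1) xR] by simp
    show "T = P" if "primeideal T R" "adjoin Q' x \<subseteq> T" "T \<subseteq> P" for T
      using min[OF that(1)] adjoin_ideal(2,3)[OF Q'd(1) xR] that by blast
  qed
  have "\<exists>n. K (Suc n) = K n"
    by (rule bounded_rank_dcc[OF br]) (use K in simp_all)
  then obtain n where n: "K (Suc n) = K n" by (rule exE)
  have "S n \<subseteq> sat P (S (Suc n))"
  proof (rule saturated_nakayama[OF P S(1) S(1) x])
    fix r assume r: "r \<in> S n"
    then have "r \<in> K (Suc n)" using K(4) n by blast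
    then obtain s q t where s: "s \<in> carrier R - P" "s \<otimes> r = q \<oplus> t \<otimes> x" "q \<in> S (Suc n)" "t \<in> carrier R"
      unfolding K_def sat_def adjoin_def by blast
    note Sd = idealD[OF S(1)[of n]]
    have "s \<otimes> r \<in> S n" by (rule Sd(4)[OF r]) (use s in simp)
    moreover have "q \<in> S n" using s SS by blast
    ultimately have "t \<otimes> x \<in> S n" using ideal_cancel[OF S(1)[of n], of q "t \<otimes> x"] s xR by simp
    then have "x \<otimes> t \<in> S n" using s xR by (simp add: m_comm)
    \<comment> \<open>\<open>S n\<close> is saturated at \<open>Q\<close> and \<open>x\<close> is
      outside \<open>Q\<close>, so the factor \<open>x\<close> can be cancelled.\<close>
    then have "t \<in> sat Q (S n)" using xQ xR s unfolding sat_def by blast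
    then have "t \<in> S n" using S(3) by blast
    then show "\<exists>s\<in>carrier R - P. \<exists>na\<in>S (Suc n). \<exists>m\<in>S n. s \<otimes> r = na \<oplus> x \<otimes> m"
      using s xR m_comm[of t x] by auto
  qed
  then have "S n \<subseteq> S (Suc n)" using SP by blast
  moreover have "y [^] n \<in> S n" using S(2) adjoin_ideal(3)[OF Q'd(1), of "y [^] n"] yR unfolding B_def by auto
  ultimately have "y [^] n \<in> sat Q (B (Suc n))" unfolding S_def by blast
  then obtain s q t where s: "s \<in> carrier R - Q" "s \<otimes> (y [^] n) = q \<oplus> t \<otimes> (y [^] Suc n)" "q \<in> Q'" "t \<in> carrier R"
    unfolding sat_def adjoin_def B_def by blast
  have sR: "s \<in> carrier R" using s by simp
  have qR: "q \<in> carrier R" "y [^] n \<in> carrier R" using s Q'd yR by auto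
  \<comment> \<open>The relation \<open>s y^n = q + t y^(n+1)\<close> with \<open>q\<close> in
    \<open>Q'\<close> reads \<open>y^n (s - t y) \<in> Q'\<close>. A prime without \<open>y\<close>
    must contain \<open>s - t y\<close>, and this forces \<open>s\<close> into
    \<open>Q\<close>.\<close>
  have "(y [^] n) \<otimes> (s \<ominus> t \<otimes> y) = s \<otimes> (y [^] n) \<ominus> t \<otimes> (y [^] Suc n)"
    unfolding nat_pow_Suc using sR s(4) qR(2) yR by algebra
  also have "\<dots> = q" unfolding s(2) nat_pow_Suc using sR s(4) qR yR by algebra
  finally have "y [^] n \<in> Q' \<or> s \<ominus> t \<otimes> y \<in> Q'" using Q'd(4)[of "y [^] n" "s \<ominus> t \<otimes> y"] s qR yR by auto
  moreover have "y [^] n \<notin> Q'" using prime_pow[OF Q' yR] y by blast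
  ultimately have "s \<ominus> t \<otimes> y \<in> Q" using \<open>Q' \<subset> Q\<close> by blast
  moreover have "t \<otimes> y \<in> Q" using idealD(4)[OF Qd(1)] y s by blast
  ultimately have "(s \<ominus> t \<otimes> y) \<oplus> t \<otimes> y \<in> Q" using idealD(3)[OF Qd(1)] by blast
  moreover have "(s \<ominus> t \<otimes> y) \<oplus> t \<otimes> y = s" using sR s(4) yR by algebra
  ultimately show False using s by simp
qed

end

section \<open>Dimension of local rings\<close>

lemma chain_mono:
  fixes C :: "nat \<Rightarrow> 'b set"
  assumes "\<forall>i<k. C i \<subset> C (Suc i)" "i \<le> j" "j \<le> k"
  shows "C i \<subseteq> C j"
  using assms(2,3)
proof (induction j rule: dec_induct)
  case (step n)
  then have "C n \<subset> C (Suc n)" using assms(1) by simp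
  then show ?case using step by simp
qed simp

lemma sup_chain_length_le:
  assumes "\<And>n C. \<lbrakk>\<forall>i\<le>n. C i \<in> F; \<forall>i<n. C i \<subset> C (Suc i)\<rbrakk> \<Longrightarrow> ereal (real n) \<le> b"
  shows "sup_chain_length F \<le> b"
  unfolding sup_chain_length_def
proof (rule Sup_least)
  fix x assume "x \<in> {ereal (real n) |n. \<exists>C. (\<forall>i\<le>n. C i \<in> F) \<and> (\<forall>i<n. C i \<subset> C (Suc i))}"
  then obtain n C where "x = ereal (real n)" "\<forall>i\<le>n. C i \<in> F" "\<forall>i<n. C i \<subset> C (Suc i)" by blast
  then show "x \<le> b" using assms[of n C] by simp
qed

lemma sup_chain_length_ge:
  assumes "\<forall>i\<le>n. C i \<in> F" "\<forall>i<n. C i \<subset> C (Suc i)"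
  shows "ereal (real n) \<le> sup_chain_length F"
  unfolding sup_chain_length_def by (rule Sup_upper) (use assms in blast)

text \<open>Equalities of dimensions and lengths are proved by strictly monotone maps in both
  directions, which need not be inverse to each other.\<close>

lemma sup_chain_length_map:
  assumes "\<And>K. K \<in> F \<Longrightarrow> f K \<in> G" "\<And>K L. \<lbrakk>K \<in> F; L \<in> F; K \<subset> L\<rbrakk> \<Longrightarrow> f K \<subset> f L"
  shows "sup_chain_length F \<le> sup_chain_length G"
proof (rule sup_chain_length_le)
  fix n C assume C: "\<forall>i\<le>n. C i \<in> F" "\<forall>i<n. C i \<subset> C (Suc i)"
  show "ereal (real n) \<le> sup_chain_length G"
  proof (rule sup_chain_length_ge[of n "\<lambda>i. f (C i)"])
    show "\<forall>i\<le>n. f (C i) \<in> G" using C(1) assms(1) by simp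
    show "\<forall>i<n. f (C i) \<subset> f (C (Suc i))" using C assms(2) by simp
  qed
qed

text \<open>Under a finite supremum the chain lengths form a finite set of natural numbers, so the
  supremum is their maximum.\<close>

lemma sup_chain_length_attained:
  assumes "F \<noteq> {}" "sup_chain_length F < \<infinity>"
  obtains n where "sup_chain_length F = ereal (real n)"
    "\<And>k C. \<lbrakk>\<forall>i\<le>k. C i \<in> F; \<forall>i<k. C i \<subset> C (Suc i)\<rbrakk> \<Longrightarrow> k \<le> n"
proof -
  let ?N = "{n. \<exists>C. (\<forall>i\<le>n. C i \<in> F) \<and> (\<forall>i<n. C i \<subset> C (Suc i))}"
  obtain K where K: "K \<in> F" using assms(1) by blast
  have 0: "0 \<in> ?N" using K by (auto intro!: exI[of _ "\<lambda>_. K"])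
  have "0 \<le> sup_chain_length F"
    using sup_chain_length_ge[of 0 "\<lambda>_. K" F] K by (simp add: zero_ereal_def)
  then obtain r where r: "sup_chain_length F = ereal r" using assms(2) by (cases "sup_chain_length F") auto
  have le: "real n \<le> r" if "n \<in> ?N" for n
    using that sup_chain_length_ge[of n _ F] r by auto
  have fin: "finite ?N"
  proof (rule finite_subset)
    show "?N \<subseteq> {..nat \<lfloor>r\<rfloor>}"
    proof
      fix x assume "x \<in> ?N"
      then have "real x \<le> r" by (rule le)
      then show "x \<in> {..nat \<lfloor>r\<rfloor>}" by (simp add: le_nat_floor)
    qed
  qed simp
  let ?n = "Max ?N"
  have n: "?n \<in> ?N" using fin 0 by (intro Max_in) auto
  have mx: "k \<le> ?n" if "\<forall>i\<le>k. C i \<in> F" "\<forall>i<k. C i \<subset> C (Suc i)" for k C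
    using fin by (rule Max_ge) (use that in blast)
  have "sup_chain_length F \<le> ereal (real ?n)"
    by (rule sup_chain_length_le) (use mx in simp)
  moreover have "ereal (real ?n) \<le> sup_chain_length F"
    using n sup_chain_length_ge by blast
  ultimately show thesis using that[of ?n] mx by simp
qed

text \<open>The closed set \<open>V(S)\<close> of the spectrum, for arbitrary \<open>S\<close>, so
  that \<open>J \<union> set xs\<close> can be used without forming the ideal it generates.\<close>

definition primes_over :: "('r, 'x) ring_scheme \<Rightarrow> 'r set \<Rightarrow> 'r set set" where
  "primes_over R S = {P. primeideal P R \<and> S \<subseteq> P}"

section \<open>Krull's height theorem and finiteness of minimal primes\<close>

context noetherian_cring
begin

text \<open>An ideal maximal among those over \<open>I\<close> that miss \<open>S\<close> is prime:
  enlarging it by either of two elements outside it meets \<open>S\<close>, and the product of the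
  two elements found there lies in \<open>S\<close> again.\<close>

lemma exists_prime_disjoint:
  assumes I: "ideal I R" and S: "S \<subseteq> carrier R" "\<one> \<in> S" "\<And>a b. \<lbrakk>a \<in> S; b \<in> S\<rbrakk> \<Longrightarrow> a \<otimes> b \<in> S"
    and disj: "I \<inter> S = {}"
  shows "\<exists>Q. primeideal Q R \<and> I \<subseteq> Q \<and> Q \<inter> S = {}"
proof -
  let ?F = "{K. ideal K R \<and> I \<subseteq> K \<and> K \<inter> S = {}}"
  have "?F \<noteq> {}" using I disj by blast
  then have "\<exists>M\<in>?F. \<forall>J\<in>?F. M \<subseteq> J \<longrightarrow> J = M"
    by (rule exists_maximal) simp
  then obtain Q where Q': "Q \<in> ?F" and max: "\<forall>J\<in>?F. Q \<subseteq> J \<longrightarrow> J = Q" by (rule bexE)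
  then have Q: "ideal Q R" "I \<subseteq> Q" "Q \<inter> S = {}" by simp_all
  have meet: "\<exists>q\<in>Q. \<exists>t\<in>carrier R. q \<oplus> t \<otimes> a \<in> S" if a: "a \<in> carrier R" "a \<notin> Q" for a
  proof (rule ccontr)
    assume n: "\<not> ?thesis"
    note A = adjoin_ideal[OF Q(1) a(1)]
    have "adjoin Q a \<inter> S = {}" using n by (auto simp: adjoin_def)
    then have "adjoin Q a \<in> ?F" using A(1,2) Q(2) by blast
    then have "adjoin Q a = Q" using max A(2) by blast
    then show False using A(3) a(2) by simp
  qed
  have "primeideal Q R"
  proof (rule primeideal_of_closed[OF Q(1)])
    show "\<one> \<notin> Q" using Q(3) S(2) by blast
    fix a b assume ab: "a \<otimes> b \<in> Q" "a \<in> carrier R" "b \<in> carrier R"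
    show "a \<in> Q \<or> b \<in> Q"
    proof (rule ccontr)
      assume "\<not> (a \<in> Q \<or> b \<in> Q)"
      then obtain q t p u where s: "q \<in> Q" "t \<in> carrier R" "q \<oplus> t \<otimes> a \<in> S"
          "p \<in> Q" "u \<in> carrier R" "p \<oplus> u \<otimes> b \<in> S"
        using meet[OF ab(2)] meet[OF ab(3)] by blast
      note Qd = idealD[OF Q(1)]
      have c: "q \<in> carrier R" "p \<in> carrier R" using s Qd(1) by auto
      have "(q \<oplus> t \<otimes> a) \<otimes> (p \<oplus> u \<otimes> b) = (p \<oplus> u \<otimes> b) \<otimes> q \<oplus> ((t \<otimes> a) \<otimes> p \<oplus> (t \<otimes> u) \<otimes> (a \<otimes> b))"
        using c s(2,5) ab(2,3) by algebra
      moreover have "(p \<oplus> u \<otimes> b) \<otimes> q \<oplus> ((t \<otimes> a) \<otimes> p \<oplus> (t \<otimes> u) \<otimes> (a \<otimes> b)) \<in> Q"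
        by (rule Qd(3)[OF Qd(4)[OF s(1)] Qd(3)[OF Qd(4)[OF s(4)] Qd(4)[OF ab(1)]]]) (use c s ab in simp_all)
      moreover have "(q \<oplus> t \<otimes> a) \<otimes> (p \<oplus> u \<otimes> b) \<in> S" using S(3) s(3,6) by blast
      ultimately show False using Q(3) by auto
    qed
  qed
  then show ?thesis using Q by blast
qed

text \<open>At a minimal prime \<open>P\<close> over \<open>I\<close> the radical of
  \<open>I_P\<close> is the maximal ideal of \<open>R_P\<close>. Otherwise some prime over
  \<open>I\<close> misses all products \<open>s x^e\<close>; the case \<open>e = 0\<close> puts it
  inside \<open>P\<close>, so it equals \<open>P\<close> and contains \<open>x\<close> after
  all.\<close>

lemma local_radical:
  assumes I: "ideal I R" and P: "primeideal P R"
    and min: "\<And>Q. \<lbrakk>primeideal Q R; I \<subseteq> Q; Q \<subseteq> P\<rbrakk> \<Longrightarrow> Q = P" and x: "x \<in> P"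
  shows "\<exists>s\<in>carrier R - P. \<exists>e::nat. s \<otimes> (x [^] e) \<in> I"
proof (rule ccontr)
  assume n: "\<not> ?thesis"
  let ?S = "{s \<otimes> (x [^] e) | s e. s \<in> carrier R - P \<and> e \<in> (UNIV::nat set)}"
  note Pd = primeD[OF P]
  have xR: "x \<in> carrier R" using x Pd(2) by blast
  have one: "\<one> \<in> carrier R - P" using Pd(3) by simp
  have "\<exists>Q. primeideal Q R \<and> I \<subseteq> Q \<and> Q \<inter> ?S = {}"
  proof (rule exists_prime_disjoint[OF I])
    show "?S \<subseteq> carrier R" using xR by auto
    have "\<one> = \<one> \<otimes> (x [^] (0::nat))" by simp
    then show "\<one> \<in> ?S" using one by blast
    show "I \<inter> ?S = {}" using n by blast
    fix a b assume "a \<in> ?S" "b \<in> ?S"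
    then obtain s t and e f :: nat where ab: "a = s \<otimes> (x [^] e)" "b = t \<otimes> (x [^] f)"
      "s \<in> carrier R - P" "t \<in> carrier R - P" by blast
    have c: "s \<in> carrier R" "t \<in> carrier R" "x [^] e \<in> carrier R" "x [^] f \<in> carrier R" using ab xR by auto
    have "a \<otimes> b = (s \<otimes> t) \<otimes> (x [^] (e + f))"
      unfolding ab(1,2) nat_pow_mult[OF xR, symmetric] using c by algebra
    then show "a \<otimes> b \<in> ?S" using Pd(5)[OF ab(3,4)] by blast
  qed
  then obtain Q where Q: "primeideal Q R" "I \<subseteq> Q" "Q \<inter> ?S = {}" by blast
  have "Q \<subseteq> P"
  proof
    fix r assume r: "r \<in> Q"
    then have rR: "r \<in> carrier R" using primeD(2)[OF Q(1)] by blast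
    show "r \<in> P"
    proof (rule ccontr)
      assume "r \<notin> P"
      moreover have "r = r \<otimes> (x [^] (0::nat))" using rR by simp
      ultimately have "r \<in> ?S" using rR by blast
      then show False using Q(3) r by blast
    qed
  qed
  then have "Q = P" using min Q by blast
  moreover have "x = \<one> \<otimes> (x [^] (1::nat))" using xR by simp
  then have "x \<in> ?S" using one by blast
  ultimately show False using Q(3) x by blast
qed

text \<open>Induction on the number of elements of \<open>X\<close>. Take a prime \<open>Q\<close>
  directly below \<open>P\<close> and \<open>z\<close> in \<open>X\<close> outside \<open>Q\<close>.
  Up to a unit at \<open>P\<close>, some power of each other \<open>x\<close> is an element
  \<open>f x\<close> of \<open>Q\<close> plus a multiple of \<open>z\<close>. The principal ideal
  theorem makes \<open>Q\<close> minimal over \<open>I\<close> and these \<open>f x\<close>, of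
  which there is at least one fewer.\<close>

lemma height_bound:
  assumes I: "ideal I R"
  shows "\<lbrakk>finite X; card X \<le> n; primeideal P R; X \<subseteq> P;
     \<forall>T. primeideal T R \<longrightarrow> I \<subseteq> T \<longrightarrow> X \<subseteq> T \<longrightarrow> T \<subseteq> P \<longrightarrow> T = P;
     \<forall>i\<le>k. C i \<in> primes_over R I; \<forall>i<k. C i \<subset> C (Suc i); C k = P\<rbrakk> \<Longrightarrow> k \<le> n"
proof (induction n arbitrary: X P C k)
  case 0
  then have X: "X = {}" by simp
  have "C 0 \<subseteq> C k" using chain_mono[OF 0(7), of 0 k] by simp
  moreover have "C 0 \<in> primes_over R I" using 0(6) by simp
  ultimately have eq: "C 0 = P" using 0(5,8) X by (simp add: primes_over_def)
  show ?case
  proof (rule ccontr)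
    assume "\<not> k \<le> 0"
    then have "C 0 \<subset> C (Suc 0)" "C (Suc 0) \<subseteq> C k" using 0(7) chain_mono[OF 0(7), of "Suc 0" k] by auto
    then show False using eq 0(8) by simp
  qed
next
  case (Suc n)
  show ?case
  proof (cases k)
    case 0 then show ?thesis by simp
  next
    case k: (Suc k')
    have Ck': "primeideal (C k') R" "I \<subseteq> C k'" "C k' \<subset> P"
      using Suc.prems(6,7,8) k by (auto simp: primes_over_def)
    let ?F = "{T. primeideal T R \<and> C k' \<subseteq> T \<and> T \<subset> P}"
    have "?F \<noteq> {}" using Ck' by blast
    then have "\<exists>M\<in>?F. \<forall>J\<in>?F. M \<subseteq> J \<longrightarrow> J = M"
      by (rule exists_maximal) (simp add: primeD(1))
    then obtain Q where "Q \<in> ?F" and max: "\<forall>J\<in>?F. Q \<subseteq> J \<longrightarrow> J = Q" by (rule bexE)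
    then have Q: "primeideal Q R" "C k' \<subseteq> Q" "Q \<subset> P" by simp_all
    have between: "T = P" if "primeideal T R" "Q \<subset> T" "T \<subseteq> P" for T
    proof (rule ccontr)
      assume "T \<noteq> P"
      then have "T \<in> ?F" using that Q(2) by blast
      then show False using max that(2) by blast
    qed
    have IQ: "I \<subseteq> Q" using Ck'(2) Q(2) by blast
    \<comment> \<open>If all of \<open>X\<close> lay in \<open>Q\<close>, minimality of
      \<open>P\<close> would give \<open>Q = P\<close>.\<close>
    have "\<not> X \<subseteq> Q" using Suc.prems(5) Q(1,3) IQ by blast
    then obtain z where z: "z \<in> X" "z \<notin> Q" by blast
    have zR: "z \<in> carrier R" using z Suc.prems(4) primeD(2)[OF Suc.prems(3)] by blast
    note A = adjoin_ideal[OF primeD(1)[OF Q(1)] zR]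
    have minA: "T = P" if "primeideal T R" "adjoin Q z \<subseteq> T" "T \<subseteq> P" for T
      using between[OF that(1) _ that(3)] A(2,3) that(2) z(2) by blast
    have "\<forall>x\<in>X - {z}. \<exists>y. y \<in> Q \<and> (\<exists>s\<in>carrier R - P. \<exists>e::nat. \<exists>t\<in>carrier R. s \<otimes> (x [^] e) = y \<oplus> t \<otimes> z)"
    proof
      fix x assume "x \<in> X - {z}"
      then have "x \<in> P" using Suc.prems(4) by blast
      then obtain s and e :: nat where "s \<in> carrier R - P" "s \<otimes> (x [^] e) \<in> adjoin Q z"
        using local_radical[OF A(1) Suc.prems(3) minA] by blast
      then show "\<exists>y. y \<in> Q \<and> (\<exists>s\<in>carrier R - P. \<exists>e::nat. \<exists>t\<in>carrier R. s \<otimes> (x [^] e) = y \<oplus> t \<otimes> z)"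
        unfolding adjoin_def by blast
    qed
    then obtain f where f: "\<forall>x\<in>X - {z}. f x \<in> Q \<and>
        (\<exists>s\<in>carrier R - P. \<exists>e::nat. \<exists>t\<in>carrier R. s \<otimes> (x [^] e) = f x \<oplus> t \<otimes> z)"
      by (rule bchoice[THEN exE])
    let ?Y = "f ` (X - {z})"
    have "k' \<le> n"
    \<comment> \<open>The chain loses its top \<open>P\<close>, and its new top \<open>C k'\<close>
      is raised to \<open>Q\<close>.\<close>
    proof (rule Suc.IH[of ?Y Q k' "\<lambda>i. if i = k' then Q else C i"])
      show "finite ?Y" using Suc.prems(1) by simp
      have "card ?Y \<le> card (X - {z})" using Suc.prems(1) by (intro card_image_le) simp
      also have "\<dots> \<le> n" using Suc.prems(1,2) z(1) by simp
      finally show "card ?Y \<le> n" .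
      show "primeideal Q R" by (rule Q)
      show "?Y \<subseteq> Q" using f by blast
      show "\<forall>i\<le>k'. (if i = k' then Q else C i) \<in> primes_over R I"
        using Suc.prems(6) k Q(1) IQ by (auto simp: primes_over_def)
      show "\<forall>i<k'. (if i = k' then Q else C i) \<subset> (if Suc i = k' then Q else C (Suc i))"
      proof (intro allI impI)
        fix i assume i: "i < k'"
        then have "C i \<subset> C (Suc i)" using Suc.prems(7) k by simp
        then show "(if i = k' then Q else C i) \<subset> (if Suc i = k' then Q else C (Suc i))"
          using i Q(2) by auto
      qed
      show "\<forall>T. primeideal T R \<longrightarrow> I \<subseteq> T \<longrightarrow> ?Y \<subseteq> T \<longrightarrow> T \<subseteq> Q \<longrightarrow> T = Q"
      proof (intro allI impI, rule ccontr)
        fix T assume T: "primeideal T R" "I \<subseteq> T" "?Y \<subseteq> T" "T \<subseteq> Q" "T \<noteq> Q"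
        then have TQ: "T \<subset> Q" by blast
        have zP: "z \<in> P" using z Suc.prems(4) by blast
        show False
        \<comment> \<open>A prime \<open>U\<close> inside \<open>P\<close> over \<open>T\<close> and
          \<open>z\<close> contains every \<open>f x\<close>, hence a power of every
          \<open>x\<close> up to a unit at \<open>P\<close>, hence all of \<open>X\<close>. So
          \<open>P\<close> is minimal over \<open>T\<close> and \<open>z\<close>, although
          \<open>Q\<close> lies strictly between \<open>T\<close> and \<open>P\<close>.\<close>
        proof (rule principal_ideal_theorem[OF T(1) Q(1) Suc.prems(3) TQ Q(3) zP])
          fix U assume U: "primeideal U R" "T \<subseteq> U" "z \<in> U" "U \<subseteq> P"
          note Ud = primeD[OF U(1)]
          have "X \<subseteq> U"
          proof
            fix x assume x: "x \<in> X"
            show "x \<in> U"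
            proof (cases "x = z")
              case True then show ?thesis using U by simp
            next
              case False
              then have fx: "f x \<in> U" using T(3) U(2) x by blast
              from False x f obtain s t and e :: nat where s: "s \<in> carrier R - P" "t \<in> carrier R"
                "s \<otimes> (x [^] e) = f x \<oplus> t \<otimes> z" by blast
              have xR: "x \<in> carrier R" using x Suc.prems(4) primeD(2)[OF Suc.prems(3)] by blast
              have "t \<otimes> z \<in> U" using idealD(4)[OF Ud(1) U(3) s(2)] .
              then have "s \<otimes> (x [^] e) \<in> U" unfolding s(3) using idealD(3)[OF Ud(1) fx] by simp
              then have "s \<in> U \<or> x [^] e \<in> U" using Ud(4) s(1) xR by simp
              then show ?thesis using s(1) U(4) prime_pow[OF U(1) xR] by blast
            qed
          qed
          then show "U = P" using Suc.prems(5) U(1,4) T(2) U(2) by blast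
        qed
      qed
    qed simp
    then show ?thesis using k by simp
  qed
qed

text \<open>Noetherian induction. If a proper \<open>I\<close> is not prime, some
  \<open>a \<otimes> b\<close> lies in \<open>I\<close> with neither factor in it, and every prime
  over \<open>I\<close> lies over \<open>adjoin I a\<close> or \<open>adjoin I b\<close>.\<close>

lemma finite_minimal_primes:
  assumes "ideal I R"
  shows "\<exists>F. finite F \<and> F \<subseteq> primes_over R I \<and> (\<forall>P\<in>primes_over R I. \<exists>Q\<in>F. Q \<subseteq> P)"
  using assms
proof (induction I rule: ideal_induct)
  case (step I)
  show ?case
  proof (cases "primeideal I R")
    case True
    then show ?thesis by (intro exI[of _ "{I}"]) (simp add: primes_over_def)
  next
    case False
    interpret I: ideal I R by (rule step.hyps)
    have "carrier R = I \<or> (\<exists>a b. a \<in> carrier R \<and> b \<in> carrier R \<and> a \<otimes> b \<in> I \<and> a \<notin> I \<and> b \<notin> I)"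
      by (rule I.primeidealCD[OF is_cring False])
    then show ?thesis
    proof
      assume "carrier R = I"
      then have "primes_over R I = {}"
        using primeD(2,3) one_closed unfolding primes_over_def by blast
      then show ?thesis by (intro exI[of _ "{}"]) simp
    next
      assume "\<exists>a b. a \<in> carrier R \<and> b \<in> carrier R \<and> a \<otimes> b \<in> I \<and> a \<notin> I \<and> b \<notin> I"
      then obtain a b where ab: "a \<in> carrier R" "b \<in> carrier R" "a \<otimes> b \<in> I" "a \<notin> I" "b \<notin> I" by blast
      note A = adjoin_ideal[OF step.hyps ab(1)] and B = adjoin_ideal[OF step.hyps ab(2)]
      have "I \<subset> adjoin I a" "I \<subset> adjoin I b" using A(2,3) B(2,3) ab(4,5) by blast+
      then obtain F G where F: "finite F" "F \<subseteq> primes_over R (adjoin I a)"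
          "\<forall>P\<in>primes_over R (adjoin I a). \<exists>Q\<in>F. Q \<subseteq> P"
        and G: "finite G" "G \<subseteq> primes_over R (adjoin I b)"
          "\<forall>P\<in>primes_over R (adjoin I b). \<exists>Q\<in>G. Q \<subseteq> P"
        using step.IH[OF A(1)] step.IH[OF B(1)] by blast
      have "\<exists>Q\<in>F \<union> G. Q \<subseteq> P" if P: "P \<in> primes_over R I" for P
      proof -
        have P': "primeideal P R" "I \<subseteq> P" using P by (auto simp: primes_over_def)
        have "a \<in> P \<or> b \<in> P" using primeD(4)[OF P'(1)] ab P'(2) by blast
        then have "adjoin I a \<subseteq> P \<or> adjoin I b \<subseteq> P"
          using A(4) B(4) primeD(1)[OF P'(1)] P'(2) by blast
        then have "P \<in> primes_over R (adjoin I a) \<or> P \<in> primes_over R (adjoin I b)"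
          using P'(1) by (simp add: primes_over_def)
        then show ?thesis using F(3) G(3) by blast
      qed
      moreover have "F \<union> G \<subseteq> primes_over R I"
        using F(2) G(2) A(2) B(2) by (force simp: primes_over_def)
      ultimately show ?thesis using F(1) G(1) by (intro exI[of _ "F \<union> G"]) blast
    qed
  qed
qed

end

section \<open>Prime avoidance\<close>

lemma (in cring) exists_inter_not_mem_prime:
  assumes P: "primeideal P R" and I: "ideal I R" "\<not> I \<subseteq> P"
    and "finite G" "\<And>Q. Q \<in> G \<Longrightarrow> primeideal Q R" "\<And>Q. Q \<in> G \<Longrightarrow> \<not> Q \<subseteq> P"
  shows "\<exists>w\<in>I. w \<notin> P \<and> (\<forall>Q\<in>G. w \<in> Q)"
  using assms(4-6)
proof (induction G rule: finite_induct)
  case empty then show ?case using I by blast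
next
  case (insert Q G)
  have "\<exists>w\<in>I. w \<notin> P \<and> (\<forall>Q\<in>G. w \<in> Q)" by (rule insert.IH) (use insert.prems in simp_all)
  then obtain w where w: "w \<in> I" "w \<notin> P" "\<forall>Q\<in>G. w \<in> Q" by blast
  obtain q where q: "q \<in> Q" "q \<notin> P" using insert.prems(2)[of Q] by auto
  have Q: "primeideal Q R" using insert.prems by simp
  have c: "w \<in> carrier R" "q \<in> carrier R" using w q idealD(1)[OF I(1)] primeD(2)[OF Q] by auto
  have "q \<otimes> w \<in> I" using idealD(4)[OF I(1) w(1) c(2)] .
  moreover have "q \<otimes> w \<notin> P" using primeD(4)[OF P] c w(2) q(2) by blast
  moreover have "q \<otimes> w \<in> Q" using idealD(4)[OF primeD(1)[OF Q] q(1) c(1)] c by (simp add: m_comm)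
  moreover have "q \<otimes> w \<in> T" if "T \<in> G" for T
    using idealD(4)[OF primeD(1), of T w q] insert.prems(1)[of T] that w(3) c(2) by simp
  ultimately show ?case by blast
qed

lemma (in cring) prime_avoidance:
  assumes "finite F" "\<forall>P\<in>F. primeideal P R" and I: "ideal I R"
    and "\<forall>P\<in>F. \<not> I \<subseteq> P"
  shows "\<exists>x\<in>I. \<forall>P\<in>F. x \<notin> P"
  using assms(1,2,4)
proof (induction F rule: finite_psubset_induct)
  case (psubset F)
  show ?case
  proof (cases "\<exists>P\<in>F. \<exists>Q\<in>F. P \<noteq> Q \<and> P \<subseteq> Q")
    case True
    then obtain P Q where PQ: "P \<in> F" "Q \<in> F" "P \<noteq> Q" "P \<subseteq> Q" by blast
    have "\<exists>x\<in>I. \<forall>P\<in>F - {P}. x \<notin> P" by (rule psubset.IH) (use PQ psubset.prems in auto)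
    then show ?thesis using PQ by blast
  next
    case anti: False
    show ?thesis
    proof (cases "F = {}")
      case True then show ?thesis using idealD(2)[OF I] by blast
    next
      case False
      then obtain P where P: "P \<in> F" by blast
      have "\<exists>x\<in>I. \<forall>P\<in>F - {P}. x \<notin> P" by (rule psubset.IH) (use P psubset.prems in auto)
      then obtain x where x: "x \<in> I" "\<forall>Q\<in>F - {P}. x \<notin> Q" by blast
      have Pp: "primeideal P R" "\<not> I \<subseteq> P" using psubset.prems P by simp_all
      have "\<exists>w\<in>I. w \<notin> P \<and> (\<forall>Q\<in>F - {P}. w \<in> Q)"
        by (rule exists_inter_not_mem_prime[OF Pp(1) I Pp(2)]) (use psubset.hyps psubset.prems anti P in auto)
      then obtain w where w: "w \<in> I" "w \<notin> P" "\<forall>Q\<in>F - {P}. w \<in> Q" by blast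
      have c: "x \<in> carrier R" "w \<in> carrier R" using x w idealD(1)[OF I] by auto
      show ?thesis
      proof (cases "x \<in> P")
        case False then show ?thesis using x by blast
      next
        case True
        have "x \<oplus> w \<notin> Q" if Q: "Q \<in> F" for Q
        proof
          assume *: "x \<oplus> w \<in> Q"
          have Qi: "ideal Q R" using psubset.prems Q primeD(1) by blast
          show False
          proof (cases "Q = P")
            case True
            then show False using ideal_cancel[OF Qi *] \<open>x \<in> P\<close> c w(2) by blast
          next
            case False
            then have "w \<in> Q" "x \<notin> Q" using Q w(3) x(2) by auto
            moreover have "w \<oplus> x \<in> Q" using * c by (simp add: a_comm)
            ultimately show False using ideal_cancel[OF Qi] c by blast
          qed
        qed
        moreover have "x \<oplus> w \<in> I" using idealD(3)[OF I x(1) w(1)] .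
        ultimately show ?thesis by blast
      qed
    qed
  qed
qed

text \<open>Preimage and image under the projection to \<open>R/I\<close> are strictly monotone on
  primes. From here on dimensions are computed with primes of \<open>R\<close>.\<close>

lemma (in cring) krull_dim_quot:
  assumes I: "ideal I R"
  shows "krull_dim (R Quot I) = sup_chain_length (primes_over R I)"
proof -
  have carr: "carrier (R Quot I) = (+>) I ` carrier R"
    unfolding FactRing_def A_RCOSETS_def' by (simp add: UNION_singleton_eq_range)
  interpret I: ideal I R by fact
  have oneQ: "\<one>\<^bsub>R Quot I\<^esub> = I +> \<one>" by (simp add: FactRing_def)
  have multQ: "(I +> r) \<otimes>\<^bsub>R Quot I\<^esub> (I +> s) = I +> (r \<otimes> s)" if "r \<in> carrier R" "s \<in> carrier R" for r s
    using I.rcoset_mult_add[OF that] by (simp add: FactRing_def)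
  interpret h: ring_hom_ring R "R Quot I" "(+>) I" by (rule I.rcos_ring_hom_ring)
  have crQ: "cring (R Quot I)" by (rule I.quotient_is_cring[OF is_cring])
  let ?v = "\<lambda>Q. {r \<in> carrier R. I +> r \<in> Q}"
  have v: "?v Q \<in> primes_over R I" if Q: "primeideal Q (R Quot I)" for Q
  proof -
    interpret Q: primeideal Q "R Quot I" by fact
    have "primeideal (?v Q) R" by (rule h.primeideal_vimage[OF is_cring Q])
    moreover have "I \<subseteq> ?v Q"
    proof
      fix i assume i: "i \<in> I"
      then have "I +> i = \<zero>\<^bsub>R Quot I\<^esub>" unfolding FactRing_def by (simp add: I.a_rcos_const)
      then have "I +> i \<in> Q" by simp
      then show "i \<in> ?v Q" using i I.a_subset by blast
    qed
    ultimately show ?thesis by (simp add: primes_over_def)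
  qed
  have vs: "?v Q \<subset> ?v Q'" if Q: "primeideal Q (R Quot I)" "primeideal Q' (R Quot I)" "Q \<subset> Q'" for Q Q'
  proof -
    have "Q' \<subseteq> carrier (R Quot I)" by (rule cring.primeD(2)[OF crQ Q(2)])
    then have "\<exists>r\<in>carrier R. I +> r \<in> Q' - Q" using Q(3) unfolding carr by blast
    then show ?thesis using Q(3) by blast
  qed
  let ?w = "\<lambda>P. (+>) I ` P"
  \<comment> \<open>As \<open>P\<close> contains \<open>I\<close>, whether a coset comes from
    \<open>P\<close> does not depend on its representative.\<close>
  have mem: "I +> r \<in> ?w P \<longleftrightarrow> r \<in> P" if P: "ideal P R" "I \<subseteq> P" "r \<in> carrier R" for P r
  proof
    assume "I +> r \<in> ?w P"
    then obtain p where p: "p \<in> P" "I +> r = I +> p" by blast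
    have pR: "p \<in> carrier R" using p idealD(1)[OF P(1)] by blast
    then have "r \<ominus> p \<in> P" using quotient_eq_iff_same_a_r_cos[OF I P(3) pR] p P(2) by blast
    then have "(r \<ominus> p) \<oplus> p \<in> P" using p idealD(3)[OF P(1)] by blast
    moreover have "(r \<ominus> p) \<oplus> p = r" using P(3) pR by algebra
    ultimately show "r \<in> P" by simp
  qed simp
  have w: "primeideal (?w P) (R Quot I)" if P: "P \<in> primes_over R I" for P
  proof -
    have P': "primeideal P R" "I \<subseteq> P" using P by (auto simp: primes_over_def)
    note Pd = primeD[OF P'(1)] idealD[OF primeD(1)[OF P'(1)]]
    interpret S: cring "R Quot I" by (rule crQ)
    show ?thesis
    proof (rule S.primeideal_of_closed)
      show "ideal (?w P) (R Quot I)"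
        by (rule ring_ideal_imp_quot_ideal[OF I Pd(1)])
      show "\<one>\<^bsub>R Quot I\<^esub> \<notin> ?w P"
        unfolding oneQ using mem[OF Pd(1) P'(2) one_closed] Pd(3) by blast
      fix a b assume ab: "a \<otimes>\<^bsub>R Quot I\<^esub> b \<in> ?w P" "a \<in> carrier (R Quot I)" "b \<in> carrier (R Quot I)"
      then obtain r s where rs: "r \<in> carrier R" "s \<in> carrier R" "a = I +> r" "b = I +> s"
        unfolding carr by blast
      have "I +> (r \<otimes> s) \<in> ?w P" using ab(1) unfolding rs(3,4) multQ[OF rs(1,2)] .
      then have "r \<otimes> s \<in> P" using mem[OF Pd(1) P'(2) m_closed[OF rs(1,2)]] by blast
      then show "a \<in> ?w P \<or> b \<in> ?w P" using Pd(4) rs by blast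
    qed
  qed
  have ws: "?w P \<subset> ?w P'" if P: "P \<in> primes_over R I" "P' \<in> primes_over R I" "P \<subset> P'" for P P'
  proof -
    have p: "primeideal P R" "I \<subseteq> P" "primeideal P' R" using P by (auto simp: primes_over_def)
    obtain r where r: "r \<in> P'" "r \<notin> P" using P(3) by blast
    have "I +> r \<notin> ?w P" using mem[OF primeD(1)[OF p(1)] p(2)] r primeD(2)[OF p(3)] by blast
    then show ?thesis using r P(3) by blast
  qed
  show ?thesis unfolding krull_dim_def
  proof (rule antisym)
    show "sup_chain_length {P. primeideal P (R Quot I)} \<le> sup_chain_length (primes_over R I)"
      by (rule sup_chain_length_map[where f = ?v]) (use v vs in simp_all)
    show "sup_chain_length (primes_over R I) \<le> sup_chain_length {P. primeideal P (R Quot I)}"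
      by (rule sup_chain_length_map[where f = ?w]) (use w ws in simp_all)
  qed
qed

section \<open>Dimension and parameters of noetherian local rings\<close>

locale noetherian_local = noetherian_cring +
  fixes \<mm> assumes local: "local_ring R \<mm>"
begin

lemma maximal: "maximalideal \<mm> R"
  using local by (auto simp: local_ring_def)

lemma prime_max: "primeideal \<mm> R"
  by (rule maximalideal_prime[OF maximal])

lemma proper_subset_max:
  assumes "ideal I R" "\<one> \<notin> I"
  shows "I \<subseteq> \<mm>"
proof -
  let ?F = "{K. ideal K R \<and> I \<subseteq> K \<and> \<one> \<notin> K}"
  have "?F \<noteq> {}" using assms by blast
  then have "\<exists>M\<in>?F. \<forall>J\<in>?F. M \<subseteq> J \<longrightarrow> J = M"
    by (rule exists_maximal) simp
  then obtain M where M: "M \<in> ?F" and max: "\<forall>J\<in>?F. M \<subseteq> J \<longrightarrow> J = M" by (rule bexE)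
  have "maximalideal M R"
  proof (rule maximalidealI)
    show "ideal M R" using M by simp
    show "carrier R \<noteq> M" using M by auto
    fix J assume J: "ideal J R" "M \<subseteq> J" "J \<subseteq> carrier R"
    show "J = M \<or> J = carrier R"
    proof (cases "\<one> \<in> J")
      case True
      then show ?thesis using ideal.one_imp_carrier[OF J(1)] by simp
    next
      case False
      then have "J \<in> ?F" using M J by blast
      then show ?thesis using max J(2) by blast
    qed
  qed
  then have "M = \<mm>" using local by (auto simp: local_ring_def)
  then show ?thesis using M by simp
qed

lemma prime_subset_max: "primeideal P R \<Longrightarrow> P \<subseteq> \<mm>"
  by (rule proper_subset_max) (simp_all add: primeD)

lemma max_in_primes_over: "S \<subseteq> \<mm> \<Longrightarrow> \<mm> \<in> primes_over R S"
  using prime_max by (simp add: primes_over_def)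

text \<open>The height bound speaks of chains ending at a minimal prime over
  \<open>J \<union> X\<close>, here \<open>\<mm>\<close>. A chain that ends elsewhere can be
  prolonged by \<open>\<mm>\<close>.\<close>

lemma dim_le_card_parameters:
  assumes J: "ideal J R" and X: "finite X" "primes_over R (J \<union> X) = {\<mm>}"
    and C: "\<forall>i\<le>k. C i \<in> primes_over R J" "\<forall>i<k. C i \<subset> C (Suc i)"
  shows "k \<le> card X"
proof -
  have Jm: "J \<subseteq> \<mm>" "X \<subseteq> \<mm>" using X(2) by (auto simp: primes_over_def)
  have min: "\<forall>T. primeideal T R \<longrightarrow> J \<subseteq> T \<longrightarrow> X \<subseteq> T \<longrightarrow> T \<subseteq> \<mm> \<longrightarrow> T = \<mm>"
    using X(2) unfolding primes_over_def by blast
  note hb = height_bound[OF J X(1) order_refl prime_max Jm(2) min]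
  show ?thesis
  proof (cases "C k = \<mm>")
    case True
    then show ?thesis using hb[OF C] by blast
  next
    case False
    have Ck: "C k \<subset> \<mm>" using False C(1) prime_subset_max[of "C k"] by (auto simp: primes_over_def)
    let ?C = "\<lambda>i. if i = Suc k then \<mm> else C i"
    have "Suc k \<le> card X"
    proof (rule hb)
      show "\<forall>i\<le>Suc k. ?C i \<in> primes_over R J"
        using C(1) max_in_primes_over[OF Jm(1)] by (simp add: le_Suc_eq)
      show "\<forall>i<Suc k. ?C i \<subset> ?C (Suc i)" using C(2) Ck by (simp add: less_Suc_eq)
    qed simp
    then show ?thesis by simp
  qed
qed

text \<open>Finitely many generators of \<open>\<mm>\<close> leave \<open>\<mm>\<close> as the only
  prime over them, so their number bounds the dimension.\<close>

lemma dim_finite: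
  assumes J: "ideal J R" "J \<subseteq> \<mm>"
  obtains n where "sup_chain_length (primes_over R J) = ereal (real n)"
    "\<And>k C. \<lbrakk>\<forall>i\<le>k. C i \<in> primes_over R J; \<forall>i<k. C i \<subset> C (Suc i)\<rbrakk> \<Longrightarrow> k \<le> n"
proof -
  have mi: "ideal \<mm> R" using prime_max by (rule primeD)
  obtain S where S: "S \<subseteq> carrier R" "finite S" "\<mm> = Idl S" using finetely_gen[OF mi] by blast
  have "primes_over R (J \<union> S) = {\<mm>}"
  proof (intro equalityI subsetI)
    fix P assume "P \<in> primes_over R (J \<union> S)"
    then have P: "primeideal P R" "S \<subseteq> P" by (auto simp: primes_over_def)
    then have "\<mm> \<subseteq> P" unfolding S(3) using genideal_minimal[OF primeD(1)[OF P(1)]] by blast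
    then show "P \<in> {\<mm>}" using prime_subset_max[OF P(1)] by blast
  next
    fix P assume "P \<in> {\<mm>}"
    moreover have "S \<subseteq> \<mm>" using genideal_self[OF S(1)] S(3) by simp
    ultimately show "P \<in> primes_over R (J \<union> S)" using max_in_primes_over[of "J \<union> S"] J(2) by simp
  qed
  note b = dim_le_card_parameters[OF J(1) S(2) this]
  have "sup_chain_length (primes_over R J) \<le> ereal (real (card S))"
    by (rule sup_chain_length_le) (use b in simp)
  then have "sup_chain_length (primes_over R J) < \<infinity>"
    using le_less_trans[of _ "ereal (real (card S))" \<infinity>] by simp
  moreover have "primes_over R J \<noteq> {}" using max_in_primes_over[OF J(2)] by blast
  ultimately show thesis using sup_chain_length_attained that by metis
qed

lemma dim_zero_iff:
  assumes "S \<subseteq> \<mm>"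
  shows "sup_chain_length (primes_over R S) = 0 \<longleftrightarrow> primes_over R S = {\<mm>}"
proof
  assume 0: "sup_chain_length (primes_over R S) = 0"
  have "P = \<mm>" if P: "P \<in> primes_over R S" for P
  proof (rule ccontr)
    assume "P \<noteq> \<mm>"
    then have lt: "P \<subset> \<mm>" using prime_subset_max[of P] P by (auto simp: primes_over_def)
    let ?C = "\<lambda>i::nat. if i = 0 then P else \<mm>"
    have "ereal (real 1) \<le> sup_chain_length (primes_over R S)"
      by (rule sup_chain_length_ge[where C = ?C]) (use P lt max_in_primes_over[OF assms] in auto)
    then show False using 0 by simp
  qed
  then show "primes_over R S = {\<mm>}" using max_in_primes_over[OF assms] by blast
next
  assume eq: "primes_over R S = {\<mm>}"
  show "sup_chain_length (primes_over R S) = 0"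
  proof (rule antisym)
    show "sup_chain_length (primes_over R S) \<le> 0"
    proof (rule sup_chain_length_le)
      fix n C assume C: "\<forall>i\<le>n. C i \<in> primes_over R S" "\<forall>i<n. C i \<subset> C (Suc i)"
      have "n = 0"
      proof (rule ccontr)
        assume "n \<noteq> 0"
        then have "C 0 \<subset> C (Suc 0)" "C 0 \<in> {\<mm>}" "C (Suc 0) \<in> {\<mm>}" using C eq by auto
        then show False by simp
      qed
      then show "ereal (real n) \<le> 0" by simp
    qed
    show "0 \<le> sup_chain_length (primes_over R S)"
      using sup_chain_length_ge[of 0 "\<lambda>_. \<mm>" "primes_over R S"] eq by (simp add: zero_ereal_def)
  qed
qed

text \<open>Induction on the bound \<open>n\<close>. Finitely many primes suffice to have one below
  each prime over \<open>J\<close>; an element \<open>x\<close> of \<open>\<mm>\<close> avoiding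
  those other than \<open>\<mm>\<close> lowers the bound, because a chain of positive length over
  \<open>adjoin J x\<close> can be prolonged downwards by one of them.\<close>

lemma exists_parameters:
  assumes "ideal J R" "J \<subseteq> \<mm>"
    and "\<forall>k C. (\<forall>i\<le>k. C i \<in> primes_over R J) \<longrightarrow> (\<forall>i<k. C i \<subset> C (Suc i)) \<longrightarrow> k \<le> n"
  shows "\<exists>xs. set xs \<subseteq> \<mm> \<and> length xs \<le> n \<and> primes_over R (J \<union> set xs) = {\<mm>}"
  using assms
proof (induction n arbitrary: J)
  case 0
  have "sup_chain_length (primes_over R J) \<le> ereal (real 0)"
    by (rule sup_chain_length_le) (use 0(3) in fastforce)
  moreover have "ereal (real 0) \<le> sup_chain_length (primes_over R J)"
    by (rule sup_chain_length_ge[where C = "\<lambda>_. \<mm>"]) (use max_in_primes_over[OF 0(2)] in simp_all)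
  ultimately have "sup_chain_length (primes_over R J) = 0" by (simp add: zero_ereal_def)
  then have "primes_over R J = {\<mm>}" using dim_zero_iff[OF 0(2)] by simp
  then show ?case by (intro exI[of _ "[]"]) simp
next
  case (Suc n)
  obtain F where F: "finite F" "F \<subseteq> primes_over R J" "\<forall>P\<in>primes_over R J. \<exists>Q\<in>F. Q \<subseteq> P"
    using finite_minimal_primes[OF Suc.prems(1)] by blast
  \<comment> \<open>\<open>\<mm>\<close> may belong to \<open>F\<close>, and no element of
    \<open>\<mm>\<close> avoids it.\<close>
  have "\<exists>x\<in>\<mm>. \<forall>P\<in>F - {\<mm>}. x \<notin> P"
  proof (rule prime_avoidance)
    show "finite (F - {\<mm>})" using F by simp
    show "\<forall>P\<in>F - {\<mm>}. primeideal P R" using F(2) by (auto simp: primes_over_def)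
    then show "\<forall>P\<in>F - {\<mm>}. \<not> \<mm> \<subseteq> P" using prime_subset_max by blast
    show "ideal \<mm> R" using prime_max by (rule primeD)
  qed
  then obtain x where x: "x \<in> \<mm>" "\<forall>P\<in>F - {\<mm>}. x \<notin> P" by blast
  have xR: "x \<in> carrier R" using x primeD(2)[OF prime_max] by blast
  note A = adjoin_ideal[OF Suc.prems(1) xR]
  have "\<exists>xs. set xs \<subseteq> \<mm> \<and> length xs \<le> n \<and> primes_over R (adjoin J x \<union> set xs) = {\<mm>}"
  proof (rule Suc.IH[OF A(1)])
    show "adjoin J x \<subseteq> \<mm>" using A(4)[OF primeD(1)[OF prime_max] Suc.prems(2) x(1)] .
    show "\<forall>k C. (\<forall>i\<le>k. C i \<in> primes_over R (adjoin J x)) \<longrightarrow> (\<forall>i<k. C i \<subset> C (Suc i)) \<longrightarrow> k \<le> n"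
    proof (intro allI impI)
      fix k C assume C: "\<forall>i\<le>k. C i \<in> primes_over R (adjoin J x)" "\<forall>i<k. C i \<subset> C (Suc i)"
      have sub: "primes_over R (adjoin J x) \<subseteq> primes_over R J"
        using A(2) by (auto simp: primes_over_def)
      have CJ: "\<forall>i\<le>k. C i \<in> primes_over R J" using C(1) sub by blast
      have x0: "x \<in> C 0" "primeideal (C 0) R" using C(1) A(3) by (auto simp: primes_over_def)
      obtain Q where Q: "Q \<in> F" "Q \<subseteq> C 0" using F(3) CJ by blast
      show "k \<le> n"
      proof (cases "Q = \<mm>")
        \<comment> \<open>If the prime found below the chain is \<open>\<mm>\<close>, the chain
          consists of \<open>\<mm>\<close> alone and has length 0.\<close>
        case True
        then have 0: "C 0 = \<mm>" using Q(2) prime_subset_max[OF x0(2)] by blast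
        have "k = 0"
        proof (rule ccontr)
          assume "k \<noteq> 0"
          then have "C 0 \<subset> C (Suc 0)" "primeideal (C (Suc 0)) R" using C by (auto simp: primes_over_def)
          then show False using 0 prime_subset_max[of "C (Suc 0)"] by blast
        qed
        then show ?thesis by simp
      next
        case False
        \<comment> \<open>\<open>x\<close> lies in \<open>C 0\<close> but not in \<open>Q\<close>,
          so \<open>Q\<close> prolongs the chain strictly.\<close>
        then have lt: "Q \<subset> C 0" using x(2) x0(1) Q by blast
        let ?C = "\<lambda>i. case i of 0 \<Rightarrow> Q | Suc j \<Rightarrow> C j"
        have "\<forall>i\<le>Suc k. ?C i \<in> primes_over R J" using Q(1) F(2) CJ by (auto split: nat.split)
        moreover have "\<forall>i<Suc k. ?C i \<subset> ?C (Suc i)" using lt C(2) by (auto split: nat.split)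
        ultimately have "Suc k \<le> Suc n" using Suc.prems(3) by blast
        then show ?thesis by simp
      qed
    qed
  qed
  then obtain xs where xs: "set xs \<subseteq> \<mm>" "length xs \<le> n" "primes_over R (adjoin J x \<union> set xs) = {\<mm>}" by blast
  have "primes_over R (J \<union> set (x # xs)) = primes_over R (adjoin J x \<union> set xs)"
  proof -
    have "adjoin J x \<subseteq> P \<longleftrightarrow> J \<subseteq> P \<and> x \<in> P" if "primeideal P R" for P
      using A(2,3) A(4)[OF primeD(1)[OF that]] by blast
    then show ?thesis unfolding primes_over_def by auto
  qed
  then show ?case using xs x(1) by (intro exI[of _ "x # xs"]) simp
qed

end

section \<open>Modules of finite length\<close>

lemma sup_chain_length_dcc:
  assumes "sup_chain_length F < \<infinity>" "\<forall>n::nat. K n \<in> F" "\<forall>n. K (Suc n) \<subseteq> K n"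
  shows "\<exists>n. K (Suc n) = K n"
proof (rule ccontr)
  assume "\<nexists>n. K (Suc n) = K n"
  then have lt: "K (Suc n) \<subset> K n" for n using assms(3) by blast
  have le: "ereal (real n) \<le> sup_chain_length F" for n
  \<comment> \<open>The first \<open>n + 1\<close> terms of a strictly descending sequence, read
    backwards, form an ascending chain.\<close>
  proof (rule sup_chain_length_ge[of n "\<lambda>i. K (n - i)"])
    show "\<forall>i\<le>n. K (n - i) \<in> F" using assms(2) by blast
    show "\<forall>i<n. K (n - i) \<subset> K (n - Suc i)"
    proof (intro allI impI)
      fix i assume "i < n"
      then have "n - i = Suc (n - Suc i)" by simp
      then show "K (n - i) \<subset> K (n - Suc i)" using lt[of "n - Suc i"] by simp
    qed
  qed
  show False
  proof (cases "sup_chain_length F")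
    case (real r)
    obtain n :: nat where "r < real n" using reals_Archimedean2 by blast
    then show False using le[of n] real by simp
  next
    case MInf then show False using le[of 0] by simp
  qed (use assms(1) in simp)
qed

text \<open>The library's locale for modules with the module operations, rather than those of the ring, as
  default.\<close>
locale rmodule = module R M for R and M (structure)

section \<open>Submodules and quotient modules\<close>

lemma module_record_simps [simp]:
  "carrier (module_record C pl z sm) = C" "ring.add (module_record C pl z sm) = pl"
  "ring.zero (module_record C pl z sm) = z" "smult (module_record C pl z sm) = sm"
  by (simp_all add: module_record_def)

lemma (in rmodule) submoduleD:
  assumes "submodule N R M"
  shows "N \<subseteq> carrier M" "\<zero> \<in> N" "\<And>x y. \<lbrakk>x \<in> N; y \<in> N\<rbrakk> \<Longrightarrow> x \<oplus> y \<in> N"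
    "\<And>r x. \<lbrakk>r \<in> carrier R; x \<in> N\<rbrakk> \<Longrightarrow> r \<odot> x \<in> N" "\<And>x. x \<in> N \<Longrightarrow> \<ominus> x \<in> N"
    "\<And>x y. \<lbrakk>x \<in> N; y \<in> N\<rbrakk> \<Longrightarrow> x \<ominus> y \<in> N"
proof -
  note E = submoduleE[OF assms]
  show "N \<subseteq> carrier M" "\<And>x y. \<lbrakk>x \<in> N; y \<in> N\<rbrakk> \<Longrightarrow> x \<oplus> y \<in> N"
    "\<And>r x. \<lbrakk>r \<in> carrier R; x \<in> N\<rbrakk> \<Longrightarrow> r \<odot> x \<in> N" and inv: "\<And>x. x \<in> N \<Longrightarrow> \<ominus> x \<in> N"
    using E by blast+
  obtain x where x: "x \<in> N" using E(2) by blast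
  then have "x \<oplus> \<ominus> x \<in> N" using E(3,5) by blast
  then show "\<zero> \<in> N" using x E(1) by (auto simp: M.r_neg)
  show "x \<ominus> y \<in> N" if "x \<in> N" "y \<in> N" for x y
    using E(5)[OF that(1) inv[OF that(2)]] by (simp add: a_minus_def)
qed

lemma (in rmodule) submodule_of_closed:
  assumes "N \<subseteq> carrier M" "\<zero> \<in> N" "\<And>x y. \<lbrakk>x \<in> N; y \<in> N\<rbrakk> \<Longrightarrow> x \<oplus> y \<in> N"
    and sm: "\<And>r x. \<lbrakk>r \<in> carrier R; x \<in> N\<rbrakk> \<Longrightarrow> r \<odot> x \<in> N"
  shows "submodule N R M"
proof (rule submoduleI)
  show "\<ominus> x \<in> N" if x: "x \<in> N" for x
  proof -
    have "(\<ominus>\<^bsub>R\<^esub> \<one>\<^bsub>R\<^esub>) \<odot> x = \<ominus> x" using x assms(1) by (simp add: smult_l_minus subset_eq)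
    moreover have "(\<ominus>\<^bsub>R\<^esub> \<one>\<^bsub>R\<^esub>) \<odot> x \<in> N" by (rule sm) (use x in simp_all)
    ultimately show ?thesis by simp
  qed
qed (rule assms; assumption)+

lemma (in rmodule) minus_cancel:
  assumes "x \<in> carrier M" "y \<in> carrier M"
  shows "(x \<ominus> y) \<oplus> y = x" "y \<oplus> (x \<ominus> y) = x" "(x \<oplus> y) \<ominus> y = x" "(y \<oplus> x) \<ominus> y = x"
  using assms by (simp_all add: a_minus_def M.a_assoc M.l_neg M.r_neg M.a_comm[of y] M.a_lcomm)

lemma (in rmodule) smult_minus:
  assumes "r \<in> carrier R" "s \<in> carrier R" "x \<in> carrier M" "y \<in> carrier M"
  shows "r \<odot> (x \<ominus> y) = r \<odot> x \<ominus> r \<odot> y"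
    "(r \<ominus>\<^bsub>R\<^esub> s) \<odot> x = r \<odot> x \<ominus> s \<odot> x"
  using assms by (simp_all add: a_minus_def smult_r_distr smult_l_distr smult_r_minus smult_l_minus)

lemma (in rmodule) submodule_abelian_subgroup:
  "submodule N R M \<Longrightarrow> abelian_subgroup N M"
  by (rule abelian_subgroupI3[OF additive_subgroupI]) (simp_all add: submodule_def M.abelian_group_axioms)

lemma (in rmodule) quot_coset_eq:
  assumes "submodule N R M" "x \<in> carrier M" "y \<in> carrier M"
  shows "N +> x = N +> y \<longleftrightarrow> x \<ominus> y \<in> N"
proof -
  note N = submoduleD[OF assms(1)]
  have sg: "subgroup N (add_monoid M)" using assms(1) by (simp add: submodule_def)
  show ?thesis
  proof
    assume "N +> x = N +> y"
    moreover have "\<zero> \<oplus> x \<in> N +> x" by (rule M.a_rcosI) (use N assms in simp_all)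
    ultimately have "x \<in> N +> y" using assms by simp
    then obtain n where "n \<in> N" "x = n \<oplus> y" unfolding a_r_coset_def' by blast
    then show "x \<ominus> y \<in> N" using minus_cancel(3)[of n y] N(1) assms by (simp add: subset_eq)
  next
    assume d: "x \<ominus> y \<in> N"
    have "(x \<ominus> y) \<oplus> y \<in> N +> y" by (rule M.a_rcosI[OF d]) (use N assms in simp_all)
    then have "x \<in> N +> y" using minus_cancel(1) assms by simp
    then show "N +> x = N +> y" using M.a_repr_independence[OF _ assms(3) sg] by simp
  qed
qed

lemma (in rmodule) quot_zero:
  assumes "submodule N R M"
  shows "\<zero>\<^bsub>module_quot M N\<^esub> = N +> \<zero>"
  using submoduleD(1)[OF assms] by (simp add: module_quot_def)

lemma (in rmodule) quot_carrier:
  "carrier (module_quot M N) = (\<lambda>x. N +> x) ` carrier M"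
  unfolding module_quot_def A_RCOSETS_def' by (simp add: UNION_singleton_eq_range)

lemma (in rmodule) quot_add:
  assumes "submodule N R M" "x \<in> carrier M" "y \<in> carrier M"
  shows "(N +> x) \<oplus>\<^bsub>module_quot M N\<^esub> (N +> y) = N +> (x \<oplus> y)"
  using abelian_subgroup.a_rcos_sum[OF submodule_abelian_subgroup[OF assms(1)] assms(2,3)]
  by (simp add: module_quot_def)

lemma (in rmodule) mem_coset_self:
  assumes "submodule N R M" "x \<in> carrier M"
  shows "x \<in> N +> x"
  using abelian_subgroup.a_rcos_self[OF submodule_abelian_subgroup[OF assms(1)] assms(2)] .

lemma (in rmodule) mem_coset_eq:
  assumes "submodule N R M" "x \<in> carrier M" "y \<in> N +> x"
  shows "N +> y = N +> x" "y \<in> carrier M"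
proof -
  have sg: "subgroup N (add_monoid M)" using assms(1) by (simp add: submodule_def)
  show "N +> y = N +> x" using M.a_repr_independence[OF assms(3,2) sg] by simp
  show "y \<in> carrier M" using M.a_r_coset_subset_G[OF submoduleD(1)[OF assms(1)] assms(2)] assms(3) by blast
qed

text \<open>The scalar action of \<open>module_quot\<close> is a union over all representatives of a
  coset; all members of this union are one and the same coset.\<close>

lemma (in rmodule) quot_smult:
  assumes N: "submodule N R M" and r: "r \<in> carrier R" and x: "x \<in> carrier M"
  shows "r \<odot>\<^bsub>module_quot M N\<^esub> (N +> x) = N +> (r \<odot> x)"
proof -
  have eq: "N +> (r \<odot> y) = N +> (r \<odot> x)" if "y \<in> N +> x" for y
  proof -
    note y = mem_coset_eq[OF N x that]
    have "y \<ominus> x \<in> N" using y quot_coset_eq[OF N y(2) x] by blast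
    from submoduleD(4)[OF N r this] have "r \<odot> y \<ominus> r \<odot> x \<in> N"
      unfolding smult_minus(1)[OF r r y(2) x] .
    then show ?thesis using quot_coset_eq[OF N] r x y(2) by simp
  qed
  have "r \<odot>\<^bsub>module_quot M N\<^esub> (N +> x) = (\<Union>y\<in>N +> x. N +> (r \<odot> y))"
    by (simp add: module_quot_def)
  also have "\<dots> = (\<Union>y\<in>N +> x. N +> (r \<odot> x))" using eq by (intro SUP_cong refl)
  also have "\<dots> = N +> (r \<odot> x)" using mem_coset_self[OF N x] by blast
  finally show ?thesis .
qed

lemma (in rmodule) module_quot_module:
  assumes N: "submodule N R M"
  shows "module R (module_quot M N)" (is "module R ?Q")
proof (rule moduleI)
  show "cring R" by (rule R.is_cring)
  show "abelian_group ?Q"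
  proof (rule abelian_group.intro)
    interpret N: abelian_subgroup N M by (rule submodule_abelian_subgroup[OF N])
    \<comment> \<open>\<open>module_quot M N\<close> has the carrier and the addition of the factor
      group \<open>M A_Mod N\<close>, written in another record, so the group axioms are taken
      over.\<close>
    have "comm_group (add_monoid ?Q) \<longleftrightarrow> comm_group (M A_Mod N)"
      by (simp add: comm_group_def comm_monoid_def comm_monoid_axioms_def group_def group_axioms_def monoid_def Units_def
          module_quot_def module_record_def A_FactGroup_def FactGroup_def A_RCOSETS_def set_add_def)
    then have "comm_group (add_monoid ?Q)" using N.a_factorgroup_is_comm_group by simp
    then interpret Q: comm_group "add_monoid ?Q" .
    show "abelian_monoid ?Q" by unfold_locales
    show "abelian_group_axioms ?Q" by unfold_locales
  qed
next
  fix r s X Y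
  assume r: "r \<in> carrier R" "s \<in> carrier R" and "X \<in> carrier ?Q" "Y \<in> carrier ?Q"
  then obtain x y where xy: "x \<in> carrier M" "y \<in> carrier M" "X = N +> x" "Y = N +> y"
    unfolding quot_carrier by blast
  show "(r \<oplus>\<^bsub>R\<^esub> s) \<odot>\<^bsub>?Q\<^esub> X = r \<odot>\<^bsub>?Q\<^esub> X \<oplus>\<^bsub>?Q\<^esub> s \<odot>\<^bsub>?Q\<^esub> X"
    using r xy by (simp add: quot_add[OF N] quot_smult[OF N] smult_l_distr)
  show "r \<odot>\<^bsub>?Q\<^esub> (X \<oplus>\<^bsub>?Q\<^esub> Y) = r \<odot>\<^bsub>?Q\<^esub> X \<oplus>\<^bsub>?Q\<^esub> r \<odot>\<^bsub>?Q\<^esub> Y"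
    using r xy by (simp add: quot_add[OF N] quot_smult[OF N] smult_r_distr)
  show "(r \<otimes>\<^bsub>R\<^esub> s) \<odot>\<^bsub>?Q\<^esub> X = r \<odot>\<^bsub>?Q\<^esub> (s \<odot>\<^bsub>?Q\<^esub> X)"
    using r xy by (simp add: quot_smult[OF N] smult_assoc1)
next
  fix r X assume r: "r \<in> carrier R" and "X \<in> carrier ?Q"
  then obtain x where x: "x \<in> carrier M" "X = N +> x" unfolding quot_carrier by blast
  show "r \<odot>\<^bsub>?Q\<^esub> X \<in> carrier ?Q"
    using r x by (simp add: quot_smult[OF N] quot_carrier)
next
  fix X assume "X \<in> carrier ?Q"
  then obtain x where x: "x \<in> carrier M" "X = N +> x" unfolding quot_carrier by blast
  then show "\<one>\<^bsub>R\<^esub> \<odot>\<^bsub>?Q\<^esub> X = X" by (simp add: quot_smult[OF N])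
qed

lemma (in rmodule) quot_submodule_vimage:
  assumes N: "submodule N R M" and K: "submodule K R (module_quot M N)"
  shows "submodule {x \<in> carrier M. N +> x \<in> K} R M" "N \<subseteq> {x \<in> carrier M. N +> x \<in> K}"
proof -
  interpret Q: rmodule R "module_quot M N" by (intro rmodule.intro module_quot_module[OF N])
  note Kd = Q.submoduleD[OF K]
  have z: "N +> \<zero> \<in> K" using Kd(2) unfolding quot_zero[OF N] .
  show "submodule {x \<in> carrier M. N +> x \<in> K} R M"
  proof (rule submodule_of_closed)
    fix x y assume xy: "x \<in> {x \<in> carrier M. N +> x \<in> K}" "y \<in> {x \<in> carrier M. N +> x \<in> K}"
    then have "N +> (x \<oplus> y) \<in> K" using Kd(3)[of "N +> x" "N +> y"] by (simp add: quot_add[OF N])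
    then show "x \<oplus> y \<in> {x \<in> carrier M. N +> x \<in> K}" using xy by simp
  next
    fix r x assume rx: "r \<in> carrier R" "x \<in> {x \<in> carrier M. N +> x \<in> K}"
    then have "N +> (r \<odot> x) \<in> K" using Kd(4)[of r "N +> x"] by (simp add: quot_smult[OF N])
    then show "r \<odot> x \<in> {x \<in> carrier M. N +> x \<in> K}" using rx by simp
  qed (use z in auto)
  show "N \<subseteq> {x \<in> carrier M. N +> x \<in> K}"
  proof
    fix n assume n: "n \<in> N"
    then have nM: "n \<in> carrier M" using submoduleD(1)[OF N] by blast
    have "n \<ominus> \<zero> = n" using minus_cancel(1)[OF nM M.zero_closed] nM by simp
    then have "N +> n = N +> \<zero>" using quot_coset_eq[OF N nM M.zero_closed] n by simp
    then show "n \<in> {x \<in> carrier M. N +> x \<in> K}" using z nM by simp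
  qed
qed

lemma (in rmodule) quot_submodule_image:
  assumes N: "submodule N R M" and L: "submodule L R M"
  shows "submodule ((\<lambda>x. N +> x) ` L) R (module_quot M N)"
    "\<And>x. \<lbrakk>N \<subseteq> L; x \<in> carrier M\<rbrakk> \<Longrightarrow> N +> x \<in> (\<lambda>x. N +> x) ` L \<longleftrightarrow> x \<in> L"
proof -
  interpret Q: rmodule R "module_quot M N" by (intro rmodule.intro module_quot_module[OF N])
  note Ld = submoduleD[OF L]
  have LM: "\<And>x. x \<in> L \<Longrightarrow> x \<in> carrier M" using Ld(1) by blast
  show "submodule ((\<lambda>x. N +> x) ` L) R (module_quot M N)"
  proof (rule Q.submodule_of_closed)
    show "(\<lambda>x. N +> x) ` L \<subseteq> carrier (module_quot M N)" using Ld(1) by (auto simp: quot_carrier)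
    show "\<zero>\<^bsub>module_quot M N\<^esub> \<in> (\<lambda>x. N +> x) ` L" unfolding quot_zero[OF N] using Ld(2) by blast
    fix X Y assume "X \<in> (\<lambda>x. N +> x) ` L" "Y \<in> (\<lambda>x. N +> x) ` L"
    then obtain x y where xy: "x \<in> L" "y \<in> L" "X = N +> x" "Y = N +> y" by blast
    then have "X \<oplus>\<^bsub>module_quot M N\<^esub> Y = N +> (x \<oplus> y)" using quot_add[OF N] LM by simp
    then show "X \<oplus>\<^bsub>module_quot M N\<^esub> Y \<in> (\<lambda>x. N +> x) ` L" using Ld(3) xy by blast
  next
    fix r X assume r: "r \<in> carrier R" and "X \<in> (\<lambda>x. N +> x) ` L"
    then obtain x where x: "x \<in> L" "X = N +> x" by blast
    then have "r \<odot>\<^bsub>module_quot M N\<^esub> X = N +> (r \<odot> x)" using quot_smult[OF N r] LM by simp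
    then show "r \<odot>\<^bsub>module_quot M N\<^esub> X \<in> (\<lambda>x. N +> x) ` L" using Ld(4)[OF r] x by blast
  qed
  fix x assume NL: "N \<subseteq> L" and x: "x \<in> carrier M"
  show "N +> x \<in> (\<lambda>x. N +> x) ` L \<longleftrightarrow> x \<in> L"
  proof
    assume "N +> x \<in> (\<lambda>x. N +> x) ` L"
    then obtain y where y: "y \<in> L" "N +> x = N +> y" by blast
    then have "x \<ominus> y \<in> L" using quot_coset_eq[OF N x LM] NL by blast
    then have "(x \<ominus> y) \<oplus> y \<in> L" using Ld(3) y by blast
    then show "x \<in> L" using minus_cancel(1)[OF x LM] y by simp
  qed blast
qed

lemma (in rmodule) module_length_quot:
  assumes N: "submodule N R M"
  shows "module_length R (module_quot M N) = sup_chain_length {L. submodule L R M \<and> N \<subseteq> L}"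
proof -
  interpret Q: rmodule R "module_quot M N" by (intro rmodule.intro module_quot_module[OF N])
  show ?thesis unfolding module_length_def
  proof (rule antisym)
    show "sup_chain_length {K. submodule K R (module_quot M N)} \<le> sup_chain_length {L. submodule L R M \<and> N \<subseteq> L}"
    proof (rule sup_chain_length_map[where f = "\<lambda>K. {x \<in> carrier M. N +> x \<in> K}"])
      fix K assume "K \<in> {K. submodule K R (module_quot M N)}"
      then show "{x \<in> carrier M. N +> x \<in> K} \<in> {L. submodule L R M \<and> N \<subseteq> L}"
        using quot_submodule_vimage[OF N] by simp
    next
      fix K L assume K: "L \<in> {K. submodule K R (module_quot M N)}" "K \<subset> L"
      then have "L \<subseteq> carrier (module_quot M N)" using Q.submoduleD(1) by simp
      then have "\<exists>x\<in>carrier M. N +> x \<in> L - K" using K(2) unfolding quot_carrier by blast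
      then show "{x \<in> carrier M. N +> x \<in> K} \<subset> {x \<in> carrier M. N +> x \<in> L}" using K(2) by blast
    qed
    show "sup_chain_length {L. submodule L R M \<and> N \<subseteq> L} \<le> sup_chain_length {K. submodule K R (module_quot M N)}"
    proof (rule sup_chain_length_map[where f = "\<lambda>L. (\<lambda>x. N +> x) ` L"])
      fix L assume "L \<in> {L. submodule L R M \<and> N \<subseteq> L}"
      then show "(\<lambda>x. N +> x) ` L \<in> {K. submodule K R (module_quot M N)}"
        using quot_submodule_image(1)[OF N] by simp
    next
      fix K L assume K: "K \<in> {L. submodule L R M \<and> N \<subseteq> L}" "L \<in> {L. submodule L R M \<and> N \<subseteq> L}" "K \<subset> L"
      then have KL: "submodule K R M" "N \<subseteq> K" "L \<subseteq> carrier M" using submoduleD(1) by simp_all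
      obtain x where x: "x \<in> L" "x \<notin> K" using K(3) by blast
      have "N +> x \<notin> (\<lambda>x. N +> x) ` K" using quot_submodule_image(2)[OF N KL(1,2)] x KL(3) by blast
      then show "(\<lambda>x. N +> x) ` K \<subset> (\<lambda>x. N +> x) ` L" using x K(3) by blast
    qed
  qed
qed

section \<open>Sums of submodules, ranks and finite generation\<close>

definition sum_span :: "('r, 'x) ring_scheme \<Rightarrow> ('r, 'm, 'y) module_scheme \<Rightarrow> 'm set \<Rightarrow> 'r set \<Rightarrow> 'm \<Rightarrow> 'm set" where
  "sum_span R M N I v = {n \<oplus>\<^bsub>M\<^esub> r \<odot>\<^bsub>M\<^esub> v | n r. n \<in> N \<and> r \<in> I}"

lemma (in rmodule) sum_span_submodule:
  assumes N: "submodule N R M" and I: "ideal I R" and v: "v \<in> carrier M"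
  shows "submodule (sum_span R M N I v) R M" "N \<subseteq> sum_span R M N I v"
    "\<And>r. r \<in> I \<Longrightarrow> r \<odot> v \<in> sum_span R M N I v"
    "\<And>L. \<lbrakk>submodule L R M; N \<subseteq> L; v \<in> L\<rbrakk> \<Longrightarrow> sum_span R M N I v \<subseteq> L"
proof -
  note Nd = submoduleD[OF N] and Id = R.idealD[OF I]
  have NM: "\<And>x. x \<in> N \<Longrightarrow> x \<in> carrier M" using Nd(1) by blast
  have IR: "\<And>x. x \<in> I \<Longrightarrow> x \<in> carrier R" using Id(1) by blast
  have zv: "\<zero>\<^bsub>R\<^esub> \<odot> v = \<zero>" using v by simp
  show "submodule (sum_span R M N I v) R M"
  proof (rule submodule_of_closed)
    show "sum_span R M N I v \<subseteq> carrier M" unfolding sum_span_def using NM IR v by auto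
    have "\<zero> = \<zero> \<oplus> \<zero>\<^bsub>R\<^esub> \<odot> v" using zv by simp
    then show "\<zero> \<in> sum_span R M N I v" unfolding sum_span_def using Nd(2) Id(2) by blast
    fix x y assume "x \<in> sum_span R M N I v" "y \<in> sum_span R M N I v"
    then obtain n r m s where xy: "x = n \<oplus> r \<odot> v" "y = m \<oplus> s \<odot> v" "n \<in> N" "m \<in> N" "r \<in> I" "s \<in> I"
      unfolding sum_span_def by blast
    have "x \<oplus> y = (n \<oplus> m) \<oplus> (r \<oplus>\<^bsub>R\<^esub> s) \<odot> v"
      using xy NM IR v by (simp add: smult_l_distr M.a_ac)
    then show "x \<oplus> y \<in> sum_span R M N I v" unfolding sum_span_def using Nd(3) Id(3) xy by blast
  next
    fix t x assume t: "t \<in> carrier R" and "x \<in> sum_span R M N I v"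
    then obtain n r where xy: "x = n \<oplus> r \<odot> v" "n \<in> N" "r \<in> I" unfolding sum_span_def by blast
    have "t \<odot> x = t \<odot> n \<oplus> (t \<otimes>\<^bsub>R\<^esub> r) \<odot> v"
      using xy NM IR v t by (simp add: smult_r_distr smult_assoc1)
    then show "t \<odot> x \<in> sum_span R M N I v" unfolding sum_span_def using Nd(4) Id(4) xy t by blast
  qed
  show "N \<subseteq> sum_span R M N I v"
  proof
    fix n assume n: "n \<in> N"
    then have "n = n \<oplus> \<zero>\<^bsub>R\<^esub> \<odot> v" using zv NM by simp
    then show "n \<in> sum_span R M N I v" unfolding sum_span_def using n Id(2) by blast
  qed
  show "r \<odot> v \<in> sum_span R M N I v" if r: "r \<in> I" for r
  proof -
    have "r \<odot> v = \<zero> \<oplus> r \<odot> v" using IR[OF r] v by simp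
    then show ?thesis unfolding sum_span_def using r Nd(2) by blast
  qed
  show "sum_span R M N I v \<subseteq> L" if L: "submodule L R M" "N \<subseteq> L" "v \<in> L" for L
    unfolding sum_span_def using submoduleD(3,4)[OF L(1)] L(2,3) IR by blast
qed

text \<open>The submodules \<open>N + (P + (y^n)) u\<close> descend and become stationary by finite
  length. Then \<open>y^n u\<close> is, modulo \<open>N\<close>, some \<open>r u\<close> with
  \<open>r\<close> in \<open>P + (y^(n+1))\<close>, and the condition on the annihilator of
  \<open>u\<close> turns this into \<open>y^n (1 - t y) \<in> P\<close>: the element
  \<open>y\<close> is invertible modulo \<open>P\<close>.\<close>

lemma (in rmodule) finite_length_imp_maximal:
  assumes N: "submodule N R M" and fl: "finite_length R (module_quot M N)"
    and u: "u \<in> carrier M" and P: "primeideal P R" and sub: "{r \<in> carrier R. r \<odot> u \<in> N} \<subseteq> P"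
    and y: "y \<in> carrier R" "y \<notin> P"
  shows "\<exists>t\<in>carrier R. \<one>\<^bsub>R\<^esub> \<ominus>\<^bsub>R\<^esub> t \<otimes>\<^bsub>R\<^esub> y \<in> P"
proof -
  note Pi = R.primeD(1)[OF P]
  let ?I = "\<lambda>n::nat. R.adjoin P (y [^]\<^bsub>R\<^esub> n)"
  let ?L = "\<lambda>n. sum_span R M N (?I n) u"
  have yn: "y [^]\<^bsub>R\<^esub> n \<in> carrier R" for n :: nat using y by simp
  note A = R.adjoin_ideal[OF Pi yn]
  have dec: "?I (Suc n) \<subseteq> ?I n" for n
  proof (rule A(4)[OF A(1) A(2)])
    have "y \<otimes>\<^bsub>R\<^esub> y [^]\<^bsub>R\<^esub> n \<in> ?I n" by (rule R.idealD(4)[OF A(1) A(3) y(1)])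
    then show "y [^]\<^bsub>R\<^esub> Suc n \<in> ?I n" using y(1) by (simp add: R.m_comm)
  qed
  note S = sum_span_submodule[OF N A(1) u]
  have "\<exists>n. ?L (Suc n) = ?L n"
  proof (rule sup_chain_length_dcc)
    show "sup_chain_length {L. submodule L R M \<and> N \<subseteq> L} < \<infinity>"
      using fl unfolding finite_length_def module_length_quot[OF N] .
    show "\<forall>n. ?L n \<in> {L. submodule L R M \<and> N \<subseteq> L}" using S(1,2) by blast
    show "\<forall>n. ?L (Suc n) \<subseteq> ?L n" unfolding sum_span_def using dec by blast
  qed
  then obtain n where n: "?L (Suc n) = ?L n" by blast
  have "y [^]\<^bsub>R\<^esub> n \<odot> u \<in> ?L (Suc n)" unfolding n by (rule S(3)[OF A(3)])
  then obtain m r where mr: "m \<in> N" "r \<in> ?I (Suc n)" "y [^]\<^bsub>R\<^esub> n \<odot> u = m \<oplus> r \<odot> u"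
    unfolding sum_span_def by blast
  have rR: "r \<in> carrier R" using mr(2) R.idealD(1)[OF A(1)] by blast
  have mM: "m \<in> carrier M" using mr(1) submoduleD(1)[OF N] by blast
  have "(y [^]\<^bsub>R\<^esub> n \<ominus>\<^bsub>R\<^esub> r) \<odot> u = m"
    unfolding smult_minus(2)[OF yn rR u u] mr(3) by (rule minus_cancel(3)) (use rR u mM in simp_all)
  then have d: "y [^]\<^bsub>R\<^esub> n \<ominus>\<^bsub>R\<^esub> r \<in> P" using sub mr(1) yn rR by auto
  from mr(2) obtain p t where pt: "p \<in> P" "t \<in> carrier R" "r = p \<oplus>\<^bsub>R\<^esub> t \<otimes>\<^bsub>R\<^esub> y [^]\<^bsub>R\<^esub> Suc n"
    unfolding R.adjoin_def by blast
  have pR: "p \<in> carrier R" using pt R.primeD(2)[OF P] by blast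
  have e: "(y [^]\<^bsub>R\<^esub> n \<ominus>\<^bsub>R\<^esub> r) \<oplus>\<^bsub>R\<^esub> p = y [^]\<^bsub>R\<^esub> n \<otimes>\<^bsub>R\<^esub> (\<one>\<^bsub>R\<^esub> \<ominus>\<^bsub>R\<^esub> t \<otimes>\<^bsub>R\<^esub> y)"
    unfolding pt(3) R.nat_pow_Suc using pR pt(2) yn[of n] y(1) by algebra
  have "y [^]\<^bsub>R\<^esub> n \<otimes>\<^bsub>R\<^esub> (\<one>\<^bsub>R\<^esub> \<ominus>\<^bsub>R\<^esub> t \<otimes>\<^bsub>R\<^esub> y) \<in> P"
    unfolding e[symmetric] using R.idealD(3)[OF Pi d pt(1)] .
  then have "y [^]\<^bsub>R\<^esub> n \<in> P \<or> \<one>\<^bsub>R\<^esub> \<ominus>\<^bsub>R\<^esub> t \<otimes>\<^bsub>R\<^esub> y \<in> P"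
    using R.primeD(4)[OF P _ yn] pt(2) y(1) by simp
  then show ?thesis using R.prime_pow[OF P y(1)] y(2) pt(2) by blast
qed

definition sum_sub :: "('r, 'm, 'y) module_scheme \<Rightarrow> 'm set \<Rightarrow> 'm set \<Rightarrow> 'm set" where
  "sum_sub M L N = {x \<oplus>\<^bsub>M\<^esub> y | x y. x \<in> L \<and> y \<in> N}"

lemma (in rmodule) sum_submodule:
  assumes L: "submodule L R M" and N: "submodule N R M"
  shows "submodule (sum_sub M L N) R M" "L \<subseteq> sum_sub M L N" "N \<subseteq> sum_sub M L N"
proof -
  note Nd = submoduleD[OF N] and Ld = submoduleD[OF L]
  have NM: "\<And>x. x \<in> N \<Longrightarrow> x \<in> carrier M" using Nd(1) by blast
  have LM: "\<And>x. x \<in> L \<Longrightarrow> x \<in> carrier M" using Ld(1) by blast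
  show "submodule (sum_sub M L N) R M"
  proof (rule submodule_of_closed)
    show "sum_sub M L N \<subseteq> carrier M" unfolding sum_sub_def using NM LM by auto
    have "\<zero> = \<zero> \<oplus> \<zero>" by simp
    then show "\<zero> \<in> sum_sub M L N" unfolding sum_sub_def using Nd(2) Ld(2) by blast
    fix x y assume "x \<in> sum_sub M L N" "y \<in> sum_sub M L N"
    then obtain a b c d where xy: "x = a \<oplus> b" "y = c \<oplus> d" "a \<in> L" "b \<in> N" "c \<in> L" "d \<in> N"
      unfolding sum_sub_def by blast
    have "x \<oplus> y = (a \<oplus> c) \<oplus> (b \<oplus> d)" using xy NM LM by (simp add: M.a_ac)
    then show "x \<oplus> y \<in> sum_sub M L N" unfolding sum_sub_def using Nd(3) Ld(3) xy by blast
  next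
    fix t x assume t: "t \<in> carrier R" and "x \<in> sum_sub M L N"
    then obtain a b where xy: "x = a \<oplus> b" "a \<in> L" "b \<in> N" unfolding sum_sub_def by blast
    have "t \<odot> x = t \<odot> a \<oplus> t \<odot> b" using xy NM LM t by (simp add: smult_r_distr)
    then show "t \<odot> x \<in> sum_sub M L N" unfolding sum_sub_def using Nd(4) Ld(4) xy t by blast
  qed
  show "L \<subseteq> sum_sub M L N"
  proof
    fix x assume x: "x \<in> L"
    then have "x = x \<oplus> \<zero>" using LM by simp
    then show "x \<in> sum_sub M L N" unfolding sum_sub_def using x Nd(2) by blast
  qed
  show "N \<subseteq> sum_sub M L N"
  proof
    fix x assume x: "x \<in> N"
    then have "x = \<zero> \<oplus> x" using NM by simp
    then show "x \<in> sum_sub M L N" unfolding sum_sub_def using x Ld(2) by blast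
  qed
qed

lemma (in rmodule) inter_submodule:
  assumes "submodule L R M" "submodule N R M"
  shows "submodule (L \<inter> N) R M"
proof (rule submodule_of_closed)
  note L = submoduleD[OF assms(1)] and N = submoduleD[OF assms(2)]
  show "L \<inter> N \<subseteq> carrier M" using L(1) by blast
  show "\<zero> \<in> L \<inter> N" using L(2) N(2) by simp
  show "x \<oplus> y \<in> L \<inter> N" if "x \<in> L \<inter> N" "y \<in> L \<inter> N" for x y
    using L(3)[of x y] N(3)[of x y] that by simp
  show "r \<odot> x \<in> L \<inter> N" if "r \<in> carrier R" "x \<in> L \<inter> N" for r x
    using L(4)[of r x] N(4)[of r x] that by simp
qed

text \<open>Additivity of length. For \<open>K \<subset> L\<close> the intersections with
  \<open>N'\<close> and the sums with \<open>N'\<close> cannot both agree, by the modular law, so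
  the sum of the two ranks grows.\<close>

lemma (in rmodule) bounded_rank_extend:
  assumes N': "submodule N' R M"
    and r1: "bounded_rank {L. submodule L R M \<and> N \<subseteq> L \<and> L \<subseteq> N'}" and "N \<subseteq> N'"
    and r2: "bounded_rank {L. submodule L R M \<and> N' \<subseteq> L}"
  shows "bounded_rank {L. submodule L R M \<and> N \<subseteq> L}"
proof -
  let ?F = "{L. submodule L R M \<and> N \<subseteq> L}"
  from r1 obtain l1 b1 where l1: "\<forall>K\<in>{L. submodule L R M \<and> N \<subseteq> L \<and> L \<subseteq> N'}. l1 K \<le> (b1::nat)"
    "\<forall>K\<in>{L. submodule L R M \<and> N \<subseteq> L \<and> L \<subseteq> N'}. \<forall>L\<in>{L. submodule L R M \<and> N \<subseteq> L \<and> L \<subseteq> N'}. K \<subset> L \<longrightarrow> l1 K < l1 L"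
    by (rule bounded_rankE)
  from r2 obtain l2 b2 where l2: "\<forall>K\<in>{L. submodule L R M \<and> N' \<subseteq> L}. l2 K \<le> (b2::nat)"
    "\<forall>K\<in>{L. submodule L R M \<and> N' \<subseteq> L}. \<forall>L\<in>{L. submodule L R M \<and> N' \<subseteq> L}. K \<subset> L \<longrightarrow> l2 K < l2 L"
    by (rule bounded_rankE)
  let ?i = "\<lambda>L. L \<inter> N'" and ?s = "\<lambda>L. sum_sub M L N'"
  have i: "?i L \<in> {L. submodule L R M \<and> N \<subseteq> L \<and> L \<subseteq> N'}" if "L \<in> ?F" for L
    using inter_submodule[OF _ N', of L] that assms(3) by blast
  have s: "?s L \<in> {L. submodule L R M \<and> N' \<subseteq> L}" if "L \<in> ?F" for L
    using sum_submodule[OF _ N', of L] that by blast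
  show ?thesis
  proof (rule bounded_rankI[where l = "\<lambda>L. l1 (?i L) + l2 (?s L)" and b = "b1 + b2"])
    fix L assume L: "L \<in> ?F"
    have "l1 (?i L) \<le> b1" using l1(1) i[OF L] by blast
    moreover have "l2 (?s L) \<le> b2" using l2(1) s[OF L] by blast
    ultimately show "l1 (?i L) + l2 (?s L) \<le> b1 + b2" by simp
  next
    fix K L assume K: "K \<in> ?F" and L: "L \<in> ?F" and KL: "K \<subset> L"
    have le1: "?i K = ?i L \<or> ?i K \<subset> ?i L" using KL by blast
    have le2: "?s K = ?s L \<or> ?s K \<subset> ?s L" using KL unfolding sum_sub_def by blast
    have m1: "?i K \<subset> ?i L \<Longrightarrow> l1 (?i K) < l1 (?i L)" using l1(2) i[OF K] i[OF L] by blast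
    have m2: "?s K \<subset> ?s L \<Longrightarrow> l2 (?s K) < l2 (?s L)" using l2(2) s[OF K] s[OF L] by blast
    have "\<not> (?i K = ?i L \<and> ?s K = ?s L)"
    proof
      assume eq: "?i K = ?i L \<and> ?s K = ?s L"
      have Ks: "submodule K R M" and Ls: "submodule L R M" using K L by simp_all
      have "L \<subseteq> K"
      proof
        fix x assume x: "x \<in> L"
        then have "x \<in> ?s K" using sum_submodule(2)[OF Ls N'] eq by blast
        then obtain k n where kn: "k \<in> K" "n \<in> N'" "x = k \<oplus> n" unfolding sum_sub_def by blast
        have c: "k \<in> carrier M" "n \<in> carrier M" using kn submoduleD(1)[OF Ks] submoduleD(1)[OF N'] by blast+
        have "x \<ominus> k \<in> L" using submoduleD(6)[OF Ls x] kn(1) KL by blast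
        then have "n \<in> L" unfolding kn(3) using minus_cancel(4)[OF c(2,1)] by simp
        then have "n \<in> K" using eq kn(2) by blast
        then show "x \<in> K" using submoduleD(3)[OF Ks kn(1)] kn(3) by simp
      qed
      then show False using KL by blast
    qed
    then have "l1 (?i K) < l1 (?i L) \<or> l2 (?s K) < l2 (?s L)" using le1 le2 m1 m2 by blast
    moreover have "l1 (?i K) \<le> l1 (?i L)" using le1 m1 by (elim disjE) simp_all
    moreover have "l2 (?s K) \<le> l2 (?s L)" using le2 m2 by (elim disjE) simp_all
    ultimately show "l1 (?i K) + l2 (?s K) < l1 (?i L) + l2 (?s L)" by linarith
  qed
qed

text \<open>A submodule between \<open>N\<close> and \<open>N + R v\<close> is determined by the
  ideal of those \<open>r\<close> with \<open>r v\<close> in it. That ideal contains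
  \<open>I\<close>, so the rank is borrowed from the ideals over \<open>I\<close>.\<close>

lemma (in rmodule) bounded_rank_cyclic:
  assumes N: "submodule N R M" and v: "v \<in> carrier M" and Iv: "\<And>r. r \<in> I \<Longrightarrow> r \<odot> v \<in> N"
    and I: "ideal I R" and br: "bounded_rank {K. ideal K R \<and> I \<subseteq> K}"
  shows "bounded_rank {L. submodule L R M \<and> N \<subseteq> L \<and> L \<subseteq> sum_span R M N (carrier R) v}"
proof -
  let ?c = "\<lambda>L. {r \<in> carrier R. r \<odot> v \<in> L}"
  from br obtain l b where l: "\<forall>K\<in>{K. ideal K R \<and> I \<subseteq> K}. l K \<le> (b::nat)"
    "\<forall>K\<in>{K. ideal K R \<and> I \<subseteq> K}. \<forall>L\<in>{K. ideal K R \<and> I \<subseteq> K}. K \<subset> L \<longrightarrow> l K < l L"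
    by (rule bounded_rankE)
  have c: "?c L \<in> {K. ideal K R \<and> I \<subseteq> K}" if L: "submodule L R M" "N \<subseteq> L" for L
  proof -
    note Ld = submoduleD[OF L(1)]
    have "ideal (?c L) R"
    proof (rule R.ideal_of_closed)
      show "\<zero>\<^bsub>R\<^esub> \<in> ?c L" using Ld(2) v by simp
      fix a b assume "a \<in> ?c L" "b \<in> ?c L"
      then show "a \<oplus>\<^bsub>R\<^esub> b \<in> ?c L" using Ld(3)[of "a \<odot> v" "b \<odot> v"] v by (simp add: smult_l_distr)
    next
      fix a x assume "a \<in> ?c L" "x \<in> carrier R"
      then show "x \<otimes>\<^bsub>R\<^esub> a \<in> ?c L" using Ld(4)[of x "a \<odot> v"] v by (simp add: smult_assoc1)
    qed blast
    moreover have "I \<subseteq> ?c L" using Iv L(2) R.idealD(1)[OF I] by blast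
    ultimately show ?thesis by simp
  qed
  show ?thesis
  proof (rule bounded_rankI[where l = "\<lambda>L. l (?c L)" and b = b])
    fix K assume "K \<in> {L. submodule L R M \<and> N \<subseteq> L \<and> L \<subseteq> sum_span R M N (carrier R) v}"
    then show "l (?c K) \<le> b" using l(1) c[of K] by blast
  next
    fix K L assume K: "K \<in> {L. submodule L R M \<and> N \<subseteq> L \<and> L \<subseteq> sum_span R M N (carrier R) v}"
      and L: "L \<in> {L. submodule L R M \<and> N \<subseteq> L \<and> L \<subseteq> sum_span R M N (carrier R) v}" and KL: "K \<subset> L"
    then have Ks: "submodule K R M" "N \<subseteq> K" and Ls: "submodule L R M" "N \<subseteq> L" "L \<subseteq> sum_span R M N (carrier R) v"
      by simp_all
    obtain x where x: "x \<in> L" "x \<notin> K" using KL by blast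
    then obtain n r where nr: "n \<in> N" "r \<in> carrier R" "x = n \<oplus> r \<odot> v"
      using Ls(3) unfolding sum_span_def by blast
    have nM: "n \<in> carrier M" using nr submoduleD(1)[OF N] by blast
    have "x \<ominus> n \<in> L" using submoduleD(6)[OF Ls(1) x(1)] nr(1) Ls(2) by blast
    then have "r \<odot> v \<in> L" unfolding nr(3) using minus_cancel(4)[of "r \<odot> v" n] nM nr(2) v by simp
    moreover have "r \<odot> v \<notin> K" using submoduleD(3)[OF Ks(1), of n "r \<odot> v"] nr Ks(2) x(2) by blast
    ultimately have "?c K \<subset> ?c L" using nr(2) KL by blast
    then show "l (?c K) < l (?c L)" using l(2) c[OF Ks] c[OF Ls(1,2)] by blast
  qed
qed

text \<open>\<open>Z\<close> is finitely generated modulo \<open>N\<close>.\<close>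

definition fg_over :: "('r, 'x) ring_scheme \<Rightarrow> ('r, 'm, 'y) module_scheme \<Rightarrow> 'm set \<Rightarrow> 'm set \<Rightarrow> bool" where
  "fg_over R M N Z \<longleftrightarrow> (\<exists>S. finite S \<and> S \<subseteq> Z \<and> (\<forall>L. submodule L R M \<longrightarrow> N \<subseteq> L \<longrightarrow> S \<subseteq> L \<longrightarrow> Z \<subseteq> L))"

text \<open>Induction on the generators, with \<open>N\<close> varying: adjoining one generator
  \<open>v\<close> to \<open>N\<close> is the cyclic case, and modulo the result the remaining
  generators suffice.\<close>

lemma (in rmodule) bounded_rank_of_fg:
  assumes I: "ideal I R" and br: "bounded_rank {K. ideal K R \<and> I \<subseteq> K}"
    and fg: "fg_over R M N (carrier M)" and N: "submodule N R M"
    and IN: "\<And>r x. \<lbrakk>r \<in> I; x \<in> carrier M\<rbrakk> \<Longrightarrow> r \<odot> x \<in> N"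
  shows "bounded_rank {L. submodule L R M \<and> N \<subseteq> L}"
proof -
  obtain S where S: "finite S" "S \<subseteq> carrier M" "\<forall>L. submodule L R M \<longrightarrow> N \<subseteq> L \<longrightarrow> S \<subseteq> L \<longrightarrow> carrier M \<subseteq> L"
    using fg unfolding fg_over_def by blast
  have "\<forall>N. submodule N R M \<longrightarrow> (\<forall>r\<in>I. \<forall>x\<in>carrier M. r \<odot> x \<in> N) \<longrightarrow>
     (\<forall>L. submodule L R M \<longrightarrow> N \<subseteq> L \<longrightarrow> S \<subseteq> L \<longrightarrow> carrier M \<subseteq> L) \<longrightarrow> bounded_rank {L. submodule L R M \<and> N \<subseteq> L}"
    using S(1,2)
  proof (induction S rule: finite_induct)
    case empty
    show ?case
    proof (intro allI impI)
      fix N assume N: "submodule N R M" and a: "\<forall>L. submodule L R M \<longrightarrow> N \<subseteq> L \<longrightarrow> {} \<subseteq> L \<longrightarrow> carrier M \<subseteq> L"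
      have eq: "L = carrier M" if "submodule L R M" "N \<subseteq> L" for L
        using a that submoduleD(1)[OF that(1)] by blast
      show "bounded_rank {L. submodule L R M \<and> N \<subseteq> L}"
      proof (rule bounded_rankI[where l = "\<lambda>_. 0" and b = 0])
        fix K L assume "K \<in> {L. submodule L R M \<and> N \<subseteq> L}" "L \<in> {L. submodule L R M \<and> N \<subseteq> L}"
        then have "K = carrier M" "L = carrier M" using eq[of K] eq[of L] by simp_all
        moreover assume "K \<subset> L"
        ultimately show "(0::nat) < 0" by simp
      qed simp
    qed
  next
    case (insert v S)
    show ?case
    proof (intro allI impI)
      fix N assume N: "submodule N R M" and IN: "\<forall>r\<in>I. \<forall>x\<in>carrier M. r \<odot> x \<in> N"
        and a: "\<forall>L. submodule L R M \<longrightarrow> N \<subseteq> L \<longrightarrow> insert v S \<subseteq> L \<longrightarrow> carrier M \<subseteq> L"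
      have v: "v \<in> carrier M" using insert.prems by simp
      let ?N = "sum_span R M N (carrier R) v"
      note sp = sum_span_submodule[OF N R.oneideal v]
      have vN: "v \<in> ?N" using sp(3)[of "\<one>\<^bsub>R\<^esub>"] v by simp
      show "bounded_rank {L. submodule L R M \<and> N \<subseteq> L}"
      proof (rule bounded_rank_extend[OF sp(1) _ sp(2)])
        show "bounded_rank {L. submodule L R M \<and> N \<subseteq> L \<and> L \<subseteq> ?N}"
          by (rule bounded_rank_cyclic[OF N v _ I br]) (use IN v in blast)
        have "\<forall>r\<in>I. \<forall>x\<in>carrier M. r \<odot> x \<in> ?N" using IN sp(2) by blast
        moreover have "\<forall>L. submodule L R M \<longrightarrow> ?N \<subseteq> L \<longrightarrow> S \<subseteq> L \<longrightarrow> carrier M \<subseteq> L"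
          using a vN sp(2) by blast
        ultimately show "bounded_rank {L. submodule L R M \<and> ?N \<subseteq> L}" using insert.IH insert.prems sp(1) by blast
      qed
    qed
  qed
  then show ?thesis using N IN S(3) by blast
qed

text \<open>Induction on the generators: once \<open>v\<close> is adjoined to \<open>N\<close>, the
  induction hypothesis generates \<open>Z'\<close> modulo \<open>N + R v\<close>. What remains of
  \<open>Z'\<close> consists, modulo \<open>N\<close>, of multiples of \<open>v\<close>, whose
  coefficients form a finitely generated ideal.\<close>

lemma (in rmodule) fg_over_subset:
  assumes noeth: "noetherian_ring R" and N: "submodule N R M" and Z': "submodule Z' R M"
    and NZ: "N \<subseteq> Z'" "Z' \<subseteq> Z" and ZM: "Z \<subseteq> carrier M" and fg: "fg_over R M N Z"
  shows "fg_over R M N Z'"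
proof -
  obtain S where S: "finite S" "S \<subseteq> Z" "\<forall>L. submodule L R M \<longrightarrow> N \<subseteq> L \<longrightarrow> S \<subseteq> L \<longrightarrow> Z \<subseteq> L"
    using fg unfolding fg_over_def by blast
  have SM: "S \<subseteq> carrier M" using S(2) ZM by blast
  have gen: "\<forall>L. submodule L R M \<longrightarrow> N \<subseteq> L \<longrightarrow> S \<subseteq> L \<longrightarrow> Z' \<subseteq> L" using S(3) NZ by blast
  have "\<forall>N Z'. submodule N R M \<longrightarrow> submodule Z' R M \<longrightarrow> N \<subseteq> Z' \<longrightarrow>
     (\<forall>L. submodule L R M \<longrightarrow> N \<subseteq> L \<longrightarrow> S \<subseteq> L \<longrightarrow> Z' \<subseteq> L) \<longrightarrow> fg_over R M N Z'"
    using S(1) SM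
  proof (induction S rule: finite_induct)
    case empty
    show ?case unfolding fg_over_def by (intro allI impI exI[of _ "{}"]) simp
  next
    case (insert v S)
    show ?case
    proof (intro allI impI)
      fix N Z' assume N: "submodule N R M" and Z': "submodule Z' R M" and NZ: "N \<subseteq> Z'"
        and g: "\<forall>L. submodule L R M \<longrightarrow> N \<subseteq> L \<longrightarrow> insert v S \<subseteq> L \<longrightarrow> Z' \<subseteq> L"
      have v: "v \<in> carrier M" using insert.prems by simp
      let ?N = "sum_span R M N (carrier R) v"
      note sp = sum_span_submodule[OF N R.oneideal v]
      have vN: "v \<in> ?N" using sp(3)[of "\<one>\<^bsub>R\<^esub>"] v by simp
      let ?Z = "sum_sub M Z' ?N"
      note sm = sum_submodule[OF Z' sp(1)]
      have Sg: "\<forall>L. submodule L R M \<longrightarrow> ?N \<subseteq> L \<longrightarrow> S \<subseteq> L \<longrightarrow> ?Z \<subseteq> L"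
      proof (intro allI impI)
        fix L assume L: "submodule L R M" "?N \<subseteq> L" "S \<subseteq> L"
        then have "Z' \<subseteq> L" using g vN sp(2) by blast
        then show "?Z \<subseteq> L" unfolding sum_sub_def using submoduleD(3)[OF L(1)] L(2) by blast
      qed
      then have "fg_over R M ?N ?Z" using insert.IH insert.prems sp(1) sm by blast
      then obtain T where T: "finite T" "T \<subseteq> ?Z" "\<forall>L. submodule L R M \<longrightarrow> ?N \<subseteq> L \<longrightarrow> T \<subseteq> L \<longrightarrow> ?Z \<subseteq> L"
        unfolding fg_over_def by blast
      \<comment> \<open>The generators \<open>T\<close> lie in the larger module \<open>?Z\<close>;
        each is replaced by its part in \<open>Z'\<close>, from which it differs by an element of
        \<open>?N\<close>.\<close>
      have "\<forall>t\<in>T. \<exists>z. z \<in> Z' \<and> (\<exists>n\<in>?N. t = z \<oplus> n)" using T(2) unfolding sum_sub_def by blast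
      then obtain f where f: "\<forall>t\<in>T. f t \<in> Z' \<and> (\<exists>n\<in>?N. t = f t \<oplus> n)" by (rule bchoice[THEN exE])
      let ?I = "{r \<in> carrier R. r \<odot> v \<in> Z'}"
      note Zd = submoduleD[OF Z']
      have "ideal ?I R"
      proof (rule R.ideal_of_closed)
        show "\<zero>\<^bsub>R\<^esub> \<in> ?I" using Zd(2) v by simp
        fix a b assume "a \<in> ?I" "b \<in> ?I"
        then show "a \<oplus>\<^bsub>R\<^esub> b \<in> ?I" using Zd(3)[of "a \<odot> v" "b \<odot> v"] v by (simp add: smult_l_distr)
      next
        fix a x assume "a \<in> ?I" "x \<in> carrier R"
        then show "x \<otimes>\<^bsub>R\<^esub> a \<in> ?I" using Zd(4)[of x "a \<odot> v"] v by (simp add: smult_assoc1)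
      qed blast
      then obtain A where A: "A \<subseteq> carrier R" "finite A" "?I = Idl\<^bsub>R\<^esub> A"
        using noetherian_ring.finetely_gen[OF noeth] by blast
      have AI: "A \<subseteq> ?I" using R.genideal_self[OF A(1)] A(3) by simp
      let ?S = "f ` T \<union> (\<lambda>a. a \<odot> v) ` A"
      have "Z' \<subseteq> L" if L0: "submodule L R M" "N \<subseteq> L" "?S \<subseteq> L" for L
      proof
        fix x assume x: "x \<in> Z'"
        \<comment> \<open>\<open>L\<close> is cut down to \<open>Z'\<close> so that subtracting from
          \<open>x\<close> its part in \<open>?L\<close> leaves a multiple of \<open>v\<close> that
          is still in \<open>Z'\<close>.\<close>
        let ?L = "L \<inter> Z'"
        have L: "submodule ?L R M" by (rule inter_submodule[OF L0(1) Z'])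
        note Ld = submoduleD[OF L]
        have NL: "N \<subseteq> ?L" using L0(2) NZ by blast
        have fL: "f t \<in> ?L" if "t \<in> T" for t using f L0(3) that by blast
        have "ideal {r \<in> carrier R. r \<odot> v \<in> ?L} R"
        proof (rule R.ideal_of_closed)
          show "\<zero>\<^bsub>R\<^esub> \<in> {r \<in> carrier R. r \<odot> v \<in> ?L}" using Ld(2) v by simp
          fix a b assume "a \<in> {r \<in> carrier R. r \<odot> v \<in> ?L}" "b \<in> {r \<in> carrier R. r \<odot> v \<in> ?L}"
          then show "a \<oplus>\<^bsub>R\<^esub> b \<in> {r \<in> carrier R. r \<odot> v \<in> ?L}"
            using Ld(3)[of "a \<odot> v" "b \<odot> v"] v by (simp add: smult_l_distr)
        next
          fix a x assume "a \<in> {r \<in> carrier R. r \<odot> v \<in> ?L}" "x \<in> carrier R"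
          then show "x \<otimes>\<^bsub>R\<^esub> a \<in> {r \<in> carrier R. r \<odot> v \<in> ?L}"
            using Ld(4)[of x "a \<odot> v"] v by (simp add: smult_assoc1)
        qed blast
        moreover have "A \<subseteq> {r \<in> carrier R. r \<odot> v \<in> ?L}" using L0(3) AI by blast
        ultimately have IL: "?I \<subseteq> {r \<in> carrier R. r \<odot> v \<in> ?L}" unfolding A(3) by (rule R.genideal_minimal)
        note sL = sum_submodule[OF L sp(1)]
        have "T \<subseteq> sum_sub M ?L ?N"
        proof
          fix t assume t: "t \<in> T"
          then obtain n where "n \<in> ?N" "t = f t \<oplus> n" using f by blast
          then show "t \<in> sum_sub M ?L ?N" unfolding sum_sub_def using fL[OF t] by blast
        qed
        then have "?Z \<subseteq> sum_sub M ?L ?N" using T(3) sL(1,3) by blast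
        then have "x \<in> sum_sub M ?L ?N" using x sm(2) by blast
        then obtain l n r where lnr: "l \<in> ?L" "n \<in> N" "r \<in> carrier R" "x = l \<oplus> (n \<oplus> r \<odot> v)"
          unfolding sum_sub_def sum_span_def by blast
        have c: "l \<in> carrier M" "n \<in> carrier M" "r \<odot> v \<in> carrier M"
          using lnr(1,2,3) Ld(1) submoduleD(1)[OF N] v by auto
        have ln: "l \<oplus> n \<in> ?L" using Ld(3)[OF lnr(1)] NL lnr(2) by blast
        have x': "x = (l \<oplus> n) \<oplus> r \<odot> v" unfolding lnr(4) using c by (simp add: M.a_assoc)
        have "x \<ominus> (l \<oplus> n) \<in> Z'" using Zd(6)[OF x] ln by blast
        then have "r \<odot> v \<in> Z'" unfolding x' using minus_cancel(4)[of "r \<odot> v" "l \<oplus> n"] c by simp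
        then have "r \<odot> v \<in> ?L" using IL lnr(3) by blast
        then show "x \<in> L" using x' Ld(3)[OF ln] by simp
      qed
      moreover have "finite ?S" using T(1) A(2) by simp
      moreover have "?S \<subseteq> Z'" using f AI by blast
      ultimately show "fg_over R M N Z'" unfolding fg_over_def by blast
    qed
  qed
  then show ?thesis using N Z' NZ(1) gen by blast
qed

section \<open>Finite length over a local ring\<close>

context noetherian_local
begin

text \<open>Elements outside \<open>\<mm>\<close> are units, so every ideal is saturated at
  \<open>\<mm>\<close>, and the rank on saturated ideals is a rank on all ideals over
  \<open>I\<close>.\<close>

lemma bounded_rank_primary:
  assumes I: "ideal I R" and V: "primes_over R I \<subseteq> {\<mm>}"
  shows "bounded_rank {K. ideal K R \<and> I \<subseteq> K}"
proof -
  have "bounded_rank {K. ideal K R \<and> I \<subseteq> K \<and> sat \<mm> K \<subseteq> K}"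
  proof (rule bounded_rank_saturated[OF I prime_max])
    fix Q assume "primeideal Q R" "I \<subseteq> Q"
    then show "Q = \<mm>" using V unfolding primes_over_def by blast
  qed
  moreover have "sat \<mm> K \<subseteq> K" if K: "ideal K R" for K
  proof
    fix r assume "r \<in> sat \<mm> K"
    then obtain s where s: "s \<in> carrier R - \<mm>" "s \<otimes> r \<in> K" "r \<in> carrier R" unfolding sat_def by blast
    have sR: "s \<in> carrier R" using s by simp
    have "\<not> PIdl s \<subseteq> \<mm>" using cgenideal_self[OF sR] s(1) by blast
    then have "\<one> \<in> PIdl s" using proper_subset_max[OF cgenideal_ideal[OF sR]] by blast
    then obtain t where t: "t \<in> carrier R" "\<one> = t \<otimes> s" unfolding cgenideal_def by blast
    have "t \<otimes> (s \<otimes> r) \<in> K" by (rule idealD(4)[OF K s(2) t(1)])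
    moreover have "t \<otimes> (s \<otimes> r) = r"
      using m_assoc[OF t(1) sR s(3)] t(2)[symmetric] s(3) by simp
    ultimately show "r \<in> K" by simp
  qed
  then have "{K. ideal K R \<and> I \<subseteq> K \<and> sat \<mm> K \<subseteq> K} = {K. ideal K R \<and> I \<subseteq> K}" by blast
  ultimately show ?thesis by simp
qed

lemma finite_length_quotI:
  fixes M :: "('a, 'm, 'y) module_scheme"
  assumes M: "module R M" and N: "submodule N R M" and fg: "fg_over R M N (carrier M)"
    and I: "ideal I R" and V: "primes_over R I \<subseteq> {\<mm>}"
    and IN: "\<And>r x. \<lbrakk>r \<in> I; x \<in> carrier M\<rbrakk> \<Longrightarrow> r \<odot>\<^bsub>M\<^esub> x \<in> N"
  shows "finite_length R (module_quot M N)"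
proof -
  interpret M: rmodule R M by (rule rmodule.intro) fact
  show ?thesis unfolding finite_length_def M.module_length_quot[OF N]
    by (rule bounded_rank_chain[OF M.bounded_rank_of_fg[OF I bounded_rank_primary[OF I V] fg N IN]])
qed

text \<open>If \<open>P\<close> were strictly inside \<open>\<mm>\<close>, some \<open>y\<close> in
  \<open>\<mm>\<close> would be invertible modulo \<open>P\<close>; then \<open>1 - t y\<close> lies
  in \<open>P\<close>, and 1 in \<open>\<mm>\<close>.\<close>

lemma finite_length_quotD:
  fixes M :: "('a, 'm, 'y) module_scheme"
  assumes M: "module R M" and N: "submodule N R M" and fl: "finite_length R (module_quot M N)"
    and u: "u \<in> carrier M" and P: "primeideal P R" "{r \<in> carrier R. r \<odot>\<^bsub>M\<^esub> u \<in> N} \<subseteq> P"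
  shows "P = \<mm>"
proof (rule ccontr)
  interpret M: rmodule R M by (rule rmodule.intro) fact
  assume "P \<noteq> \<mm>"
  then obtain y where y: "y \<in> \<mm>" "y \<notin> P" using prime_subset_max[OF P(1)] by blast
  note md = primeD[OF prime_max]
  have yR: "y \<in> carrier R" using y md by blast
  obtain t where t: "t \<in> carrier R" "\<one> \<ominus> t \<otimes> y \<in> P"
    using M.finite_length_imp_maximal[OF N fl u P yR y(2)] by blast
  have "\<one> \<ominus> t \<otimes> y \<in> \<mm>" using t prime_subset_max[OF P(1)] by blast
  moreover have "t \<otimes> y \<in> \<mm>" using idealD(4)[OF md(1) y(1) t(1)] .
  ultimately have "(\<one> \<ominus> t \<otimes> y) \<oplus> t \<otimes> y \<in> \<mm>" by (rule idealD(3)[OF md(1)])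
  moreover have "(\<one> \<ominus> t \<otimes> y) \<oplus> t \<otimes> y = \<one>" using t(1) yR by algebra
  ultimately show False using md(3) by simp
qed

end

section \<open>Linear maps and tensor products\<close>

definition linear_map ::
  "('r, 'x) ring_scheme \<Rightarrow> ('r, 'm, 'y) module_scheme \<Rightarrow> ('r, 'n, 'z) module_scheme \<Rightarrow> ('m \<Rightarrow> 'n) \<Rightarrow> bool" where
  "linear_map R M N f \<longleftrightarrow>
     (\<forall>x\<in>carrier M. f x \<in> carrier N) \<and>
     (\<forall>x\<in>carrier M. \<forall>y\<in>carrier M. f (x \<oplus>\<^bsub>M\<^esub> y) = f x \<oplus>\<^bsub>N\<^esub> f y) \<and>
     (\<forall>r\<in>carrier R. \<forall>x\<in>carrier M. f (r \<odot>\<^bsub>M\<^esub> x) = r \<odot>\<^bsub>N\<^esub> f x)"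

lemma linear_mapI:
  assumes "\<And>x. x \<in> carrier M \<Longrightarrow> f x \<in> carrier N"
    "\<And>x y. \<lbrakk>x \<in> carrier M; y \<in> carrier M\<rbrakk> \<Longrightarrow> f (x \<oplus>\<^bsub>M\<^esub> y) = f x \<oplus>\<^bsub>N\<^esub> f y"
    "\<And>r x. \<lbrakk>r \<in> carrier R; x \<in> carrier M\<rbrakk> \<Longrightarrow> f (r \<odot>\<^bsub>M\<^esub> x) = r \<odot>\<^bsub>N\<^esub> f x"
  shows "linear_map R M N f"
  unfolding linear_map_def by (intro conjI ballI assms)

lemma linear_mapD:
  assumes "linear_map R M N f"
  shows "\<And>x. x \<in> carrier M \<Longrightarrow> f x \<in> carrier N"
    "\<And>x y. \<lbrakk>x \<in> carrier M; y \<in> carrier M\<rbrakk> \<Longrightarrow> f (x \<oplus>\<^bsub>M\<^esub> y) = f x \<oplus>\<^bsub>N\<^esub> f y"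
    "\<And>r x. \<lbrakk>r \<in> carrier R; x \<in> carrier M\<rbrakk> \<Longrightarrow> f (r \<odot>\<^bsub>M\<^esub> x) = r \<odot>\<^bsub>N\<^esub> f x"
  using assms unfolding linear_map_def by simp_all

lemma linear_map_comp:
  "\<lbrakk>linear_map R M N f; linear_map R N P g\<rbrakk> \<Longrightarrow> linear_map R M P (\<lambda>x. g (f x))"
  unfolding linear_map_def by simp

lemma linear_map_id: "linear_map R M M id"
  unfolding linear_map_def by simp

context
  fixes R :: "('r, 'x) ring_scheme" and M :: "('r, 'm, 'y) module_scheme" and N :: "('r, 'n, 'z) module_scheme"
  assumes M: "module R M" and N: "module R N"
begin

interpretation M: rmodule R M by (intro rmodule.intro M)
interpretation N: rmodule R N by (intro rmodule.intro N)

lemma linear_map_zero: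
  assumes "linear_map R M N f"
  shows "f \<zero>\<^bsub>M\<^esub> = \<zero>\<^bsub>N\<^esub>"
proof -
  have "f (\<zero>\<^bsub>R\<^esub> \<odot>\<^bsub>M\<^esub> \<zero>\<^bsub>M\<^esub>) = \<zero>\<^bsub>R\<^esub> \<odot>\<^bsub>N\<^esub> f \<zero>\<^bsub>M\<^esub>"
    by (rule linear_mapD(3)[OF assms]) simp_all
  then show ?thesis using linear_mapD(1)[OF assms M.M.zero_closed] by simp
qed

lemma linear_map_uminus:
  assumes f: "linear_map R M N f" and x: "x \<in> carrier M"
  shows "f (\<ominus>\<^bsub>M\<^esub> x) = \<ominus>\<^bsub>N\<^esub> f x"
proof -
  have "f ((\<ominus>\<^bsub>R\<^esub> \<one>\<^bsub>R\<^esub>) \<odot>\<^bsub>M\<^esub> x) = (\<ominus>\<^bsub>R\<^esub> \<one>\<^bsub>R\<^esub>) \<odot>\<^bsub>N\<^esub> f x"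
    by (rule linear_mapD(3)[OF f]) (use x in simp_all)
  then show ?thesis using x linear_mapD(1)[OF f x] by (simp add: M.smult_l_minus N.smult_l_minus)
qed

lemma linear_map_minus:
  assumes f: "linear_map R M N f" and x: "x \<in> carrier M" "y \<in> carrier M"
  shows "f (x \<ominus>\<^bsub>M\<^esub> y) = f x \<ominus>\<^bsub>N\<^esub> f y"
  unfolding a_minus_def using linear_mapD(2)[OF f x(1)] linear_map_uminus[OF f x(2)] x(2) by simp

lemma linear_map_finsum:
  assumes f: "linear_map R M N f" and "finite A" "\<forall>a\<in>A. g a \<in> carrier M"
  shows "f (\<Oplus>\<^bsub>M\<^esub>a\<in>A. g a) = (\<Oplus>\<^bsub>N\<^esub>a\<in>A. f (g a))"
  using assms(2,3)
proof (induction A rule: finite_induct)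
  case empty then show ?case using linear_map_zero[OF f] by simp
next
  case (insert a A)
  have c: "g \<in> A \<rightarrow> carrier M" "g a \<in> carrier M" "(\<lambda>a. f (g a)) \<in> A \<rightarrow> carrier N" "f (g a) \<in> carrier N"
    using insert.prems linear_mapD(1)[OF f] by auto
  have s: "finsum M g A \<in> carrier M" using c by simp
  show ?case using insert c linear_mapD(2)[OF f c(2) s] by simp
qed

lemma linear_map_add:
  assumes f: "linear_map R M N f" and g: "linear_map R M N g"
  shows "linear_map R M N (\<lambda>x. f x \<oplus>\<^bsub>N\<^esub> g x)"
proof (rule linear_mapI)
  note fd = linear_mapD[OF f] and gd = linear_mapD[OF g]
  show "f x \<oplus>\<^bsub>N\<^esub> g x \<in> carrier N" if "x \<in> carrier M" for x using fd(1) gd(1) that by simp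
  show "f (x \<oplus>\<^bsub>M\<^esub> y) \<oplus>\<^bsub>N\<^esub> g (x \<oplus>\<^bsub>M\<^esub> y) = (f x \<oplus>\<^bsub>N\<^esub> g x) \<oplus>\<^bsub>N\<^esub> (f y \<oplus>\<^bsub>N\<^esub> g y)"
    if "x \<in> carrier M" "y \<in> carrier M" for x y
    using that fd gd by (simp add: N.M.a_ac)
  show "f (r \<odot>\<^bsub>M\<^esub> x) \<oplus>\<^bsub>N\<^esub> g (r \<odot>\<^bsub>M\<^esub> x) = r \<odot>\<^bsub>N\<^esub> (f x \<oplus>\<^bsub>N\<^esub> g x)"
    if "r \<in> carrier R" "x \<in> carrier M" for r x
    using that fd gd by (simp add: N.smult_r_distr)
qed

lemma linear_map_sum:
  assumes "finite A" "\<forall>a\<in>A. linear_map R M N (f a)"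
  shows "linear_map R M N (\<lambda>x. \<Oplus>\<^bsub>N\<^esub>a\<in>A. f a x)"
  using assms
proof (induction A rule: finite_induct)
  case empty
  show ?case by (rule linear_mapI) simp_all
next
  case (insert a A)
  have "linear_map R M N (\<lambda>x. f a x \<oplus>\<^bsub>N\<^esub> (\<Oplus>\<^bsub>N\<^esub>a\<in>A. f a x))"
    by (rule linear_map_add) (use insert in simp_all)
  moreover have "(\<Oplus>\<^bsub>N\<^esub>a\<in>insert a A. f a x) = f a x \<oplus>\<^bsub>N\<^esub> (\<Oplus>\<^bsub>N\<^esub>a\<in>A. f a x)" if "x \<in> carrier M" for x
  proof (rule N.M.finsum_insert)
    show "(\<lambda>a. f a x) \<in> A \<rightarrow> carrier N" "f a x \<in> carrier N"
      using insert.prems linear_mapD(1) that by (auto, fast+)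
  qed (use insert in simp_all)
  ultimately show ?case unfolding linear_map_def by simp
qed

lemma linear_map_kernel:
  assumes f: "linear_map R M N f"
  shows "submodule {x \<in> carrier M. f x = \<zero>\<^bsub>N\<^esub>} R M"
  by (rule M.submodule_of_closed) (use linear_mapD[OF f] linear_map_zero[OF f] in simp_all)

lemma linear_map_image:
  assumes f: "linear_map R M N f"
  shows "submodule (f ` carrier M) R N"
proof (rule N.submodule_of_closed)
  note fd = linear_mapD[OF f]
  show "f ` carrier M \<subseteq> carrier N" using fd(1) by blast
  show "\<zero>\<^bsub>N\<^esub> \<in> f ` carrier M" using linear_map_zero[OF f] M.M.zero_closed by (metis imageI)
  fix x y assume "x \<in> f ` carrier M" "y \<in> f ` carrier M"
  then obtain a b where ab: "a \<in> carrier M" "b \<in> carrier M" "x = f a" "y = f b" by blast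
  have "x \<oplus>\<^bsub>N\<^esub> y = f (a \<oplus>\<^bsub>M\<^esub> b)" using ab fd(2) by simp
  then show "x \<oplus>\<^bsub>N\<^esub> y \<in> f ` carrier M" using ab by simp
next
  note fd = linear_mapD[OF f]
  fix r x assume r: "r \<in> carrier R" and "x \<in> f ` carrier M"
  then obtain a where ab: "a \<in> carrier M" "x = f a" by blast
  have "r \<odot>\<^bsub>N\<^esub> x = f (r \<odot>\<^bsub>M\<^esub> a)" using ab fd(3) r by simp
  then show "r \<odot>\<^bsub>N\<^esub> x \<in> f ` carrier M" using ab r by simp
qed

end

lemma (in rmodule) linear_map_quot:
  assumes "submodule N R M"
  shows "linear_map R M (module_quot M N) (\<lambda>x. N +> x)"
  by (rule linear_mapI) (simp_all add: quot_carrier quot_add[OF assms] quot_smult[OF assms])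

lemma (in rmodule) gen_submodule:
  assumes "S \<subseteq> carrier M"
  shows "submodule (gen_submodule R M S) R M" "S \<subseteq> gen_submodule R M S"
    "\<And>L. \<lbrakk>submodule L R M; S \<subseteq> L\<rbrakk> \<Longrightarrow> gen_submodule R M S \<subseteq> L"
proof -
  show "S \<subseteq> gen_submodule R M S" "\<And>L. \<lbrakk>submodule L R M; S \<subseteq> L\<rbrakk> \<Longrightarrow> gen_submodule R M S \<subseteq> L"
    unfolding gen_submodule_def by blast+
  have D: "\<zero> \<in> N" "\<forall>x\<in>N. \<forall>y\<in>N. x \<oplus> y \<in> N" "\<forall>r\<in>carrier R. \<forall>x\<in>N. r \<odot> x \<in> N" if "submodule N R M" for N
    using submoduleD[OF that] by blast+
  show "submodule (gen_submodule R M S) R M"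
  proof (rule submodule_of_closed)
    show "gen_submodule R M S \<subseteq> carrier M"
      unfolding gen_submodule_def using carrier_is_submodule assms by blast
    show "\<zero> \<in> gen_submodule R M S" unfolding gen_submodule_def using D(1) by blast
    fix x y assume "x \<in> gen_submodule R M S" "y \<in> gen_submodule R M S"
    then show "x \<oplus> y \<in> gen_submodule R M S" unfolding gen_submodule_def using D(2) by blast
  next
    fix r x assume "r \<in> carrier R" "x \<in> gen_submodule R M S"
    then show "r \<odot> x \<in> gen_submodule R M S" unfolding gen_submodule_def using D(3) by blast
  qed
qed

subsection \<open>Free modules and direct sums\<close>

lemma direct_sum_simps:
  "carrier (direct_sum M) = {f. (\<forall>i. f i \<in> carrier (M i)) \<and> finite {i. f i \<noteq> \<zero>\<^bsub>M i\<^esub>}}"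
  "f \<oplus>\<^bsub>direct_sum M\<^esub> g = (\<lambda>i. f i \<oplus>\<^bsub>M i\<^esub> g i)" "\<zero>\<^bsub>direct_sum M\<^esub> = (\<lambda>i. \<zero>\<^bsub>M i\<^esub>)"
  "r \<odot>\<^bsub>direct_sum M\<^esub> f = (\<lambda>i. r \<odot>\<^bsub>M i\<^esub> f i)"
  by (simp_all add: direct_sum_def)

lemma direct_sum_mem:
  assumes "finite S" "\<And>i. f i \<in> carrier (M i)" "\<And>i. i \<notin> S \<Longrightarrow> f i = \<zero>\<^bsub>M i\<^esub>"
  shows "f \<in> carrier (direct_sum M)"
proof -
  have "{i. f i \<noteq> \<zero>\<^bsub>M i\<^esub>} \<subseteq> S" using assms(3) by blast
  then show ?thesis using assms finite_subset by (auto simp: direct_sum_simps)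
qed

lemma direct_sumD:
  assumes "f \<in> carrier (direct_sum M)"
  shows "f i \<in> carrier (M i)" "finite {i. f i \<noteq> \<zero>\<^bsub>M i\<^esub>}"
  using assms by (auto simp: direct_sum_simps)

lemma (in cring) direct_sum_module:
  assumes "\<And>i. module R (M i)"
  shows "module R (direct_sum M)"
proof (rule moduleI)
  interpret M: rmodule R "M i" for i by (intro rmodule.intro assms)
  let ?F = "direct_sum M"
  show "cring R" by (rule is_cring)
  show "abelian_group ?F"
  proof (rule abelian_groupI)
    show "\<zero>\<^bsub>?F\<^esub> \<in> carrier ?F" by (simp add: direct_sum_simps)
    fix f assume f: "f \<in> carrier ?F"
    show "\<zero>\<^bsub>?F\<^esub> \<oplus>\<^bsub>?F\<^esub> f = f" using direct_sumD(1)[OF f] by (simp add: direct_sum_simps)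
    have "(\<lambda>i. \<ominus>\<^bsub>M i\<^esub> f i) \<in> carrier ?F"
    proof (rule direct_sum_mem[OF direct_sumD(2)[OF f]])
      show "\<ominus>\<^bsub>M i\<^esub> f i = \<zero>\<^bsub>M i\<^esub>" if "i \<notin> {i. f i \<noteq> \<zero>\<^bsub>M i\<^esub>}" for i using that by simp
    qed (use direct_sumD(1)[OF f] in simp)
    moreover have "(\<lambda>i. \<ominus>\<^bsub>M i\<^esub> f i) \<oplus>\<^bsub>?F\<^esub> f = \<zero>\<^bsub>?F\<^esub>" using direct_sumD(1)[OF f] by (simp add: direct_sum_simps M.M.l_neg)
    ultimately show "\<exists>g\<in>carrier ?F. g \<oplus>\<^bsub>?F\<^esub> f = \<zero>\<^bsub>?F\<^esub>" by blast
    fix g assume g: "g \<in> carrier ?F"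
    show "f \<oplus>\<^bsub>?F\<^esub> g \<in> carrier ?F" unfolding direct_sum_simps(2)
    proof (rule direct_sum_mem[OF finite_UnI[OF direct_sumD(2)[OF f] direct_sumD(2)[OF g]]])
      show "f i \<oplus>\<^bsub>M i\<^esub> g i = \<zero>\<^bsub>M i\<^esub>" if "i \<notin> {i. f i \<noteq> \<zero>\<^bsub>M i\<^esub>} \<union> {i. g i \<noteq> \<zero>\<^bsub>M i\<^esub>}" for i
        using that by simp
    qed (use direct_sumD(1)[OF f] direct_sumD(1)[OF g] in simp)
    show "f \<oplus>\<^bsub>?F\<^esub> g = g \<oplus>\<^bsub>?F\<^esub> f"
      using direct_sumD(1)[OF f] direct_sumD(1)[OF g] by (simp add: direct_sum_simps(2) M.M.a_comm)
    fix h assume h: "h \<in> carrier ?F"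
    show "f \<oplus>\<^bsub>?F\<^esub> g \<oplus>\<^bsub>?F\<^esub> h = f \<oplus>\<^bsub>?F\<^esub> (g \<oplus>\<^bsub>?F\<^esub> h)"
      using direct_sumD(1)[OF f] direct_sumD(1)[OF g] direct_sumD(1)[OF h]
      by (simp add: direct_sum_simps(2) M.M.a_assoc)
  qed
  fix r s f g assume r: "r \<in> carrier R" "s \<in> carrier R" and f: "f \<in> carrier ?F" and g: "g \<in> carrier ?F"
  note c = direct_sumD(1)[OF f] direct_sumD(1)[OF g] r
  show "(r \<oplus> s) \<odot>\<^bsub>?F\<^esub> f = r \<odot>\<^bsub>?F\<^esub> f \<oplus>\<^bsub>?F\<^esub> s \<odot>\<^bsub>?F\<^esub> f"
    using c by (simp add: direct_sum_simps(2,4) M.smult_l_distr)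
  show "r \<odot>\<^bsub>?F\<^esub> (f \<oplus>\<^bsub>?F\<^esub> g) = r \<odot>\<^bsub>?F\<^esub> f \<oplus>\<^bsub>?F\<^esub> r \<odot>\<^bsub>?F\<^esub> g"
    using c by (simp add: direct_sum_simps(2,4) M.smult_r_distr)
  show "(r \<otimes> s) \<odot>\<^bsub>?F\<^esub> f = r \<odot>\<^bsub>?F\<^esub> (s \<odot>\<^bsub>?F\<^esub> f)"
    using c by (simp add: direct_sum_simps(4) M.smult_assoc1)
next
  interpret M: rmodule R "M i" for i by (intro rmodule.intro assms)
  fix r f assume r: "r \<in> carrier R" and f: "f \<in> carrier (direct_sum M)"
  show "r \<odot>\<^bsub>direct_sum M\<^esub> f \<in> carrier (direct_sum M)" unfolding direct_sum_simps(4)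
  proof (rule direct_sum_mem[OF direct_sumD(2)[OF f]])
    show "r \<odot>\<^bsub>M i\<^esub> f i = \<zero>\<^bsub>M i\<^esub>" if "i \<notin> {i. f i \<noteq> \<zero>\<^bsub>M i\<^esub>}" for i using that r by simp
  qed (use direct_sumD(1)[OF f] r in simp)
next
  interpret M: rmodule R "M i" for i by (intro rmodule.intro assms)
  fix f assume f: "f \<in> carrier (direct_sum M)"
  show "\<one> \<odot>\<^bsub>direct_sum M\<^esub> f = f" using direct_sumD(1)[OF f] by (simp add: direct_sum_simps(4))
qed

lemma self_module_simps [simp]:
  "carrier (self_module R) = carrier R" "ring.add (self_module R) = ring.add R"
  "ring.zero (self_module R) = \<zero>\<^bsub>R\<^esub>" "smult (self_module R) = monoid.mult R"
  by (simp_all add: self_module_def)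

lemma (in cring) self_module_module: "module R (self_module R)"
proof (rule moduleI)
  show "abelian_group (self_module R)"
  proof (rule abelian_groupI)
    fix x assume "x \<in> carrier (self_module R)"
    then show "\<exists>y\<in>carrier (self_module R). y \<oplus>\<^bsub>self_module R\<^esub> x = \<zero>\<^bsub>self_module R\<^esub>"
      by (intro bexI[of _ "\<ominus> x"]) (simp_all add: l_neg)
  qed (simp_all add: a_ac)
qed (simp_all add: is_cring l_distr r_distr m_assoc)

lemma free_module_simps:
  "carrier (free_module R B) =
     {f. (\<forall>b. f b \<in> carrier R) \<and> finite {b. f b \<noteq> \<zero>\<^bsub>R\<^esub>} \<and> {b. f b \<noteq> \<zero>\<^bsub>R\<^esub>} \<subseteq> B}"
  "f \<oplus>\<^bsub>free_module R B\<^esub> g = (\<lambda>b. f b \<oplus>\<^bsub>R\<^esub> g b)" "\<zero>\<^bsub>free_module R B\<^esub> = (\<lambda>b. \<zero>\<^bsub>R\<^esub>)"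
  "r \<odot>\<^bsub>free_module R B\<^esub> f = (\<lambda>b. r \<otimes>\<^bsub>R\<^esub> f b)"
  by (simp_all add: free_module_def)

lemma (in cring) free_module_mem:
  assumes "finite S" "S \<subseteq> B" "\<And>b. f b \<in> carrier R" "\<And>b. b \<notin> S \<Longrightarrow> f b = \<zero>"
  shows "f \<in> carrier (free_module R B)"
proof -
  have "{b. f b \<noteq> \<zero>} \<subseteq> S" using assms(4) by blast
  then show ?thesis using assms finite_subset by (auto simp: free_module_simps)
qed

lemma (in cring) free_moduleD:
  assumes "f \<in> carrier (free_module R B)"
  shows "f b \<in> carrier R" "finite {b. f b \<noteq> \<zero>}" "{b. f b \<noteq> \<zero>} \<subseteq> B" "b \<notin> B \<Longrightarrow> f b = \<zero>"
  using assms by (auto simp: free_module_simps)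

text \<open>The module axioms come from a direct sum of copies of \<open>R\<close>, in which the
  functions supported in \<open>B\<close> form a submodule; with its carrier replaced, the record of
  the direct sum is that of \<open>free_module\<close>.\<close>

lemma (in cring) free_module_module: "module R (free_module R B)"
proof -
  let ?S = "direct_sum (\<lambda>_. self_module R)" and ?C = "carrier (free_module R B)"
  interpret S: rmodule R ?S by (intro rmodule.intro direct_sum_module self_module_module)
  have c: "?C = {f \<in> carrier ?S. \<forall>b. b \<notin> B \<longrightarrow> f b = \<zero>}"
    by (auto simp: free_module_simps direct_sum_simps)
  have "submodule ?C R ?S" unfolding c
  proof (rule S.submodule_of_closed)
    fix f g assume "f \<in> {f \<in> carrier ?S. \<forall>b. b \<notin> B \<longrightarrow> f b = \<zero>}" "g \<in> {f \<in> carrier ?S. \<forall>b. b \<notin> B \<longrightarrow> f b = \<zero>}"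
    then show "f \<oplus>\<^bsub>?S\<^esub> g \<in> {f \<in> carrier ?S. \<forall>b. b \<notin> B \<longrightarrow> f b = \<zero>}"
      using S.M.a_closed[of f g] by (simp add: direct_sum_simps(2))
  next
    fix r f assume "r \<in> carrier R" "f \<in> {f \<in> carrier ?S. \<forall>b. b \<notin> B \<longrightarrow> f b = \<zero>}"
    then show "r \<odot>\<^bsub>?S\<^esub> f \<in> {f \<in> carrier ?S. \<forall>b. b \<notin> B \<longrightarrow> f b = \<zero>}"
      using S.smult_closed[of r f] by (simp add: direct_sum_simps(4))
  qed (use S.M.zero_closed in \<open>auto simp: direct_sum_simps(3)\<close>)
  then have "module R (?S\<lparr>carrier := ?C\<rparr>)" by (rule submodule.submodule_is_module[OF _ S.module_axioms])
  moreover have "?S\<lparr>carrier := ?C\<rparr> = free_module R B" by (simp add: direct_sum_def free_module_def module_record_def self_module_def)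
  ultimately show ?thesis by simp
qed

lemma (in cring) basis_vec_mem: "b \<in> B \<Longrightarrow> basis_vec R b \<in> carrier (free_module R B)"
  by (rule free_module_mem[where S = "{b}"]) (auto simp: basis_vec_def)

subsection \<open>The universal property of the tensor product\<close>

text \<open>The index set is the support of \<open>\<phi>\<close>, so that this is literally the sum
  that \<open>tensor_lift\<close> evaluates on its chosen representative.\<close>

definition linear_ext ::
  "('r, 'x) ring_scheme \<Rightarrow> ('r, 'p, 'y) module_scheme \<Rightarrow> ('b \<Rightarrow> 'p) \<Rightarrow> ('b \<Rightarrow> 'r) \<Rightarrow> 'p" where
  "linear_ext R P h \<phi> = (\<Oplus>\<^bsub>P\<^esub>b\<in>{b. \<phi> b \<noteq> \<zero>\<^bsub>R\<^esub>}. \<phi> b \<odot>\<^bsub>P\<^esub> h b)"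

context rmodule
begin

lemma linear_ext_superset:
  assumes h: "\<forall>b\<in>B. h b \<in> carrier M" and f: "\<phi> \<in> carrier (free_module R B)"
    and S: "finite S" "S \<subseteq> B" "{b. \<phi> b \<noteq> \<zero>\<^bsub>R\<^esub>} \<subseteq> S"
  shows "linear_ext R M h \<phi> = (\<Oplus>b\<in>S. \<phi> b \<odot> h b)"
  unfolding linear_ext_def
proof (rule M.add.finprod_mono_neutral_cong_left[OF S(1,3)])
  show "\<phi> b \<odot> h b = \<zero>" if "b \<in> S - {b. \<phi> b \<noteq> \<zero>\<^bsub>R\<^esub>}" for b
    using that h S(2) by (auto intro: smult_l_null)
  show "(\<lambda>b. \<phi> b \<odot> h b) \<in> S \<rightarrow> carrier M"
    using h S(2) R.free_moduleD(1)[OF f] by blast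
qed simp

lemma linear_ext_linear:
  assumes h: "\<forall>b\<in>B. h b \<in> carrier M"
  shows "linear_map R (free_module R B) M (linear_ext R M h)"
proof (rule linear_mapI)
  let ?F = "free_module R B"
  interpret F: rmodule R ?F by (intro rmodule.intro R.free_module_module)
  show "linear_ext R M h \<phi> \<in> carrier M" if f: "\<phi> \<in> carrier ?F" for \<phi>
    unfolding linear_ext_def using h R.free_moduleD[OF f] by (intro M.finsum_closed) blast
  show "linear_ext R M h (\<phi> \<oplus>\<^bsub>?F\<^esub> \<psi>) = linear_ext R M h \<phi> \<oplus> linear_ext R M h \<psi>"
    if f: "\<phi> \<in> carrier ?F" and g: "\<psi> \<in> carrier ?F" for \<phi> \<psi>
  proof -
    let ?S = "{b. \<phi> b \<noteq> \<zero>\<^bsub>R\<^esub>} \<union> {b. \<psi> b \<noteq> \<zero>\<^bsub>R\<^esub>}"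
    note fd = R.free_moduleD[OF f] and gd = R.free_moduleD[OF g]
    have S: "finite ?S" "?S \<subseteq> B" using fd(2,3) gd(2,3) by simp_all
    have sub: "{b. (\<phi> \<oplus>\<^bsub>?F\<^esub> \<psi>) b \<noteq> \<zero>\<^bsub>R\<^esub>} \<subseteq> ?S" by (auto simp: free_module_simps(2))
    have "linear_ext R M h (\<phi> \<oplus>\<^bsub>?F\<^esub> \<psi>) = (\<Oplus>b\<in>?S. (\<phi> \<oplus>\<^bsub>?F\<^esub> \<psi>) b \<odot> h b)"
      by (rule linear_ext_superset[OF h _ S sub]) (use f g in simp)
    also have "\<dots> = (\<Oplus>b\<in>?S. \<phi> b \<odot> h b \<oplus> \<psi> b \<odot> h b)"
    proof (rule M.finsum_cong')
      fix b assume "b \<in> ?S"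
      then have "h b \<in> carrier M" using S(2) h by blast
      then show "(\<phi> \<oplus>\<^bsub>?F\<^esub> \<psi>) b \<odot> h b = \<phi> b \<odot> h b \<oplus> \<psi> b \<odot> h b"
        using fd(1) gd(1) by (simp add: free_module_simps(2) smult_l_distr)
    next
      show "(\<lambda>b. \<phi> b \<odot> h b \<oplus> \<psi> b \<odot> h b) \<in> ?S \<rightarrow> carrier M" using S(2) h fd(1) gd(1) by blast
    qed simp
    also have "\<dots> = (\<Oplus>b\<in>?S. \<phi> b \<odot> h b) \<oplus> (\<Oplus>b\<in>?S. \<psi> b \<odot> h b)"
      by (rule M.finsum_addf) (use S(2) h fd(1) gd(1) in blast)+
    also have "\<dots> = linear_ext R M h \<phi> \<oplus> linear_ext R M h \<psi>"
      using linear_ext_superset[OF h f S] linear_ext_superset[OF h g S] by simp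
    finally show ?thesis .
  qed
  show "linear_ext R M h (r \<odot>\<^bsub>?F\<^esub> \<phi>) = r \<odot> linear_ext R M h \<phi>"
    if r: "r \<in> carrier R" and f: "\<phi> \<in> carrier ?F" for r \<phi>
  proof -
    let ?S = "{b. \<phi> b \<noteq> \<zero>\<^bsub>R\<^esub>}"
    note fd = R.free_moduleD[OF f]
    have sub: "{b. (r \<odot>\<^bsub>?F\<^esub> \<phi>) b \<noteq> \<zero>\<^bsub>R\<^esub>} \<subseteq> ?S" using r by (auto simp: free_module_simps(4))
    have "linear_ext R M h (r \<odot>\<^bsub>?F\<^esub> \<phi>) = (\<Oplus>b\<in>?S. (r \<odot>\<^bsub>?F\<^esub> \<phi>) b \<odot> h b)"
      by (rule linear_ext_superset[OF h _ fd(2,3) sub]) (use r f in simp)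
    also have "\<dots> = (\<Oplus>b\<in>?S. r \<odot> (\<phi> b \<odot> h b))"
    proof (rule M.finsum_cong')
      fix b assume "b \<in> ?S"
      then have "h b \<in> carrier M" using fd(3) h by blast
      then show "(r \<odot>\<^bsub>?F\<^esub> \<phi>) b \<odot> h b = r \<odot> (\<phi> b \<odot> h b)"
        using fd(1) r by (simp add: free_module_simps(4) smult_assoc1)
    next
      show "(\<lambda>b. r \<odot> (\<phi> b \<odot> h b)) \<in> ?S \<rightarrow> carrier M" using fd(1,3) h r by blast
    qed simp
    also have "\<dots> = r \<odot> (\<Oplus>b\<in>?S. \<phi> b \<odot> h b)"
      by (rule finsum_smult_ldistr[symmetric]) (use fd h r in blast)+
    finally show ?thesis unfolding linear_ext_def .
  qed
qed

lemma linear_ext_basis: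
  assumes h: "\<forall>b\<in>B. h b \<in> carrier M" and b: "b \<in> B"
  shows "linear_ext R M h (basis_vec R b) = h b"
proof -
  have "linear_ext R M h (basis_vec R b) = (\<Oplus>c\<in>{b}. basis_vec R b c \<odot> h c)"
    by (rule linear_ext_superset[OF h R.basis_vec_mem[OF b]]) (use b in \<open>auto simp: basis_vec_def\<close>)
  also have "\<dots> = h b" using h b by (simp add: basis_vec_def)
  finally show ?thesis .
qed

lemma free_module_linear_eq:
  assumes f: "linear_map R (free_module R B) M f" and g: "linear_map R (free_module R B) M g"
    and eq: "\<And>b. b \<in> B \<Longrightarrow> f (basis_vec R b) = g (basis_vec R b)"
    and x: "\<phi> \<in> carrier (free_module R B)"
  shows "f \<phi> = g \<phi>"
proof -
  let ?F = "free_module R B"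
  interpret F: rmodule R ?F by (intro rmodule.intro R.free_module_module)
  note z = linear_map_zero[OF F.module_axioms module_axioms]
  have "\<forall>\<phi>\<in>carrier ?F. {b. \<phi> b \<noteq> \<zero>\<^bsub>R\<^esub>} \<subseteq> S \<longrightarrow> f \<phi> = g \<phi>" if "finite S" for S
    using that
  proof (induction S rule: finite_induct)
    case empty
    show ?case
    proof (intro ballI impI)
      fix \<phi> assume "\<phi> \<in> carrier ?F" "{b. \<phi> b \<noteq> \<zero>\<^bsub>R\<^esub>} \<subseteq> {}"
      then have "\<phi> = \<zero>\<^bsub>?F\<^esub>" by (auto simp: free_module_simps)
      then show "f \<phi> = g \<phi>" using z[OF f] z[OF g] by simp
    qed
  next
    case (insert p S)
    show ?case
    proof (intro ballI impI)
      fix \<phi> assume x: "\<phi> \<in> carrier ?F" and sub: "{b. \<phi> b \<noteq> \<zero>\<^bsub>R\<^esub>} \<subseteq> insert p S"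
      note xd = R.free_moduleD[OF x]
      show "f \<phi> = g \<phi>"
      proof (cases "p \<in> B")
        case False
        then have "{b. \<phi> b \<noteq> \<zero>\<^bsub>R\<^esub>} \<subseteq> S" using sub xd(4) by blast
        then show ?thesis using insert.IH x by blast
      next
        case True
        let ?p = "\<phi>(p := \<zero>\<^bsub>R\<^esub>)"
        have p: "?p \<in> carrier ?F"
          by (rule R.free_module_mem[where S = "{b. \<phi> b \<noteq> \<zero>\<^bsub>R\<^esub>}"]) (use xd in auto)
        have "{b. ?p b \<noteq> \<zero>\<^bsub>R\<^esub>} \<subseteq> S" using sub by auto
        then have e: "f ?p = g ?p" using insert.IH p by blast
        note b = R.basis_vec_mem[OF True]
        have sb: "\<phi> p \<odot>\<^bsub>?F\<^esub> basis_vec R p \<in> carrier ?F" using b xd(1) by simp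
        have "\<phi> = ?p \<oplus>\<^bsub>?F\<^esub> \<phi> p \<odot>\<^bsub>?F\<^esub> basis_vec R p"
          using xd(1) by (auto simp: free_module_simps(2,4) basis_vec_def)
        then show ?thesis
          using linear_mapD(2)[OF f p sb] linear_mapD(2)[OF g p sb] e
            linear_mapD(3)[OF f xd(1) b] linear_mapD(3)[OF g xd(1) b] eq[OF True] by metis
      qed
    qed
  qed
  from this[OF R.free_moduleD(2)[OF x]] show ?thesis using x by blast
qed

end

definition bilinear_map ::
  "('r, 'x) ring_scheme \<Rightarrow> ('r, 'm, 'y) module_scheme \<Rightarrow> ('r, 'n, 'z) module_scheme \<Rightarrow>
     ('r, 'p, 'w) module_scheme \<Rightarrow> ('m \<Rightarrow> 'n \<Rightarrow> 'p) \<Rightarrow> bool" where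
  "bilinear_map R M N P h \<longleftrightarrow>
     (\<forall>n\<in>carrier N. linear_map R M P (\<lambda>m. h m n)) \<and> (\<forall>m\<in>carrier M. linear_map R N P (h m))"

locale tensor_product = R?: cring R + M?: rmodule R M + N?: rmodule R N
  for R :: "('r, 'x) ring_scheme" and M :: "('r, 'm) module" and N :: "('r, 'n) module"
begin

abbreviation "F \<equiv> tensor_free R M N"
abbreviation "rels \<equiv> tensor_relations R M N"
abbreviation "T \<equiv> tensor_prod R M N"
abbreviation "pure \<equiv> pure_tensor R M N"
abbreviation "e \<equiv> basis_vec R"

sublocale F: rmodule R F unfolding tensor_free_def by (intro rmodule.intro R.free_module_module)

lemma basis_F: "\<lbrakk>m \<in> carrier M; n \<in> carrier N\<rbrakk> \<Longrightarrow> e (m, n) \<in> carrier F"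
  unfolding tensor_free_def by (rule R.basis_vec_mem) simp

definition gens where "gens =
      {e (m \<oplus>\<^bsub>M\<^esub> m', n) \<ominus>\<^bsub>F\<^esub> (e (m, n) \<oplus>\<^bsub>F\<^esub> e (m', n)) | m m' n.
          m \<in> carrier M \<and> m' \<in> carrier M \<and> n \<in> carrier N} \<union>
       {e (m, n \<oplus>\<^bsub>N\<^esub> n') \<ominus>\<^bsub>F\<^esub> (e (m, n) \<oplus>\<^bsub>F\<^esub> e (m, n')) | m n n'.
          m \<in> carrier M \<and> n \<in> carrier N \<and> n' \<in> carrier N} \<union>
       {e (r \<odot>\<^bsub>M\<^esub> m, n) \<ominus>\<^bsub>F\<^esub> (r \<odot>\<^bsub>F\<^esub> e (m, n)) | r m n.
          r \<in> carrier R \<and> m \<in> carrier M \<and> n \<in> carrier N} \<union>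
       {e (m, r \<odot>\<^bsub>N\<^esub> n) \<ominus>\<^bsub>F\<^esub> (r \<odot>\<^bsub>F\<^esub> e (m, n)) | r m n.
          r \<in> carrier R \<and> m \<in> carrier M \<and> n \<in> carrier N}"

lemma rels_eq: "rels = gen_submodule R F gens"
  unfolding tensor_relations_def gens_def Let_def ..

lemma gens_F: "gens \<subseteq> carrier F"
proof -
  have a1: "e (m \<oplus>\<^bsub>M\<^esub> m', n) \<ominus>\<^bsub>F\<^esub> (e (m, n) \<oplus>\<^bsub>F\<^esub> e (m', n)) \<in> carrier F"
    if "m \<in> carrier M" "m' \<in> carrier M" "n \<in> carrier N" for m m' n
    by (intro F.M.minus_closed F.M.a_closed basis_F M.M.a_closed that)
  have a2: "e (m, n \<oplus>\<^bsub>N\<^esub> n') \<ominus>\<^bsub>F\<^esub> (e (m, n) \<oplus>\<^bsub>F\<^esub> e (m, n')) \<in> carrier F"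
    if "m \<in> carrier M" "n \<in> carrier N" "n' \<in> carrier N" for m n n'
    by (intro F.M.minus_closed F.M.a_closed basis_F N.M.a_closed that)
  have a3: "e (r \<odot>\<^bsub>M\<^esub> m, n) \<ominus>\<^bsub>F\<^esub> (r \<odot>\<^bsub>F\<^esub> e (m, n)) \<in> carrier F"
    if "r \<in> carrier R" "m \<in> carrier M" "n \<in> carrier N" for r m n
    by (intro F.M.minus_closed F.smult_closed basis_F M.smult_closed that)
  have a4: "e (m, r \<odot>\<^bsub>N\<^esub> n) \<ominus>\<^bsub>F\<^esub> (r \<odot>\<^bsub>F\<^esub> e (m, n)) \<in> carrier F"
    if "r \<in> carrier R" "m \<in> carrier M" "n \<in> carrier N" for r m n
    by (intro F.M.minus_closed F.smult_closed basis_F N.smult_closed that)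
  show ?thesis unfolding gens_def
    by (intro Un_least subsetI; elim CollectE exE conjE; simp only: a1 a2 a3 a4)
qed

lemma rels_submodule: "submodule rels R F" and gens_rels: "gens \<subseteq> rels"
  unfolding rels_eq using F.gen_submodule(1,2)[OF gens_F] .

sublocale T: rmodule R T
  unfolding tensor_prod_def by (intro rmodule.intro F.module_quot_module[OF rels_submodule])

lemma quot_linear: "linear_map R F T (\<lambda>x. rels +>\<^bsub>F\<^esub> x)"
  unfolding tensor_prod_def by (rule F.linear_map_quot[OF rels_submodule])

lemma pure_closed [simp]: "\<lbrakk>m \<in> carrier M; n \<in> carrier N\<rbrakk> \<Longrightarrow> pure m n \<in> carrier T"
  unfolding pure_tensor_def by (rule linear_mapD(1)[OF quot_linear basis_F])

lemma coset_eqI: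
  "\<lbrakk>x \<ominus>\<^bsub>F\<^esub> y \<in> gens; x \<in> carrier F; y \<in> carrier F\<rbrakk> \<Longrightarrow> rels +>\<^bsub>F\<^esub> x = rels +>\<^bsub>F\<^esub> y"
  using F.quot_coset_eq[OF rels_submodule] gens_rels by blast

lemma pure_bilinear: "bilinear_map R M N T pure"
  unfolding bilinear_map_def
proof (intro conjI ballI)
  note q = linear_mapD[OF quot_linear]
  fix n assume n: "n \<in> carrier N"
  show "linear_map R M T (\<lambda>m. pure m n)"
  proof (rule linear_mapI)
    show "pure m n \<in> carrier T" if "m \<in> carrier M" for m using that n by simp
    fix m m' assume m: "m \<in> carrier M" "m' \<in> carrier M"
    have "rels +>\<^bsub>F\<^esub> e (m \<oplus>\<^bsub>M\<^esub> m', n) = rels +>\<^bsub>F\<^esub> (e (m, n) \<oplus>\<^bsub>F\<^esub> e (m', n))"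
    proof (rule coset_eqI)
      show "e (m \<oplus>\<^bsub>M\<^esub> m', n) \<ominus>\<^bsub>F\<^esub> (e (m, n) \<oplus>\<^bsub>F\<^esub> e (m', n)) \<in> gens" unfolding gens_def using m n by blast
    qed (use m n in \<open>simp_all add: basis_F\<close>)
    also have "\<dots> = pure m n \<oplus>\<^bsub>T\<^esub> pure m' n"
      unfolding pure_tensor_def by (rule q(2)) (use m n in \<open>simp_all add: basis_F\<close>)
    finally show "pure (m \<oplus>\<^bsub>M\<^esub> m') n = pure m n \<oplus>\<^bsub>T\<^esub> pure m' n" unfolding pure_tensor_def .
  next
    fix r m assume m: "r \<in> carrier R" "m \<in> carrier M"
    have "rels +>\<^bsub>F\<^esub> e (r \<odot>\<^bsub>M\<^esub> m, n) = rels +>\<^bsub>F\<^esub> (r \<odot>\<^bsub>F\<^esub> e (m, n))"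
    proof (rule coset_eqI)
      show "e (r \<odot>\<^bsub>M\<^esub> m, n) \<ominus>\<^bsub>F\<^esub> (r \<odot>\<^bsub>F\<^esub> e (m, n)) \<in> gens" unfolding gens_def using m n by blast
    qed (use m n in \<open>simp_all add: basis_F\<close>)
    also have "\<dots> = r \<odot>\<^bsub>T\<^esub> pure m n"
      unfolding pure_tensor_def by (rule q(3)) (use m n in \<open>simp_all add: basis_F\<close>)
    finally show "pure (r \<odot>\<^bsub>M\<^esub> m) n = r \<odot>\<^bsub>T\<^esub> pure m n" unfolding pure_tensor_def .
  qed
next
  note q = linear_mapD[OF quot_linear]
  fix m assume m: "m \<in> carrier M"
  show "linear_map R N T (pure m)"
  proof (rule linear_mapI)
    show "pure m n \<in> carrier T" if "n \<in> carrier N" for n using that m by simp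
    fix n n' assume n: "n \<in> carrier N" "n' \<in> carrier N"
    have "rels +>\<^bsub>F\<^esub> e (m, n \<oplus>\<^bsub>N\<^esub> n') = rels +>\<^bsub>F\<^esub> (e (m, n) \<oplus>\<^bsub>F\<^esub> e (m, n'))"
    proof (rule coset_eqI)
      show "e (m, n \<oplus>\<^bsub>N\<^esub> n') \<ominus>\<^bsub>F\<^esub> (e (m, n) \<oplus>\<^bsub>F\<^esub> e (m, n')) \<in> gens" unfolding gens_def using m n by blast
    qed (use m n in \<open>simp_all add: basis_F\<close>)
    also have "\<dots> = pure m n \<oplus>\<^bsub>T\<^esub> pure m n'"
      unfolding pure_tensor_def by (rule q(2)) (use m n in \<open>simp_all add: basis_F\<close>)
    finally show "pure m (n \<oplus>\<^bsub>N\<^esub> n') = pure m n \<oplus>\<^bsub>T\<^esub> pure m n'" unfolding pure_tensor_def .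
  next
    fix r n assume n: "r \<in> carrier R" "n \<in> carrier N"
    have "rels +>\<^bsub>F\<^esub> e (m, r \<odot>\<^bsub>N\<^esub> n) = rels +>\<^bsub>F\<^esub> (r \<odot>\<^bsub>F\<^esub> e (m, n))"
    proof (rule coset_eqI)
      show "e (m, r \<odot>\<^bsub>N\<^esub> n) \<ominus>\<^bsub>F\<^esub> (r \<odot>\<^bsub>F\<^esub> e (m, n)) \<in> gens" unfolding gens_def using m n by blast
    qed (use m n in \<open>simp_all add: basis_F\<close>)
    also have "\<dots> = r \<odot>\<^bsub>T\<^esub> pure m n"
      unfolding pure_tensor_def by (rule q(3)) (use m n in \<open>simp_all add: basis_F\<close>)
    finally show "pure m (r \<odot>\<^bsub>N\<^esub> n) = r \<odot>\<^bsub>T\<^esub> pure m n" unfolding pure_tensor_def .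
  qed
qed

text \<open>Both maps are pulled back to the free module on pairs, where they agree on basis
  vectors. Identities on tensor products are thereby checked on pure tensors.\<close>

lemma tensor_linear_eq:
  fixes P :: "('r, 'p, 'w) module_scheme"
  assumes P: "module R P" and f: "linear_map R T P f" and g: "linear_map R T P g"
    and eq: "\<And>m n. \<lbrakk>m \<in> carrier M; n \<in> carrier N\<rbrakk> \<Longrightarrow> f (pure m n) = g (pure m n)"
    and t: "t \<in> carrier T"
  shows "f t = g t"
proof -
  have "carrier T = (\<lambda>x. rels +>\<^bsub>F\<^esub> x) ` carrier F" unfolding tensor_prod_def by (rule F.quot_carrier)
  then obtain \<phi> where x: "\<phi> \<in> carrier F" "t = rels +>\<^bsub>F\<^esub> \<phi>" using t by blast
  have "f (rels +>\<^bsub>F\<^esub> \<phi>) = g (rels +>\<^bsub>F\<^esub> \<phi>)"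
  proof (rule rmodule.free_module_linear_eq[OF rmodule.intro[OF P], where f = "\<lambda>x. f (rels +>\<^bsub>F\<^esub> x)"
        and g = "\<lambda>x. g (rels +>\<^bsub>F\<^esub> x)"])
    show "linear_map R (free_module R (carrier M \<times> carrier N)) P (\<lambda>x. f (rels +>\<^bsub>F\<^esub> x))"
      "linear_map R (free_module R (carrier M \<times> carrier N)) P (\<lambda>x. g (rels +>\<^bsub>F\<^esub> x))"
      using linear_map_comp[OF quot_linear f] linear_map_comp[OF quot_linear g]
      unfolding tensor_free_def by simp_all
    show "\<phi> \<in> carrier (free_module R (carrier M \<times> carrier N))" using x unfolding tensor_free_def by simp
    fix b assume "b \<in> carrier M \<times> carrier N"
    then obtain m n where b: "m \<in> carrier M" "n \<in> carrier N" "b = (m, n)" by blast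
    show "f (rels +>\<^bsub>F\<^esub> e b) = g (rels +>\<^bsub>F\<^esub> e b)"
      using eq[OF b(1,2)] unfolding pure_tensor_def b(3) .
  qed
  then show ?thesis using x by simp
qed

context
  fixes P :: "('r, 'p) module" and h :: "'m \<Rightarrow> 'n \<Rightarrow> 'p"
  assumes P: "module R P" and h: "bilinear_map R M N P h"
begin

interpretation P: rmodule R P by (intro rmodule.intro P)

private abbreviation "k \<equiv> linear_ext R P (\<lambda>p. h (fst p) (snd p))"

private lemma h_closed: "\<forall>b\<in>carrier M \<times> carrier N. h (fst b) (snd b) \<in> carrier P"
  using h linear_mapD(1) unfolding bilinear_map_def by fastforce

private lemma k_linear: "linear_map R F P k"
  unfolding tensor_free_def by (rule P.linear_ext_linear[OF h_closed])

private lemma k_basis: "\<lbrakk>m \<in> carrier M; n \<in> carrier N\<rbrakk> \<Longrightarrow> k (e (m, n)) = h m n"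
  using P.linear_ext_basis[OF h_closed, of "(m, n)"] by simp

text \<open>Bilinearity of \<open>h\<close> says that \<open>k\<close> vanishes on the generating
  relations; the kernel of \<open>k\<close> is a submodule, so it contains
  \<open>rels\<close>.\<close>

private lemma k_rels: "x \<in> rels \<Longrightarrow> k x = \<zero>\<^bsub>P\<^esub>"
proof -
  note kd = linear_mapD[OF k_linear] and km = linear_map_minus[OF F.module_axioms P k_linear]
  have h1: "linear_map R M P (\<lambda>m. h m n)" if "n \<in> carrier N" for n using h that by (simp add: bilinear_map_def)
  have h2: "linear_map R N P (h m)" if "m \<in> carrier M" for m using h that by (simp add: bilinear_map_def)
  note h1d = linear_mapD[OF h1] and h2d = linear_mapD[OF h2]
  have sub: "submodule {x \<in> carrier F. k x = \<zero>\<^bsub>P\<^esub>} R F"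
    by (rule linear_map_kernel[OF F.module_axioms P k_linear])
  have pm: "y \<ominus>\<^bsub>P\<^esub> y = \<zero>\<^bsub>P\<^esub>" if "y \<in> carrier P" for y using that by (simp add: a_minus_def P.M.r_neg)
  have "gens \<subseteq> {x \<in> carrier F. k x = \<zero>\<^bsub>P\<^esub>}"
  proof -
    have a1: "k (e (m \<oplus>\<^bsub>M\<^esub> m', n) \<ominus>\<^bsub>F\<^esub> (e (m, n) \<oplus>\<^bsub>F\<^esub> e (m', n))) = \<zero>\<^bsub>P\<^esub>"
      if m: "m \<in> carrier M" "m' \<in> carrier M" "n \<in> carrier N" for m m' n
      using m by (simp add: km kd(2) k_basis basis_F h1d(1,2) pm)
    have a2: "k (e (m, n \<oplus>\<^bsub>N\<^esub> n') \<ominus>\<^bsub>F\<^esub> (e (m, n) \<oplus>\<^bsub>F\<^esub> e (m, n'))) = \<zero>\<^bsub>P\<^esub>"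
      if m: "m \<in> carrier M" "n \<in> carrier N" "n' \<in> carrier N" for m n n'
      using m by (simp add: km kd(2) k_basis basis_F h2d(1,2) pm)
    have a3: "k (e (r \<odot>\<^bsub>M\<^esub> m, n) \<ominus>\<^bsub>F\<^esub> (r \<odot>\<^bsub>F\<^esub> e (m, n))) = \<zero>\<^bsub>P\<^esub>"
      if m: "r \<in> carrier R" "m \<in> carrier M" "n \<in> carrier N" for r m n
      using m by (simp add: km kd(3) k_basis basis_F h1d(1,3) pm)
    have a4: "k (e (m, r \<odot>\<^bsub>N\<^esub> n) \<ominus>\<^bsub>F\<^esub> (r \<odot>\<^bsub>F\<^esub> e (m, n))) = \<zero>\<^bsub>P\<^esub>"
      if m: "r \<in> carrier R" "m \<in> carrier M" "n \<in> carrier N" for r m n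
      using m by (simp add: km kd(3) k_basis basis_F h2d(1,3) pm)
    have "k x = \<zero>\<^bsub>P\<^esub>" if "x \<in> gens" for x
      using that unfolding gens_def by (elim UnE CollectE exE conjE; simp only: a1 a2 a3 a4)
    then show ?thesis using gens_F by blast
  qed
  then have "rels \<subseteq> {x \<in> carrier F. k x = \<zero>\<^bsub>P\<^esub>}" unfolding rels_eq by (rule F.gen_submodule(3)[OF gens_F sub])
  then show "x \<in> rels \<Longrightarrow> k x = \<zero>\<^bsub>P\<^esub>" by blast
qed

text \<open>Removes the choice made in \<open>tensor_lift\<close>: the chosen representative and
  \<open>x\<close> differ by a relation, on which \<open>k\<close> vanishes.\<close>

private lemma lift_coset:
  assumes x: "x \<in> carrier F"
  shows "tensor_lift R P h (rels +>\<^bsub>F\<^esub> x) = k x"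
proof -
  let ?y = "SOME y. y \<in> rels +>\<^bsub>F\<^esub> x"
  have "?y \<in> rels +>\<^bsub>F\<^esub> x" by (rule someI[of _ x]) (rule F.mem_coset_self[OF rels_submodule x])
  note y = F.mem_coset_eq[OF rels_submodule x this]
  have "?y \<ominus>\<^bsub>F\<^esub> x \<in> rels" using F.quot_coset_eq[OF rels_submodule y(2) x] y(1) by simp
  then have "k (?y \<ominus>\<^bsub>F\<^esub> x) = \<zero>\<^bsub>P\<^esub>" by (rule k_rels)
  then have z: "k ?y \<ominus>\<^bsub>P\<^esub> k x = \<zero>\<^bsub>P\<^esub>" unfolding linear_map_minus[OF F.module_axioms P k_linear y(2) x] .
  have "k ?y = (k ?y \<ominus>\<^bsub>P\<^esub> k x) \<oplus>\<^bsub>P\<^esub> k x"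
    by (rule P.minus_cancel(1)[symmetric]) (rule linear_mapD(1)[OF k_linear], rule x y)+
  then have "k ?y = k x" unfolding z using linear_mapD(1)[OF k_linear x] by simp
  then show ?thesis unfolding tensor_lift_def Let_def linear_ext_def .
qed

lemma tensor_lift_linear: "linear_map R T P (tensor_lift R P h)"
proof -
  note q = linear_mapD[OF quot_linear] and kd = linear_mapD[OF k_linear]
  have carr: "carrier T = (\<lambda>x. rels +>\<^bsub>F\<^esub> x) ` carrier F" unfolding tensor_prod_def by (rule F.quot_carrier)
  show ?thesis
  proof (rule linear_mapI)
    fix t assume "t \<in> carrier T"
    then obtain x where x: "x \<in> carrier F" "t = rels +>\<^bsub>F\<^esub> x" unfolding carr by blast
    then show "tensor_lift R P h t \<in> carrier P" using lift_coset kd(1) by simp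
  next
    fix t s assume "t \<in> carrier T" "s \<in> carrier T"
    then obtain x y where x: "x \<in> carrier F" "t = rels +>\<^bsub>F\<^esub> x" "y \<in> carrier F" "s = rels +>\<^bsub>F\<^esub> y"
      unfolding carr by blast
    then show "tensor_lift R P h (t \<oplus>\<^bsub>T\<^esub> s) = tensor_lift R P h t \<oplus>\<^bsub>P\<^esub> tensor_lift R P h s"
      using lift_coset kd(2) q(2)[symmetric] by simp
  next
    fix r t assume r: "r \<in> carrier R" and "t \<in> carrier T"
    then obtain x where x: "x \<in> carrier F" "t = rels +>\<^bsub>F\<^esub> x" unfolding carr by blast
    then show "tensor_lift R P h (r \<odot>\<^bsub>T\<^esub> t) = r \<odot>\<^bsub>P\<^esub> tensor_lift R P h t"
      using r lift_coset kd(3) q(3)[symmetric] by simp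
  qed
qed

lemma tensor_lift_pure:
  "\<lbrakk>m \<in> carrier M; n \<in> carrier N\<rbrakk> \<Longrightarrow> tensor_lift R P h (pure m n) = h m n"
  unfolding pure_tensor_def using lift_coset[OF basis_F] k_basis by simp

end

end

context
  fixes R :: "('r, 'x) ring_scheme" and M :: "('r, 'm) module" and N :: "('r, 'n) module"
    and M' :: "('r, 'p) module" and N' :: "('r, 'q) module" and f g
  assumes MN: "tensor_product R M N" and MN': "tensor_product R M' N'"
    and f: "linear_map R M M' f" and g: "linear_map R N N' g"
begin

interpretation A: tensor_product R M N by (rule MN)
interpretation B: tensor_product R M' N' by (rule MN')

lemma tensor_map_bilinear: "bilinear_map R M N B.T (\<lambda>m n. B.pure (f m) (g n))"
  unfolding bilinear_map_def
proof (intro conjI ballI)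
  fix n assume "n \<in> carrier N"
  then have "linear_map R M' B.T (\<lambda>m. B.pure m (g n))"
    using B.pure_bilinear linear_mapD(1)[OF g] unfolding bilinear_map_def by blast
  then show "linear_map R M B.T (\<lambda>m. B.pure (f m) (g n))" by (rule linear_map_comp[OF f])
next
  fix m assume "m \<in> carrier M"
  then have "linear_map R N' B.T (B.pure (f m))"
    using B.pure_bilinear linear_mapD(1)[OF f] unfolding bilinear_map_def by blast
  then show "linear_map R N B.T (\<lambda>n. B.pure (f m) (g n))" by (rule linear_map_comp[OF g])
qed

lemma tensor_map_linear: "linear_map R A.T B.T (tensor_map R M' N' f g)"
  unfolding tensor_map_def by (rule A.tensor_lift_linear[OF B.T.module_axioms tensor_map_bilinear])

lemma tensor_map_pure:
  "\<lbrakk>m \<in> carrier M; n \<in> carrier N\<rbrakk> \<Longrightarrow> tensor_map R M' N' f g (A.pure m n) = B.pure (f m) (g n)"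
  unfolding tensor_map_def by (rule A.tensor_lift_pure[OF B.T.module_axioms tensor_map_bilinear])

end

text \<open>For finite \<open>B\<close>, \<open>R\<^sup>B \<otimes> N\<close> is the module of functions from \<open>B\<close> to \<open>N\<close>; \<open>coord b\<close> reads off
  the value at \<open>b\<close>.\<close>

locale tensor_free_left = R?: cring R + N?: rmodule R N
  for R :: "('r, 'x) ring_scheme" and N :: "('r, 'n) module" +
  fixes B :: "'b set"
  assumes fin: "finite B"
begin

abbreviation "K \<equiv> free_module R B"

sublocale tensor_product R K N
  by (intro tensor_product.intro rmodule.intro R.is_cring R.free_module_module N.module_axioms)

definition coord :: "'b \<Rightarrow> (('b \<Rightarrow> 'r) \<times> 'n \<Rightarrow> 'r) set \<Rightarrow> 'n" where
  "coord b = tensor_lift R N (\<lambda>f n. f b \<odot>\<^bsub>N\<^esub> n)"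

lemma coord_bilinear: "bilinear_map R K N N (\<lambda>f n. f b \<odot>\<^bsub>N\<^esub> n)"
  unfolding bilinear_map_def
proof (intro conjI ballI)
  fix n assume n: "n \<in> carrier N"
  show "linear_map R K N (\<lambda>f. f b \<odot>\<^bsub>N\<^esub> n)"
  proof (rule linear_mapI)
    fix f assume f: "f \<in> carrier K"
    note fb = R.free_moduleD(1)[OF f, of b]
    show "f b \<odot>\<^bsub>N\<^esub> n \<in> carrier N" using fb n by simp
    show "(f \<oplus>\<^bsub>K\<^esub> g) b \<odot>\<^bsub>N\<^esub> n = f b \<odot>\<^bsub>N\<^esub> n \<oplus>\<^bsub>N\<^esub> g b \<odot>\<^bsub>N\<^esub> n" if g: "g \<in> carrier K" for g
      using fb R.free_moduleD(1)[OF g, of b] n by (simp add: free_module_simps(2) N.smult_l_distr)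
    show "(r \<odot>\<^bsub>K\<^esub> f) b \<odot>\<^bsub>N\<^esub> n = r \<odot>\<^bsub>N\<^esub> (f b \<odot>\<^bsub>N\<^esub> n)" if "r \<in> carrier R" for r
      using fb that n by (simp add: free_module_simps(4) N.smult_assoc1)
  qed
next
  fix f assume f: "f \<in> carrier K"
  note fb = R.free_moduleD(1)[OF f, of b]
  show "linear_map R N N (\<lambda>n. f b \<odot>\<^bsub>N\<^esub> n)"
  proof (rule linear_mapI)
    fix r x assume rx: "r \<in> carrier R" "x \<in> carrier N"
    show "f b \<odot>\<^bsub>N\<^esub> (r \<odot>\<^bsub>N\<^esub> x) = r \<odot>\<^bsub>N\<^esub> (f b \<odot>\<^bsub>N\<^esub> x)"
      using rx fb N.smult_assoc1[of "f b" r x] N.smult_assoc1[of r "f b" x] by (simp add: R.m_comm)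
  qed (use fb in \<open>simp_all add: N.smult_r_distr\<close>)
qed

lemma coord_linear: "linear_map R T N (coord b)"
  unfolding coord_def by (rule tensor_lift_linear[OF N.module_axioms coord_bilinear])

lemma coord_pure: "\<lbrakk>f \<in> carrier K; n \<in> carrier N\<rbrakk> \<Longrightarrow> coord b (pure f n) = f b \<odot>\<^bsub>N\<^esub> n"
  unfolding coord_def by (rule tensor_lift_pure[OF N.module_axioms coord_bilinear])

lemma pure_linear: "f \<in> carrier K \<Longrightarrow> linear_map R N T (pure f)"
  "n \<in> carrier N \<Longrightarrow> linear_map R K T (\<lambda>f. pure f n)"
  using pure_bilinear unfolding bilinear_map_def by simp_all

text \<open>Both sides are linear in \<open>t\<close>, so \<open>t\<close> may be taken to be a pure
  tensor; they are then linear in its first factor, which may be taken to be a basis vector.\<close>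

lemma coord_expansion:
  assumes t: "t \<in> carrier T"
  shows "t = (\<Oplus>\<^bsub>T\<^esub>b\<in>B. pure (basis_vec R b) (coord b t))"
proof -
  have "id t = (\<Oplus>\<^bsub>T\<^esub>b\<in>B. pure (basis_vec R b) (coord b t))"
  proof (rule tensor_linear_eq[OF T.module_axioms linear_map_id _ _ t,
        where g = "\<lambda>t. \<Oplus>\<^bsub>T\<^esub>b\<in>B. pure (basis_vec R b) (coord b t)"])
    show "linear_map R T T (\<lambda>t. \<Oplus>\<^bsub>T\<^esub>b\<in>B. pure (basis_vec R b) (coord b t))"
    proof (rule linear_map_sum[OF T.module_axioms T.module_axioms fin], rule ballI)
      fix b assume "b \<in> B"
      show "linear_map R T T (\<lambda>t. pure (basis_vec R b) (coord b t))"
        by (rule linear_map_comp[OF coord_linear pure_linear(1)[OF R.basis_vec_mem[OF \<open>b \<in> B\<close>]]])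
    qed
    fix f n assume f: "f \<in> carrier K" and n: "n \<in> carrier N"
    have lin: "linear_map R K T (\<lambda>f. \<Oplus>\<^bsub>T\<^esub>b\<in>B. pure (basis_vec R b) (coord b (pure f n)))"
    proof (rule linear_map_sum[OF R.free_module_module T.module_axioms fin], rule ballI)
      fix b assume "b \<in> B"
      show "linear_map R K T (\<lambda>f. pure (basis_vec R b) (coord b (pure f n)))"
        by (rule linear_map_comp[OF linear_map_comp[OF pure_linear(2)[OF n] coord_linear]
              pure_linear(1)[OF R.basis_vec_mem[OF \<open>b \<in> B\<close>]]])
    qed
    have "pure f n = (\<Oplus>\<^bsub>T\<^esub>b\<in>B. pure (basis_vec R b) (coord b (pure f n)))"
    proof (rule T.free_module_linear_eq[OF pure_linear(2)[OF n] lin _ f])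
      fix c assume c: "c \<in> B"
      have "(\<Oplus>\<^bsub>T\<^esub>b\<in>B. pure (basis_vec R b) (coord b (pure (basis_vec R c) n))) =
        (\<Oplus>\<^bsub>T\<^esub>b\<in>B. if c = b then pure (basis_vec R b) n else \<zero>\<^bsub>T\<^esub>)"
      proof (rule T.M.finsum_cong')
        show "(\<lambda>b. if c = b then pure (basis_vec R b) n else \<zero>\<^bsub>T\<^esub>) \<in> B \<rightarrow> carrier T"
          by (rule Pi_I) (simp add: R.basis_vec_mem n)
        fix b assume b: "b \<in> B"
        note bp = R.basis_vec_mem[OF b]
        show "pure (basis_vec R b) (coord b (pure (basis_vec R c) n)) =
            (if c = b then pure (basis_vec R b) n else \<zero>\<^bsub>T\<^esub>)"
          unfolding coord_pure[OF R.basis_vec_mem[OF c] n]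
          using n linear_map_zero[OF N.module_axioms T.module_axioms pure_linear(1)[OF bp]]
          by (simp add: basis_vec_def)
      qed simp
      also have "\<dots> = pure (basis_vec R c) n"
        by (rule T.M.finsum_singleton[OF c fin]) (rule Pi_I, simp add: R.basis_vec_mem n)
      finally show "pure (basis_vec R c) n = (\<Oplus>\<^bsub>T\<^esub>b\<in>B. pure (basis_vec R b) (coord b (pure (basis_vec R c) n)))"
        by simp
    qed
    then show "id (pure f n) = (\<Oplus>\<^bsub>T\<^esub>b\<in>B. pure (basis_vec R b) (coord b (pure f n)))" by simp
  qed
  then show ?thesis by simp
qed

lemma coord_inject:
  assumes "t \<in> carrier T" "s \<in> carrier T" "\<And>b. b \<in> B \<Longrightarrow> coord b t = coord b s"
  shows "t = s"
proof -
  have "(\<Oplus>\<^bsub>T\<^esub>b\<in>B. pure (basis_vec R b) (coord b t)) = (\<Oplus>\<^bsub>T\<^esub>b\<in>B. pure (basis_vec R b) (coord b s))"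
  proof (rule T.M.finsum_cong')
    show "(\<lambda>b. pure (basis_vec R b) (coord b s)) \<in> B \<rightarrow> carrier T"
      by (rule Pi_I) (simp add: R.basis_vec_mem linear_mapD(1)[OF coord_linear assms(2)])
  qed (use assms(3) in simp_all)
  then show ?thesis using coord_expansion[OF assms(1)] coord_expansion[OF assms(2)] by simp
qed

lemma coord_surj:
  assumes c: "\<And>b. b \<in> B \<Longrightarrow> c b \<in> carrier N"
  obtains t where "t \<in> carrier T" "\<And>b. b \<in> B \<Longrightarrow> coord b t = c b"
proof -
  let ?t = "\<Oplus>\<^bsub>T\<^esub>b\<in>B. pure (basis_vec R b) (c b)"
  have p: "\<forall>b\<in>B. pure (basis_vec R b) (c b) \<in> carrier T" using c by (simp add: R.basis_vec_mem)
  have "coord a ?t = c a" if a: "a \<in> B" for a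
  proof -
    have "coord a ?t = (\<Oplus>\<^bsub>N\<^esub>b\<in>B. coord a (pure (basis_vec R b) (c b)))"
      by (rule linear_map_finsum[OF T.module_axioms N.module_axioms coord_linear fin p])
    also have "\<dots> = (\<Oplus>\<^bsub>N\<^esub>b\<in>B. if a = b then c b else \<zero>\<^bsub>N\<^esub>)"
    proof (rule N.M.finsum_cong')
      show "(\<lambda>b. if a = b then c b else \<zero>\<^bsub>N\<^esub>) \<in> B \<rightarrow> carrier N" by (rule Pi_I) (use c in simp)
      fix b assume b: "b \<in> B"
      show "coord a (pure (basis_vec R b) (c b)) = (if a = b then c b else \<zero>\<^bsub>N\<^esub>)"
        unfolding coord_pure[OF R.basis_vec_mem[OF b] c[OF b]] using c[OF b] by (simp add: basis_vec_def)
    qed simp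
    also have "\<dots> = c a" by (rule N.M.finsum_singleton[OF a fin]) (rule Pi_I, use c in simp)
    finally show ?thesis .
  qed
  moreover have "?t \<in> carrier T" using p by (intro T.M.finsum_closed Pi_I) simp
  ultimately show thesis using that by blast
qed

end

section \<open>Localization\<close>

locale mult_set = cring R for R (structure) +
  fixes S :: "'a set"
  assumes S_carr: "S \<subseteq> carrier R" and S_one: "\<one> \<in> S" and S_mult: "\<lbrakk>s \<in> S; t \<in> S\<rbrakk> \<Longrightarrow> s \<otimes> t \<in> S"
begin

lemma S_closed: "s \<in> S \<Longrightarrow> s \<in> carrier R"
  using S_carr by blast

context
  fixes M :: "('a, 'm) module"
  assumes M: "module R M"
begin

interpretation M: rmodule R M by (intro rmodule.intro M)

abbreviation "fr \<equiv> fraction S M"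
abbreviation "L \<equiv> loc_module R S M"

lemmas smult_norm = M.smult_assoc1[symmetric] M.smult_r_distr

lemma fraction_mem:
  "(n, t) \<in> fr m s \<longleftrightarrow> n \<in> carrier M \<and> t \<in> S \<and> (\<exists>u\<in>S. u \<odot>\<^bsub>M\<^esub> (t \<odot>\<^bsub>M\<^esub> m) = u \<odot>\<^bsub>M\<^esub> (s \<odot>\<^bsub>M\<^esub> n))"
  by (simp add: fraction_def)

lemma fraction_self: "\<lbrakk>m \<in> carrier M; s \<in> S\<rbrakk> \<Longrightarrow> (m, s) \<in> fr m s"
  using S_one unfolding fraction_mem by blast

lemma fraction_trans:
  assumes c: "m \<in> carrier M" "n \<in> carrier M" "k \<in> carrier M" "s \<in> S" "t \<in> S" "r \<in> S"
    and u: "u \<in> S" "u \<odot>\<^bsub>M\<^esub> (t \<odot>\<^bsub>M\<^esub> m) = u \<odot>\<^bsub>M\<^esub> (s \<odot>\<^bsub>M\<^esub> n)"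
    and v: "v \<in> S" "v \<odot>\<^bsub>M\<^esub> (r \<odot>\<^bsub>M\<^esub> n) = v \<odot>\<^bsub>M\<^esub> (t \<odot>\<^bsub>M\<^esub> k)"
  shows "\<exists>w\<in>S. w \<odot>\<^bsub>M\<^esub> (r \<odot>\<^bsub>M\<^esub> m) = w \<odot>\<^bsub>M\<^esub> (s \<odot>\<^bsub>M\<^esub> k)"
\<comment> \<open>The first equation times \<open>v r\<close> and the second times
  \<open>u s\<close> share the term in \<open>n\<close>; what the two outer terms have in common is
  the factor \<open>u v t\<close>.\<close>
proof (rule bexI[of _ "u \<otimes> v \<otimes> t"])
  note d = c(1-3) S_closed[OF c(4)] S_closed[OF c(5)] S_closed[OF c(6)] S_closed[OF u(1)] S_closed[OF v(1)]
  have "(u \<otimes> v \<otimes> t) \<odot>\<^bsub>M\<^esub> (r \<odot>\<^bsub>M\<^esub> m) = (v \<otimes> r) \<odot>\<^bsub>M\<^esub> (u \<odot>\<^bsub>M\<^esub> (t \<odot>\<^bsub>M\<^esub> m))"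
    using d by (simp add: smult_norm m_ac)
  also have "\<dots> = (u \<otimes> s) \<odot>\<^bsub>M\<^esub> (v \<odot>\<^bsub>M\<^esub> (r \<odot>\<^bsub>M\<^esub> n))"
    unfolding u(2) using d by (simp add: smult_norm m_ac)
  also have "\<dots> = (u \<otimes> v \<otimes> t) \<odot>\<^bsub>M\<^esub> (s \<odot>\<^bsub>M\<^esub> k)"
    unfolding v(2) using d by (simp add: smult_norm m_ac)
  finally show "(u \<otimes> v \<otimes> t) \<odot>\<^bsub>M\<^esub> (r \<odot>\<^bsub>M\<^esub> m) = (u \<otimes> v \<otimes> t) \<odot>\<^bsub>M\<^esub> (s \<odot>\<^bsub>M\<^esub> k)" .
  show "u \<otimes> v \<otimes> t \<in> S" using S_mult u(1) v(1) c(5) by simp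
qed

lemma fraction_eq:
  assumes c: "m \<in> carrier M" "n \<in> carrier M" "s \<in> S" "t \<in> S"
  shows "fr m s = fr n t \<longleftrightarrow> (\<exists>u\<in>S. u \<odot>\<^bsub>M\<^esub> (t \<odot>\<^bsub>M\<^esub> m) = u \<odot>\<^bsub>M\<^esub> (s \<odot>\<^bsub>M\<^esub> n))"
proof
  assume "fr m s = fr n t"
  then have "(n, t) \<in> fr m s" using fraction_self[OF c(2,4)] by simp
  then show "\<exists>u\<in>S. u \<odot>\<^bsub>M\<^esub> (t \<odot>\<^bsub>M\<^esub> m) = u \<odot>\<^bsub>M\<^esub> (s \<odot>\<^bsub>M\<^esub> n)" unfolding fraction_mem by blast
next
  assume "\<exists>u\<in>S. u \<odot>\<^bsub>M\<^esub> (t \<odot>\<^bsub>M\<^esub> m) = u \<odot>\<^bsub>M\<^esub> (s \<odot>\<^bsub>M\<^esub> n)"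
  then obtain u where u: "u \<in> S" "u \<odot>\<^bsub>M\<^esub> (t \<odot>\<^bsub>M\<^esub> m) = u \<odot>\<^bsub>M\<^esub> (s \<odot>\<^bsub>M\<^esub> n)" by blast
  show "fr m s = fr n t"
  proof (rule Set.set_eqI)
    fix z :: "'m \<times> 'a"
    obtain k r where z: "z = (k, r)" by (cases z)
    have "(\<exists>w\<in>S. w \<odot>\<^bsub>M\<^esub> (r \<odot>\<^bsub>M\<^esub> m) = w \<odot>\<^bsub>M\<^esub> (s \<odot>\<^bsub>M\<^esub> k)) \<longleftrightarrow>
        (\<exists>w\<in>S. w \<odot>\<^bsub>M\<^esub> (r \<odot>\<^bsub>M\<^esub> n) = w \<odot>\<^bsub>M\<^esub> (t \<odot>\<^bsub>M\<^esub> k))" if kr: "k \<in> carrier M" "r \<in> S"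
    proof
      assume "\<exists>w\<in>S. w \<odot>\<^bsub>M\<^esub> (r \<odot>\<^bsub>M\<^esub> m) = w \<odot>\<^bsub>M\<^esub> (s \<odot>\<^bsub>M\<^esub> k)"
      then obtain w where w: "w \<in> S" "w \<odot>\<^bsub>M\<^esub> (r \<odot>\<^bsub>M\<^esub> m) = w \<odot>\<^bsub>M\<^esub> (s \<odot>\<^bsub>M\<^esub> k)" by blast
      show "\<exists>w\<in>S. w \<odot>\<^bsub>M\<^esub> (r \<odot>\<^bsub>M\<^esub> n) = w \<odot>\<^bsub>M\<^esub> (t \<odot>\<^bsub>M\<^esub> k)"
        by (rule fraction_trans[OF c(2,1) kr(1) c(4,3) kr(2) u(1) u(2)[symmetric] w])
    next
      assume "\<exists>w\<in>S. w \<odot>\<^bsub>M\<^esub> (r \<odot>\<^bsub>M\<^esub> n) = w \<odot>\<^bsub>M\<^esub> (t \<odot>\<^bsub>M\<^esub> k)"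
      then obtain w where w: "w \<in> S" "w \<odot>\<^bsub>M\<^esub> (r \<odot>\<^bsub>M\<^esub> n) = w \<odot>\<^bsub>M\<^esub> (t \<odot>\<^bsub>M\<^esub> k)" by blast
      show "\<exists>w\<in>S. w \<odot>\<^bsub>M\<^esub> (r \<odot>\<^bsub>M\<^esub> m) = w \<odot>\<^bsub>M\<^esub> (s \<odot>\<^bsub>M\<^esub> k)"
        by (rule fraction_trans[OF c(1,2) kr(1) c(3,4) kr(2) u w])
    qed
    then show "z \<in> fr m s \<longleftrightarrow> z \<in> fr n t" unfolding z fraction_mem by blast
  qed
qed

lemma fraction_eqI:
  "\<lbrakk>t \<odot>\<^bsub>M\<^esub> m = s \<odot>\<^bsub>M\<^esub> n; m \<in> carrier M; n \<in> carrier M; s \<in> S; t \<in> S\<rbrakk> \<Longrightarrow> fr m s = fr n t"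
  using fraction_eq[of m n s t] S_one by auto

lemma loc_simps:
  "carrier L = {fr m s | m s. m \<in> carrier M \<and> s \<in> S}"
  "T \<oplus>\<^bsub>L\<^esub> U = (\<Union>(m, s)\<in>T. \<Union>(n, t)\<in>U. fr (t \<odot>\<^bsub>M\<^esub> m \<oplus>\<^bsub>M\<^esub> s \<odot>\<^bsub>M\<^esub> n) (s \<otimes> t))"
  "\<zero>\<^bsub>L\<^esub> = fr \<zero>\<^bsub>M\<^esub> \<one>"
  "V \<odot>\<^bsub>L\<^esub> T = (\<Union>(r, u)\<in>V. \<Union>(m, s)\<in>T. fr (r \<odot>\<^bsub>M\<^esub> m) (u \<otimes> s))"
  by (simp_all add: loc_module_def)

lemma loc_carrierI: "\<lbrakk>m \<in> carrier M; s \<in> S\<rbrakk> \<Longrightarrow> fr m s \<in> carrier L"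
  unfolding loc_simps by blast

lemma fraction_memD:
  assumes "(n, t) \<in> fr m s"
  shows "n \<in> carrier M" "t \<in> S" "\<exists>u\<in>S. u \<odot>\<^bsub>M\<^esub> (t \<odot>\<^bsub>M\<^esub> m) = u \<odot>\<^bsub>M\<^esub> (s \<odot>\<^bsub>M\<^esub> n)"
  using assms unfolding fraction_mem by blast+

text \<open>Addition in \<open>loc_module\<close> is a union over all representatives of both
  fractions. All members of the union are the same class, so the union is that class.\<close>

lemma loc_add:
  assumes c: "m \<in> carrier M" "n \<in> carrier M" "s \<in> S" "t \<in> S"
  shows "fr m s \<oplus>\<^bsub>L\<^esub> fr n t = fr (t \<odot>\<^bsub>M\<^esub> m \<oplus>\<^bsub>M\<^esub> s \<odot>\<^bsub>M\<^esub> n) (s \<otimes> t)"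
proof -
  have eq: "fr (t' \<odot>\<^bsub>M\<^esub> m' \<oplus>\<^bsub>M\<^esub> s' \<odot>\<^bsub>M\<^esub> n') (s' \<otimes> t') = fr (t \<odot>\<^bsub>M\<^esub> m \<oplus>\<^bsub>M\<^esub> s \<odot>\<^bsub>M\<^esub> n) (s \<otimes> t)"
    if a: "(m', s') \<in> fr m s" and b: "(n', t') \<in> fr n t" for m' s' n' t'
  proof -
    note ad = fraction_memD[OF a] and bd = fraction_memD[OF b]
    obtain u where u: "u \<in> S" "u \<odot>\<^bsub>M\<^esub> (s' \<odot>\<^bsub>M\<^esub> m) = u \<odot>\<^bsub>M\<^esub> (s \<odot>\<^bsub>M\<^esub> m')" using ad(3) by blast
    obtain v where v: "v \<in> S" "v \<odot>\<^bsub>M\<^esub> (t' \<odot>\<^bsub>M\<^esub> n) = v \<odot>\<^bsub>M\<^esub> (t \<odot>\<^bsub>M\<^esub> n')" using bd(3) by blast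
    note d = c(1,2) ad(1) bd(1) S_closed[OF c(3)] S_closed[OF c(4)] S_closed[OF ad(2)] S_closed[OF bd(2)]
      S_closed[OF u(1)] S_closed[OF v(1)]
    have "(u \<otimes> v) \<odot>\<^bsub>M\<^esub> ((s \<otimes> t) \<odot>\<^bsub>M\<^esub> (t' \<odot>\<^bsub>M\<^esub> m' \<oplus>\<^bsub>M\<^esub> s' \<odot>\<^bsub>M\<^esub> n')) =
        (v \<otimes> t \<otimes> t') \<odot>\<^bsub>M\<^esub> (u \<odot>\<^bsub>M\<^esub> (s \<odot>\<^bsub>M\<^esub> m')) \<oplus>\<^bsub>M\<^esub> (u \<otimes> s \<otimes> s') \<odot>\<^bsub>M\<^esub> (v \<odot>\<^bsub>M\<^esub> (t \<odot>\<^bsub>M\<^esub> n'))"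
      using d by (simp add: smult_norm m_ac)
    also have "\<dots> = (u \<otimes> v) \<odot>\<^bsub>M\<^esub> ((s' \<otimes> t') \<odot>\<^bsub>M\<^esub> (t \<odot>\<^bsub>M\<^esub> m \<oplus>\<^bsub>M\<^esub> s \<odot>\<^bsub>M\<^esub> n))"
      unfolding u(2)[symmetric] v(2)[symmetric] using d by (simp add: smult_norm m_ac)
    finally have "(u \<otimes> v) \<odot>\<^bsub>M\<^esub> ((s \<otimes> t) \<odot>\<^bsub>M\<^esub> (t' \<odot>\<^bsub>M\<^esub> m' \<oplus>\<^bsub>M\<^esub> s' \<odot>\<^bsub>M\<^esub> n')) =
      (u \<otimes> v) \<odot>\<^bsub>M\<^esub> ((s' \<otimes> t') \<odot>\<^bsub>M\<^esub> (t \<odot>\<^bsub>M\<^esub> m \<oplus>\<^bsub>M\<^esub> s \<odot>\<^bsub>M\<^esub> n))" .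
    moreover have "u \<otimes> v \<in> S" "s \<otimes> t \<in> S" "s' \<otimes> t' \<in> S" using S_mult u(1) v(1) c ad(2) bd(2) by simp_all
    ultimately show ?thesis using fraction_eq[of "t' \<odot>\<^bsub>M\<^esub> m' \<oplus>\<^bsub>M\<^esub> s' \<odot>\<^bsub>M\<^esub> n'" "t \<odot>\<^bsub>M\<^esub> m \<oplus>\<^bsub>M\<^esub> s \<odot>\<^bsub>M\<^esub> n" "s' \<otimes> t'" "s \<otimes> t"] d by auto
  qed
  have "fr m s \<oplus>\<^bsub>L\<^esub> fr n t = (\<Union>(m', s')\<in>fr m s. \<Union>(n', t')\<in>fr n t. fr (t \<odot>\<^bsub>M\<^esub> m \<oplus>\<^bsub>M\<^esub> s \<odot>\<^bsub>M\<^esub> n) (s \<otimes> t))"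
    unfolding loc_simps by (intro SUP_cong refl) (auto simp only: eq split: prod.split)
  also have "\<dots> = fr (t \<odot>\<^bsub>M\<^esub> m \<oplus>\<^bsub>M\<^esub> s \<odot>\<^bsub>M\<^esub> n) (s \<otimes> t)"
    using fraction_self[OF c(1,3)] fraction_self[OF c(2,4)] by fast
  finally show ?thesis .
qed

end

abbreviation "rfr \<equiv> fraction S (self_module R)"
abbreviation "RS \<equiv> loc_ring R S"

lemma loc_smult:
  fixes M :: "('a, 'm) module"
  assumes M: "module R M" and c: "r \<in> carrier R" "m \<in> carrier M" "u \<in> S" "s \<in> S"
  shows "rfr r u \<odot>\<^bsub>loc_module R S M\<^esub> fraction S M m s = fraction S M (r \<odot>\<^bsub>M\<^esub> m) (u \<otimes> s)"
proof -
  interpret M: rmodule R M by (intro rmodule.intro M)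
  note smN = M.smult_assoc1[symmetric] M.smult_r_distr
  have eq: "fraction S M (r' \<odot>\<^bsub>M\<^esub> m') (u' \<otimes> s') = fraction S M (r \<odot>\<^bsub>M\<^esub> m) (u \<otimes> s)"
    if a: "(r', u') \<in> rfr r u" and b: "(m', s') \<in> fraction S M m s" for r' u' m' s'
  proof -
    note ad = fraction_memD[OF self_module_module a] and bd = fraction_memD[OF M b]
    obtain v where v: "v \<in> S" "v \<otimes> (u' \<otimes> r) = v \<otimes> (u \<otimes> r')" using ad(3) by auto
    obtain w where w: "w \<in> S" "w \<odot>\<^bsub>M\<^esub> (s' \<odot>\<^bsub>M\<^esub> m) = w \<odot>\<^bsub>M\<^esub> (s \<odot>\<^bsub>M\<^esub> m')" using bd(3) by blast
    have ad1: "r' \<in> carrier R" using ad(1) by simp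
    note d = c(1,2) ad1 bd(1) S_closed[OF c(3)] S_closed[OF c(4)] S_closed[OF ad(2)] S_closed[OF bd(2)]
      S_closed[OF v(1)] S_closed[OF w(1)]
    have "(v \<otimes> w) \<odot>\<^bsub>M\<^esub> ((u \<otimes> s) \<odot>\<^bsub>M\<^esub> (r' \<odot>\<^bsub>M\<^esub> m')) = (v \<otimes> (u \<otimes> r')) \<odot>\<^bsub>M\<^esub> (w \<odot>\<^bsub>M\<^esub> (s \<odot>\<^bsub>M\<^esub> m'))"
      using d by (simp add: smN m_ac)
    also have "\<dots> = (v \<otimes> w) \<odot>\<^bsub>M\<^esub> ((u' \<otimes> s') \<odot>\<^bsub>M\<^esub> (r \<odot>\<^bsub>M\<^esub> m))"
      unfolding v(2)[symmetric] w(2)[symmetric] using d by (simp add: smN m_ac)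
    finally have "(v \<otimes> w) \<odot>\<^bsub>M\<^esub> ((u \<otimes> s) \<odot>\<^bsub>M\<^esub> (r' \<odot>\<^bsub>M\<^esub> m')) = (v \<otimes> w) \<odot>\<^bsub>M\<^esub> ((u' \<otimes> s') \<odot>\<^bsub>M\<^esub> (r \<odot>\<^bsub>M\<^esub> m))" .
    moreover have "v \<otimes> w \<in> S" "u \<otimes> s \<in> S" "u' \<otimes> s' \<in> S" using S_mult v(1) w(1) c ad(2) bd(2) by simp_all
    ultimately show ?thesis using fraction_eq[OF M, of "r' \<odot>\<^bsub>M\<^esub> m'" "r \<odot>\<^bsub>M\<^esub> m" "u' \<otimes> s'" "u \<otimes> s"] d by auto
  qed
  have "rfr r u \<odot>\<^bsub>loc_module R S M\<^esub> fraction S M m s =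
      (\<Union>(r', u')\<in>rfr r u. \<Union>(m', s')\<in>fraction S M m s. fraction S M (r \<odot>\<^bsub>M\<^esub> m) (u \<otimes> s))"
    unfolding loc_simps[OF M] by (intro SUP_cong refl) (auto simp only: eq split: prod.split)
  also have "\<dots> = fraction S M (r \<odot>\<^bsub>M\<^esub> m) (u \<otimes> s)"
    using fraction_self[OF self_module_module, of r u] fraction_self[OF M c(2,4)] c by fastforce
  finally show ?thesis .
qed

lemma loc_abelian_group:
  fixes M :: "('a, 'm) module"
  assumes M: "module R M"
  shows "abelian_group (loc_module R S M)"
proof -
  interpret M: rmodule R M by (intro rmodule.intro M)
  note smN = M.smult_assoc1[symmetric] M.smult_r_distr
  let ?L = "loc_module R S M" and ?f = "fraction S M"
  note add = loc_add[OF M] and eqI = fraction_eqI[OF M] and inL = loc_carrierI[OF M]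
  note SC = S_closed
  show ?thesis
  proof (rule abelian_groupI)
    show "\<zero>\<^bsub>?L\<^esub> \<in> carrier ?L" unfolding loc_simps(3)[OF M] by (rule inL) (simp_all add: S_one)
    fix X assume "X \<in> carrier ?L"
    then obtain x s where x: "x \<in> carrier M" "s \<in> S" "X = ?f x s" unfolding loc_simps[OF M] by blast
    show "\<zero>\<^bsub>?L\<^esub> \<oplus>\<^bsub>?L\<^esub> X = X" unfolding loc_simps(3)[OF M] x(3)
      using x(1,2) S_one SC[OF x(2)] by (simp add: add)
    have "?f (\<ominus>\<^bsub>M\<^esub> x) s \<oplus>\<^bsub>?L\<^esub> X = ?f (s \<odot>\<^bsub>M\<^esub> (\<ominus>\<^bsub>M\<^esub> x) \<oplus>\<^bsub>M\<^esub> s \<odot>\<^bsub>M\<^esub> x) (s \<otimes> s)" unfolding x(3)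
      using x(1,2) by (simp add: add)
    also have "s \<odot>\<^bsub>M\<^esub> (\<ominus>\<^bsub>M\<^esub> x) \<oplus>\<^bsub>M\<^esub> s \<odot>\<^bsub>M\<^esub> x = \<zero>\<^bsub>M\<^esub>" using x(1) SC[OF x(2)] by (simp add: M.smult_r_minus M.M.l_neg)
    also have "?f \<zero>\<^bsub>M\<^esub> (s \<otimes> s) = \<zero>\<^bsub>?L\<^esub>" unfolding loc_simps(3)[OF M]
      by (rule eqI) (use SC[OF x(2)] x(2) S_one S_mult in simp_all)
    finally have "?f (\<ominus>\<^bsub>M\<^esub> x) s \<oplus>\<^bsub>?L\<^esub> X = \<zero>\<^bsub>?L\<^esub>" .
    moreover have "?f (\<ominus>\<^bsub>M\<^esub> x) s \<in> carrier ?L" by (rule inL) (use x in simp_all)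
    ultimately show "\<exists>Y\<in>carrier ?L. Y \<oplus>\<^bsub>?L\<^esub> X = \<zero>\<^bsub>?L\<^esub>" by blast
    fix Y assume "Y \<in> carrier ?L"
    then obtain y t where y: "y \<in> carrier M" "t \<in> S" "Y = ?f y t" unfolding loc_simps[OF M] by blast
    note c = x(1,2) y(1,2) SC[OF x(2)] SC[OF y(2)]
    have XY: "X \<oplus>\<^bsub>?L\<^esub> Y = ?f (t \<odot>\<^bsub>M\<^esub> x \<oplus>\<^bsub>M\<^esub> s \<odot>\<^bsub>M\<^esub> y) (s \<otimes> t)" unfolding x(3) y(3) using c by (simp add: add)
    show "X \<oplus>\<^bsub>?L\<^esub> Y \<in> carrier ?L" unfolding XY by (rule inL) (use c S_mult in simp_all)
    show "X \<oplus>\<^bsub>?L\<^esub> Y = Y \<oplus>\<^bsub>?L\<^esub> X" unfolding XY unfolding x(3) y(3)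
      using c by (simp add: add M.M.a_comm m_comm)
    fix Z assume "Z \<in> carrier ?L"
    then obtain z r where z: "z \<in> carrier M" "r \<in> S" "Z = ?f z r" unfolding loc_simps[OF M] by blast
    show "X \<oplus>\<^bsub>?L\<^esub> Y \<oplus>\<^bsub>?L\<^esub> Z = X \<oplus>\<^bsub>?L\<^esub> (Y \<oplus>\<^bsub>?L\<^esub> Z)" unfolding x(3) y(3) z(3)
      using c z(1,2) SC[OF z(2)] by (simp add: add S_mult smN m_ac M.M.a_assoc)
  qed
qed

lemma loc_ring_simps:
  "carrier RS = {rfr r s | r s. r \<in> carrier R \<and> s \<in> S}" "\<one>\<^bsub>RS\<^esub> = rfr \<one> \<one>" "\<zero>\<^bsub>RS\<^esub> = rfr \<zero> \<one>"
  by (simp_all add: loc_ring_def Let_def loc_module_def)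

lemma loc_ring_mult:
  "\<lbrakk>r \<in> carrier R; m \<in> carrier R; u \<in> S; s \<in> S\<rbrakk> \<Longrightarrow> rfr r u \<otimes>\<^bsub>RS\<^esub> rfr m s = rfr (r \<otimes> m) (u \<otimes> s)"
  using loc_smult[OF self_module_module, of r m u s] by (simp add: loc_ring_def Let_def)

lemma loc_ring_add:
  "\<lbrakk>r \<in> carrier R; m \<in> carrier R; u \<in> S; s \<in> S\<rbrakk> \<Longrightarrow> rfr r u \<oplus>\<^bsub>RS\<^esub> rfr m s = rfr (s \<otimes> r \<oplus> u \<otimes> m) (u \<otimes> s)"
  using loc_add[OF self_module_module, of r m u s] by (simp add: loc_ring_def Let_def)

lemma rfr_closed: "\<lbrakk>r \<in> carrier R; s \<in> S\<rbrakk> \<Longrightarrow> rfr r s \<in> carrier RS"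
  unfolding loc_ring_simps by blast

lemma rfr_eq:
  "\<lbrakk>m \<in> carrier R; n \<in> carrier R; s \<in> S; t \<in> S\<rbrakk> \<Longrightarrow> rfr m s = rfr n t \<longleftrightarrow> (\<exists>u\<in>S. u \<otimes> (t \<otimes> m) = u \<otimes> (s \<otimes> n))"
  using fraction_eq[OF self_module_module, of m n s t] by simp

lemma rfr_eqI:
  "\<lbrakk>t \<otimes> m = s \<otimes> n; m \<in> carrier R; n \<in> carrier R; s \<in> S; t \<in> S\<rbrakk> \<Longrightarrow> rfr m s = rfr n t"
  using fraction_eqI[OF self_module_module, of t m s n] by simp

text \<open>The additive group is that of the localized module \<open>self_module R\<close>; only
  the multiplicative axioms and distributivity are computed with fractions.\<close>

lemma loc_ring_cring: "cring RS"
proof (rule cringI)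
  let ?A = "loc_module R S (self_module R)"
  interpret A: abelian_group ?A by (rule loc_abelian_group[OF self_module_module])
  have eq: "carrier RS = carrier ?A" "ring.add RS = ring.add ?A" "\<zero>\<^bsub>RS\<^esub> = \<zero>\<^bsub>?A\<^esub>"
    by (simp_all add: loc_ring_def Let_def)
  show "abelian_group RS"
  proof (rule abelian_groupI)
    fix x assume "x \<in> carrier RS"
    then show "\<exists>y\<in>carrier RS. y \<oplus>\<^bsub>RS\<^esub> x = \<zero>\<^bsub>RS\<^esub>" unfolding eq
      by (intro bexI[of _ "\<ominus>\<^bsub>?A\<^esub> x"]) (simp_all add: A.l_neg)
  qed (simp_all add: eq A.a_ac)
  show "comm_monoid RS"
  proof (rule comm_monoidI)
    show "\<one>\<^bsub>RS\<^esub> \<in> carrier RS" unfolding loc_ring_simps(2) by (rule rfr_closed) (simp_all add: S_one)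
    fix X assume "X \<in> carrier RS"
    then obtain x s where x: "x \<in> carrier R" "s \<in> S" "X = rfr x s" unfolding loc_ring_simps by blast
    show "\<one>\<^bsub>RS\<^esub> \<otimes>\<^bsub>RS\<^esub> X = X" unfolding loc_ring_simps(2) x(3)
      using x(1,2) S_one S_closed by (simp add: loc_ring_mult)
    fix Y assume "Y \<in> carrier RS"
    then obtain y t where y: "y \<in> carrier R" "t \<in> S" "Y = rfr y t" unfolding loc_ring_simps by blast
    have XY: "X \<otimes>\<^bsub>RS\<^esub> Y = rfr (x \<otimes> y) (s \<otimes> t)" unfolding x(3) y(3) using x y by (simp add: loc_ring_mult)
    show "X \<otimes>\<^bsub>RS\<^esub> Y \<in> carrier RS" unfolding XY by (rule rfr_closed) (use x y S_mult in simp_all)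
    show "X \<otimes>\<^bsub>RS\<^esub> Y = Y \<otimes>\<^bsub>RS\<^esub> X" unfolding x(3) y(3)
      using x(1,2) y(1,2) S_closed by (simp add: loc_ring_mult m_comm)
    fix Z assume "Z \<in> carrier RS"
    then obtain z r where z: "z \<in> carrier R" "r \<in> S" "Z = rfr z r" unfolding loc_ring_simps by blast
    show "X \<otimes>\<^bsub>RS\<^esub> Y \<otimes>\<^bsub>RS\<^esub> Z = X \<otimes>\<^bsub>RS\<^esub> (Y \<otimes>\<^bsub>RS\<^esub> Z)" unfolding x(3) y(3) z(3)
      using x(1,2) y(1,2) z(1,2) S_closed by (simp add: loc_ring_mult S_mult m_assoc)
  qed
  fix X Y Z assume "X \<in> carrier RS" "Y \<in> carrier RS" "Z \<in> carrier RS"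
  then obtain x s y t z r where x: "x \<in> carrier R" "s \<in> S" "X = rfr x s"
    and y: "y \<in> carrier R" "t \<in> S" "Y = rfr y t" and z: "z \<in> carrier R" "r \<in> S" "Z = rfr z r"
    unfolding loc_ring_simps by blast
  note c = x(1,2) y(1,2) z(1,2) S_closed[OF x(2)] S_closed[OF y(2)] S_closed[OF z(2)]
  have "(X \<oplus>\<^bsub>RS\<^esub> Y) \<otimes>\<^bsub>RS\<^esub> Z = rfr ((t \<otimes> x \<oplus> s \<otimes> y) \<otimes> z) ((s \<otimes> t) \<otimes> r)"
    unfolding x(3) y(3) z(3) using c by (simp add: loc_ring_mult loc_ring_add S_mult)
  \<comment> \<open>The two sides of distributivity differ by a common factor \<open>r\<close> of
    numerator and denominator.\<close>
  also have "\<dots> = rfr ((t \<otimes> r) \<otimes> (x \<otimes> z) \<oplus> (s \<otimes> r) \<otimes> (y \<otimes> z)) ((s \<otimes> r) \<otimes> (t \<otimes> r))"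
  proof (rule rfr_eqI)
    show "s \<otimes> r \<otimes> (t \<otimes> r) \<otimes> ((t \<otimes> x \<oplus> s \<otimes> y) \<otimes> z) = s \<otimes> t \<otimes> r \<otimes> ((t \<otimes> r) \<otimes> (x \<otimes> z) \<oplus> (s \<otimes> r) \<otimes> (y \<otimes> z))"
      using c(1,3,5,7-9) by algebra
  qed (use c S_mult in simp_all)
  also have "\<dots> = X \<otimes>\<^bsub>RS\<^esub> Z \<oplus>\<^bsub>RS\<^esub> Y \<otimes>\<^bsub>RS\<^esub> Z"
    unfolding x(3) y(3) z(3) using c by (simp add: loc_ring_mult loc_ring_add S_mult)
  finally show "(X \<oplus>\<^bsub>RS\<^esub> Y) \<otimes>\<^bsub>RS\<^esub> Z = X \<otimes>\<^bsub>RS\<^esub> Z \<oplus>\<^bsub>RS\<^esub> Y \<otimes>\<^bsub>RS\<^esub> Z" .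
qed

lemma loc_module_module:
  fixes M :: "('a, 'm) module"
  assumes M: "module R M"
  shows "module RS (loc_module R S M)"
proof (rule moduleI[OF loc_ring_cring loc_abelian_group[OF M]])
  interpret M: rmodule R M by (intro rmodule.intro M)
  note smN = M.smult_assoc1[symmetric] M.smult_r_distr M.smult_l_distr
  let ?L = "loc_module R S M" and ?f = "fraction S M"
  note add = loc_add[OF M] and eqI = fraction_eqI[OF M] and inL = loc_carrierI[OF M] and sm = loc_smult[OF M]
  fix A B X Y assume "A \<in> carrier RS" "X \<in> carrier ?L"
  then obtain a s x t where a: "a \<in> carrier R" "s \<in> S" "A = rfr a s" and x: "x \<in> carrier M" "t \<in> S" "X = ?f x t"
    unfolding loc_ring_simps loc_simps[OF M] by blast
  note c = a(1,2) x(1,2) S_closed[OF a(2)] S_closed[OF x(2)]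
  have AX: "A \<odot>\<^bsub>?L\<^esub> X = ?f (a \<odot>\<^bsub>M\<^esub> x) (s \<otimes> t)" unfolding a(3) x(3) using c by (simp add: sm)
  show "A \<odot>\<^bsub>?L\<^esub> X \<in> carrier ?L" unfolding AX by (rule inL) (use c S_mult in simp_all)
  {
    assume "B \<in> carrier RS"
    then obtain b r where b: "b \<in> carrier R" "r \<in> S" "B = rfr b r" unfolding loc_ring_simps by blast
    note d = c b(1,2) S_closed[OF b(2)]
    have "(A \<oplus>\<^bsub>RS\<^esub> B) \<odot>\<^bsub>?L\<^esub> X = ?f ((r \<otimes> a \<oplus> s \<otimes> b) \<odot>\<^bsub>M\<^esub> x) (s \<otimes> r \<otimes> t)"
      unfolding a(3) b(3) x(3) using d by (simp add: loc_ring_add sm S_mult)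
    also have "\<dots> = ?f ((r \<otimes> t) \<odot>\<^bsub>M\<^esub> (a \<odot>\<^bsub>M\<^esub> x) \<oplus>\<^bsub>M\<^esub> (s \<otimes> t) \<odot>\<^bsub>M\<^esub> (b \<odot>\<^bsub>M\<^esub> x)) ((s \<otimes> t) \<otimes> (r \<otimes> t))"
      by (rule eqI) (use d S_mult in \<open>simp_all add: smN m_ac\<close>)
    also have "\<dots> = A \<odot>\<^bsub>?L\<^esub> X \<oplus>\<^bsub>?L\<^esub> B \<odot>\<^bsub>?L\<^esub> X"
      unfolding a(3) b(3) x(3) using d by (simp add: sm add S_mult)
    finally show "(A \<oplus>\<^bsub>RS\<^esub> B) \<odot>\<^bsub>?L\<^esub> X = A \<odot>\<^bsub>?L\<^esub> X \<oplus>\<^bsub>?L\<^esub> B \<odot>\<^bsub>?L\<^esub> X" .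
    show "(A \<otimes>\<^bsub>RS\<^esub> B) \<odot>\<^bsub>?L\<^esub> X = A \<odot>\<^bsub>?L\<^esub> (B \<odot>\<^bsub>?L\<^esub> X)"
      unfolding a(3) b(3) x(3) using d by (simp add: loc_ring_mult sm S_mult M.smult_assoc1 m_assoc)
  }
  assume "Y \<in> carrier ?L"
  then obtain y r where y: "y \<in> carrier M" "r \<in> S" "Y = ?f y r" unfolding loc_simps[OF M] by blast
  note d = c y(1,2) S_closed[OF y(2)]
  have "A \<odot>\<^bsub>?L\<^esub> (X \<oplus>\<^bsub>?L\<^esub> Y) = ?f (a \<odot>\<^bsub>M\<^esub> (r \<odot>\<^bsub>M\<^esub> x \<oplus>\<^bsub>M\<^esub> t \<odot>\<^bsub>M\<^esub> y)) (s \<otimes> (t \<otimes> r))"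
    unfolding a(3) x(3) y(3) using d by (simp add: add sm S_mult)
  also have "\<dots> = ?f ((s \<otimes> r) \<odot>\<^bsub>M\<^esub> (a \<odot>\<^bsub>M\<^esub> x) \<oplus>\<^bsub>M\<^esub> (s \<otimes> t) \<odot>\<^bsub>M\<^esub> (a \<odot>\<^bsub>M\<^esub> y)) ((s \<otimes> t) \<otimes> (s \<otimes> r))"
    by (rule eqI) (use d S_mult in \<open>simp_all add: smN m_ac\<close>)
  also have "\<dots> = A \<odot>\<^bsub>?L\<^esub> X \<oplus>\<^bsub>?L\<^esub> A \<odot>\<^bsub>?L\<^esub> Y"
    unfolding a(3) x(3) y(3) using d by (simp add: sm add S_mult)
  finally show "A \<odot>\<^bsub>?L\<^esub> (X \<oplus>\<^bsub>?L\<^esub> Y) = A \<odot>\<^bsub>?L\<^esub> X \<oplus>\<^bsub>?L\<^esub> A \<odot>\<^bsub>?L\<^esub> Y" .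
next
  interpret M: rmodule R M by (intro rmodule.intro M)
  fix X assume "X \<in> carrier (loc_module R S M)"
  then obtain x t where x: "x \<in> carrier M" "t \<in> S" "X = fraction S M x t" unfolding loc_simps[OF M] by blast
  show "\<one>\<^bsub>RS\<^esub> \<odot>\<^bsub>loc_module R S M\<^esub> X = X" unfolding loc_ring_simps(2) x(3)
    using x(1,2) S_closed S_one by (simp add: loc_smult[OF M])
qed

text \<open>A fraction vanishes iff some element of \<open>S\<close> kills its numerator.\<close>

lemma loc_module_nontrivial:
  fixes M :: "('a, 'm) module"
  assumes M: "module R M"
  shows "carrier (loc_module R S M) \<noteq> {\<zero>\<^bsub>loc_module R S M\<^esub>} \<longleftrightarrow> (\<exists>x\<in>carrier M. \<forall>u\<in>S. u \<odot>\<^bsub>M\<^esub> x \<noteq> \<zero>\<^bsub>M\<^esub>)"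
proof -
  interpret M: rmodule R M by (intro rmodule.intro M)
  have z: "fraction S M x s = \<zero>\<^bsub>loc_module R S M\<^esub> \<longleftrightarrow> (\<exists>u\<in>S. u \<odot>\<^bsub>M\<^esub> x = \<zero>\<^bsub>M\<^esub>)"
    if x: "x \<in> carrier M" and s: "s \<in> S" for x s
  proof -
    have "u \<odot>\<^bsub>M\<^esub> (\<one> \<odot>\<^bsub>M\<^esub> x) = u \<odot>\<^bsub>M\<^esub> (s \<odot>\<^bsub>M\<^esub> \<zero>\<^bsub>M\<^esub>) \<longleftrightarrow> u \<odot>\<^bsub>M\<^esub> x = \<zero>\<^bsub>M\<^esub>" if "u \<in> S" for u
      using x S_closed[OF s] S_closed[OF that] by simp
    then show ?thesis unfolding loc_simps(3)[OF M] fraction_eq[OF M x M.M.zero_closed s S_one] by blast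
  qed
  have ne: "\<zero>\<^bsub>loc_module R S M\<^esub> \<in> carrier (loc_module R S M)"
    unfolding loc_simps(3)[OF M] by (rule loc_carrierI[OF M]) (simp_all add: S_one)
  show ?thesis
  proof
    assume "carrier (loc_module R S M) \<noteq> {\<zero>\<^bsub>loc_module R S M\<^esub>}"
    then obtain X where "X \<in> carrier (loc_module R S M)" "X \<noteq> \<zero>\<^bsub>loc_module R S M\<^esub>" using ne by blast
    then obtain x s where x: "x \<in> carrier M" "s \<in> S" "fraction S M x s \<noteq> \<zero>\<^bsub>loc_module R S M\<^esub>"
      unfolding loc_simps(1)[OF M] by blast
    then show "\<exists>x\<in>carrier M. \<forall>u\<in>S. u \<odot>\<^bsub>M\<^esub> x \<noteq> \<zero>\<^bsub>M\<^esub>" using z[OF x(1,2)] by blast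
  next
    assume "\<exists>x\<in>carrier M. \<forall>u\<in>S. u \<odot>\<^bsub>M\<^esub> x \<noteq> \<zero>\<^bsub>M\<^esub>"
    then obtain x where x: "x \<in> carrier M" "\<forall>u\<in>S. u \<odot>\<^bsub>M\<^esub> x \<noteq> \<zero>\<^bsub>M\<^esub>" by blast
    then have "fraction S M x \<one> \<noteq> \<zero>\<^bsub>loc_module R S M\<^esub>" using z[OF x(1) S_one] by blast
    moreover have "fraction S M x \<one> \<in> carrier (loc_module R S M)" by (rule loc_carrierI[OF M x(1) S_one])
    ultimately show "carrier (loc_module R S M) \<noteq> {\<zero>\<^bsub>loc_module R S M\<^esub>}" by blast
  qed
qed

text \<open>The differential of \<open>cplx_at\<close> is a union over the representatives of a
  fraction; this evaluates it on any one of them.\<close>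

lemma loc_map:
  fixes M :: "('a, 'm) module" and N :: "('a, 'n) module"
  assumes M: "module R M" and N: "module R N" and f: "linear_map R M N f" and m: "m \<in> carrier M" and s: "s \<in> S"
  shows "(\<Union>(x, t)\<in>fraction S M m s. fraction S N (f x) t) = fraction S N (f m) s"
proof -
  note fd = linear_mapD[OF f]
  interpret M: rmodule R M by (intro rmodule.intro M)
  have eq: "fraction S N (f x) t = fraction S N (f m) s" if a: "(x, t) \<in> fraction S M m s" for x t
  proof -
    note ad = fraction_memD[OF M a]
    obtain u where u: "u \<in> S" "u \<odot>\<^bsub>M\<^esub> (t \<odot>\<^bsub>M\<^esub> m) = u \<odot>\<^bsub>M\<^esub> (s \<odot>\<^bsub>M\<^esub> x)" using ad(3) by blast
    note c = S_closed[OF u(1)] S_closed[OF ad(2)] S_closed[OF s]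
    have "f (u \<odot>\<^bsub>M\<^esub> (t \<odot>\<^bsub>M\<^esub> m)) = f (u \<odot>\<^bsub>M\<^esub> (s \<odot>\<^bsub>M\<^esub> x))" using u(2) by simp
    then have "u \<odot>\<^bsub>N\<^esub> (s \<odot>\<^bsub>N\<^esub> f x) = u \<odot>\<^bsub>N\<^esub> (t \<odot>\<^bsub>N\<^esub> f m)" using c m ad(1) by (simp add: fd(3))
    then show ?thesis using fraction_eq[OF N fd(1)[OF ad(1)] fd(1)[OF m] ad(2) s] u(1) by blast
  qed
  have "(\<Union>(x, t)\<in>fraction S M m s. fraction S N (f x) t) = (\<Union>(x, t)\<in>fraction S M m s. fraction S N (f m) s)"
    by (intro SUP_cong refl) (auto simp only: eq split: prod.split)
  also have "\<dots> = fraction S N (f m) s" using fraction_self[OF M m s] by blast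
  finally show ?thesis .
qed

end

lemma (in cring) prime_mult_set: "primeideal P R \<Longrightarrow> mult_set R (carrier R - P)"
  using primeD(3,5) by (intro mult_set.intro is_cring mult_set_axioms.intro) auto

section \<open>Supports and dimensions of complexes\<close>

locale chain_complex = cring R for R :: "('r, 'x) ring_scheme" (structure) +
  fixes X :: "('r, 'm) cplx"
  assumes obj_module: "\<And>i. module R (obj X i)"
    and bd_linear: "\<And>i. linear_map R (obj X i) (obj X (i - 1)) (bd X i)"
    and bd_bd: "\<And>i x. x \<in> carrier (obj X i) \<Longrightarrow> bd X (i - 1) (bd X i x) = \<zero>\<^bsub>obj X (i - 1 - 1)\<^esub>"
begin

sublocale O: rmodule R "obj X i" for i by (intro rmodule.intro obj_module)

lemma cycles_submodule: "submodule (cycles X i) R (obj X i)"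
  unfolding cycles_def by (rule linear_map_kernel[OF obj_module obj_module bd_linear])

lemma bd_linear': "linear_map R (obj X (i + 1)) (obj X i) (bd X (i + 1))"
  using bd_linear[of "i + 1"] by simp

lemma boundaries_submodule: "submodule (boundaries X i) R (obj X i)"
  unfolding boundaries_def by (rule linear_map_image[OF obj_module obj_module bd_linear'])

lemma boundaries_cycles: "boundaries X i \<subseteq> cycles X i"
proof
  fix y assume "y \<in> boundaries X i"
  then obtain x where x: "x \<in> carrier (obj X (i + 1))" "y = bd X (i + 1) x" unfolding boundaries_def by blast
  have "bd X i (bd X (i + 1) x) = \<zero>\<^bsub>obj X (i - 1)\<^esub>" using bd_bd[OF x(1)] by simp
  then show "y \<in> cycles X i" unfolding cycles_def x(2) using linear_mapD(1)[OF bd_linear' x(1)] by simp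
qed

abbreviation "Z i \<equiv> (obj X i)\<lparr>carrier := cycles X i\<rparr>"

lemma Z_module: "module R (Z i)"
  by (rule submodule.submodule_is_module[OF cycles_submodule obj_module])

text \<open>In \<open>homology\<close> the cycles form a module of their own; submodules have to be
  moved between it and the ambient module.\<close>

lemma Z_submodule_iff:
  assumes "N \<subseteq> cycles X i"
  shows "submodule N R (Z i) \<longleftrightarrow> submodule N R (obj X i)"
proof -
  interpret Z: rmodule R "Z i" by (intro rmodule.intro Z_module)
  show ?thesis
  proof
    assume "submodule N R (Z i)"
    note Nd = Z.submoduleD(2-4)[OF this]
    show "submodule N R (obj X i)"
      by (rule O.submodule_of_closed)
        (use Nd assms O.submoduleD(1)[OF cycles_submodule] in \<open>simp_all, blast\<close>)
  next
    assume "submodule N R (obj X i)"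
    note Nd = O.submoduleD(2-4)[OF this]
    show "submodule N R (Z i)" by (rule Z.submodule_of_closed) (use Nd assms in simp_all)
  qed
qed

lemma boundaries_Z: "submodule (boundaries X i) R (Z i)"
  using Z_submodule_iff[OF boundaries_cycles] boundaries_submodule by simp

lemma homology_module: "module R (homology X i)"
  unfolding homology_def by (rule rmodule.module_quot_module[OF rmodule.intro[OF Z_module] boundaries_Z])

lemma homology_class_zero:
  assumes "x \<in> cycles X i"
  shows "boundaries X i +>\<^bsub>Z i\<^esub> x = \<zero>\<^bsub>homology X i\<^esub> \<longleftrightarrow> x \<in> boundaries X i"
proof -
  interpret Z: rmodule R "Z i" by (intro rmodule.intro Z_module)
  have xc: "x \<in> carrier (Z i)" using assms by simp
  have "x \<ominus>\<^bsub>Z i\<^esub> \<zero>\<^bsub>Z i\<^esub> = x" using Z.minus_cancel(1)[OF xc Z.M.zero_closed] xc Z.M.minus_closed[OF xc Z.M.zero_closed] by (metis Z.M.r_zero)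
  then show ?thesis unfolding homology_def Z.quot_zero[OF boundaries_Z]
    using Z.quot_coset_eq[OF boundaries_Z xc Z.M.zero_closed] by simp
qed

lemma homology_carrier: "carrier (homology X i) = (\<lambda>x. boundaries X i +>\<^bsub>Z i\<^esub> x) ` cycles X i"
  unfolding homology_def rmodule.quot_carrier[OF rmodule.intro[OF Z_module]] by simp

lemma homology_nontrivial:
  "carrier (homology X i) \<noteq> {\<zero>\<^bsub>homology X i\<^esub>} \<longleftrightarrow> \<not> cycles X i \<subseteq> boundaries X i"
proof -
  have z: "\<zero>\<^bsub>obj X i\<^esub> \<in> cycles X i" by (rule O.submoduleD(2)[OF cycles_submodule])
  let ?k = "\<lambda>x. boundaries X i +>\<^bsub>Z i\<^esub> x"
  show ?thesis
  proof
    assume ne: "carrier (homology X i) \<noteq> {\<zero>\<^bsub>homology X i\<^esub>}"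
    show "\<not> cycles X i \<subseteq> boundaries X i"
    proof
      assume sub: "cycles X i \<subseteq> boundaries X i"
      have "?k x = \<zero>\<^bsub>homology X i\<^esub>" if "x \<in> cycles X i" for x
        using homology_class_zero[OF that] sub that by (simp add: subsetD)
      then have "?k ` cycles X i = (\<lambda>x. \<zero>\<^bsub>homology X i\<^esub>) ` cycles X i" by (rule image_cong[OF refl])
      also have "\<dots> = {\<zero>\<^bsub>homology X i\<^esub>}" using z by (intro image_constant)
      finally show False using ne unfolding homology_carrier by (rule notE[rotated])
    qed
  next
    assume "\<not> cycles X i \<subseteq> boundaries X i"
    then obtain x where x: "x \<in> cycles X i" "x \<notin> boundaries X i" unfolding subset_iff by blast
    have "?k x \<in> carrier (homology X i)" unfolding homology_carrier by (rule imageI[OF x(1)])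
    moreover have "?k x \<noteq> \<zero>\<^bsub>homology X i\<^esub>" using homology_class_zero[OF x(1)] x(2) by simp
    ultimately show "carrier (homology X i) \<noteq> {\<zero>\<^bsub>homology X i\<^esub>}" by (metis singletonD)
  qed
qed

lemma homology_smult:
  assumes "r \<in> carrier R" "x \<in> cycles X i"
  shows "r \<odot>\<^bsub>homology X i\<^esub> (boundaries X i +>\<^bsub>Z i\<^esub> x) = boundaries X i +>\<^bsub>Z i\<^esub> (r \<odot>\<^bsub>obj X i\<^esub> x)"
  unfolding homology_def using rmodule.quot_smult[OF rmodule.intro[OF Z_module] boundaries_Z assms(1), of x] assms(2) by simp

text \<open>The support is expressed by cycles and boundaries of \<open>X\<close> itself, so that no
  exchange of localization with homology is required.\<close>

lemma mem_module_supp_homology: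
  "P \<in> module_supp R (homology X i) \<longleftrightarrow>
     primeideal P R \<and> (\<exists>x\<in>cycles X i. \<forall>u\<in>carrier R - P. u \<odot>\<^bsub>obj X i\<^esub> x \<notin> boundaries X i)"
proof (cases "primeideal P R")
  case True
  interpret S: mult_set R "carrier R - P" by (rule prime_mult_set[OF True])
  have "(\<exists>y\<in>carrier (homology X i). \<forall>u\<in>carrier R - P. u \<odot>\<^bsub>homology X i\<^esub> y \<noteq> \<zero>\<^bsub>homology X i\<^esub>) \<longleftrightarrow>
    (\<exists>x\<in>cycles X i. \<forall>u\<in>carrier R - P. u \<odot>\<^bsub>homology X i\<^esub> (boundaries X i +>\<^bsub>Z i\<^esub> x) \<noteq> \<zero>\<^bsub>homology X i\<^esub>)"
    unfolding homology_carrier by blast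
  also have "\<dots> \<longleftrightarrow> (\<exists>x\<in>cycles X i. \<forall>u\<in>carrier R - P. u \<odot>\<^bsub>obj X i\<^esub> x \<notin> boundaries X i)"
  proof (intro bex_cong ball_cong refl)
    fix x u assume x: "x \<in> cycles X i" and u: "u \<in> carrier R - P"
    then have "u \<odot>\<^bsub>obj X i\<^esub> x \<in> cycles X i" using O.submoduleD(4)[OF cycles_submodule] by blast
    then show "(u \<odot>\<^bsub>homology X i\<^esub> (boundaries X i +>\<^bsub>Z i\<^esub> x) \<noteq> \<zero>\<^bsub>homology X i\<^esub>) = (u \<odot>\<^bsub>obj X i\<^esub> x \<notin> boundaries X i)"
      using homology_smult[of u x i] u x homology_class_zero[of "u \<odot>\<^bsub>obj X i\<^esub> x" i] by simp
  qed
  finally have "carrier (module_at R P (homology X i)) \<noteq> {\<zero>\<^bsub>module_at R P (homology X i)\<^esub>} \<longleftrightarrow>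
      (\<exists>x\<in>cycles X i. \<forall>u\<in>carrier R - P. u \<odot>\<^bsub>obj X i\<^esub> x \<notin> boundaries X i)"
    unfolding module_at_def S.loc_module_nontrivial[OF homology_module] .
  then show ?thesis using True unfolding module_supp_def mem_Collect_eq by blast
next
  case False then show ?thesis by (simp add: module_supp_def)
qed

end

text \<open>The class of \<open>u\<close> makes \<open>R/I\<close> a submodule of \<open>H\<^sub>0\<close>, while \<open>I\<close> annihilates all homology. This alone
  determines the support, the infima and the dimension, and it is inherited by localizations.\<close>

locale cyclic_complex = chain_complex R X for R :: "('r, 'x) ring_scheme" (structure) and X :: "('r, 'm) cplx" +
  fixes I :: "'r set" and u :: 'm
  assumes neg: "i < 0 \<Longrightarrow> carrier (obj X i) = {\<zero>\<^bsub>obj X i\<^esub>}"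
    and u_closed: "u \<in> carrier (obj X 0)"
    and I_iff: "r \<in> carrier R \<Longrightarrow> r \<odot>\<^bsub>obj X 0\<^esub> u \<in> boundaries X 0 \<longleftrightarrow> r \<in> I"
    and I_carr: "I \<subseteq> carrier R"
    and I_annihilates: "\<lbrakk>r \<in> I; x \<in> cycles X i\<rbrakk> \<Longrightarrow> r \<odot>\<^bsub>obj X i\<^esub> x \<in> boundaries X i"
begin

lemma I_eq: "I = {r \<in> carrier R. r \<odot>\<^bsub>obj X 0\<^esub> u \<in> boundaries X 0}"
  using I_iff I_carr by blast

lemma I_ideal: "ideal I R"
proof (rule ideal_of_closed[OF I_carr])
  note Bd = O.submoduleD[OF boundaries_submodule[of 0]]
  show "\<zero> \<in> I" unfolding I_eq using Bd(2) u_closed by simp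
  show "a \<oplus> b \<in> I" if "a \<in> I" "b \<in> I" for a b
    using that Bd(3)[of "a \<odot>\<^bsub>obj X 0\<^esub> u" "b \<odot>\<^bsub>obj X 0\<^esub> u"] u_closed unfolding I_eq by (simp add: O.smult_l_distr)
  show "x \<otimes> a \<in> I" if "a \<in> I" "x \<in> carrier R" for a x
    using that Bd(4)[of x "a \<odot>\<^bsub>obj X 0\<^esub> u"] u_closed unfolding I_eq by (simp add: O.smult_assoc1)
qed

lemma zero_cycles: "cycles X 0 = carrier (obj X 0)"
proof -
  have "bd X 0 x = \<zero>\<^bsub>obj X (0 - 1)\<^esub>" if "x \<in> carrier (obj X 0)" for x
    using linear_mapD(1)[OF bd_linear that] neg[of "0 - 1"] by simp
  then show ?thesis unfolding cycles_def by auto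
qed

text \<open>A prime in the support contains \<open>I\<close> because elements of \<open>I\<close>
  kill all homology; conversely the class of \<open>u\<close> survives localization at every prime
  over \<open>I\<close>.\<close>

lemma csupp_eq: "csupp R X = primes_over R I"
proof (intro equalityI subsetI)
  fix P assume "P \<in> csupp R X"
  then obtain i where "P \<in> module_supp R (homology X i)" unfolding csupp_def by blast
  then have P: "primeideal P R" and "\<exists>x\<in>cycles X i. \<forall>v\<in>carrier R - P. v \<odot>\<^bsub>obj X i\<^esub> x \<notin> boundaries X i"
    unfolding mem_module_supp_homology by simp_all
  then obtain x where x: "x \<in> cycles X i" "\<forall>v\<in>carrier R - P. v \<odot>\<^bsub>obj X i\<^esub> x \<notin> boundaries X i" by blast
  have "I \<subseteq> P" using I_annihilates[OF _ x(1)] x(2) I_carr by blast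
  then show "P \<in> primes_over R I" using P by (simp add: primes_over_def)
next
  fix P assume "P \<in> primes_over R I"
  then have P: "primeideal P R" "I \<subseteq> P" by (simp_all add: primes_over_def)
  have "\<forall>v\<in>carrier R - P. v \<odot>\<^bsub>obj X 0\<^esub> u \<notin> boundaries X 0" using I_iff P(2) by blast
  then have "P \<in> module_supp R (homology X 0)"
    unfolding mem_module_supp_homology using P(1) u_closed zero_cycles by blast
  then show "P \<in> csupp R X" unfolding csupp_def by blast
qed

lemma cinf_zero:
  assumes "\<one> \<notin> I"
  shows "cinf X = 0"
  unfolding cinf_def
proof (rule antisym)
  have "u \<notin> boundaries X 0" using I_iff[of \<one>] assms u_closed by simp
  then have "carrier (homology X 0) \<noteq> {\<zero>\<^bsub>homology X 0\<^esub>}"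
    unfolding homology_nontrivial zero_cycles using u_closed by blast
  then have "ereal (of_int 0) \<in> {ereal (of_int i) |i. carrier (homology X i) \<noteq> {\<zero>\<^bsub>homology X i\<^esub>}}" by blast
  then have "Inf {ereal (of_int i) |i. carrier (homology X i) \<noteq> {\<zero>\<^bsub>homology X i\<^esub>}} \<le> ereal (of_int 0)" by (rule Inf_lower)
  then show "Inf {ereal (of_int i) |i. carrier (homology X i) \<noteq> {\<zero>\<^bsub>homology X i\<^esub>}} \<le> 0" by (simp add: zero_ereal_def)
  show "0 \<le> Inf {ereal (of_int i) |i. carrier (homology X i) \<noteq> {\<zero>\<^bsub>homology X i\<^esub>}}"
  proof (rule Inf_greatest)
    fix z assume "z \<in> {ereal (of_int i) |i. carrier (homology X i) \<noteq> {\<zero>\<^bsub>homology X i\<^esub>}}"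
    then obtain i where i: "z = ereal (of_int i)" "carrier (homology X i) \<noteq> {\<zero>\<^bsub>homology X i\<^esub>}" by blast
    have "\<not> i < 0"
    proof
      assume "i < 0"
      then have "cycles X i \<subseteq> {\<zero>\<^bsub>obj X i\<^esub>}" using neg unfolding cycles_def by blast
      then have "cycles X i \<subseteq> boundaries X i" using O.submoduleD(2)[OF boundaries_submodule[of i]] by blast
      then show False using i(2) homology_nontrivial by blast
    qed
    then show "0 \<le> z" unfolding i(1) by (simp add: zero_ereal_def)
  qed
qed

end

section \<open>Localized complexes\<close>

locale localized_complex = chain_complex R X for R :: "('r, 'x) ring_scheme" (structure) and X :: "('r, 'm) cplx" +
  fixes P assumes P: "primeideal P R"
begin

sublocale S: mult_set R "carrier R - P" by (rule prime_mult_set[OF P])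

abbreviation "RP \<equiv> ring_at R P"
abbreviation "XP \<equiv> cplx_at R P X"
abbreviation "fracX i \<equiv> fraction (carrier R - P) (obj X i)"

lemma obj_XP: "obj XP i = loc_module R (carrier R - P) (obj X i)"
  by (simp add: cplx_at_def module_at_def)

lemma XP_carrier: "carrier (obj XP i) = {fracX i m s | m s. m \<in> carrier (obj X i) \<and> s \<in> carrier R - P}"
  unfolding obj_XP by (rule S.loc_simps(1)[OF obj_module])

lemma XP_zero: "\<zero>\<^bsub>obj XP i\<^esub> = fracX i \<zero>\<^bsub>obj X i\<^esub> \<one>"
  unfolding obj_XP by (rule S.loc_simps(3)[OF obj_module])

lemma bd_XP:
  assumes "m \<in> carrier (obj X i)" "s \<in> carrier R - P"
  shows "bd XP i (fracX i m s) = fracX (i - 1) (bd X i m) s"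
  using S.loc_map[OF obj_module obj_module bd_linear assms] by (simp add: cplx_at_def)

lemma cplx_at_chain_complex: "chain_complex RP XP"
proof (intro chain_complex.intro chain_complex_axioms.intro)
  show "cring RP" unfolding ring_at_def by (rule S.loc_ring_cring)
  fix i
  show "module RP (obj XP i)" unfolding ring_at_def obj_XP by (rule S.loc_module_module[OF obj_module])
  note bl = linear_mapD[OF bd_linear[of i]]
  note add = S.loc_add[OF obj_module] and sm = S.loc_smult[OF obj_module]
  show "linear_map RP (obj XP i) (obj XP (i - 1)) (bd XP i)"
  proof (rule linear_mapI)
    fix T assume "T \<in> carrier (obj XP i)"
    then obtain m s where m: "m \<in> carrier (obj X i)" "s \<in> carrier R - P" "T = fracX i m s" unfolding XP_carrier by blast
    show "bd XP i T \<in> carrier (obj XP (i - 1))"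
      unfolding m(3) bd_XP[OF m(1,2)] XP_carrier using bl(1)[OF m(1)] m(2) by blast
    fix U assume "U \<in> carrier (obj XP i)"
    then obtain n t where n: "n \<in> carrier (obj X i)" "t \<in> carrier R - P" "U = fracX i n t" unfolding XP_carrier by blast
    have st: "s \<otimes> t \<in> carrier R - P" using S.S_mult m(2) n(2) by blast
    have c: "s \<in> carrier R" "t \<in> carrier R" using m(2) n(2) by simp_all
    have "bd XP i (T \<oplus>\<^bsub>obj XP i\<^esub> U) = bd XP i (fracX i (t \<odot>\<^bsub>obj X i\<^esub> m \<oplus>\<^bsub>obj X i\<^esub> s \<odot>\<^bsub>obj X i\<^esub> n) (s \<otimes> t))"
      unfolding m(3) n(3) obj_XP add[OF m(1) n(1) m(2) n(2)] ..
    also have "\<dots> = fracX (i - 1) (bd X i (t \<odot>\<^bsub>obj X i\<^esub> m \<oplus>\<^bsub>obj X i\<^esub> s \<odot>\<^bsub>obj X i\<^esub> n)) (s \<otimes> t)"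
      by (rule bd_XP[OF _ st]) (use c m(1) n(1) in simp)
    also have "\<dots> = fracX (i - 1) (t \<odot>\<^bsub>obj X (i - 1)\<^esub> bd X i m \<oplus>\<^bsub>obj X (i - 1)\<^esub> s \<odot>\<^bsub>obj X (i - 1)\<^esub> bd X i n) (s \<otimes> t)"
      using c m(1) n(1) by (simp add: bl)
    also have "\<dots> = bd XP i T \<oplus>\<^bsub>obj XP (i - 1)\<^esub> bd XP i U"
      unfolding m(3) n(3) bd_XP[OF m(1,2)] bd_XP[OF n(1,2)] obj_XP add[OF bl(1)[OF m(1)] bl(1)[OF n(1)] m(2) n(2)] ..
    finally show "bd XP i (T \<oplus>\<^bsub>obj XP i\<^esub> U) = bd XP i T \<oplus>\<^bsub>obj XP (i - 1)\<^esub> bd XP i U" .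
  next
    fix V T assume "V \<in> carrier RP" "T \<in> carrier (obj XP i)"
    then obtain r v m s where m: "m \<in> carrier (obj X i)" "s \<in> carrier R - P" "T = fracX i m s"
      and r: "r \<in> carrier R" "v \<in> carrier R - P" "V = S.rfr r v"
      unfolding XP_carrier ring_at_def S.loc_ring_simps by blast
    have vs: "v \<otimes> s \<in> carrier R - P" using S.S_mult m(2) r(2) by blast
    have "bd XP i (V \<odot>\<^bsub>obj XP i\<^esub> T) = bd XP i (fracX i (r \<odot>\<^bsub>obj X i\<^esub> m) (v \<otimes> s))"
      unfolding m(3) r(3) obj_XP sm[OF r(1) m(1) r(2) m(2)] ..
    also have "\<dots> = fracX (i - 1) (bd X i (r \<odot>\<^bsub>obj X i\<^esub> m)) (v \<otimes> s)"
      by (rule bd_XP[OF _ vs]) (use r(1) m(1) in simp)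
    also have "\<dots> = V \<odot>\<^bsub>obj XP (i - 1)\<^esub> bd XP i T"
      unfolding m(3) r(3) bd_XP[OF m(1,2)] obj_XP sm[OF r(1) bl(1)[OF m(1)] r(2) m(2)] bl(3)[OF r(1) m(1)] ..
    finally show "bd XP i (V \<odot>\<^bsub>obj XP i\<^esub> T) = V \<odot>\<^bsub>obj XP (i - 1)\<^esub> bd XP i T" .
  qed
  fix T assume "T \<in> carrier (obj XP i)"
  then obtain m s where m: "m \<in> carrier (obj X i)" "s \<in> carrier R - P" "T = fracX i m s" unfolding XP_carrier by blast
  have "bd XP (i - 1) (bd XP i T) = fracX (i - 1 - 1) \<zero>\<^bsub>obj X (i - 1 - 1)\<^esub> s"
    unfolding m(3) bd_XP[OF m(1,2)] bd_XP[OF bl(1)[OF m(1)] m(2)] bd_bd[OF m(1)] ..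
  also have "\<dots> = \<zero>\<^bsub>obj XP (i - 1 - 1)\<^esub>" unfolding XP_zero
    by (rule S.fraction_eqI[OF obj_module]) (use m(2) S.S_one in simp_all)
  finally show "bd XP (i - 1) (bd XP i T) = \<zero>\<^bsub>obj XP (i - 1 - 1)\<^esub>" .
qed

end

context cyclic_complex
begin

text \<open>The extension of \<open>I\<close> to the localization at \<open>P\<close>.\<close>

definition I_at :: "'r set \<Rightarrow> ('r \<times> 'r) set set" where
  "I_at P = {fraction (carrier R - P) (self_module R) r s | r s. r \<in> I \<and> s \<in> carrier R - P}"

text \<open>Boundaries of the localized complex are the fractions whose numerator is a boundary, so
  each condition becomes the original one after denominators are cleared.\<close>

lemma cyclic_complex_at:
  assumes P: "primeideal P R"
  shows "cyclic_complex (ring_at R P) (cplx_at R P X) (I_at P) (fraction (carrier R - P) (obj X 0) u \<one>)"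
proof -
  interpret L: localized_complex R X P
    by (intro localized_complex.intro localized_complex_axioms.intro chain_complex_axioms P)
  interpret LC: chain_complex "ring_at R P" "cplx_at R P X" by (rule L.cplx_at_chain_complex)
  have IR: "\<And>r. r \<in> I \<Longrightarrow> r \<in> carrier R" using I_carr by blast
  have BP: "T \<in> boundaries L.XP i \<longleftrightarrow> (\<exists>y t. y \<in> carrier (obj X (i + 1)) \<and> t \<in> carrier R - P \<and> T = L.fracX i (bd X (i + 1) y) t)" for T i
  proof
    assume "T \<in> boundaries L.XP i"
    then obtain U where "U \<in> carrier (obj L.XP (i + 1))" "T = bd L.XP (i + 1) U" unfolding boundaries_def by blast
    then obtain y t where y: "y \<in> carrier (obj X (i + 1))" "t \<in> carrier R - P" "T = bd L.XP (i + 1) (L.fracX (i + 1) y t)"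
      unfolding L.XP_carrier by blast
    then show "\<exists>y t. y \<in> carrier (obj X (i + 1)) \<and> t \<in> carrier R - P \<and> T = L.fracX i (bd X (i + 1) y) t"
      using L.bd_XP[OF y(1,2)] by auto
  next
    assume "\<exists>y t. y \<in> carrier (obj X (i + 1)) \<and> t \<in> carrier R - P \<and> T = L.fracX i (bd X (i + 1) y) t"
    then obtain y t where y: "y \<in> carrier (obj X (i + 1))" "t \<in> carrier R - P" "T = L.fracX i (bd X (i + 1) y) t" by blast
    then have "T = bd L.XP (i + 1) (L.fracX (i + 1) y t)" using L.bd_XP[OF y(1,2)] by simp
    moreover have "L.fracX (i + 1) y t \<in> carrier (obj L.XP (i + 1))" unfolding L.XP_carrier using y by blast
    ultimately show "T \<in> boundaries L.XP i" unfolding boundaries_def by blast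
  qed
  show ?thesis
  proof (intro cyclic_complex.intro cyclic_complex_axioms.intro LC.chain_complex_axioms)
    fix i :: int assume i: "i < 0"
    have "L.fracX i m s = \<zero>\<^bsub>obj L.XP i\<^esub>" if "m \<in> carrier (obj X i)" "s \<in> carrier R - P" for m s
      unfolding L.XP_zero using that(1) unfolding neg[OF i]
      by (intro L.S.fraction_eqI[OF obj_module]) (use that(2) L.S.S_one in simp_all)
    then have "carrier (obj L.XP i) \<subseteq> {\<zero>\<^bsub>obj L.XP i\<^esub>}" unfolding L.XP_carrier by blast
    then show "carrier (obj L.XP i) = {\<zero>\<^bsub>obj L.XP i\<^esub>}" using LC.O.M.zero_closed[of i] by blast
  next
    show "L.fracX 0 u \<one> \<in> carrier (obj L.XP 0)" unfolding L.XP_carrier using u_closed L.S.S_one by blast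
  next
    show "I_at P \<subseteq> carrier L.RP" unfolding I_at_def ring_at_def L.S.loc_ring_simps using IR by blast
  next
    fix V assume "V \<in> carrier L.RP"
    then obtain r s where r: "r \<in> carrier R" "s \<in> carrier R - P" "V = L.S.rfr r s"
      unfolding ring_at_def L.S.loc_ring_simps by blast
    have sR: "s \<in> carrier R" using r(2) by simp
    have ru: "r \<odot>\<^bsub>obj X 0\<^esub> u \<in> carrier (obj X 0)" using r(1) u_closed by simp
    have Vu: "V \<odot>\<^bsub>obj L.XP 0\<^esub> L.fracX 0 u \<one> = L.fracX 0 (r \<odot>\<^bsub>obj X 0\<^esub> u) s"
      unfolding r(3) L.obj_XP L.S.loc_smult[OF obj_module r(1) u_closed r(2) L.S.S_one] using sR by simp
    note Bd = O.submoduleD[OF boundaries_submodule[of 0]]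
    show "V \<odot>\<^bsub>obj L.XP 0\<^esub> L.fracX 0 u \<one> \<in> boundaries L.XP 0 \<longleftrightarrow> V \<in> I_at P"
      unfolding Vu
    proof
      assume "L.fracX 0 (r \<odot>\<^bsub>obj X 0\<^esub> u) s \<in> boundaries L.XP 0"
      then obtain y t where y: "y \<in> carrier (obj X (0 + 1))" "t \<in> carrier R - P"
        "L.fracX 0 (r \<odot>\<^bsub>obj X 0\<^esub> u) s = L.fracX 0 (bd X (0 + 1) y) t" unfolding BP by blast
      have yb: "bd X (0 + 1) y \<in> boundaries X 0" unfolding boundaries_def using y(1) by blast
      then have yc: "bd X (0 + 1) y \<in> carrier (obj X 0)" using Bd(1) by blast
      obtain v where v: "v \<in> carrier R - P" "v \<odot>\<^bsub>obj X 0\<^esub> (t \<odot>\<^bsub>obj X 0\<^esub> (r \<odot>\<^bsub>obj X 0\<^esub> u)) = v \<odot>\<^bsub>obj X 0\<^esub> (s \<odot>\<^bsub>obj X 0\<^esub> bd X (0 + 1) y)"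
        using y(3) L.S.fraction_eq[OF obj_module ru yc r(2) y(2)] by blast
      have vt: "v \<otimes> t \<in> carrier R - P" using L.S.S_mult v(1) y(2) by blast
      have c: "v \<in> carrier R" "t \<in> carrier R" using v(1) y(2) by simp_all
      have "(v \<otimes> t \<otimes> r) \<odot>\<^bsub>obj X 0\<^esub> u = v \<odot>\<^bsub>obj X 0\<^esub> (s \<odot>\<^bsub>obj X 0\<^esub> bd X (0 + 1) y)"
        unfolding v(2)[symmetric] using c r(1) u_closed by (simp add: O.smult_assoc1)
      also have "\<dots> \<in> boundaries X 0" using Bd(4) c sR yb by blast
      finally have I: "v \<otimes> t \<otimes> r \<in> I" using I_iff c r(1) by simp
      \<comment> \<open>The given numerator \<open>r\<close> need not lie in \<open>I\<close>;
        expanding the fraction by \<open>v \<otimes> t\<close> produces one that does.\<close>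
      have "V = L.S.rfr (v \<otimes> t \<otimes> r) (v \<otimes> t \<otimes> s)" unfolding r(3)
        by (rule L.S.rfr_eqI) (use c r(1,2) sR L.S.S_mult[OF vt r(2)] in \<open>simp_all add: m_ac\<close>)
      then show "V \<in> I_at P" unfolding I_at_def using I L.S.S_mult[OF vt r(2)] by blast
    next
      assume "V \<in> I_at P"
      then obtain a t where a: "a \<in> I" "t \<in> carrier R - P" "V = L.S.rfr a t" unfolding I_at_def by blast
      have "a \<odot>\<^bsub>obj X 0\<^esub> u \<in> boundaries X 0" using I_iff[OF IR[OF a(1)]] a(1) by simp
      then obtain y where y: "y \<in> carrier (obj X (0 + 1))" "a \<odot>\<^bsub>obj X 0\<^esub> u = bd X (0 + 1) y" unfolding boundaries_def by blast
      have "L.fracX 0 (r \<odot>\<^bsub>obj X 0\<^esub> u) s = V \<odot>\<^bsub>obj L.XP 0\<^esub> L.fracX 0 u \<one>" by (rule Vu[symmetric])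
      also have "\<dots> = L.fracX 0 (a \<odot>\<^bsub>obj X 0\<^esub> u) t"
        unfolding a(3) L.obj_XP L.S.loc_smult[OF obj_module IR[OF a(1)] u_closed a(2) L.S.S_one] using a(2) by simp
      finally show "L.fracX 0 (r \<odot>\<^bsub>obj X 0\<^esub> u) s \<in> boundaries L.XP 0" unfolding BP y(2) using y(1) a(2) by blast
    qed
  next
    fix V T i assume "V \<in> I_at P" "T \<in> cycles L.XP i"
    then obtain a t where a: "a \<in> I" "t \<in> carrier R - P" "V = L.S.rfr a t" unfolding I_at_def by blast
    have T: "T \<in> carrier (obj L.XP i)" "bd L.XP i T = \<zero>\<^bsub>obj L.XP (i - 1)\<^esub>"
      using \<open>T \<in> cycles L.XP i\<close> unfolding cycles_def by simp_all
    obtain m s where m: "m \<in> carrier (obj X i)" "s \<in> carrier R - P" "T = L.fracX i m s"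
      using T(1) unfolding L.XP_carrier by blast
    note bl = linear_mapD[OF bd_linear[of i]]
    have "L.fracX (i - 1) (bd X i m) s = L.fracX (i - 1) \<zero>\<^bsub>obj X (i - 1)\<^esub> \<one>"
      using T(2) unfolding m(3) L.bd_XP[OF m(1,2)] L.XP_zero .
    then obtain v where v: "v \<in> carrier R - P"
      "v \<odot>\<^bsub>obj X (i - 1)\<^esub> (\<one> \<odot>\<^bsub>obj X (i - 1)\<^esub> bd X i m) = v \<odot>\<^bsub>obj X (i - 1)\<^esub> (s \<odot>\<^bsub>obj X (i - 1)\<^esub> \<zero>\<^bsub>obj X (i - 1)\<^esub>)"
      using L.S.fraction_eq[OF obj_module bl(1)[OF m(1)] O.M.zero_closed m(2) L.S.S_one] by blast
    have c: "v \<in> carrier R" "s \<in> carrier R" "a \<in> carrier R" "t \<in> carrier R" using v(1) m(2) a(2) IR[OF a(1)] by simp_all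
    \<comment> \<open>The numerator \<open>m\<close> of a localized cycle becomes a cycle only after
      multiplication by some \<open>v\<close> outside \<open>P\<close>.\<close>
    have "bd X i (v \<odot>\<^bsub>obj X i\<^esub> m) = \<zero>\<^bsub>obj X (i - 1)\<^esub>" using v(2) c m(1) bl(1)[OF m(1)] by (simp add: bl(3))
    then have "v \<odot>\<^bsub>obj X i\<^esub> m \<in> cycles X i" unfolding cycles_def using c m(1) by simp
    then have "a \<odot>\<^bsub>obj X i\<^esub> (v \<odot>\<^bsub>obj X i\<^esub> m) \<in> boundaries X i" by (rule I_annihilates[OF a(1)])
    then obtain y where y: "y \<in> carrier (obj X (i + 1))" "a \<odot>\<^bsub>obj X i\<^esub> (v \<odot>\<^bsub>obj X i\<^esub> m) = bd X (i + 1) y"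
      unfolding boundaries_def by blast
    have ts: "t \<otimes> s \<in> carrier R - P" using L.S.S_mult a(2) m(2) by blast
    have vts: "v \<otimes> (t \<otimes> s) \<in> carrier R - P" using L.S.S_mult v(1) ts by blast
    have "V \<odot>\<^bsub>obj L.XP i\<^esub> T = L.fracX i (a \<odot>\<^bsub>obj X i\<^esub> m) (t \<otimes> s)"
      unfolding a(3) m(3) L.obj_XP L.S.loc_smult[OF obj_module c(3) m(1) a(2) m(2)] ..
    also have "\<dots> = L.fracX i (a \<odot>\<^bsub>obj X i\<^esub> (v \<odot>\<^bsub>obj X i\<^esub> m)) (v \<otimes> (t \<otimes> s))"
      by (rule L.S.fraction_eqI[OF obj_module])
        (use c m(1) ts vts in \<open>simp_all add: O.smult_assoc1[symmetric] m_ac\<close>)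
    finally show "V \<odot>\<^bsub>obj L.XP i\<^esub> T \<in> boundaries L.XP i" unfolding BP y(2) using y(1) vts by blast
  qed
qed

lemma one_notin_I_at:
  assumes P: "P \<in> primes_over R I"
  shows "\<one>\<^bsub>ring_at R P\<^esub> \<notin> I_at P"
proof
  have Pp: "primeideal P R" "I \<subseteq> P" using P by (simp_all add: primes_over_def)
  interpret S: mult_set R "carrier R - P" by (rule prime_mult_set[OF Pp(1)])
  assume "\<one>\<^bsub>ring_at R P\<^esub> \<in> I_at P"
  then obtain a t where a: "a \<in> I" "t \<in> carrier R - P" "S.rfr \<one> \<one> = S.rfr a t"
    unfolding I_at_def ring_at_def S.loc_ring_simps by blast
  have aR: "a \<in> carrier R" using a(1) I_carr by blast
  obtain v where v: "v \<in> carrier R - P" "v \<otimes> (t \<otimes> \<one>) = v \<otimes> (\<one> \<otimes> a)"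
    using a(3) S.rfr_eq[OF one_closed aR S.S_one a(2)] by blast
  have "v \<otimes> t \<in> P" using v a(1,2) aR Pp(2) idealD(4)[OF primeD(1)[OF Pp(1)], of a v] by auto
  moreover have "v \<otimes> t \<in> carrier R - P" using S.S_mult v(1) a(2) by blast
  ultimately show False by blast
qed

lemma cinf_at_zero:
  assumes "P \<in> primes_over R I"
  shows "cinf (cplx_at R P X) = 0"
proof -
  have P: "primeideal P R" using assms by (simp add: primes_over_def)
  show ?thesis by (rule cyclic_complex.cinf_zero[OF cyclic_complex_at[OF P] one_notin_I_at[OF assms]])
qed

text \<open>The infima at the primes of the support all vanish, so the supremum runs over the
  numbers \<open>dim R/P\<close>. A chain of primes over \<open>I\<close> is also a chain over its
  own first term, which shows that nothing is lost.\<close>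

lemma cdim_eq: "cdim R X = sup_chain_length (primes_over R I)"
proof -
  have eq: "krull_dim (R Quot P) - cinf (cplx_at R P X) = sup_chain_length (primes_over R P)"
    if "P \<in> primes_over R I" for P
  proof -
    have "primeideal P R" using that by (simp add: primes_over_def)
    then have "krull_dim (R Quot P) = sup_chain_length (primes_over R P)" by (intro krull_dim_quot primeD)
    then show ?thesis using cinf_at_zero[OF that] by simp
  qed
  have "cdim R X = Sup {sup_chain_length (primes_over R P) |P. P \<in> primes_over R I}"
    unfolding cdim_def csupp_eq using eq by (intro arg_cong[where f = Sup]) (auto, metis)
  also have "\<dots> = sup_chain_length (primes_over R I)"
  proof (rule antisym)
    show "Sup {sup_chain_length (primes_over R P) |P. P \<in> primes_over R I} \<le> sup_chain_length (primes_over R I)"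
    proof (rule Sup_least)
      fix z assume "z \<in> {sup_chain_length (primes_over R P) |P. P \<in> primes_over R I}"
      then obtain P where P: "P \<in> primes_over R I" "z = sup_chain_length (primes_over R P)" by blast
      have "primes_over R P \<subseteq> primes_over R I" using P(1) unfolding primes_over_def by blast
      then show "z \<le> sup_chain_length (primes_over R I)" unfolding P(2)
        by (intro sup_chain_length_map[where f = id]) auto
    qed
    show "sup_chain_length (primes_over R I) \<le> Sup {sup_chain_length (primes_over R P) |P. P \<in> primes_over R I}"
    proof (rule sup_chain_length_le)
      fix n C assume C: "\<forall>i\<le>n. C i \<in> primes_over R I" "\<forall>i<n. C i \<subset> C (Suc i)"
      have "\<forall>i\<le>n. C i \<in> primes_over R (C 0)"
      proof (intro allI impI)
        fix i assume i: "i \<le> n"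
        then have "C 0 \<subseteq> C i" using chain_mono[OF C(2), of 0 i] by simp
        then show "C i \<in> primes_over R (C 0)" using C(1) i by (simp add: primes_over_def)
      qed
      then have "ereal (real n) \<le> sup_chain_length (primes_over R (C 0))" using C(2) by (rule sup_chain_length_ge)
      also have "\<dots> \<le> Sup {sup_chain_length (primes_over R P) |P. P \<in> primes_over R I}"
        by (rule Sup_upper) (use C(1) in blast)
      finally show "ereal (real n) \<le> Sup {sup_chain_length (primes_over R P) |P. P \<in> primes_over R I}" .
    qed
  qed
  finally show ?thesis .
qed

text \<open>The localized complex is cyclic again, so \<open>cdim_eq\<close> turns its dimension
  into chains of primes over the extended ideal. Contraction and extension match these with the
  primes between \<open>I\<close> and \<open>P\<close>.\<close>

lemma cdim_at_eq:
  assumes P: "primeideal P R"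
  shows "cdim (ring_at R P) (cplx_at R P X) = sup_chain_length {Q \<in> primes_over R I. Q \<subseteq> P}"
proof -
  interpret S: mult_set R "carrier R - P" by (rule prime_mult_set[OF P])
  interpret RS: cring S.RS by (rule S.loc_ring_cring)
  interpret C: cyclic_complex "ring_at R P" "cplx_at R P X" "I_at P" "fraction (carrier R - P) (obj X 0) u \<one>"
    by (rule cyclic_complex_at[OF P])
  have eqR: "ring_at R P = S.RS" by (simp add: ring_at_def)
  let ?c = "\<lambda>Q. {r \<in> carrier R. S.rfr r \<one> \<in> Q}"
  let ?e = "\<lambda>Q. {S.rfr r s | r s. r \<in> Q \<and> s \<in> carrier R - P}"
  \<comment> \<open>A fraction and its numerator generate each other because \<open>s\<close>
    becomes a unit; an ideal of the localization is therefore determined by numerators.\<close>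
  have split: "S.rfr r s = S.rfr \<one> s \<otimes>\<^bsub>S.RS\<^esub> S.rfr r \<one>" "S.rfr r \<one> = S.rfr s \<one> \<otimes>\<^bsub>S.RS\<^esub> S.rfr r s"
    if r: "r \<in> carrier R" and s: "s \<in> carrier R - P" for r s
  proof -
    show "S.rfr r s = S.rfr \<one> s \<otimes>\<^bsub>S.RS\<^esub> S.rfr r \<one>" using r s S.S_one by (simp add: S.loc_ring_mult)
    have "S.rfr s \<one> \<otimes>\<^bsub>S.RS\<^esub> S.rfr r s = S.rfr (s \<otimes> r) s" using r s S.S_one by (simp add: S.loc_ring_mult)
    also have "\<dots> = S.rfr r \<one>" by (rule S.rfr_eqI) (use r s S.S_one in simp_all)
    finally show "S.rfr r \<one> = S.rfr s \<one> \<otimes>\<^bsub>S.RS\<^esub> S.rfr r s" by simp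
  qed
  have cmem: "S.rfr r s \<in> Q \<longleftrightarrow> r \<in> ?c Q" if Q: "ideal Q S.RS" and r: "r \<in> carrier R" and s: "s \<in> carrier R - P" for Q r s
  proof
    have sR: "s \<in> carrier R" using s by simp
    assume "S.rfr r s \<in> Q"
    then have "S.rfr s \<one> \<otimes>\<^bsub>S.RS\<^esub> S.rfr r s \<in> Q" by (rule RS.idealD(4)[OF Q]) (rule S.rfr_closed[OF sR S.S_one])
    then show "r \<in> ?c Q" using split(2)[OF r s] r by simp
  next
    assume "r \<in> ?c Q"
    then have "S.rfr \<one> s \<otimes>\<^bsub>S.RS\<^esub> S.rfr r \<one> \<in> Q" by (intro RS.idealD(4)[OF Q] S.rfr_closed one_closed s) simp
    then show "S.rfr r s \<in> Q" using split(1)[OF r s] by simp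
  qed
  have c: "?c Q \<in> {Q \<in> primes_over R I. Q \<subseteq> P}" if "Q \<in> primes_over S.RS (I_at P)" for Q
  proof -
    have Q: "primeideal Q S.RS" "I_at P \<subseteq> Q" using that by (simp_all add: primes_over_def)
    note Qi = RS.primeD(1)[OF Q(1)]
    have cid: "ideal (?c Q) R"
    proof (rule ideal_of_closed)
      show "\<zero> \<in> ?c Q" using RS.idealD(2)[OF Qi] unfolding S.loc_ring_simps by simp
      fix a b assume ab: "a \<in> ?c Q" "b \<in> ?c Q"
      then have "S.rfr a \<one> \<oplus>\<^bsub>S.RS\<^esub> S.rfr b \<one> \<in> Q" by (intro RS.idealD(3)[OF Qi]) simp_all
      then show "a \<oplus> b \<in> ?c Q" using ab S.S_one by (simp add: S.loc_ring_add)
    next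
      fix a x assume ax: "a \<in> ?c Q" "x \<in> carrier R"
      then have "S.rfr x \<one> \<otimes>\<^bsub>S.RS\<^esub> S.rfr a \<one> \<in> Q" by (intro RS.idealD(4)[OF Qi] S.rfr_closed S.S_one) simp_all
      then show "x \<otimes> a \<in> ?c Q" using ax S.S_one by (simp add: S.loc_ring_mult)
    qed blast
    have "primeideal (?c Q) R"
    proof (rule primeideal_of_closed[OF cid])
      show "\<one> \<notin> ?c Q" using RS.primeD(3)[OF Q(1)] unfolding S.loc_ring_simps by simp
      fix a b assume ab: "a \<otimes> b \<in> ?c Q" "a \<in> carrier R" "b \<in> carrier R"
      then have "S.rfr a \<one> \<otimes>\<^bsub>S.RS\<^esub> S.rfr b \<one> \<in> Q" using S.S_one by (simp add: S.loc_ring_mult)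
      then have "S.rfr a \<one> \<in> Q \<or> S.rfr b \<one> \<in> Q"
        by (rule RS.primeD(4)[OF Q(1)]) (rule S.rfr_closed[OF _ S.S_one], rule ab)+
      then show "a \<in> ?c Q \<or> b \<in> ?c Q" using ab by simp
    qed
    moreover have "I \<subseteq> ?c Q"
    proof
      fix r assume r: "r \<in> I"
      then have "S.rfr r \<one> \<in> I_at P" unfolding I_at_def using S.S_one by blast
      then show "r \<in> ?c Q" using Q(2) r I_carr by blast
    qed
    moreover have "?c Q \<subseteq> P"
    proof
      fix r assume r: "r \<in> ?c Q"
      show "r \<in> P"
      proof (rule ccontr)
        assume "r \<notin> P"
        then have rS: "r \<in> carrier R - P" using r by simp
        have "S.rfr r r \<in> Q" using cmem[OF Qi _ rS] r by simp
        moreover have "S.rfr r r = \<one>\<^bsub>S.RS\<^esub>" unfolding S.loc_ring_simps by (rule S.rfr_eqI) (use rS S.S_one in simp_all)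
        ultimately show False using RS.primeD(3)[OF Q(1)] by simp
      qed
    qed
    ultimately show ?thesis by (simp add: primes_over_def)
  qed
  have cs: "?c Q \<subset> ?c Q'" if QQ: "Q \<in> primes_over S.RS (I_at P)" "Q' \<in> primes_over S.RS (I_at P)" "Q \<subset> Q'" for Q Q'
  proof -
    have Q: "ideal Q S.RS" "ideal Q' S.RS" using QQ RS.primeD(1) by (simp_all add: primes_over_def)
    obtain T where T: "T \<in> Q'" "T \<notin> Q" using QQ(3) by blast
    then have "T \<in> carrier S.RS" using RS.idealD(1)[OF Q(2)] by blast
    then obtain r s where r: "r \<in> carrier R" "s \<in> carrier R - P" "T = S.rfr r s" unfolding S.loc_ring_simps by blast
    have "r \<in> ?c Q'" "r \<notin> ?c Q" using T cmem[OF Q(2) r(1,2)] cmem[OF Q(1) r(1,2)] unfolding r(3) by simp_all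
    then show ?thesis using QQ(3) by blast
  qed
  have emem: "S.rfr r s \<in> ?e Q \<longleftrightarrow> r \<in> Q" if Q: "primeideal Q R" "Q \<subseteq> P" and r: "r \<in> carrier R" "s \<in> carrier R - P" for Q r s
  proof
    assume "S.rfr r s \<in> ?e Q"
    then obtain q t where q: "q \<in> Q" "t \<in> carrier R - P" "S.rfr r s = S.rfr q t" by blast
    have qR: "q \<in> carrier R" using q(1) primeD(2)[OF Q(1)] by blast
    obtain v where v: "v \<in> carrier R - P" "v \<otimes> (t \<otimes> r) = v \<otimes> (s \<otimes> q)" using q(3) S.rfr_eq[OF r(1) qR r(2) q(2)] by blast
    have c: "v \<in> carrier R" "t \<in> carrier R" "s \<in> carrier R" using v(1) q(2) r(2) by simp_all
    have "s \<otimes> q \<in> Q" using idealD(4)[OF primeD(1)[OF Q(1)] q(1) c(3)] .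
    then have "v \<otimes> (s \<otimes> q) \<in> Q" using idealD(4)[OF primeD(1)[OF Q(1)] _ c(1)] by blast
    then have "(v \<otimes> t) \<otimes> r \<in> Q" unfolding v(2)[symmetric] using c r(1) by (simp add: m_assoc)
    then have "v \<otimes> t \<in> Q \<or> r \<in> Q" by (rule primeD(4)[OF Q(1)]) (use c r(1) in simp_all)
    moreover have "v \<otimes> t \<in> carrier R - P" using S.S_mult v(1) q(2) by blast
    ultimately show "r \<in> Q" using Q(2) by blast
  next
    assume "r \<in> Q" then show "S.rfr r s \<in> ?e Q" using r(2) by blast
  qed
  have e: "?e Q \<in> primes_over S.RS (I_at P)" if "Q \<in> {Q \<in> primes_over R I. Q \<subseteq> P}" for Q
  proof -
    have Q: "primeideal Q R" "Q \<subseteq> P" "I \<subseteq> Q" using that by (simp_all add: primes_over_def)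
    note Qd = idealD[OF primeD(1)[OF Q(1)]]
    have QR: "\<And>q. q \<in> Q \<Longrightarrow> q \<in> carrier R" using Qd(1) by blast
    have eid: "ideal (?e Q) S.RS"
    proof (rule RS.ideal_of_closed)
      show "?e Q \<subseteq> carrier S.RS" unfolding S.loc_ring_simps using QR by blast
      show "\<zero>\<^bsub>S.RS\<^esub> \<in> ?e Q" unfolding S.loc_ring_simps using Qd(2) S.S_one by blast
      fix A B assume "A \<in> ?e Q" "B \<in> ?e Q"
      then obtain a s b t where ab: "a \<in> Q" "s \<in> carrier R - P" "A = S.rfr a s" "b \<in> Q" "t \<in> carrier R - P" "B = S.rfr b t" by blast
      have "A \<oplus>\<^bsub>S.RS\<^esub> B = S.rfr (t \<otimes> a \<oplus> s \<otimes> b) (s \<otimes> t)" unfolding ab(3,6) by (rule S.loc_ring_add) (use ab QR in simp_all)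
      moreover have "t \<otimes> a \<oplus> s \<otimes> b \<in> Q" using ab(2,5) by (intro Qd(3) Qd(4) ab) simp_all
      moreover have "s \<otimes> t \<in> carrier R - P" using S.S_mult ab(2,5) by blast
      ultimately show "A \<oplus>\<^bsub>S.RS\<^esub> B \<in> ?e Q" by blast
    next
      fix A V assume "A \<in> ?e Q" "V \<in> carrier S.RS"
      then obtain a s r t where ab: "a \<in> Q" "s \<in> carrier R - P" "A = S.rfr a s" "r \<in> carrier R" "t \<in> carrier R - P" "V = S.rfr r t"
        unfolding S.loc_ring_simps by blast
      have "V \<otimes>\<^bsub>S.RS\<^esub> A = S.rfr (r \<otimes> a) (t \<otimes> s)" unfolding ab(3,6) by (rule S.loc_ring_mult) (use ab QR in simp_all)
      moreover have "r \<otimes> a \<in> Q" by (rule Qd(4)[OF ab(1,4)])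
      moreover have "t \<otimes> s \<in> carrier R - P" using S.S_mult ab(2,5) by blast
      ultimately show "V \<otimes>\<^bsub>S.RS\<^esub> A \<in> ?e Q" by blast
    qed
    have "primeideal (?e Q) S.RS"
    proof (rule RS.primeideal_of_closed[OF eid])
      show "\<one>\<^bsub>S.RS\<^esub> \<notin> ?e Q" unfolding S.loc_ring_simps(2)
        using emem[OF Q(1,2) one_closed S.S_one] primeD(3)[OF Q(1)] by blast
      fix A B assume AB: "A \<otimes>\<^bsub>S.RS\<^esub> B \<in> ?e Q" and "A \<in> carrier S.RS" "B \<in> carrier S.RS"
      then obtain a s b t where ab: "a \<in> carrier R" "s \<in> carrier R - P" "A = S.rfr a s"
          "b \<in> carrier R" "t \<in> carrier R - P" "B = S.rfr b t" unfolding S.loc_ring_simps by blast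
      have "S.rfr (a \<otimes> b) (s \<otimes> t) \<in> ?e Q" using AB unfolding ab(3,6) S.loc_ring_mult[OF ab(1,4,2,5)] .
      then have "a \<otimes> b \<in> Q" using emem[OF Q(1,2) m_closed[OF ab(1,4)] S.S_mult[OF ab(2,5)]] by blast
      then have "a \<in> Q \<or> b \<in> Q" using primeD(4)[OF Q(1)] ab by blast
      then show "A \<in> ?e Q \<or> B \<in> ?e Q" unfolding ab(3,6) using ab(2,5) by blast
    qed
    moreover have "I_at P \<subseteq> ?e Q" unfolding I_at_def using Q(3) by blast
    ultimately show ?thesis by (simp add: primes_over_def)
  qed
  have es: "?e Q \<subset> ?e Q'" if QQ: "Q \<in> {Q \<in> primes_over R I. Q \<subseteq> P}" "Q' \<in> {Q \<in> primes_over R I. Q \<subseteq> P}" "Q \<subset> Q'" for Q Q'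
  proof -
    have Q: "primeideal Q R" "Q \<subseteq> P" "Q' \<subseteq> carrier R" using QQ primeD(2) by (simp_all add: primes_over_def)
    obtain r where r: "r \<in> Q'" "r \<notin> Q" using QQ(3) by blast
    have "S.rfr r \<one> \<notin> ?e Q" using emem[OF Q(1,2) _ S.S_one] r Q(3) by blast
    moreover have "S.rfr r \<one> \<in> ?e Q'" using r(1) S.S_one by blast
    ultimately show ?thesis using QQ(3) by blast
  qed
  show ?thesis unfolding C.cdim_eq unfolding eqR
  proof (rule antisym)
    show "sup_chain_length (primes_over S.RS (I_at P)) \<le> sup_chain_length {Q \<in> primes_over R I. Q \<subseteq> P}"
      by (rule sup_chain_length_map[where f = ?c, OF c cs])
    show "sup_chain_length {Q \<in> primes_over R I. Q \<subseteq> P} \<le> sup_chain_length (primes_over S.RS (I_at P))"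
      by (rule sup_chain_length_map[where f = ?e, OF e es])
  qed
qed

end

section \<open>DG algebras\<close>

context abelian_group
begin

lemma signed_closed [simp]: "x \<in> carrier G \<Longrightarrow> signed G k x \<in> carrier G"
  by (simp add: signed_def)

lemma signed_zero [simp]: "signed G k \<zero> = \<zero>"
  by (simp add: signed_def)

lemma signed_add: "\<lbrakk>x \<in> carrier G; y \<in> carrier G\<rbrakk> \<Longrightarrow> signed G k (x \<oplus> y) = signed G k x \<oplus> signed G k y"
  by (simp add: signed_def minus_add)

lemma signed_signed: "x \<in> carrier G \<Longrightarrow> signed G k (signed G l x) = signed G (k + l) x"
  by (auto simp: signed_def)

lemma signed_Suc: "x \<in> carrier G \<Longrightarrow> signed G (1 + k) x = \<ominus> signed G k x"
  by (auto simp: signed_def)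

lemma signed_cong: "even (k - l) \<Longrightarrow> signed G k x = signed G l x"
  by (auto simp: signed_def)

lemma signed_finsum:
  assumes "finite F" "\<forall>i\<in>F. f i \<in> carrier G"
  shows "signed G k (\<Oplus>i\<in>F. f i) = (\<Oplus>i\<in>F. signed G k (f i))"
  using assms
proof (induction F rule: finite_induct)
  case (insert a F)
  then show ?case by (simp add: signed_add Pi_def)
qed simp

lemma finsum_mem:
  assumes "finite F" "\<zero> \<in> H" "\<forall>x\<in>H. \<forall>y\<in>H. x \<oplus> y \<in> H" "H \<subseteq> carrier G" "\<forall>i\<in>F. f i \<in> H"
  shows "(\<Oplus>i\<in>F. f i) \<in> H"
  using assms(1,5)
proof (induction F rule: finite_induct)
  case (insert a F)
  have "f \<in> F \<rightarrow> carrier G" "f a \<in> carrier G" using insert.prems assms(4) by auto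
  then have "finsum G f (insert a F) = f a \<oplus> finsum G f F" using insert by simp
  then show ?case using insert assms(3) by simp
qed (use assms in simp)

text \<open>The summands for \<open>(i, j)\<close> and \<open>(j, i)\<close> cancel; the induction
  splits off one index \<open>k\<close> and pairs its row with its column.\<close>

lemma finsum_finsum_antisym:
  assumes "finite F"
    and "\<forall>i\<in>F. \<forall>j\<in>F. i \<noteq> j \<longrightarrow> a i j \<in> carrier G \<and> a j i = \<ominus> a i j"
  shows "(\<Oplus>i\<in>F. \<Oplus>j\<in>F - {i}. a i j) = \<zero>"
  using assms
proof (induction F rule: finite_induct)
  case (insert k F)
  have c: "a i j \<in> carrier G" if "i \<in> insert k F" "j \<in> insert k F" "i \<noteq> j" for i j
    using insert.prems that by blast
  have neg: "a i k = \<ominus> a k i" if "i \<in> F" for i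
  proof -
    have "k \<noteq> i" using insert.hyps(2) that by blast
    moreover have "k \<in> insert k F" "i \<in> insert k F" using that by simp_all
    ultimately show ?thesis using insert.prems by metis
  qed
  have s1: "(\<Oplus>j\<in>insert k F - {k}. a k j) = (\<Oplus>j\<in>F. a k j)" using insert.hyps(2) by simp
  have kc: "a k \<in> F \<rightarrow> carrier G" using c insert.hyps(2) by auto
  have kc': "(\<lambda>i. a i k) \<in> F \<rightarrow> carrier G" using c insert.hyps(2) by auto
  have ic: "(\<lambda>i. \<Oplus>j\<in>F - {i}. a i j) \<in> F \<rightarrow> carrier G"
    by (rule Pi_I, rule finsum_closed) (use c in auto)
  have ic': "(\<lambda>i. \<Oplus>j\<in>insert k F - {i}. a i j) \<in> insert k F \<rightarrow> carrier G"
    by (rule Pi_I, rule finsum_closed) (use c in auto)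
  have s2: "(\<Oplus>j\<in>insert k F - {i}. a i j) = a i k \<oplus> (\<Oplus>j\<in>F - {i}. a i j)" if i: "i \<in> F" for i
  proof -
    have "insert k F - {i} = insert k (F - {i})" using i insert.hyps(2) by blast
    moreover have "(\<Oplus>j\<in>insert k (F - {i}). a i j) = a i k \<oplus> (\<Oplus>j\<in>F - {i}. a i j)"
    proof (rule finsum_insert)
      show "finite (F - {i})" "k \<notin> F - {i}" using insert.hyps by simp_all
      show "a i \<in> F - {i} \<rightarrow> carrier G" using c i by auto
      show "a i k \<in> carrier G" using c[of i k] i insert.hyps(2) by auto
    qed
    ultimately show ?thesis by simp
  qed
  have "(\<Oplus>i\<in>insert k F. \<Oplus>j\<in>insert k F - {i}. a i j) =
      (\<Oplus>j\<in>insert k F - {k}. a k j) \<oplus> (\<Oplus>i\<in>F. \<Oplus>j\<in>insert k F - {i}. a i j)"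
    by (rule finsum_insert) (use insert.hyps ic' in auto)
  also have "(\<Oplus>i\<in>F. \<Oplus>j\<in>insert k F - {i}. a i j) = (\<Oplus>i\<in>F. a i k \<oplus> (\<Oplus>j\<in>F - {i}. a i j))"
    by (rule finsum_cong') (use s2 kc' ic in auto)
  also have "\<dots> = (\<Oplus>i\<in>F. a i k) \<oplus> (\<Oplus>i\<in>F. \<Oplus>j\<in>F - {i}. a i j)"
    by (rule finsum_addf[OF kc' ic])
  also have "(\<Oplus>i\<in>F. \<Oplus>j\<in>F - {i}. a i j) = \<zero>" by (rule insert.IH) (use insert.prems in blast)
  also have "(\<Oplus>j\<in>insert k F - {k}. a k j) \<oplus> ((\<Oplus>i\<in>F. a i k) \<oplus> \<zero>) = (\<Oplus>j\<in>F. a k j) \<oplus> (\<Oplus>i\<in>F. a i k)"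
    unfolding s1 using kc' by simp
  also have "\<dots> = (\<Oplus>j\<in>F. a k j \<oplus> a j k)" by (rule finsum_addf[OF kc kc', symmetric])
  also have "\<dots> = (\<Oplus>j\<in>F. \<zero>)"
  proof (rule finsum_cong')
    fix j assume j: "j \<in> F"
    then have "a k j \<in> carrier G" using c insert.hyps(2) by auto
    then show "a k j \<oplus> a j k = \<zero>" unfolding neg[OF j] by (rule r_neg)
  qed auto
  finally show ?case by simp
qed simp

end

text \<open>The base ring is the degree zero part of \<open>A\<close> itself; tying its action to
  the product lets module computations in the complex be done by multiplication in
  \<open>A\<close>.\<close>

locale dg_over_deg0 =
  fixes A :: "('a, 'a) dg_alg" (structure)
  assumes dg: "dg_algebra (deg0_ring A) A"
    and smult_mult: "\<forall>r\<in>carrier (deg0_ring A). \<forall>a\<in>carrier A. r \<odot> a = r \<otimes> a"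
begin

abbreviation "R \<equiv> deg0_ring A"

sublocale R: cring R by (rule module.axioms(1)[OF dg_algebra.axioms(1)[OF dg]])
sublocale A: ring A by (rule dg_algebra.axioms(2)[OF dg])
sublocale M: rmodule R A by (intro rmodule.intro dg_algebra.axioms(1)[OF dg])
sublocale dg: dg_algebra R A by (rule dg)

lemma deg0_simps [simp]:
  "carrier R = homog A 0" "monoid.mult R = monoid.mult A" "ring.add R = ring.add A" "\<one>\<^bsub>R\<^esub> = \<one>" "\<zero>\<^bsub>R\<^esub> = \<zero>"
  by (simp_all add: deg0_ring_def)

lemma homogD:
  shows "homog A i \<subseteq> carrier A" "\<zero> \<in> homog A i" "\<lbrakk>a \<in> homog A i; b \<in> homog A i\<rbrakk> \<Longrightarrow> a \<oplus> b \<in> homog A i"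
    "\<lbrakk>r \<in> homog A 0; a \<in> homog A i\<rbrakk> \<Longrightarrow> r \<otimes> a \<in> homog A i" "a \<in> homog A i \<Longrightarrow> \<ominus> a \<in> homog A i"
    "a \<in> homog A i \<Longrightarrow> signed A k a \<in> homog A i"
proof -
  note D = M.submoduleD[OF dg.homog_submodule[of i]]
  show "homog A i \<subseteq> carrier A" "\<zero> \<in> homog A i" "\<lbrakk>a \<in> homog A i; b \<in> homog A i\<rbrakk> \<Longrightarrow> a \<oplus> b \<in> homog A i"
    "a \<in> homog A i \<Longrightarrow> \<ominus> a \<in> homog A i"
    using D by simp_all
  then show "a \<in> homog A i \<Longrightarrow> signed A k a \<in> homog A i" by (simp add: signed_def)
  show "\<lbrakk>r \<in> homog A 0; a \<in> homog A i\<rbrakk> \<Longrightarrow> r \<otimes> a \<in> homog A i"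
    using dg.homog_mult[of r 0 a i] by simp
qed

lemma homog_carr: "a \<in> homog A i \<Longrightarrow> a \<in> carrier A"
  using homogD(1) by blast

lemma smult_eq: "\<lbrakk>r \<in> homog A 0; a \<in> carrier A\<rbrakk> \<Longrightarrow> r \<odot> a = r \<otimes> a"
  using smult_mult by simp

lemma deg0_comm: "\<lbrakk>r \<in> homog A 0; a \<in> homog A i\<rbrakk> \<Longrightarrow> a \<otimes> r = r \<otimes> a"
  using dg.graded_comm[of r 0 a i] by (simp add: signed_def)

lemma d_smult: "\<lbrakk>r \<in> homog A 0; a \<in> homog A i\<rbrakk> \<Longrightarrow> dgd A (r \<otimes> a) = r \<otimes> dgd A a"
  using dg.d_smult[of r a] smult_eq[of r] homog_carr[of a i] homog_carr[OF dg.d_homog[of a i]] by simp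

lemma d_zero [simp]: "dgd A \<zero> = \<zero>"
proof -
  have z: "\<zero> \<in> homog A 0" by (rule homogD)
  have "dgd A (\<zero> \<otimes> \<zero>) = \<zero> \<otimes> dgd A \<zero>" by (rule d_smult[OF z z])
  then show ?thesis using homog_carr[OF dg.d_homog[OF z]] by simp
qed

lemma d_uminus: "a \<in> homog A i \<Longrightarrow> dgd A (\<ominus> a) = \<ominus> dgd A a"
proof -
  assume a: "a \<in> homog A i"
  have m: "\<ominus> \<one> \<in> homog A 0" by (rule homogD(5)[OF dg.homog_one])
  note c = homog_carr[OF a] homog_carr[OF dg.d_homog[OF a]]
  have "dgd A ((\<ominus> \<one>) \<otimes> a) = (\<ominus> \<one>) \<otimes> dgd A a" by (rule d_smult[OF m a])
  then show ?thesis using c by (simp add: A.l_minus)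
qed

lemma d_signed: "a \<in> homog A i \<Longrightarrow> dgd A (signed A k a) = signed A k (dgd A a)"
  using d_uminus by (simp add: signed_def)

lemma mult_signed: "\<lbrakk>x \<in> carrier A; a \<in> carrier A\<rbrakk> \<Longrightarrow> x \<otimes> signed A k a = signed A k (x \<otimes> a)"
  by (simp add: signed_def A.r_minus)

lemma d_finsum:
  assumes "finite F" "\<forall>i\<in>F. f i \<in> carrier A"
  shows "dgd A (\<Oplus>i\<in>F. f i) = (\<Oplus>i\<in>F. dgd A (f i))"
proof -
  \<comment> \<open>The axioms locate the differentials of homogeneous elements only; decomposition
    into homogeneous parts extends this to all of \<open>A\<close>.\<close>
  have dc: "dgd A a \<in> carrier A" if a: "a \<in> carrier A" for a
  proof -
    obtain J g where J: "finite J" "\<forall>i\<in>J. g i \<in> homog A i" "a = (\<Oplus>i\<in>J. g i)" using dg.homog_span[OF a] by blast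
    have "(\<Oplus>i\<in>J. g i) \<in> {x \<in> carrier A. dgd A x \<in> carrier A}"
    proof (rule A.finsum_mem[OF J(1)])
      show "\<forall>i\<in>J. g i \<in> {x \<in> carrier A. dgd A x \<in> carrier A}"
        using J(2) homog_carr dg.d_homog by blast
      show "\<forall>x\<in>{x \<in> carrier A. dgd A x \<in> carrier A}. \<forall>y\<in>{x \<in> carrier A. dgd A x \<in> carrier A}.
         x \<oplus> y \<in> {x \<in> carrier A. dgd A x \<in> carrier A}"
        by (simp add: dg.d_add)
    qed auto
    then show ?thesis using J(3) by simp
  qed
  show ?thesis using assms
  proof (induction F rule: finite_induct)
    case (insert a F)
    have c: "f \<in> F \<rightarrow> carrier A" "f a \<in> carrier A" "(\<lambda>i. dgd A (f i)) \<in> F \<rightarrow> carrier A" "dgd A (f a) \<in> carrier A"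
      using insert.prems dc by auto
    have "dgd A (f a \<oplus> finsum A f F) = dgd A (f a) \<oplus> dgd A (finsum A f F)"
      by (rule dg.d_add) (use c in simp_all)
    then show ?case using insert c by simp
  qed simp
qed

abbreviation "X \<equiv> dg_cplx A"

lemma X_simps [simp]:
  "carrier (obj X i) = homog A i" "ring.add (obj X i) = ring.add A" "\<zero>\<^bsub>obj X i\<^esub> = \<zero>"
  "smult (obj X i) = smult A" "bd X i = dgd A"
  by (simp_all add: dg_cplx_def)

lemma X_module: "module R (obj X i)"
proof -
  have "module R (A\<lparr>carrier := homog A i\<rparr>)"
    by (rule submodule.submodule_is_module[OF dg.homog_submodule M.module_axioms])
  then interpret N: rmodule R "A\<lparr>carrier := homog A i\<rparr>" by (rule rmodule.intro)
  show ?thesis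
  proof (rule moduleI)
    show "abelian_group (obj X i)"
    proof (rule abelian_groupI)
      fix x assume "x \<in> carrier (obj X i)"
      then show "\<exists>y\<in>carrier (obj X i). y \<oplus>\<^bsub>obj X i\<^esub> x = \<zero>\<^bsub>obj X i\<^esub>"
        by (intro bexI[of _ "\<ominus> x"]) (simp_all add: A.l_neg homog_carr homogD)
    qed (simp_all add: homog_carr A.a_assoc A.a_comm A.a_lcomm homogD)
  qed (use R.is_cring N.smult_closed N.smult_l_distr N.smult_r_distr N.smult_assoc1 N.smult_one in simp_all)
qed

lemma X_complex: "chain_complex R X"
proof (intro chain_complex.intro chain_complex_axioms.intro R.is_cring X_module)
  fix i
  show "linear_map R (obj X i) (obj X (i - 1)) (bd X i)"
    by (rule linear_mapI) (simp_all add: dg.d_homog dg.d_add dg.d_smult homog_carr)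
  show "bd X (i - 1) (bd X i x) = \<zero>\<^bsub>obj X (i - 1 - 1)\<^esub>" if "x \<in> carrier (obj X i)" for x
    using that dg.d_d homog_carr by simp
qed

sublocale X: chain_complex R X by (rule X_complex)

definition J where "J = dgd A ` homog A 1"

lemma J_boundaries: "boundaries X 0 = J"
  by (simp add: boundaries_def J_def)

lemma J_closed: "J \<subseteq> homog A 0"
  unfolding J_def using dg.d_homog[of _ 1] by auto

lemma X_cyclic: "cyclic_complex R X J \<one>"
proof (intro cyclic_complex.intro cyclic_complex_axioms.intro X_complex)
  show "carrier (obj X i) = {\<zero>\<^bsub>obj X i\<^esub>}" if "i < 0" for i using dg.homog_neg[OF that] by simp
  show "\<one> \<in> carrier (obj X 0)" using dg.homog_one by simp
  show "J \<subseteq> carrier R" using J_closed by simp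
  show "r \<odot>\<^bsub>obj X 0\<^esub> \<one> \<in> boundaries X 0 \<longleftrightarrow> r \<in> J" if "r \<in> carrier R" for r
    unfolding J_boundaries using that by (simp add: smult_eq homog_carr)
  fix r x i assume "r \<in> J" and x: "x \<in> cycles X i"
  then obtain a where a: "a \<in> homog A 1" "r = dgd A a" unfolding J_def by blast
  have x': "x \<in> homog A i" "dgd A x = \<zero>" using x unfolding cycles_def by simp_all
  have r: "r \<in> homog A 0" using a dg.d_homog[OF a(1)] by simp
  have "dgd A (a \<otimes> x) = r \<otimes> x"
    using dg.leibniz[OF a(1) x'(1)] x' r a homog_carr by simp
  moreover have "a \<otimes> x \<in> homog A (i + 1)" using dg.homog_mult[OF a(1) x'(1)] by (simp add: add.commute)
  ultimately show "r \<odot>\<^bsub>obj X i\<^esub> x \<in> boundaries X i"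
    unfolding boundaries_def using r x'(1) homog_carr by (force simp: smult_eq)
qed

end

text \<open>A model of \<open>K(x) \<otimes> A\<close>: the element \<open>c\<close> stands for \<open>\<Sum>\<^sub>I e\<^sub>I \<otimes> c I\<close>.\<close>

locale koszul_model = dg_over_deg0 +
  fixes xs :: "'a list"
  assumes xs: "set xs \<subseteq> homog A 0"
begin

abbreviation "D \<equiv> {..<length xs}"

text \<open>Indexed by all sets of naturals, with zero components outside \<open>D\<close>, so that
  \<open>direct_sum\<close> over this index type yields exactly the families on the subsets of
  \<open>D\<close>.\<close>

definition comp :: "int \<Rightarrow> nat set \<Rightarrow> ('a, 'a) module" where
  "comp n I = module_record (if I \<subseteq> D then homog A (n - int (card I)) else {\<zero>}) (ring.add A) \<zero> (smult A)"

text \<open>Exponent of the sign for moving \<open>e_i\<close> past those factors of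
  \<open>e_I\<close> that have a smaller index.\<close>

definition sg :: "nat set \<Rightarrow> nat \<Rightarrow> int" where "sg I i = int (card {j \<in> I. j < i})"

definition kd :: "(nat set \<Rightarrow> 'a) \<Rightarrow> nat set \<Rightarrow> 'a" where
  "kd c I = (\<Oplus>i\<in>D - I. signed A (sg I i) (xs ! i \<otimes> c (insert i I)))"

text \<open>The sign in front of \<open>dgd\<close> is the one with which the tensor differential
  passes \<open>e_I\<close>, an element of degree \<open>card I\<close>.\<close>

definition C :: "('a, nat set \<Rightarrow> 'a) cplx" where
  "C = \<lparr>obj = (\<lambda>n. direct_sum (comp n)),
        bd = (\<lambda>n c I. kd c I \<oplus> signed A (int (card I)) (dgd A (c I)))\<rparr>"

lemma bd_C: "bd C n c I = kd c I \<oplus> signed A (int (card I)) (dgd A (c I))"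
  by (simp add: C_def)

lemma C_ops [simp]:
  "c \<oplus>\<^bsub>obj C n\<^esub> c' = (\<lambda>I. c I \<oplus> c' I)" "\<zero>\<^bsub>obj C n\<^esub> = (\<lambda>I. \<zero>)" "r \<odot>\<^bsub>obj C n\<^esub> c = (\<lambda>I. r \<odot> c I)"
  by (simp_all add: C_def direct_sum_def comp_def)

lemma C_mem:
  "c \<in> carrier (obj C n) \<longleftrightarrow>
     (\<forall>I. I \<subseteq> D \<longrightarrow> c I \<in> homog A (n - int (card I))) \<and> (\<forall>I. \<not> I \<subseteq> D \<longrightarrow> c I = \<zero>)"
proof
  assume "c \<in> carrier (obj C n)"
  then have "c I \<in> carrier (comp n I)" for I using direct_sumD(1)[of c "comp n"] by (simp add: C_def)
  then show "(\<forall>I. I \<subseteq> D \<longrightarrow> c I \<in> homog A (n - int (card I))) \<and> (\<forall>I. \<not> I \<subseteq> D \<longrightarrow> c I = \<zero>)"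
    unfolding comp_def by (metis module_record_simps(1) singletonD)
next
  assume c: "(\<forall>I. I \<subseteq> D \<longrightarrow> c I \<in> homog A (n - int (card I))) \<and> (\<forall>I. \<not> I \<subseteq> D \<longrightarrow> c I = \<zero>)"
  have "c \<in> carrier (direct_sum (comp n))"
  proof (rule direct_sum_mem[where S = "Pow D"])
    show "c I \<in> carrier (comp n I)" for I using c by (simp add: comp_def)
    show "c I = \<zero>\<^bsub>comp n I\<^esub>" if "I \<notin> Pow D" for I using c that by (simp add: comp_def)
  qed simp
  then show "c \<in> carrier (obj C n)" by (simp add: C_def)
qed

lemma C_D:
  assumes "c \<in> carrier (obj C n)"
  shows "I \<subseteq> D \<Longrightarrow> c I \<in> homog A (n - int (card I))" "\<not> I \<subseteq> D \<Longrightarrow> c I = \<zero>" "c I \<in> carrier A"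
proof -
  show 1: "I \<subseteq> D \<Longrightarrow> c I \<in> homog A (n - int (card I))" and 2: "\<not> I \<subseteq> D \<Longrightarrow> c I = \<zero>"
    using assms unfolding C_mem by blast+
  show "c I \<in> carrier A" by (cases "I \<subseteq> D") (use 1 2 homog_carr in auto)
qed

lemma comp_module: "module R (comp n I)"
proof (cases "I \<subseteq> D")
  case True
  then have "comp n I = obj X (n - int (card I))" by (simp add: comp_def dg_cplx_def)
  then show ?thesis using X_module by simp
next
  case False
  have "obj X (-1) = comp n I" using False dg.homog_neg[of "-1"] by (simp add: comp_def dg_cplx_def)
  then show ?thesis using X_module[of "-1"] by simp
qed

lemma C_module: "module R (obj C n)"
  using R.direct_sum_module[of "comp n", OF comp_module] by (simp add: C_def)

lemma xs_nth: "i \<in> D \<Longrightarrow> xs ! i \<in> homog A 0"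
  using xs nth_mem by auto

lemma xs_carr: "i \<in> D \<Longrightarrow> xs ! i \<in> carrier A"
  using xs_nth homog_carr by blast

lemma card_ins: "\<lbrakk>I \<subseteq> D; i \<in> D - I\<rbrakk> \<Longrightarrow> int (card (insert i I)) = 1 + int (card I)"
  using finite_subset[of I D] by simp

lemma sg_insert: "\<lbrakk>I \<subseteq> D; k \<notin> I\<rbrakk> \<Longrightarrow> sg (insert k I) i = sg I i + (if k < i then 1 else 0)"
proof -
  assume I: "I \<subseteq> D" "k \<notin> I"
  have f: "finite {j \<in> I. j < i}" using finite_subset[OF I(1)] by simp
  have "{j \<in> insert k I. j < i} = (if k < i then insert k {j \<in> I. j < i} else {j \<in> I. j < i})" by auto
  then show ?thesis unfolding sg_def using f I(2) by simp
qed

lemma kd_term_homog: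
  assumes c: "c \<in> carrier (obj C n)" and I: "I \<subseteq> D" and i: "i \<in> D - I"
  shows "xs ! i \<otimes> c (insert i I) \<in> homog A (n - 1 - int (card I))"
proof -
  have "insert i I \<subseteq> D" using I i by blast
  then have "c (insert i I) \<in> homog A (n - int (card (insert i I)))" by (rule C_D(1)[OF c])
  moreover have "n - int (card (insert i I)) = n - 1 - int (card I)" using card_ins[OF I i] by simp
  ultimately have "c (insert i I) \<in> homog A (n - 1 - int (card I))" by simp
  then show ?thesis using homogD(4)[OF xs_nth] i by blast
qed

lemma kd_outside:
  assumes c: "c \<in> carrier (obj C n)" and I: "\<not> I \<subseteq> D"
  shows "kd c I = \<zero>"
  unfolding kd_def
proof (rule A.add.finprod_one_eqI)
  fix i assume i: "i \<in> D - I"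
  have "c (insert i I) = \<zero>" by (rule C_D(2)[OF c]) (use I in blast)
  then show "signed A (sg I i) (xs ! i \<otimes> c (insert i I)) = \<zero>" using i xs_carr by simp
qed

lemma kd_homog:
  assumes c: "c \<in> carrier (obj C n)" and I: "I \<subseteq> D"
  shows "kd c I \<in> homog A (n - 1 - int (card I))"
  unfolding kd_def
proof (rule A.finsum_mem)
  show "\<forall>i\<in>D - I. signed A (sg I i) (xs ! i \<otimes> c (insert i I)) \<in> homog A (n - 1 - int (card I))"
    using kd_term_homog[OF c I] homogD(6) by blast
qed (use homogD in auto)

lemma kd_carr:
  assumes c: "c \<in> carrier (obj C n)"
  shows "kd c I \<in> carrier A"
proof (cases "I \<subseteq> D")
  case True
  then show ?thesis using homog_carr[OF kd_homog[OF c]] by simp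
next
  case False
  then show ?thesis using kd_outside[OF c] by simp
qed

lemma term_carr: "\<lbrakk>c \<in> carrier (obj C n); i \<in> D\<rbrakk> \<Longrightarrow> signed A k (xs ! i \<otimes> c I) \<in> carrier A"
  using C_D(3) xs_carr by simp

lemma bd_closed:
  assumes c: "c \<in> carrier (obj C n)"
  shows "bd C n c \<in> carrier (obj C (n - 1))"
  unfolding C_mem bd_C
proof (intro conjI allI impI)
  fix I assume I: "I \<subseteq> D"
  have "dgd A (c I) \<in> homog A (n - 1 - int (card I))"
    using dg.d_homog[OF C_D(1)[OF c I]] by (simp add: algebra_simps)
  then show "kd c I \<oplus> signed A (int (card I)) (dgd A (c I)) \<in> homog A (n - 1 - int (card I))"
    using kd_homog[OF c I] homogD(3,6) by blast
next
  fix I assume I: "\<not> I \<subseteq> D"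
  show "kd c I \<oplus> signed A (int (card I)) (dgd A (c I)) = \<zero>"
    using kd_outside[OF c I] C_D(2)[OF c I] by simp
qed

lemma kd_add:
  assumes c: "c \<in> carrier (obj C n)" and c': "c' \<in> carrier (obj C n)"
  shows "kd (\<lambda>I. c I \<oplus> c' I) I = kd c I \<oplus> kd c' I"
proof -
  have "kd (\<lambda>I. c I \<oplus> c' I) I = (\<Oplus>i\<in>D - I. signed A (sg I i) (xs ! i \<otimes> c (insert i I)) \<oplus>
      signed A (sg I i) (xs ! i \<otimes> c' (insert i I)))"
    unfolding kd_def
  proof (rule A.finsum_cong')
    fix i assume "i \<in> D - I"
    then show "signed A (sg I i) (xs ! i \<otimes> (c (insert i I) \<oplus> c' (insert i I))) =
        signed A (sg I i) (xs ! i \<otimes> c (insert i I)) \<oplus> signed A (sg I i) (xs ! i \<otimes> c' (insert i I))"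
      using xs_carr C_D(3)[OF c] C_D(3)[OF c'] by (simp add: A.r_distr A.signed_add)
  qed (use term_carr[OF c] term_carr[OF c'] in auto)
  also have "\<dots> = kd c I \<oplus> kd c' I" unfolding kd_def
    by (rule A.finsum_addf) (use term_carr[OF c] term_carr[OF c'] in auto)
  finally show ?thesis .
qed

lemma kd_smult:
  assumes c: "c \<in> carrier (obj C n)" and r: "r \<in> homog A 0"
  shows "kd (\<lambda>I. r \<otimes> c I) I = r \<otimes> kd c I"
proof -
  have rA: "r \<in> carrier A" using r homog_carr by blast
  have "r \<otimes> kd c I = (\<Oplus>i\<in>D - I. r \<otimes> signed A (sg I i) (xs ! i \<otimes> c (insert i I)))"
    unfolding kd_def by (rule A.finsum_rdistr) (use term_carr[OF c] rA in auto)
  also have "\<dots> = kd (\<lambda>I. r \<otimes> c I) I" unfolding kd_def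
  proof (rule A.finsum_cong')
    fix i assume i: "i \<in> D - I"
    have cc: "xs ! i \<in> carrier A" "c (insert i I) \<in> carrier A" using i xs_carr C_D(3)[OF c] by auto
    have "r \<otimes> (xs ! i \<otimes> c (insert i I)) = xs ! i \<otimes> (r \<otimes> c (insert i I))"
      using deg0_comm[OF r xs_nth[of i]] i cc rA by (simp add: A.m_assoc[symmetric])
    then show "r \<otimes> signed A (sg I i) (xs ! i \<otimes> c (insert i I)) =
        signed A (sg I i) (xs ! i \<otimes> (r \<otimes> c (insert i I)))"
      using cc rA by (simp add: mult_signed)
  qed (use xs_carr C_D(3)[OF c] rA in auto)
  finally show ?thesis by simp
qed

lemma C_smult: "\<lbrakk>c \<in> carrier (obj C n); r \<in> homog A 0\<rbrakk> \<Longrightarrow> r \<odot>\<^bsub>obj C n\<^esub> c = (\<lambda>I. r \<otimes> c I)"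
  using C_D(3) smult_eq by auto

lemma d_c_carr:
  assumes c: "c \<in> carrier (obj C n)"
  shows "dgd A (c I) \<in> carrier A"
proof (cases "I \<subseteq> D")
  case True
  then show ?thesis using homog_carr[OF dg.d_homog[OF C_D(1)[OF c]]] by simp
next
  case False
  then show ?thesis using C_D(2)[OF c] by simp
qed

lemma d_c_smult:
  assumes c: "c \<in> carrier (obj C n)" and r: "r \<in> homog A 0"
  shows "dgd A (r \<otimes> c I) = r \<otimes> dgd A (c I)"
  using d_smult[OF r C_D(1)[OF c]] C_D(2)[OF c] homog_carr[OF r] by (cases "I \<subseteq> D") auto

lemma d_c_signed:
  assumes c: "c \<in> carrier (obj C n)"
  shows "dgd A (signed A k (c I)) = signed A k (dgd A (c I))"
  using d_signed[OF C_D(1)[OF c]] C_D(2)[OF c] by (cases "I \<subseteq> D") auto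

lemma C_linear: "linear_map R (obj C n) (obj C (n - 1)) (bd C n)"
proof (rule linear_mapI)
  show "bd C n c \<in> carrier (obj C (n - 1))" if "c \<in> carrier (obj C n)" for c by (rule bd_closed[OF that])
  fix c assume c: "c \<in> carrier (obj C n)"
  show "bd C n (c \<oplus>\<^bsub>obj C n\<^esub> c') = bd C n c \<oplus>\<^bsub>obj C (n - 1)\<^esub> bd C n c'" if c': "c' \<in> carrier (obj C n)" for c'
  proof
    fix I
    have "dgd A (c I \<oplus> c' I) = dgd A (c I) \<oplus> dgd A (c' I)"
      by (rule dg.d_add) (use C_D(3)[OF c] C_D(3)[OF c'] in simp_all)
    then show "bd C n (c \<oplus>\<^bsub>obj C n\<^esub> c') I = (bd C n c \<oplus>\<^bsub>obj C (n - 1)\<^esub> bd C n c') I"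
      using kd_carr[OF c] kd_carr[OF c'] d_c_carr[OF c] d_c_carr[OF c']
      by (simp add: bd_C kd_add[OF c c'] A.signed_add A.a_ac)
  qed
  show "bd C n (r \<odot>\<^bsub>obj C n\<^esub> c) = r \<odot>\<^bsub>obj C (n - 1)\<^esub> bd C n c" if "r \<in> carrier R" for r
  proof
    fix I
    have r: "r \<in> homog A 0" "r \<in> carrier A" using that homog_carr by simp_all
    show "bd C n (r \<odot>\<^bsub>obj C n\<^esub> c) I = (r \<odot>\<^bsub>obj C (n - 1)\<^esub> bd C n c) I"
      unfolding C_smult[OF c r(1)] C_smult[OF bd_closed[OF c] r(1)] bd_C kd_smult[OF c r(1)] d_c_smult[OF c r(1)]
      using r kd_carr[OF c] d_c_carr[OF c] by (simp add: A.r_distr mult_signed)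
  qed
qed

text \<open>The double sum over pairs \<open>(i, j)\<close> is antisymmetric: the product of both
  entries with the coefficient is symmetric, while exactly one of \<open>i < j\<close> and
  \<open>j < i\<close> holds, so that an exchange flips the sign.\<close>

lemma kd_kd:
  assumes c: "c \<in> carrier (obj C n)" and I: "I \<subseteq> D"
  shows "kd (kd c) I = \<zero>"
proof -
  let ?a = "\<lambda>i j. signed A (sg I i + (sg I j + (if i < j then 1 else 0))) (xs ! i \<otimes> (xs ! j \<otimes> c (insert j (insert i I))))"
  have "kd (kd c) I = (\<Oplus>i\<in>D - I. \<Oplus>j\<in>(D - I) - {i}. ?a i j)"
    unfolding kd_def[of "kd c"]
  proof (rule A.finsum_cong')
    show "(\<lambda>i. \<Oplus>j\<in>(D - I) - {i}. ?a i j) \<in> D - I \<rightarrow> carrier A"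
      by (rule Pi_I, rule A.finsum_closed, rule Pi_I) (use xs_carr C_D(3)[OF c] in simp)
    fix i assume i: "i \<in> D - I"
    have xi: "xs ! i \<in> carrier A" using i xs_carr by blast
    have set: "D - insert i I = (D - I) - {i}" by blast
    have tc: "(\<lambda>j. signed A (sg (insert i I) j) (xs ! j \<otimes> c (insert j (insert i I)))) \<in> (D - I) - {i} \<rightarrow> carrier A"
      by (rule Pi_I, rule term_carr[OF c]) blast
    have "xs ! i \<otimes> kd c (insert i I) =
        (\<Oplus>j\<in>(D - I) - {i}. xs ! i \<otimes> signed A (sg (insert i I) j) (xs ! j \<otimes> c (insert j (insert i I))))"
      unfolding kd_def set by (rule A.finsum_rdistr[OF _ xi tc]) simp
    then have "signed A (sg I i) (xs ! i \<otimes> kd c (insert i I)) =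
        (\<Oplus>j\<in>(D - I) - {i}. signed A (sg I i) (xs ! i \<otimes> signed A (sg (insert i I) j) (xs ! j \<otimes> c (insert j (insert i I)))))"
      using A.signed_finsum[of "(D - I) - {i}" "\<lambda>j. xs ! i \<otimes> signed A (sg (insert i I) j) (xs ! j \<otimes> c (insert j (insert i I)))" "sg I i"]
        tc xi by (simp add: Pi_def)
    also have "\<dots> = (\<Oplus>j\<in>(D - I) - {i}. ?a i j)"
    proof (rule A.finsum_cong')
      show "?a i \<in> (D - I) - {i} \<rightarrow> carrier A" by (rule Pi_I) (use xs_carr xi C_D(3)[OF c] in simp)
      fix j assume j: "j \<in> (D - I) - {i}"
      have xj: "xs ! j \<in> carrier A" "c (insert j (insert i I)) \<in> carrier A" using j xs_carr C_D(3)[OF c] by auto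
      have "sg (insert i I) j = sg I j + (if i < j then 1 else 0)" using sg_insert[OF I] i by blast
      then show "signed A (sg I i) (xs ! i \<otimes> signed A (sg (insert i I) j) (xs ! j \<otimes> c (insert j (insert i I)))) = ?a i j"
        using xi xj by (simp add: mult_signed A.signed_signed)
    qed simp
    finally show "signed A (sg I i) (xs ! i \<otimes> kd c (insert i I)) = (\<Oplus>j\<in>(D - I) - {i}. ?a i j)" .
  qed simp
  also have "\<dots> = \<zero>"
  proof (rule A.finsum_finsum_antisym, simp, intro ballI impI conjI)
    fix i j assume i: "i \<in> D - I" and j: "j \<in> D - I" and ij: "i \<noteq> j"
    have cc: "xs ! i \<in> carrier A" "xs ! j \<in> carrier A" "c (insert j (insert i I)) \<in> carrier A"
      using i j xs_carr C_D(3)[OF c] by auto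
    show "?a i j \<in> carrier A" using cc by simp
    have comm: "xs ! j \<otimes> (xs ! i \<otimes> c (insert i (insert j I))) = xs ! i \<otimes> (xs ! j \<otimes> c (insert j (insert i I)))"
      using deg0_comm[OF xs_nth[of i] xs_nth[of j]] i j cc by (simp add: A.m_assoc[symmetric] insert_commute)
    have sgn: "signed A (sg I j + (sg I i + (if j < i then 1 else 0))) y = \<ominus> signed A (sg I i + (sg I j + (if i < j then 1 else 0))) y"
      if "y \<in> carrier A" for y
    proof -
      have "\<ominus> signed A (sg I i + (sg I j + (if i < j then 1 else 0))) y =
         signed A (1 + (sg I i + (sg I j + (if i < j then 1 else 0)))) y" by (rule A.signed_Suc[OF that, symmetric])
      also have "\<dots> = signed A (sg I j + (sg I i + (if j < i then 1 else 0))) y"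
        by (rule A.signed_cong) (use ij in auto)
      finally show ?thesis by simp
    qed
    show "?a j i = \<ominus> ?a i j" unfolding comm by (rule sgn) (use cc in simp)
  qed
  finally show ?thesis .
qed

text \<open>The Koszul part and the internal part each square to zero, and they anticommute:
  coefficients entering \<open>kd\<close> at \<open>I\<close> are taken at sets with one element
  more, which changes the sign in front of \<open>dgd\<close>.\<close>

lemma C_bd_bd:
  assumes c: "c \<in> carrier (obj C n)"
  shows "bd C (n - 1) (bd C n c) = (\<lambda>I. \<zero>)"
proof
  fix I
  show "bd C (n - 1) (bd C n c) I = \<zero>"
  proof (cases "I \<subseteq> D")
    case False
    have "bd C (n - 1) (bd C n c) \<in> carrier (obj C (n - 1 - 1))" by (intro bd_closed c)
    then show ?thesis by (rule C_D(2)[OF _ False])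
  next
    case I: True
    let ?k = "int (card I)"
    let ?dc = "\<lambda>I. signed A (int (card I)) (dgd A (c I))"
    have kc: "kd c \<in> carrier (obj C (n - 1))"
      unfolding C_mem using kd_homog[OF c] kd_outside[OF c] by blast
    have dcc: "?dc \<in> carrier (obj C (n - 1))"
      unfolding C_mem
    proof (intro conjI allI impI)
      fix I assume I: "I \<subseteq> D"
      show "?dc I \<in> homog A (n - 1 - int (card I))"
        using homogD(6)[OF dg.d_homog[OF C_D(1)[OF c I]]] by (simp add: algebra_simps)
    qed (use C_D(2)[OF c] in simp)
    have bde: "bd C n c = (\<lambda>I. kd c I \<oplus> ?dc I)" by (rule ext) (rule bd_C)
    have 1: "kd (bd C n c) I = kd ?dc I"
      unfolding bde kd_add[OF kc dcc] kd_kd[OF c I] using kd_carr[OF dcc] by simp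
    have dk: "dgd A (kd c I) = (\<Oplus>i\<in>D - I. signed A (sg I i) (xs ! i \<otimes> dgd A (c (insert i I))))"
    proof -
      have "dgd A (kd c I) = (\<Oplus>i\<in>D - I. dgd A (signed A (sg I i) (xs ! i \<otimes> c (insert i I))))"
        unfolding kd_def by (rule d_finsum) (use term_carr[OF c] in auto)
      also have "\<dots> = (\<Oplus>i\<in>D - I. signed A (sg I i) (xs ! i \<otimes> dgd A (c (insert i I))))"
      proof (rule A.finsum_cong')
        fix i assume i: "i \<in> D - I"
        show "dgd A (signed A (sg I i) (xs ! i \<otimes> c (insert i I))) = signed A (sg I i) (xs ! i \<otimes> dgd A (c (insert i I)))"
          using d_signed[OF kd_term_homog[OF c I i]] d_c_smult[OF c xs_nth[of i]] i by simp
      qed (use xs_carr d_c_carr[OF c] in auto)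
      finally show ?thesis .
    qed
    have 2: "kd ?dc I = \<ominus> signed A ?k (dgd A (kd c I))"
    proof -
      let ?t = "\<lambda>i. signed A (sg I i) (xs ! i \<otimes> dgd A (c (insert i I)))"
      have tc: "\<forall>i\<in>D - I. ?t i \<in> carrier A" using xs_carr d_c_carr[OF c] by simp
      have "\<ominus> signed A ?k (dgd A (kd c I)) = signed A (1 + ?k) (\<Oplus>i\<in>D - I. ?t i)"
        unfolding dk by (rule A.signed_Suc[symmetric]) (rule A.finsum_closed, use tc in auto)
      also have "\<dots> = (\<Oplus>i\<in>D - I. signed A (1 + ?k) (?t i))"
        by (rule A.signed_finsum) (use tc in simp_all)
      also have "\<dots> = kd ?dc I" unfolding kd_def
      proof (rule A.finsum_cong')
        fix i assume i: "i \<in> D - I"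
        have cc: "xs ! i \<in> carrier A" "dgd A (c (insert i I)) \<in> carrier A" using i xs_carr d_c_carr[OF c] by auto
        show "signed A (1 + ?k) (?t i) = signed A (sg I i) (xs ! i \<otimes> signed A (int (card (insert i I))) (dgd A (c (insert i I))))"
          unfolding card_ins[OF I i] using cc by (simp add: mult_signed A.signed_signed add.commute)
      qed (use xs_carr d_c_carr[OF c] in auto)
      finally show ?thesis by simp
    qed
    have dcI: "dgd A (kd c I \<oplus> ?dc I) = dgd A (kd c I) \<oplus> dgd A (?dc I)"
      by (rule dg.d_add) (use kd_carr[OF c] d_c_carr[OF c] in simp_all)
    have "dgd A (?dc I) = \<zero>"
      using d_signed[OF dg.d_homog[OF C_D(1)[OF c I]]] dg.d_d[OF C_D(3)[OF c]] by simp
    moreover have dkc: "dgd A (kd c I) \<in> carrier A" using d_c_carr[OF kc] .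
    ultimately have "dgd A (bd C n c I) = dgd A (kd c I)" unfolding bde using dcI by simp
    then show ?thesis unfolding bd_C[of "n - 1"] 1 2 using dkc by (simp add: A.l_neg)
  qed
qed

lemma C_complex: "chain_complex R C"
  by (intro chain_complex.intro chain_complex_axioms.intro R.is_cring C_module C_linear)
    (use C_bd_bd in simp)

end

section \<open>Homology of the Koszul complex\<close>

lemma linear_map_image_submodule:
  assumes M: "module R M" and N: "module R N" and f: "linear_map R M N f" and K: "submodule K R M"
  shows "submodule (f ` K) R N"
proof -
  interpret M: rmodule R M by (intro rmodule.intro M)
  interpret N: rmodule R N by (intro rmodule.intro N)
  note fd = linear_mapD[OF f] and Kd = M.submoduleD[OF K]
  have KM: "\<And>x. x \<in> K \<Longrightarrow> x \<in> carrier M" using Kd(1) by blast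
  show ?thesis
  proof (rule N.submodule_of_closed)
    show "f ` K \<subseteq> carrier N" using fd(1) KM by blast
    show "\<zero>\<^bsub>N\<^esub> \<in> f ` K" using linear_map_zero[OF M N f] Kd(2) by (metis imageI)
    fix x y assume "x \<in> f ` K" "y \<in> f ` K"
    then obtain a b where ab: "a \<in> K" "b \<in> K" "x = f a" "y = f b" by blast
    have "x \<oplus>\<^bsub>N\<^esub> y = f (a \<oplus>\<^bsub>M\<^esub> b)" using ab fd(2) KM by simp
    then show "x \<oplus>\<^bsub>N\<^esub> y \<in> f ` K" using Kd(3)[OF ab(1,2)] by simp
  next
    fix r x assume r: "r \<in> carrier R" and "x \<in> f ` K"
    then obtain a where ab: "a \<in> K" "x = f a" by blast
    have "r \<odot>\<^bsub>N\<^esub> x = f (r \<odot>\<^bsub>M\<^esub> a)" using ab fd(3) r KM by simp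
    then show "r \<odot>\<^bsub>N\<^esub> x \<in> f ` K" using Kd(4)[OF r ab(1)] by simp
  qed
qed

context koszul_model
begin

sublocale C: chain_complex R C by (rule C_complex)

lemma C_cycle_eq:
  assumes "c \<in> cycles C n"
  shows "c \<in> carrier (obj C n)" "kd c I \<oplus> signed A (int (card I)) (dgd A (c I)) = \<zero>"
proof -
  show "c \<in> carrier (obj C n)" using assms by (simp add: cycles_def)
  have "bd C n c = (\<lambda>I. \<zero>)" using assms by (simp add: cycles_def)
  then show "kd c I \<oplus> signed A (int (card I)) (dgd A (c I)) = \<zero>"
    using bd_C[of n c I] by simp
qed

lemma boundaries_C_I:
  assumes "e \<in> carrier (obj C (n + 1))" "c \<in> carrier (obj C n)" "\<And>I. I \<subseteq> D \<Longrightarrow> bd C (n + 1) e I = c I"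
  shows "c \<in> boundaries C n"
proof -
  have "bd C (n + 1) e \<in> carrier (obj C n)" using bd_closed[OF assms(1)] by simp
  then have "bd C (n + 1) e = c" using assms(3) C_D(2)[OF assms(2)] C_D(2) by (intro ext) metis
  then show ?thesis unfolding boundaries_def using assms(1) by blast
qed

lemma kd_eq_neg:
  assumes "c \<in> cycles C n"
  shows "kd c I = \<ominus> signed A (int (card I)) (dgd A (c I))"
  using A.minus_equality[OF C_cycle_eq(2)[OF assms, of I]] kd_carr[OF C_cycle_eq(1)[OF assms]]
    d_c_carr[OF C_cycle_eq(1)[OF assms]] by simp

text \<open>Multiplication by \<open>x\<^sub>k\<close> is null-homotopic, the homotopy being exterior multiplication by \<open>e\<^sub>k\<close>.\<close>

lemma x_annihilates:
  assumes k: "k \<in> D" and z: "c \<in> cycles C n"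
  shows "xs ! k \<odot>\<^bsub>obj C n\<^esub> c \<in> boundaries C n"
proof -
  note c = C_cycle_eq(1)[OF z]
  let ?h = "\<lambda>J. if k \<in> J then signed A (sg J k) (c (J - {k})) else \<zero>"
  have xk: "xs ! k \<in> homog A 0" "xs ! k \<in> carrier A" using k xs_nth xs_carr by blast+
  have h: "?h \<in> carrier (obj C (n + 1))"
    unfolding C_mem
  proof (intro conjI allI impI)
    fix J assume J: "J \<subseteq> D"
    show "?h J \<in> homog A (n + 1 - int (card J))"
    proof (cases "k \<in> J")
      case True
      have fJ: "finite J" using finite_subset[OF J] by simp
      have "card J = Suc (card (J - {k}))" using card.remove[OF fJ True] .
      then have e: "n - int (card (J - {k})) = n + 1 - int (card J)" by simp
      have "c (J - {k}) \<in> homog A (n - int (card (J - {k})))" using C_D(1)[OF c, of "J - {k}"] J by blast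
      then have "c (J - {k}) \<in> homog A (n + 1 - int (card J))" unfolding e .
      then show ?thesis using True homogD(6) by simp
    next
      case False then show ?thesis using homogD(2) by simp
    qed
  next
    fix J assume J: "\<not> J \<subseteq> D"
    have "\<not> J - {k} \<subseteq> D" using J k by blast
    then show "?h J = \<zero>" using C_D(2)[OF c] by simp
  qed
  show ?thesis unfolding C_smult[OF c xk(1)]
  proof (rule boundaries_C_I[OF h])
    show "(\<lambda>I. xs ! k \<otimes> c I) \<in> carrier (obj C n)"
      using C.O.smult_closed[of "xs ! k" c n] xk(1) c unfolding C_smult[OF c xk(1)] by simp
    fix J assume J: "J \<subseteq> D"
    show "bd C (n + 1) ?h J = xs ! k \<otimes> c J"
    proof (cases "k \<in> J")
      case False
      \<comment> \<open>Only the term with \<open>i = k\<close> survives, and its two signs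
        cancel.\<close>
      have "kd ?h J = (\<Oplus>i\<in>D - J. if k = i then xs ! k \<otimes> c J else \<zero>)"
        unfolding kd_def
      proof (rule A.finsum_cong')
        fix i assume i: "i \<in> D - J"
        show "signed A (sg J i) (xs ! i \<otimes> ?h (insert i J)) = (if k = i then xs ! k \<otimes> c J else \<zero>)"
        proof (cases "k = i")
          case True
          have "insert i J - {k} = J" using i True by blast
          moreover have "sg (insert i J) k = sg J k" using sg_insert[OF J, of i k] i True by simp
          moreover have "signed A (sg J k) (signed A (sg J k) (xs ! k \<otimes> c J)) = xs ! k \<otimes> c J"
            using A.signed_signed[of "xs ! k \<otimes> c J"] xk(2) C_D(3)[OF c] by (simp add: signed_def)
          ultimately show ?thesis using True mult_signed[OF xk(2) C_D(3)[OF c]] by simp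
        next
          case neq: False
          then have "?h (insert i J) = \<zero>" using False by simp
          then show ?thesis using neq i xs_carr by simp
        qed
      qed (use xk(2) C_D(3)[OF c] in auto)
      also have "\<dots> = xs ! k \<otimes> c J"
        by (rule A.finsum_singleton) (use k False xk(2) C_D(3)[OF c] in auto)
      finally show ?thesis unfolding bd_C using False xk(2) C_D(3)[OF c] by simp
    next
      case True
      \<comment> \<open>The cycle equation of \<open>c\<close> at \<open>J'\<close> has, up to a
        common sign, the terms of \<open>bd C (n + 1) ?h J\<close> and one more, the term with index
        \<open>k\<close>. That term is \<open>xs ! k \<otimes> c J\<close>, so solving for it gives
        the claim.\<close>
      define J' where "J' = J - {k}"
      have J': "J' \<subseteq> D" "k \<notin> J'" "J = insert k J'" using J True unfolding J'_def by auto
      have DJ: "D - J' = insert k (D - J)" using J' k by blast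
      have kDJ: "k \<notin> D - J" using True by simp
      let ?t = "\<lambda>i. signed A (sg J' i) (xs ! i \<otimes> c (insert i J'))"
      let ?S = "\<Oplus>i\<in>D - J. ?t i"
      have tc: "\<forall>i\<in>D. ?t i \<in> carrier A" using term_carr[OF c] by blast
      have Sc: "?S \<in> carrier A" by (rule A.finsum_closed) (use tc in auto)
      have sgk: "sg J k = sg J' k" using sg_insert[OF J'(1,2), of k] J'(3) by simp
      have hJ: "?h J = signed A (sg J' k) (c J')" using True sgk unfolding J'_def by simp
      have kd1: "kd ?h J = \<ominus> signed A (sg J' k) ?S"
      proof -
        have "\<ominus> signed A (sg J' k) ?S = signed A (1 + sg J' k) ?S" by (rule A.signed_Suc[OF Sc, symmetric])
        also have "\<dots> = (\<Oplus>i\<in>D - J. signed A (1 + sg J' k) (?t i))"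
          by (rule A.signed_finsum) (use tc in simp_all)
        also have "\<dots> = kd ?h J" unfolding kd_def
        proof (rule A.finsum_cong')
          fix i assume i: "i \<in> D - J"
          have ik: "i \<noteq> k" "i \<notin> J'" using i True J'(3) by auto
          have "insert i J - {k} = insert i J'" using ik J' by auto
          then have hi: "?h (insert i J) = signed A (sg (insert i J) k) (c (insert i J'))" using True by simp
          have s1: "sg (insert i J) k = sg J' k + (if i < k then 1 else 0)"
            using sg_insert[OF J, of i k] i sgk by simp
          have s2: "sg J i = sg J' i + (if k < i then 1 else 0)" using sg_insert[OF J'(1,2), of i] J'(3) by simp
          have cc: "xs ! i \<in> carrier A" "c (insert i J') \<in> carrier A" using i xs_carr C_D(3)[OF c] by auto
          have "signed A (sg J i) (xs ! i \<otimes> ?h (insert i J)) =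
              signed A (sg J i + sg (insert i J) k) (xs ! i \<otimes> c (insert i J'))"
            unfolding hi using cc by (simp add: mult_signed A.signed_signed)
          \<comment> \<open>Exactly one of \<open>i < k\<close> and \<open>k < i\<close> holds,
            which accounts for the additional 1.\<close>
          also have "\<dots> = signed A (1 + sg J' k + sg J' i) (xs ! i \<otimes> c (insert i J'))"
            by (rule A.signed_cong) (use ik(1) s1 s2 in auto)
          also have "\<dots> = signed A (1 + sg J' k) (?t i)" using cc by (simp add: A.signed_signed)
          finally show "signed A (1 + sg J' k) (?t i) = signed A (sg J i) (xs ! i \<otimes> ?h (insert i J))" by simp
        next
          show "(\<lambda>i. signed A (sg J i) (xs ! i \<otimes> ?h (insert i J))) \<in> D - J \<rightarrow> carrier A"
            by (rule Pi_I) (use term_carr[OF h] in blast)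
        qed simp
        finally show ?thesis by simp
      qed
      have kdJ': "kd c J' = signed A (sg J' k) (xs ! k \<otimes> c J) \<oplus> ?S"
        unfolding kd_def DJ J'(3)[symmetric]
      proof -
        have "(\<Oplus>i\<in>insert k (D - J). ?t i) = ?t k \<oplus> ?S"
          by (rule A.finsum_insert) (use kDJ tc k in auto)
        then show "(\<Oplus>i\<in>insert k (D - J). ?t i) = signed A (sg J' k) (xs ! k \<otimes> c J) \<oplus> ?S"
          using J'(3) by simp
      qed
      let ?d = "dgd A (c J')" and ?m = "int (card J')" and ?y = "xs ! k \<otimes> c J"
      have cd: "?d \<in> carrier A" "?y \<in> carrier A" using d_c_carr[OF c] xk(2) C_D(3)[OF c] by simp_all
      have cy: "signed A (sg J' k) ?y \<oplus> ?S \<oplus> signed A ?m ?d = \<zero>"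
        using C_cycle_eq(2)[OF z, of J'] unfolding kdJ' .
      have dh: "signed A (int (card J)) (dgd A (?h J)) = \<ominus> signed A (sg J' k) (signed A ?m ?d)"
      proof -
        have "int (card J) = 1 + ?m" using card_ins[OF J'(1), of k] J' k by simp
        then have "signed A (int (card J)) (dgd A (?h J)) = signed A (1 + ?m) (signed A (sg J' k) ?d)"
          unfolding hJ d_c_signed[OF c] by simp
        also have "\<dots> = \<ominus> signed A ?m (signed A (sg J' k) ?d)" by (rule A.signed_Suc) (use cd in simp)
        also have "signed A ?m (signed A (sg J' k) ?d) = signed A (sg J' k) (signed A ?m ?d)"
          using cd by (simp add: A.signed_signed add.commute)
        finally show ?thesis .
      qed
      have "bd C (n + 1) ?h J = \<ominus> signed A (sg J' k) ?S \<oplus> \<ominus> signed A (sg J' k) (signed A ?m ?d)"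
        unfolding bd_C kd1 dh ..
      also have "\<dots> = \<ominus> signed A (sg J' k) (?S \<oplus> signed A ?m ?d)"
        using Sc cd by (simp add: A.signed_add A.minus_add A.a_comm)
      also have "?S \<oplus> signed A ?m ?d = \<ominus> signed A (sg J' k) ?y"
      proof -
        have "(?S \<oplus> signed A ?m ?d) \<oplus> signed A (sg J' k) ?y = \<zero>"
          using cy Sc cd by (simp add: A.a_ac)
        then show ?thesis using A.minus_equality[of "?S \<oplus> signed A ?m ?d" "signed A (sg J' k) ?y"] Sc cd by simp
      qed
      also have "\<ominus> signed A (sg J' k) (\<ominus> signed A (sg J' k) ?y) = ?y"
        using cd by (simp add: signed_def)
      finally show ?thesis .
    qed
  qed
qed

text \<open>The homotopy is left multiplication by \<open>a\<close>, with the sign for passing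
  \<open>e_I\<close>. The Leibniz rule gives \<open>dgd A a\<close> times \<open>c\<close> and a
  rest, and the cycle equation makes this rest cancel against the Koszul part.\<close>

lemma d_annihilates:
  assumes a: "a \<in> homog A 1" and z: "c \<in> cycles C n"
  shows "dgd A a \<odot>\<^bsub>obj C n\<^esub> c \<in> boundaries C n"
proof -
  note c = C_cycle_eq(1)[OF z]
  have da: "dgd A a \<in> homog A 0" using dg.d_homog[OF a] by simp
  have aA: "a \<in> carrier A" "dgd A a \<in> carrier A" using a da homog_carr by blast+
  let ?h = "\<lambda>I. signed A (int (card I)) (a \<otimes> c I)"
  have ac: "a \<otimes> c I \<in> homog A (n + 1 - int (card I))" if "I \<subseteq> D" for I
    using dg.homog_mult[OF a C_D(1)[OF c that]] by (simp add: algebra_simps)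
  have h: "?h \<in> carrier (obj C (n + 1))"
    unfolding C_mem using homogD(6)[OF ac] C_D(2)[OF c] aA by simp
  show ?thesis unfolding C_smult[OF c da]
  proof (rule boundaries_C_I[OF h])
    show "(\<lambda>I. dgd A a \<otimes> c I) \<in> carrier (obj C n)"
      using C.O.smult_closed[of "dgd A a" c n] da c unfolding C_smult[OF c da] by simp
    fix I assume I: "I \<subseteq> D"
    let ?k = "int (card I)"
    note cI = C_D(3)[OF c, of I] d_c_carr[OF c, of I] kd_carr[OF c, of I]
    have "kd ?h I = (\<Oplus>i\<in>D - I. signed A (1 + ?k) (a \<otimes> signed A (sg I i) (xs ! i \<otimes> c (insert i I))))"
      unfolding kd_def
    proof (rule A.finsum_cong')
      fix i assume i: "i \<in> D - I"
      have cc: "xs ! i \<in> carrier A" "c (insert i I) \<in> carrier A" using i xs_carr C_D(3)[OF c] by auto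
      have "xs ! i \<otimes> (a \<otimes> c (insert i I)) = a \<otimes> (xs ! i \<otimes> c (insert i I))"
        using deg0_comm[OF xs_nth[of i] a] i cc aA by (simp add: A.m_assoc[symmetric])
      then show "signed A (sg I i) (xs ! i \<otimes> ?h (insert i I)) =
          signed A (1 + ?k) (a \<otimes> signed A (sg I i) (xs ! i \<otimes> c (insert i I)))"
        unfolding card_ins[OF I i] using cc aA by (simp add: mult_signed A.signed_signed add.commute)
    qed (use xs_carr C_D(3)[OF c] aA in auto)
    also have "\<dots> = signed A (1 + ?k) (\<Oplus>i\<in>D - I. a \<otimes> signed A (sg I i) (xs ! i \<otimes> c (insert i I)))"
      by (rule A.signed_finsum[symmetric]) (use xs_carr C_D(3)[OF c] aA in auto)
    also have "(\<Oplus>i\<in>D - I. a \<otimes> signed A (sg I i) (xs ! i \<otimes> c (insert i I))) = a \<otimes> kd c I"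
      unfolding kd_def by (rule A.finsum_rdistr[symmetric]) (use term_carr[OF c] aA in auto)
    also have "signed A (1 + ?k) (a \<otimes> kd c I) = \<ominus> signed A ?k (a \<otimes> kd c I)"
      by (rule A.signed_Suc) (use cI aA in simp)
    also have "\<dots> = a \<otimes> dgd A (c I)"
      unfolding kd_eq_neg[OF z] using cI aA by (simp add: signed_def A.r_minus)
    finally have 1: "kd ?h I = a \<otimes> dgd A (c I)" .
    have "dgd A (a \<otimes> c I) = dgd A a \<otimes> c I \<oplus> signed A 1 (a \<otimes> dgd A (c I))"
      by (rule dg.leibniz[OF a C_D(1)[OF c I]])
    then have l: "dgd A (a \<otimes> c I) = dgd A a \<otimes> c I \<oplus> \<ominus> (a \<otimes> dgd A (c I))" by (simp add: signed_def)
    have dc: "dgd A (a \<otimes> c I) \<in> carrier A" using homog_carr[OF dg.d_homog[OF ac[OF I]]] .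
    have 2: "signed A ?k (dgd A (?h I)) = dgd A (a \<otimes> c I)"
      unfolding d_signed[OF ac[OF I]] using dc by (simp add: signed_def)
    show "bd C (n + 1) ?h I = dgd A a \<otimes> c I"
      unfolding bd_C 1 2 l using A.a_lcomm[of "a \<otimes> dgd A (c I)" "dgd A a \<otimes> c I" "\<ominus> (a \<otimes> dgd A (c I))"]
        A.r_neg[of "a \<otimes> dgd A (c I)"] cI aA by simp
  qed
qed

text \<open>The ideal \<open>J + (x)\<close>, described by the coefficients at the empty set of the
  boundaries in degree 0, which is the form that \<open>cyclic_complex\<close> asks for.\<close>

definition JX where "JX = (\<lambda>c. bd C 1 c {}) ` carrier (obj C 1)"

definition unit where "unit = (\<lambda>I::nat set. if I = {} then \<one> else \<zero>)"

lemma bd_C_empty: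
  assumes c: "c \<in> carrier (obj C 1)"
  shows "bd C 1 c {} = (\<Oplus>i\<in>D. xs ! i \<otimes> c {i}) \<oplus> dgd A (c {})"
  by (simp add: bd_C kd_def sg_def signed_def)

lemma C0_eq:
  assumes "c \<in> carrier (obj C 0)" "I \<noteq> {}"
  shows "c I = \<zero>"
proof (cases "I \<subseteq> D")
  case True
  then have "card I > 0" using assms(2) finite_subset[of I D] by (simp add: card_gt_0_iff)
  then have "homog A (0 - int (card I)) = {\<zero>}" by (intro dg.homog_neg) simp
  then show ?thesis using C_D(1)[OF assms(1) True] by simp
next
  case False then show ?thesis using C_D(2)[OF assms(1)] by simp
qed

lemma JX_closed: "JX \<subseteq> homog A 0"
proof
  fix r assume "r \<in> JX"
  then obtain c where c: "c \<in> carrier (obj C 1)" "r = bd C 1 c {}" unfolding JX_def by blast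
  show "r \<in> homog A 0" using C_D(1)[OF bd_closed[OF c(1)], of "{}"] unfolding c(2) by simp
qed

lemma C_cyclic: "cyclic_complex R C JX unit"
proof (intro cyclic_complex.intro cyclic_complex_axioms.intro C_complex)
  show "JX \<subseteq> carrier R" using JX_closed by simp
  show u: "unit \<in> carrier (obj C 0)"
    unfolding C_mem unit_def using dg.homog_one homogD(2) by auto
  show "carrier (obj C i) = {\<zero>\<^bsub>obj C i\<^esub>}" if i: "i < 0" for i
  proof (intro equalityI subsetI)
    fix c assume c: "c \<in> carrier (obj C i)"
    have "c I = \<zero>" for I
    proof (cases "I \<subseteq> D")
      case True
      have "homog A (i - int (card I)) = {\<zero>}" using i by (intro dg.homog_neg) simp
      then show ?thesis using C_D(1)[OF c True] by simp
    next
      case False then show ?thesis using C_D(2)[OF c] by simp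
    qed
    then show "c \<in> {\<zero>\<^bsub>obj C i\<^esub>}" by auto
  next
    fix c assume "c \<in> {\<zero>\<^bsub>obj C i\<^esub>}"
    then show "c \<in> carrier (obj C i)" using C.O.M.zero_closed by simp
  qed
  show "r \<odot>\<^bsub>obj C 0\<^esub> unit \<in> boundaries C 0 \<longleftrightarrow> r \<in> JX" if "r \<in> carrier R" for r
  proof -
    have r: "r \<in> homog A 0" "r \<in> carrier A" using that homog_carr by simp_all
    have ru: "r \<odot>\<^bsub>obj C 0\<^esub> unit = (\<lambda>I. if I = {} then r else \<zero>)"
      unfolding C_smult[OF u r(1)] unfolding unit_def using r(2) by auto
    show ?thesis
    proof
      assume "r \<odot>\<^bsub>obj C 0\<^esub> unit \<in> boundaries C 0"
      then obtain c where c: "c \<in> carrier (obj C 1)" "r \<odot>\<^bsub>obj C 0\<^esub> unit = bd C 1 c" unfolding boundaries_def by auto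
      have "r = bd C 1 c {}" using fun_cong[OF c(2)[unfolded ru], of "{}"] by simp
      then show "r \<in> JX" unfolding JX_def using c(1) by blast
    next
      assume "r \<in> JX"
      then obtain c where c: "c \<in> carrier (obj C 1)" "r = bd C 1 c {}" unfolding JX_def by blast
      have b: "bd C 1 c \<in> carrier (obj C 0)" using bd_closed[OF c(1)] by simp
      have "bd C 1 c = r \<odot>\<^bsub>obj C 0\<^esub> unit" unfolding ru using c(2) C0_eq[OF b] by auto
      then show "r \<odot>\<^bsub>obj C 0\<^esub> unit \<in> boundaries C 0" unfolding boundaries_def using imageI[OF c(1), of "bd C 1"] by simp
    qed
  qed
  fix r z i assume "r \<in> JX" and z: "z \<in> cycles C i"
  then obtain c where c: "c \<in> carrier (obj C 1)" "r = bd C 1 c {}" unfolding JX_def by blast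
  note zc = C_cycle_eq(1)[OF z]
  \<comment> \<open>The scalars carrying \<open>z\<close> into the boundaries are closed under
    addition, so it suffices to find among them the summands of \<open>r\<close>: multiples of the
    \<open>xs ! k\<close> and one element of \<open>J\<close>.\<close>
  let ?H = "{s \<in> homog A 0. s \<odot>\<^bsub>obj C i\<^esub> z \<in> boundaries C i}"
  note Bd = C.O.submoduleD[OF C.boundaries_submodule[of i]]
  have H0: "\<zero> \<in> ?H" using Bd(2) C.O.smult_l_null[OF zc] homogD(2) by simp
  have Hadd: "\<forall>x\<in>?H. \<forall>y\<in>?H. x \<oplus> y \<in> ?H"
  proof (intro ballI)
    fix x y assume x: "x \<in> ?H" and y: "y \<in> ?H"
    have "(x \<oplus>\<^bsub>R\<^esub> y) \<odot>\<^bsub>obj C i\<^esub> z = x \<odot>\<^bsub>obj C i\<^esub> z \<oplus>\<^bsub>obj C i\<^esub> y \<odot>\<^bsub>obj C i\<^esub> z"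
      by (rule C.O.smult_l_distr) (use x y zc in simp_all)
    moreover have "x \<odot>\<^bsub>obj C i\<^esub> z \<oplus>\<^bsub>obj C i\<^esub> y \<odot>\<^bsub>obj C i\<^esub> z \<in> boundaries C i"
      by (rule Bd(3)) (use x y in simp_all)
    ultimately have "(x \<oplus> y) \<odot>\<^bsub>obj C i\<^esub> z \<in> boundaries C i" by simp
    then show "x \<oplus> y \<in> ?H" using x y homogD(3) by blast
  qed
  have trm: "xs ! k \<otimes> c {k} \<in> ?H" if k: "k \<in> D" for k
  proof -
    have ck: "c {k} \<in> homog A 0" using C_D(1)[OF c(1), of "{k}"] k by simp
    have "xs ! k \<otimes> c {k} = c {k} \<otimes>\<^bsub>R\<^esub> (xs ! k)" using deg0_comm[OF xs_nth[OF k] ck] by simp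
    moreover have "(c {k} \<otimes>\<^bsub>R\<^esub> (xs ! k)) \<odot>\<^bsub>obj C i\<^esub> z = c {k} \<odot>\<^bsub>obj C i\<^esub> (xs ! k \<odot>\<^bsub>obj C i\<^esub> z)"
      by (rule C.O.smult_assoc1) (use ck xs_nth[OF k] zc in simp_all)
    moreover have "c {k} \<odot>\<^bsub>obj C i\<^esub> (xs ! k \<odot>\<^bsub>obj C i\<^esub> z) \<in> boundaries C i"
      by (rule Bd(4)[OF _ x_annihilates[OF k z]]) (use ck in simp)
    ultimately show ?thesis using homogD(4)[OF xs_nth[OF k] ck] by simp
  qed
  have "(\<Oplus>i\<in>D. xs ! i \<otimes> c {i}) \<in> ?H"
    by (rule A.finsum_mem[OF _ H0 Hadd]) (use trm homogD(1) in auto)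
  moreover have "dgd A (c {}) \<in> ?H"
  proof -
    have "c {} \<in> homog A 1" using C_D(1)[OF c(1), of "{}"] by simp
    then show ?thesis using d_annihilates[OF _ z] dg.d_homog[of "c {}" 1] by simp
  qed
  ultimately have "r \<in> ?H" unfolding c(2) bd_C_empty[OF c(1)] using Hadd by blast
  then show "r \<odot>\<^bsub>obj C i\<^esub> z \<in> boundaries C i" by simp
qed

text \<open>Each element of \<open>J\<close> and each entry of \<open>xs\<close> is obtained from a
  chain with a single nonzero coefficient; conversely every element of \<open>JX\<close> is a sum of
  an element of \<open>J\<close> and multiples of entries of \<open>xs\<close>.\<close>

lemma primes_over_JX: "primes_over R JX = primes_over R (J \<union> set xs)"
proof (intro equalityI subsetI)
  fix P assume "P \<in> primes_over R JX"
  then have P: "primeideal P R" "JX \<subseteq> P" by (simp_all add: primes_over_def)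
  have "J \<subseteq> JX"
  proof
    fix r assume "r \<in> J"
    then obtain a where a: "a \<in> homog A 1" "r = dgd A a" unfolding J_def by blast
    let ?c = "\<lambda>I::nat set. if I = {} then a else \<zero>"
    have c: "?c \<in> carrier (obj C 1)" unfolding C_mem using a(1) homogD(2) by auto
    have "(\<Oplus>i\<in>D. xs ! i \<otimes> ?c {i}) = \<zero>" by (rule A.add.finprod_one_eqI) (use xs_carr in simp)
    then have "bd C 1 ?c {} = r" unfolding bd_C_empty[OF c] a(2) using homog_carr[OF dg.d_homog[OF a(1)]] by simp
    then show "r \<in> JX" unfolding JX_def using c by blast
  qed
  moreover have "set xs \<subseteq> JX"
  proof
    fix x assume "x \<in> set xs"
    then obtain k where k: "k \<in> D" "x = xs ! k" by (metis in_set_conv_nth lessThan_iff)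
    let ?c = "\<lambda>I. if I = {k} then \<one> else \<zero>"
    have c: "?c \<in> carrier (obj C 1)" unfolding C_mem using dg.homog_one homogD(2) k(1) by auto
    have "(\<Oplus>i\<in>D. xs ! i \<otimes> ?c {i}) = (\<Oplus>i\<in>D. if k = i then xs ! i else \<zero>)"
      by (rule A.finsum_cong') (use xs_carr in auto)
    also have "\<dots> = xs ! k" by (rule A.finsum_singleton) (use k xs_carr in auto)
    finally have "bd C 1 ?c {} = x" unfolding bd_C_empty[OF c] k(2) using xs_carr[OF k(1)] by simp
    then show "x \<in> JX" unfolding JX_def using c by blast
  qed
  ultimately show "P \<in> primes_over R (J \<union> set xs)" using P by (auto simp: primes_over_def)
next
  fix P assume "P \<in> primes_over R (J \<union> set xs)"
  then have P: "primeideal P R" "J \<subseteq> P" "set xs \<subseteq> P" by (simp_all add: primes_over_def)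
  note Pi = R.primeD(1)[OF P(1)]
  note Pd = R.idealD[OF Pi]
  have PA: "P \<subseteq> carrier A" using Pd(1) homogD(1)[of 0] by simp
  have "JX \<subseteq> P"
  proof
    fix r assume "r \<in> JX"
    then obtain c where c: "c \<in> carrier (obj C 1)" "r = bd C 1 c {}" unfolding JX_def by blast
    have "xs ! i \<otimes> c {i} \<in> P" if i: "i \<in> D" for i
    proof -
      have ci: "c {i} \<in> homog A 0" using C_D(1)[OF c(1), of "{i}"] i by simp
      have "xs ! i \<in> P" using P(3) i nth_mem by auto
      then have "c {i} \<otimes>\<^bsub>R\<^esub> xs ! i \<in> P" by (rule Pd(4)) (use ci in simp)
      then show ?thesis using deg0_comm[OF xs_nth[OF i] ci] by simp
    qed
    then have "(\<Oplus>i\<in>D. xs ! i \<otimes> c {i}) \<in> P"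
      by (intro A.finsum_mem) (use Pd(2,3) PA in auto)
    moreover have "dgd A (c {}) \<in> P"
    proof -
      have "c {} \<in> homog A 1" using C_D(1)[OF c(1), of "{}"] by simp
      then show ?thesis using P(2) unfolding J_def by blast
    qed
    ultimately show "r \<in> P" unfolding c(2) bd_C_empty[OF c(1)] using Pd(3) by simp
  qed
  then show "P \<in> primes_over R JX" using P(1) by (simp add: primes_over_def)
qed

text \<open>The homology of \<open>C\<close> is shown to be finitely generated by filtering \<open>C\<close> by the down-closed
  families \<open>F\<close> of subsets of \<open>D\<close>: the cochains supported in \<open>F\<close> form a subcomplex, and adding one
  set to \<open>F\<close> adds a shifted copy of \<open>A\<close> as a quotient.\<close>

definition part :: "nat set set \<Rightarrow> int \<Rightarrow> (nat set \<Rightarrow> 'a) set" where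
  "part F n = {c \<in> carrier (obj C n). \<forall>I. I \<notin> F \<longrightarrow> c I = \<zero>}"

lemma part_submodule: "submodule (part F n) R (obj C n)"
proof (rule C.O.submodule_of_closed)
  show "part F n \<subseteq> carrier (obj C n)" by (auto simp: part_def)
  show "\<zero>\<^bsub>obj C n\<^esub> \<in> part F n" using C.O.M.zero_closed[of n] by (simp add: part_def)
  show "x \<oplus>\<^bsub>obj C n\<^esub> y \<in> part F n" if "x \<in> part F n" "y \<in> part F n" for x y
    using that C.O.M.a_closed[of x n y] by (simp add: part_def)
  show "r \<odot>\<^bsub>obj C n\<^esub> x \<in> part F n" if "r \<in> carrier R" "x \<in> part F n" for r x
    using that C.O.smult_closed[of r x n] by (simp add: part_def smult_eq homog_carr)
qed

definition Zp where "Zp F n = part F n \<inter> cycles C n"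
definition Bp where "Bp F n = bd C (n + 1) ` part F (n + 1)"

lemma Zp_submodule: "submodule (Zp F n) R (obj C n)"
  unfolding Zp_def by (rule C.O.inter_submodule[OF part_submodule C.cycles_submodule])

lemma fg_part:
  assumes noeth: "noetherian_ring R" and hX: "\<forall>m. fg_over R (obj X m) (boundaries X m) (cycles X m)"
    and "finite F" "F \<subseteq> Pow D" "\<forall>I\<in>F. \<forall>K. K \<subseteq> I \<longrightarrow> K \<in> F"
  shows "fg_over R (obj C n) (Bp F n) (Zp F n)"
  using assms(3-5)
proof (induction F rule: finite_psubset_induct)
  case (psubset F)
  show ?case
  proof (cases "F = {}")
    case True
    have "Zp F n \<subseteq> {\<zero>\<^bsub>obj C n\<^esub>}" unfolding Zp_def part_def True by auto
    then have "\<forall>L. submodule L R (obj C n) \<longrightarrow> Bp F n \<subseteq> L \<longrightarrow> {} \<subseteq> L \<longrightarrow> Zp F n \<subseteq> L"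
      using C.O.submoduleD(2)[of _ n] by blast
    then show ?thesis unfolding fg_over_def by (intro exI[of _ "{}"]) simp
  next
    case False
    \<comment> \<open>\<open>K\<close> is chosen of maximal size in \<open>F\<close>, so no proper
      \<open>insert i K\<close> lies in \<open>F\<close>: the Koszul part at \<open>K\<close>
      vanishes, and evaluation at \<open>K\<close> commutes with the differentials up to sign.
      Removing \<open>K\<close> keeps the family closed under subsets.\<close>
    have "Max (card ` F) \<in> card ` F" using False psubset.hyps by (intro Max_in) simp_all
    then obtain K where K: "K \<in> F" "card K = Max (card ` F)" by auto
    have Kmax: "card I \<le> card K" if "I \<in> F" for I unfolding K(2) using that psubset.hyps by simp
    have KD: "K \<subseteq> D" using K(1) psubset.prems(1) by blast
    have fin: "finite I" if "I \<in> F" for I using that psubset.prems(1) finite_subset[of I D] by blast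
    let ?F = "F - {K}"
    have insK: "insert i K \<notin> F" if "i \<notin> K" for i
      using Kmax[of "insert i K"] fin[OF K(1)] that by auto
    have IH: "fg_over R (obj C n) (Bp ?F n) (Zp ?F n)"
    proof (rule psubset.IH)
      show "?F \<subset> F" using K(1) by blast
      show "?F \<subseteq> Pow D" using psubset.prems(1) by blast
      show "\<forall>I\<in>?F. \<forall>L. L \<subseteq> I \<longrightarrow> L \<in> ?F"
      proof (intro ballI allI impI)
        fix I L assume I: "I \<in> ?F" and L: "L \<subseteq> I"
        have "L \<in> F" using psubset.prems(2) I L by blast
        moreover have "L \<noteq> K"
        proof
          assume "L = K"
          then have "K = I" using card_subset_eq[of I K] fin[of I] I L Kmax[of I] card_mono[of I K] by force
          then show False using I by blast
        qed
        ultimately show "L \<in> ?F" by blast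
      qed
    qed
    let ?m = "n - int (card K)"
    let ?ev = "\<lambda>c::nat set \<Rightarrow> 'a. c K"
    have ev: "linear_map R (obj C n) (obj X ?m) ?ev"
      by (rule linear_mapI) (use C_D(1)[OF _ KD] in simp_all)
    have evZ: "?ev c \<in> cycles X ?m" if c: "c \<in> Zp F n" for c
    proof -
      have cc: "c \<in> cycles C n" "c \<in> carrier (obj C n)" "\<forall>I. I \<notin> F \<longrightarrow> c I = \<zero>"
        using c unfolding Zp_def part_def by auto
      have "kd c K = \<zero>" unfolding kd_def
        by (rule A.add.finprod_one_eqI) (use cc(3) insK xs_carr in simp)
      then have "signed A (int (card K)) (dgd A (c K)) = \<zero>"
        using C_cycle_eq(2)[OF cc(1), of K] d_c_carr[OF cc(2)] by simp
      then have "dgd A (c K) = \<zero>" using d_c_carr[OF cc(2), of K] A.minus_minus[of "dgd A (c K)"]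
        by (auto simp: signed_def split: if_splits)
      then show ?thesis unfolding cycles_def using C_D(1)[OF cc(2) KD] by simp
    qed
    \<comment> \<open>The values at \<open>K\<close> of the cycles, together with the boundaries of
      \<open>A\<close>, form a submodule of the cycles of \<open>A\<close>, so they are finitely
      generated modulo boundaries.\<close>
    let ?L = "sum_sub (obj X ?m) (?ev ` Zp F n) (boundaries X ?m)"
    note evZsub = linear_map_image_submodule[OF C_module X_module ev Zp_submodule[of F n]]
    note Lsub = X.O.sum_submodule[OF evZsub X.boundaries_submodule]
    have "?L \<subseteq> cycles X ?m"
    proof
      fix y assume "y \<in> ?L"
      then obtain a b where ab: "a \<in> cycles X ?m" "b \<in> boundaries X ?m" "y = a \<oplus>\<^bsub>obj X ?m\<^esub> b"
        unfolding sum_sub_def using evZ by blast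
      show "y \<in> cycles X ?m" unfolding ab(3)
        using X.O.submoduleD(3)[OF X.cycles_submodule ab(1)] X.boundaries_cycles ab(2) by blast
    qed
    then have "fg_over R (obj X ?m) (boundaries X ?m) ?L"
      using X.O.fg_over_subset[OF noeth X.boundaries_submodule Lsub(1) Lsub(3) _ X.O.submoduleD(1)[OF X.cycles_submodule]] hX
      by blast
    then obtain S where S: "finite S" "S \<subseteq> ?L" "\<forall>L. submodule L R (obj X ?m) \<longrightarrow> boundaries X ?m \<subseteq> L \<longrightarrow> S \<subseteq> L \<longrightarrow> ?L \<subseteq> L"
      unfolding fg_over_def by blast
    have "\<forall>s\<in>S. \<exists>c. c \<in> Zp F n \<and> (\<exists>b\<in>boundaries X ?m. s = ?ev c \<oplus>\<^bsub>obj X ?m\<^esub> b)"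
      using S(2) unfolding sum_sub_def by blast
    then obtain g where g: "\<forall>s\<in>S. g s \<in> Zp F n \<and> (\<exists>b\<in>boundaries X ?m. s = ?ev (g s) \<oplus>\<^bsub>obj X ?m\<^esub> b)"
      by (rule bchoice[THEN exE])
    obtain S' where S': "finite S'" "S' \<subseteq> Zp ?F n"
      "\<forall>L. submodule L R (obj C n) \<longrightarrow> Bp ?F n \<subseteq> L \<longrightarrow> S' \<subseteq> L \<longrightarrow> Zp ?F n \<subseteq> L"
      using IH unfolding fg_over_def by blast
    have sub: "part ?F k \<subseteq> part F k" for k unfolding part_def by blast
    have "Zp F n \<subseteq> L" if L: "submodule L R (obj C n)" "Bp F n \<subseteq> L" "g ` S \<union> S' \<subseteq> L" for L
    proof
      fix c assume c: "c \<in> Zp F n"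
      let ?Q = "L \<inter> Zp F n"
      have Q: "submodule ?Q R (obj C n)" by (rule C.O.inter_submodule[OF L(1) Zp_submodule])
      note evQ = linear_map_image_submodule[OF C_module X_module ev Q]
      note QB = X.O.sum_submodule[OF evQ X.boundaries_submodule[of ?m]]
      have "S \<subseteq> sum_sub (obj X ?m) (?ev ` ?Q) (boundaries X ?m)"
      proof
        fix s assume s: "s \<in> S"
        then obtain b where b: "b \<in> boundaries X ?m" "s = ?ev (g s) \<oplus>\<^bsub>obj X ?m\<^esub> b" using g by blast
        have "g s \<in> ?Q" using g L(3) s by blast
        then show "s \<in> sum_sub (obj X ?m) (?ev ` ?Q) (boundaries X ?m)" unfolding sum_sub_def using b by blast
      qed
      then have "?L \<subseteq> sum_sub (obj X ?m) (?ev ` ?Q) (boundaries X ?m)" using S(3) QB(1,3) by blast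
      moreover have "?ev c \<in> ?L" using Lsub(2) c by blast
      ultimately have "?ev c \<in> sum_sub (obj X ?m) (?ev ` ?Q) (boundaries X ?m)" by blast
      then obtain l b where lb: "l \<in> ?Q" "b \<in> boundaries X ?m" "c K = l K \<oplus> b"
        unfolding sum_sub_def by auto
      obtain a where a: "a \<in> homog A (?m + 1)" "b = dgd A a" using lb(2) unfolding boundaries_def by auto
      \<comment> \<open>A chain concentrated at \<open>K\<close>, with the sign that cancels the one
        in \<open>bd\<close>, so that its boundary takes the value \<open>b\<close> at
        \<open>K\<close>. Subtracting this boundary and \<open>l\<close> from \<open>c\<close>
        leaves a cycle that vanishes at \<open>K\<close>.\<close>
      let ?e = "\<lambda>I. if I = K then signed A (int (card K)) a else \<zero>"
      have e: "?e \<in> part F (n + 1)"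
      proof -
        have "signed A (int (card K)) a \<in> homog A (n + 1 - int (card K))"
          using homogD(6)[OF a(1)] by (simp add: algebra_simps)
        then have "?e \<in> carrier (obj C (n + 1))" unfolding C_mem using KD homogD(2) by auto
        then show ?thesis unfolding part_def using K(1) by auto
      qed
      have eC: "?e \<in> carrier (obj C (n + 1))" using e unfolding part_def by blast
      let ?b = "bd C (n + 1) ?e"
      have bB: "?b \<in> Bp F n" unfolding Bp_def using e by blast
      have bK: "?b K = b"
      proof -
        have "kd ?e K = \<zero>" unfolding kd_def
        proof (rule A.add.finprod_one_eqI)
          fix i assume i: "i \<in> D - K"
          then have "insert i K \<noteq> K" by blast
          then show "signed A (sg K i) (xs ! i \<otimes> ?e (insert i K)) = \<zero>" using i xs_carr by simp
        qed
        moreover have "signed A (int (card K)) (dgd A (?e K)) = b"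
          using d_uminus[OF a(1)] homog_carr[OF dg.d_homog[OF a(1)]] unfolding a(2) by (simp add: signed_def)
        moreover have "b \<in> carrier A" unfolding a(2) using homog_carr[OF dg.d_homog[OF a(1)]] .
        ultimately show ?thesis unfolding bd_C by simp
      qed
      have bZ: "?b \<in> Zp F n"
      proof -
        have "?b \<in> cycles C n" using C.boundaries_cycles[of n] eC unfolding boundaries_def by blast
        moreover have "?b I = \<zero>" if I: "I \<notin> F" for I
        proof -
          have "?e (insert i I) = \<zero>" for i
          proof -
            have "insert i I \<noteq> K" using psubset.prems(2) K(1) I by blast
            then show ?thesis by simp
          qed
          then have "kd ?e I = \<zero>" unfolding kd_def
            by (intro A.add.finprod_one_eqI) (use xs_carr in simp)
          moreover have "?e I = \<zero>" using I K(1) by auto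
          ultimately show ?thesis unfolding bd_C by simp
        qed
        ultimately show ?thesis unfolding Zp_def part_def cycles_def by blast
      qed
      note Ld = C.O.submoduleD[OF L(1)]
      note Zd = C.O.submoduleD[OF Zp_submodule[of F n]]
      have lbL: "l \<oplus>\<^bsub>obj C n\<^esub> ?b \<in> L" using Ld(3) lb(1) bB L(2) by blast
      have lbZ: "l \<oplus>\<^bsub>obj C n\<^esub> ?b \<in> Zp F n" using Zd(3) lb(1) bZ by blast
      let ?c = "c \<ominus>\<^bsub>obj C n\<^esub> (l \<oplus>\<^bsub>obj C n\<^esub> ?b)"
      have cZ: "?c \<in> Zp F n" using Zd(6)[OF c lbZ] .
      have carr: "c \<in> carrier (obj C n)" "l \<oplus>\<^bsub>obj C n\<^esub> ?b \<in> carrier (obj C n)" using c lbZ Zd(1) by blast+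
      have "?ev ?c = ?ev c \<ominus>\<^bsub>obj X ?m\<^esub> ?ev (l \<oplus>\<^bsub>obj C n\<^esub> ?b)"
        by (rule linear_map_minus[OF C_module X_module ev carr])
      also have "?ev (l \<oplus>\<^bsub>obj C n\<^esub> ?b) = ?ev c" using lb(3) bK by simp
      also have "?ev c \<ominus>\<^bsub>obj X ?m\<^esub> ?ev c = \<zero>"
        using X.O.M.r_neg[of "?ev c" ?m] C_D(1)[OF carr(1) KD] by (simp add: a_minus_def)
      finally have "?c K = \<zero>" .
      then have "?c \<in> Zp ?F n" using cZ unfolding Zp_def part_def by auto
      moreover have "Bp ?F n \<subseteq> L" using L(2) sub unfolding Bp_def by blast
      ultimately have "?c \<in> L" using S'(3) L(1,3) by blast
      then have "?c \<oplus>\<^bsub>obj C n\<^esub> (l \<oplus>\<^bsub>obj C n\<^esub> ?b) \<in> L" using Ld(3) lbL by blast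
      then show "c \<in> L" using C.O.minus_cancel(1)[OF carr] by simp
    qed
    moreover have "finite (g ` S \<union> S')" using S(1) S'(1) by simp
    moreover have "g ` S \<union> S' \<subseteq> Zp F n" using g S'(2) sub unfolding Zp_def by blast
    ultimately show ?thesis unfolding fg_over_def by blast
  qed
qed

text \<open>For the family of all subsets of \<open>D\<close> the filtration reaches the whole
  complex.\<close>

lemma C_homology_fg:
  assumes "noetherian_ring R" "\<forall>m. fg_over R (obj X m) (boundaries X m) (cycles X m)"
  shows "fg_over R (obj C n) (boundaries C n) (cycles C n)"
proof -
  have "part (Pow D) k = carrier (obj C k)" for k unfolding part_def using C_D(2) by auto
  then have "Zp (Pow D) n = cycles C n" "Bp (Pow D) n = boundaries C n"
    unfolding Zp_def Bp_def boundaries_def cycles_def by auto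
  then show ?thesis using fg_part[OF assms, of "Pow D" n] by auto
qed

end

section \<open>Identification with the tensor product\<close>

text \<open>Of the differential of \<open>Y\<close> only its target and its compatibility with
  \<open>\<Phi>\<close> are asked for; linearity and square zero are inherited from \<open>C\<close>
  by injectivity.\<close>

locale complex_iso = C: chain_complex R C for R :: "('r, 'x) ring_scheme" and C :: "('r, 'm) cplx" +
  fixes Y :: "('r, 'n) cplx" and \<Phi> :: "int \<Rightarrow> 'n \<Rightarrow> 'm"
  assumes Y_module: "\<And>n. module R (obj Y n)"
    and \<Phi>_linear: "\<And>n. linear_map R (obj Y n) (obj C n) (\<Phi> n)"
    and \<Phi>_inj: "\<And>n y y'. \<lbrakk>y \<in> carrier (obj Y n); y' \<in> carrier (obj Y n); \<Phi> n y = \<Phi> n y'\<rbrakk> \<Longrightarrow> y = y'"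
    and \<Phi>_surj: "\<And>n c. c \<in> carrier (obj C n) \<Longrightarrow> \<exists>y\<in>carrier (obj Y n). \<Phi> n y = c"
    and Y_bd: "\<And>n y. y \<in> carrier (obj Y n) \<Longrightarrow> bd Y n y \<in> carrier (obj Y (n - 1))"
    and \<Phi>_bd: "\<And>n y. y \<in> carrier (obj Y n) \<Longrightarrow> \<Phi> (n - 1) (bd Y n y) = bd C n (\<Phi> n y)"
begin

interpretation YO: rmodule R "obj Y n" for n by (intro rmodule.intro Y_module)

lemma \<Phi>_zero: "\<Phi> n \<zero>\<^bsub>obj Y n\<^esub> = \<zero>\<^bsub>obj C n\<^esub>"
  by (rule linear_map_zero[OF Y_module C.obj_module \<Phi>_linear])

lemma Y_complex: "chain_complex R Y"
proof (intro chain_complex.intro chain_complex_axioms.intro C.is_cring Y_module)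
  fix n
  note \<phi> = linear_mapD[OF \<Phi>_linear] and b = linear_mapD[OF C.bd_linear]
  show "linear_map R (obj Y n) (obj Y (n - 1)) (bd Y n)"
  proof (rule linear_mapI)
    show "bd Y n x \<in> carrier (obj Y (n - 1))" if "x \<in> carrier (obj Y n)" for x by (rule Y_bd[OF that])
    fix x assume x: "x \<in> carrier (obj Y n)"
    show "bd Y n (x \<oplus>\<^bsub>obj Y n\<^esub> y) = bd Y n x \<oplus>\<^bsub>obj Y (n - 1)\<^esub> bd Y n y" if y: "y \<in> carrier (obj Y n)" for y
      by (rule \<Phi>_inj[where n = "n - 1"]) (use x y in \<open>simp_all add: Y_bd \<Phi>_bd \<phi> b\<close>)
    show "bd Y n (r \<odot>\<^bsub>obj Y n\<^esub> x) = r \<odot>\<^bsub>obj Y (n - 1)\<^esub> bd Y n x" if r: "r \<in> carrier R" for r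
      by (rule \<Phi>_inj[where n = "n - 1"]) (use x r in \<open>simp_all add: Y_bd \<Phi>_bd \<phi> b\<close>)
  qed
  show "bd Y (n - 1) (bd Y n x) = \<zero>\<^bsub>obj Y (n - 1 - 1)\<^esub>" if x: "x \<in> carrier (obj Y n)" for x
  proof (rule \<Phi>_inj[OF Y_bd[OF Y_bd[OF x]] YO.M.zero_closed])
    show "\<Phi> (n - 1 - 1) (bd Y (n - 1) (bd Y n x)) = \<Phi> (n - 1 - 1) \<zero>\<^bsub>obj Y (n - 1 - 1)\<^esub>"
      unfolding \<Phi>_bd[OF Y_bd[OF x]] \<Phi>_bd[OF x] \<Phi>_zero by (rule C.bd_bd[OF \<phi>(1)[OF x]])
  qed
qed

sublocale Y: chain_complex R Y by (rule Y_complex)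

lemma cycles_iff: "y \<in> carrier (obj Y n) \<Longrightarrow> y \<in> cycles Y n \<longleftrightarrow> \<Phi> n y \<in> cycles C n"
proof -
  assume y: "y \<in> carrier (obj Y n)"
  have "bd Y n y = \<zero>\<^bsub>obj Y (n - 1)\<^esub> \<longleftrightarrow> \<Phi> (n - 1) (bd Y n y) = \<Phi> (n - 1) \<zero>\<^bsub>obj Y (n - 1)\<^esub>"
  proof
    assume "\<Phi> (n - 1) (bd Y n y) = \<Phi> (n - 1) \<zero>\<^bsub>obj Y (n - 1)\<^esub>"
    then show "bd Y n y = \<zero>\<^bsub>obj Y (n - 1)\<^esub>" by (rule \<Phi>_inj[OF Y_bd[OF y] YO.M.zero_closed])
  qed simp
  then show ?thesis unfolding cycles_def \<Phi>_zero \<Phi>_bd[OF y] using y linear_mapD(1)[OF \<Phi>_linear y] by simp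
qed

lemma boundaries_iff:
  assumes y: "y \<in> carrier (obj Y n)"
  shows "y \<in> boundaries Y n \<longleftrightarrow> \<Phi> n y \<in> boundaries C n"
proof
  have n: "n + 1 - 1 = n" by simp
  have bdn: "\<Phi> n (bd Y (n + 1) x) = bd C (n + 1) (\<Phi> (n + 1) x)" if "x \<in> carrier (obj Y (n + 1))" for x
    using \<Phi>_bd[OF that] unfolding n .
  assume "y \<in> boundaries Y n"
  then obtain x where x: "y = bd Y (n + 1) x" "x \<in> carrier (obj Y (n + 1))" unfolding boundaries_def by (rule imageE)
  have "bd C (n + 1) (\<Phi> (n + 1) x) \<in> boundaries C n"
    unfolding boundaries_def by (rule imageI[OF linear_mapD(1)[OF \<Phi>_linear x(2)]])
  then show "\<Phi> n y \<in> boundaries C n" unfolding x(1) bdn[OF x(2)] .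
next
  have n: "n + 1 - 1 = n" by simp
  assume "\<Phi> n y \<in> boundaries C n"
  then obtain c where c: "\<Phi> n y = bd C (n + 1) c" "c \<in> carrier (obj C (n + 1))" unfolding boundaries_def by (rule imageE)
  obtain x where x: "x \<in> carrier (obj Y (n + 1))" "\<Phi> (n + 1) x = c" using \<Phi>_surj[OF c(2)] by (rule bexE)
  have "\<Phi> n y = \<Phi> n (bd Y (n + 1) x)" using \<Phi>_bd[OF x(1)] unfolding n x(2) c(1) by (rule sym)
  then have "y = bd Y (n + 1) x" by (rule \<Phi>_inj[OF y Y_bd[OF x(1), unfolded n]])
  then show "y \<in> boundaries Y n" unfolding boundaries_def using imageI[OF x(1), of "bd Y (n + 1)"] by simp
qed

lemma Y_cyclic:
  assumes "cyclic_complex R C I u"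
  shows "\<exists>v. cyclic_complex R Y I v"
proof -
  interpret CC: cyclic_complex R C I u by fact
  obtain v where v: "v \<in> carrier (obj Y 0)" "\<Phi> 0 v = u" using \<Phi>_surj[OF CC.u_closed] by blast
  note \<phi> = linear_mapD[OF \<Phi>_linear]
  have "cyclic_complex R Y I v"
  proof (intro cyclic_complex.intro cyclic_complex_axioms.intro Y_complex CC.I_carr v(1))
    fix i :: int assume i: "i < 0"
    have "y = \<zero>\<^bsub>obj Y i\<^esub>" if y: "y \<in> carrier (obj Y i)" for y
    proof (rule \<Phi>_inj[OF y YO.M.zero_closed])
      show "\<Phi> i y = \<Phi> i \<zero>\<^bsub>obj Y i\<^esub>" using \<phi>(1)[OF y] unfolding CC.neg[OF i] \<Phi>_zero by simp
    qed
    then show "carrier (obj Y i) = {\<zero>\<^bsub>obj Y i\<^esub>}" using YO.M.zero_closed by blast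
  next
    fix r assume r: "r \<in> carrier R"
    show "r \<odot>\<^bsub>obj Y 0\<^esub> v \<in> boundaries Y 0 \<longleftrightarrow> r \<in> I"
      using boundaries_iff[of "r \<odot>\<^bsub>obj Y 0\<^esub> v" 0] CC.I_iff[OF r] r v by (simp add: \<phi>)
  next
    fix r x i assume r: "r \<in> I" and x: "x \<in> cycles Y i"
    have rR: "r \<in> carrier R" using r CC.I_carr by blast
    have xY: "x \<in> carrier (obj Y i)" using x unfolding cycles_def by blast
    have "r \<odot>\<^bsub>obj C i\<^esub> \<Phi> i x \<in> boundaries C i" by (rule CC.I_annihilates[OF r]) (use cycles_iff[OF xY] x in simp)
    then show "r \<odot>\<^bsub>obj Y i\<^esub> x \<in> boundaries Y i"
      using boundaries_iff[of "r \<odot>\<^bsub>obj Y i\<^esub> x" i] rR xY by (simp add: \<phi>)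
  qed
  then show ?thesis by blast
qed

lemma Y_fg:
  assumes "fg_over R (obj C n) (boundaries C n) (cycles C n)"
  shows "fg_over R (obj Y n) (boundaries Y n) (cycles Y n)"
proof -
  obtain S where S: "finite S" "S \<subseteq> cycles C n"
    "\<forall>L. submodule L R (obj C n) \<longrightarrow> boundaries C n \<subseteq> L \<longrightarrow> S \<subseteq> L \<longrightarrow> cycles C n \<subseteq> L"
    using assms unfolding fg_over_def by blast
  have "\<forall>s\<in>S. \<exists>y. y \<in> carrier (obj Y n) \<and> \<Phi> n y = s"
  proof
    fix s assume "s \<in> S"
    then have "s \<in> carrier (obj C n)" using S(2) unfolding cycles_def by blast
    then show "\<exists>y. y \<in> carrier (obj Y n) \<and> \<Phi> n y = s" using \<Phi>_surj by blast
  qed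
  then obtain g where g: "\<forall>s\<in>S. g s \<in> carrier (obj Y n) \<and> \<Phi> n (g s) = s" by (rule bchoice[THEN exE])
  have "cycles Y n \<subseteq> L" if L: "submodule L R (obj Y n)" "boundaries Y n \<subseteq> L" "g ` S \<subseteq> L" for L
  proof
    fix y assume y: "y \<in> cycles Y n"
    then have yY: "y \<in> carrier (obj Y n)" unfolding cycles_def by blast
    have sub: "submodule (\<Phi> n ` L) R (obj C n)"
      by (rule linear_map_image_submodule[OF Y_module C.obj_module \<Phi>_linear L(1)])
    have "boundaries C n \<subseteq> \<Phi> n ` L"
    proof
      fix c assume c: "c \<in> boundaries C n"
      then have "c \<in> carrier (obj C n)" using C.O.submoduleD(1)[OF C.boundaries_submodule[of n]] by blast
      then obtain x where x: "x \<in> carrier (obj Y n)" "\<Phi> n x = c" using \<Phi>_surj by blast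
      then have "x \<in> boundaries Y n" using boundaries_iff[OF x(1)] c by simp
      then show "c \<in> \<Phi> n ` L" using L(2) x(2) by blast
    qed
    moreover have "S \<subseteq> \<Phi> n ` L"
    proof
      fix s assume "s \<in> S"
      then have "g s \<in> L" "\<Phi> n (g s) = s" using g L(3) by blast+
      then show "s \<in> \<Phi> n ` L" by (metis imageI)
    qed
    ultimately have "cycles C n \<subseteq> \<Phi> n ` L" using S(3) sub by blast
    then have "\<Phi> n y \<in> \<Phi> n ` L" using cycles_iff[OF yY] y by blast
    then obtain l where l: "l \<in> L" "\<Phi> n y = \<Phi> n l" by blast
    have "l \<in> carrier (obj Y n)" using l(1) YO.submoduleD(1)[OF L(1)] by blast
    then have "y = l" by (rule \<Phi>_inj[OF yY _ l(2)])
    then show "y \<in> L" using l(1) by simp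
  qed
  moreover have "g ` S \<subseteq> cycles Y n"
  proof
    fix y assume "y \<in> g ` S"
    then obtain s where s: "s \<in> S" "y = g s" by blast
    then show "y \<in> cycles Y n" using g S(2) cycles_iff[of y n] by auto
  qed
  moreover have "finite (g ` S)" using S(1) by simp
  ultimately show ?thesis unfolding fg_over_def by blast
qed

end

text \<open>Homological finiteness concerns the direct sum of all homology modules. Its generators,
  projected to degree \<open>i\<close> and lifted to cycles, generate the cycles modulo
  boundaries.\<close>

lemma (in chain_complex) homologically_finite_fg:
  assumes hf: "homologically_finite R X"
  shows "fg_over R (obj X i) (boundaries X i) (cycles X i)"
proof -
  interpret H: rmodule R "homology X j" for j by (intro rmodule.intro homology_module)
  have DM: "module R (direct_sum (homology X))" by (rule direct_sum_module[OF homology_module])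
  interpret DM: rmodule R "direct_sum (homology X)" by (intro rmodule.intro DM)
  obtain G where G: "G \<subseteq> carrier (direct_sum (homology X))" "finite G"
    "gen_submodule R (direct_sum (homology X)) G = carrier (direct_sum (homology X))"
    using hf unfolding homologically_finite_def fg_module_def by blast
  let ?k = "\<lambda>x. boundaries X i +>\<^bsub>Z i\<^esub> x"
  interpret Zi: rmodule R "Z i" by (intro rmodule.intro Z_module)
  have "\<forall>g\<in>G. \<exists>x. x \<in> cycles X i \<and> ?k x = g i"
  proof
    fix g assume g: "g \<in> G"
    have "g i \<in> carrier (homology X i)" by (rule direct_sumD(1)[OF subsetD[OF G(1) g]])
    then obtain x where "g i = ?k x" "x \<in> cycles X i" unfolding homology_carrier by (rule imageE)
    then show "\<exists>x. x \<in> cycles X i \<and> ?k x = g i" by (intro exI[of _ x]) simp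
  qed
  then obtain f where f: "\<forall>g\<in>G. f g \<in> cycles X i \<and> ?k (f g) = g i" by (rule bchoice[THEN exE])
  have gen: "cycles X i \<subseteq> L" if L: "submodule L R (obj X i)" "boundaries X i \<subseteq> L" "f ` G \<subseteq> L" for L
  proof
    fix x assume x: "x \<in> cycles X i"
    let ?L = "L \<inter> cycles X i"
    have Ls: "submodule ?L R (Z i)"
      using Z_submodule_iff[of ?L i] O.inter_submodule[OF L(1) cycles_submodule] by simp
    have BL: "boundaries X i \<subseteq> ?L" using L(2) boundaries_cycles by blast
    have I: "submodule (?k ` ?L) R (homology X i)"
      unfolding homology_def by (rule Zi.quot_submodule_image(1)[OF boundaries_Z Ls])
    have lin: "linear_map R (direct_sum (homology X)) (homology X i) (\<lambda>h. h i)"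
      by (rule linear_mapI) (rule direct_sumD(1), assumption, simp_all add: direct_sum_simps(2,4))
    let ?V = "{h \<in> carrier (direct_sum (homology X)). h i \<in> ?k ` ?L}"
    note Id = H.submoduleD[OF I] and ld = linear_mapD[OF lin]
    have V: "submodule ?V R (direct_sum (homology X))"
    proof (rule DM.submodule_of_closed)
      show "?V \<subseteq> carrier (direct_sum (homology X))" by blast
      show "\<zero>\<^bsub>direct_sum (homology X)\<^esub> \<in> ?V" using Id(2) DM.M.zero_closed by (simp add: direct_sum_simps(3))
      show "a \<oplus>\<^bsub>direct_sum (homology X)\<^esub> b \<in> ?V" if "a \<in> ?V" "b \<in> ?V" for a b
        using that ld(2)[of a b] Id(3)[of "a i" "b i"] DM.M.a_closed[of a b] by simp
      show "r \<odot>\<^bsub>direct_sum (homology X)\<^esub> a \<in> ?V" if "r \<in> carrier R" "a \<in> ?V" for r a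
        using that ld(3)[of r a] Id(4)[of r "a i"] DM.smult_closed[of r a] by simp
    qed
    have "G \<subseteq> ?V"
    proof
      fix g assume g: "g \<in> G"
      then have "f g \<in> ?L" "?k (f g) = g i" using f L(3) by blast+
      then have "g i \<in> ?k ` ?L" by (metis imageI)
      then show "g \<in> ?V" using g G(1) by blast
    qed
    then have "carrier (direct_sum (homology X)) \<subseteq> ?V"
      using DM.gen_submodule(3)[OF G(1) V] G(3) by simp
    \<comment> \<open>A class in degree \<open>i\<close> enters the direct sum as the family
      concentrated in that degree.\<close>
    moreover have "(\<lambda>j. if j = i then ?k x else \<zero>\<^bsub>homology X j\<^esub>) \<in> carrier (direct_sum (homology X))"
    proof (rule direct_sum_mem[where S = "{i}"])
      show "(if j = i then ?k x else \<zero>\<^bsub>homology X j\<^esub>) \<in> carrier (homology X j)" for j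
        using homology_carrier[of i] x by simp
    qed simp_all
    ultimately have "?k x \<in> ?k ` ?L" by auto
    then have "x \<in> ?L" using Zi.quot_submodule_image(2)[OF boundaries_Z Ls BL] x by simp
    then show "x \<in> L" by blast
  qed
  have "\<forall>L. submodule L R (obj X i) \<longrightarrow> boundaries X i \<subseteq> L \<longrightarrow> f ` G \<subseteq> L \<longrightarrow> cycles X i \<subseteq> L"
    by (intro allI impI) (rule gen)
  moreover have "f ` G \<subseteq> cycles X i" using f by blast
  moreover have "finite (f ` G)" using G(2) by simp
  ultimately show ?thesis unfolding fg_over_def by (intro exI[of _ "f ` G"] conjI)
qed

lemma (in tensor_product) tensor_prod_module: "module R (tensor_prod R M N)"
  by (rule T.module_axioms)

section \<open>The isomorphism from the tensor product to the coordinate model\<close>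

context koszul_model
begin

definition B :: "int \<Rightarrow> nat set set" where "B i = {I. I \<subseteq> D \<and> int (card I) = i}"

abbreviation "K i \<equiv> free_module R (B i)"
abbreviation "KT i j \<equiv> tensor_prod R (K i) (obj X j)"
abbreviation "co j I \<equiv> tensor_free_left.coord R (obj X j) I"
abbreviation "Y \<equiv> koszul_on R xs X"

lemma B_finite: "finite (B i)"
  by (rule finite_subset[of _ "Pow D"]) (auto simp: B_def)

lemma TF: "tensor_free_left R (obj X j) (B i)"
  by (intro tensor_free_left.intro tensor_free_left_axioms.intro rmodule.intro R.is_cring X_module B_finite)

lemma obj_koszul: "obj (koszul R xs) i = K i"
  by (simp add: koszul_def B_def)

lemma obj_Y: "obj Y n = direct_sum (\<lambda>i. KT i (n - i))"
  by (simp add: koszul_on_def tensor_cplx_def obj_koszul)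

lemma bd_Y: "bd Y n z i = tensor_map R (K i) (obj X (n - 1 - i)) (bd (koszul R xs) (i + 1)) id (z (i + 1))
    \<oplus>\<^bsub>KT i (n - 1 - i)\<^esub> signed (KT i (n - 1 - i)) i (tensor_map R (K i) (obj X (n - 1 - i)) id (dgd A) (z i))"
  by (simp add: koszul_on_def tensor_cplx_def obj_koszul Let_def)

lemma T_module: "module R (KT i j)"
  by (rule tensor_product.tensor_prod_module[OF tensor_product.intro[OF R.is_cring rmodule.intro[OF R.free_module_module] rmodule.intro[OF X_module]]])

lemma Y_module: "module R (obj Y n)"
  unfolding obj_Y by (rule R.direct_sum_module) (rule T_module)

text \<open>The sums in \<open>koszul\<close> are formed in the record of the degree zero ring,
  those of the model in \<open>A\<close>; the two notions have to be matched on elements of degree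
  zero.\<close>

lemma finsum_R: "\<lbrakk>finite S; \<forall>i\<in>S. f i \<in> homog A 0\<rbrakk> \<Longrightarrow> finsum R f S = finsum A f S"
proof (induction S rule: finite_induct)
  case (insert a S)
  have "f \<in> S \<rightarrow> carrier R" "f a \<in> carrier R" "f \<in> S \<rightarrow> carrier A" "f a \<in> carrier A"
    using insert.prems homog_carr by auto
  then show ?case using insert by simp
qed simp

lemma signed_R: "x \<in> homog A 0 \<Longrightarrow> signed R k x = signed A k x"
proof -
  assume x: "x \<in> homog A 0"
  have "\<ominus> x \<oplus>\<^bsub>R\<^esub> x = \<zero>\<^bsub>R\<^esub>" using A.l_neg[OF homog_carr[OF x]] by simp
  then have "\<ominus>\<^bsub>R\<^esub> x = \<ominus> x" by (rule R.minus_equality) (use x homogD(5) in simp_all)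
  then show ?thesis by (simp add: signed_def)
qed

lemma K_D: "f \<in> carrier (K i) \<Longrightarrow> f I \<in> homog A 0" "\<lbrakk>f \<in> carrier (K i); I \<notin> B i\<rbrakk> \<Longrightarrow> f I = \<zero>"
  using R.free_moduleD(1,4)[of f "B i"] by simp_all

lemma bd_K:
  assumes f: "f \<in> carrier (K i)"
  shows "bd (koszul R xs) i f I = (\<Oplus>k\<in>D - I. signed A (sg I k) (xs ! k \<otimes> f (insert k I)))"
proof -
  have t: "xs ! k \<otimes> f (insert k I) \<in> homog A 0" if "k \<in> D" for k
    using homogD(4)[OF xs_nth[OF that] K_D(1)[OF f]] .
  have "bd (koszul R xs) i f I = (\<Oplus>\<^bsub>R\<^esub>k\<in>D - I. signed R (sg I k) (xs ! k \<otimes> f (insert k I)))"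
    by (simp add: koszul_def sg_def)
  also have "\<dots> = (\<Oplus>k\<in>D - I. signed R (sg I k) (xs ! k \<otimes> f (insert k I)))"
    by (rule finsum_R) (use t signed_R homogD(6) in auto)
  also have "\<dots> = (\<Oplus>k\<in>D - I. signed A (sg I k) (xs ! k \<otimes> f (insert k I)))"
    by (rule A.finsum_cong') (use t homog_carr[OF homogD(6)] signed_R in auto)
  finally show ?thesis .
qed

lemma bd_K_linear: "linear_map R (K (i + 1)) (K i) (bd (koszul R xs) (i + 1))"
proof (rule linear_mapI)
  interpret K: rmodule R "K i" for i by (intro rmodule.intro R.free_module_module)
  have t: "signed A (sg I k) (xs ! k \<otimes> f (insert k I)) \<in> homog A 0" if "k \<in> D" "f \<in> carrier (K (i + 1))" for k I f
    using homogD(6)[OF homogD(4)[OF xs_nth[OF that(1)] K_D(1)[OF that(2)]]] .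
  fix f assume f: "f \<in> carrier (K (i + 1))"
  note bf = bd_K[OF f]
  show "bd (koszul R xs) (i + 1) f \<in> carrier (K i)"
  proof (rule R.free_module_mem[where S = "B i", OF B_finite order_refl])
    show "bd (koszul R xs) (i + 1) f I \<in> carrier R" for I unfolding bf deg0_simps
      by (rule A.finsum_mem) (use t[OF _ f] homogD in auto)
    fix I assume I: "I \<notin> B i"
    have "f (insert k I) = \<zero>" if k: "k \<in> D - I" for k
    proof (rule K_D(2)[OF f])
      show "insert k I \<notin> B (i + 1)"
      proof
        assume a: "insert k I \<in> B (i + 1)"
        then have "I \<subseteq> D" unfolding B_def by blast
        then show False using card_ins[of I k] k a I unfolding B_def by simp
      qed
    qed
    then show "bd (koszul R xs) (i + 1) f I = \<zero>\<^bsub>R\<^esub>" unfolding bf deg0_simps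
      by (intro A.add.finprod_one_eqI) (use xs_carr in simp)
  qed
  show "bd (koszul R xs) (i + 1) (f \<oplus>\<^bsub>K (i + 1)\<^esub> g) = bd (koszul R xs) (i + 1) f \<oplus>\<^bsub>K i\<^esub> bd (koszul R xs) (i + 1) g"
    if g: "g \<in> carrier (K (i + 1))" for g
  proof
    fix I
    have "bd (koszul R xs) (i + 1) (f \<oplus>\<^bsub>K (i + 1)\<^esub> g) I = (\<Oplus>k\<in>D - I. signed A (sg I k) (xs ! k \<otimes> f (insert k I)) \<oplus>
      signed A (sg I k) (xs ! k \<otimes> g (insert k I)))"
      unfolding bd_K[OF K.M.a_closed[OF f g]]
    proof (rule A.finsum_cong')
      fix k assume "k \<in> D - I"
      then show "signed A (sg I k) (xs ! k \<otimes> (f \<oplus>\<^bsub>K (i + 1)\<^esub> g) (insert k I)) =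
        signed A (sg I k) (xs ! k \<otimes> f (insert k I)) \<oplus> signed A (sg I k) (xs ! k \<otimes> g (insert k I))"
        using xs_carr homog_carr[OF K_D(1)[OF f]] homog_carr[OF K_D(1)[OF g]]
        by (simp add: free_module_simps(2) A.r_distr A.signed_add)
    qed (use homog_carr[OF t[OF _ f]] homog_carr[OF t[OF _ g]] in auto)
    also have "\<dots> = bd (koszul R xs) (i + 1) f I \<oplus> bd (koszul R xs) (i + 1) g I" unfolding bf bd_K[OF g]
      by (rule A.finsum_addf) (use homog_carr[OF t[OF _ f]] homog_carr[OF t[OF _ g]] in auto)
    finally show "bd (koszul R xs) (i + 1) (f \<oplus>\<^bsub>K (i + 1)\<^esub> g) I = (bd (koszul R xs) (i + 1) f \<oplus>\<^bsub>K i\<^esub> bd (koszul R xs) (i + 1) g) I"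
      by (simp add: free_module_simps(2))
  qed
  show "bd (koszul R xs) (i + 1) (r \<odot>\<^bsub>K (i + 1)\<^esub> f) = r \<odot>\<^bsub>K i\<^esub> bd (koszul R xs) (i + 1) f" if r: "r \<in> carrier R" for r
  proof
    fix I
    have r': "r \<in> homog A 0" "r \<in> carrier A" using r homog_carr by simp_all
    have "r \<otimes> bd (koszul R xs) (i + 1) f I = (\<Oplus>k\<in>D - I. r \<otimes> signed A (sg I k) (xs ! k \<otimes> f (insert k I)))"
      unfolding bf by (rule A.finsum_rdistr) (use homog_carr[OF t[OF _ f]] r' in auto)
    also have "\<dots> = bd (koszul R xs) (i + 1) (r \<odot>\<^bsub>K (i + 1)\<^esub> f) I" unfolding bd_K[OF K.smult_closed[OF r f]]
    proof (rule A.finsum_cong')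
      fix k assume k: "k \<in> D - I"
      have cc: "xs ! k \<in> carrier A" "f (insert k I) \<in> carrier A" using k xs_carr homog_carr[OF K_D(1)[OF f]] by auto
      have "r \<otimes> (xs ! k \<otimes> f (insert k I)) = xs ! k \<otimes> (r \<otimes> f (insert k I))"
        using deg0_comm[OF r'(1) xs_nth[of k]] k cc r' by (simp add: A.m_assoc[symmetric])
      then show "r \<otimes> signed A (sg I k) (xs ! k \<otimes> f (insert k I)) =
        signed A (sg I k) (xs ! k \<otimes> (r \<odot>\<^bsub>K (i + 1)\<^esub> f) (insert k I))"
        using cc r' by (simp add: mult_signed free_module_simps(4))
    qed (use homog_carr[OF t[OF _ K.smult_closed[OF r f]]] in auto)
    finally show "bd (koszul R xs) (i + 1) (r \<odot>\<^bsub>K (i + 1)\<^esub> f) I = (r \<odot>\<^bsub>K i\<^esub> bd (koszul R xs) (i + 1) f) I"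
      by (simp add: free_module_simps(4))
  qed
qed

lemma co_linear: "linear_map R (KT i j) (obj X j) (co j I)"
  by (rule tensor_free_left.coord_linear[OF TF])

lemma co_homog: "t \<in> carrier (KT i j) \<Longrightarrow> co j I t \<in> homog A j"
  using linear_mapD(1)[OF co_linear] by simp

lemma co_pure: "\<lbrakk>f \<in> carrier (K i); a \<in> homog A j\<rbrakk> \<Longrightarrow> co j I (pure_tensor R (K i) (obj X j) f a) = f I \<otimes> a"
  using tensor_free_left.coord_pure[OF TF, of f i a j I] K_D(1) homog_carr by (simp add: smult_eq)

lemma TP: "tensor_product R (K i) (obj X j)"
  by (intro tensor_product.intro rmodule.intro R.is_cring R.free_module_module X_module)

text \<open>Both sides are linear in \<open>t\<close>, so a pure tensor may be taken, whose
  coordinates are the products \<open>f I \<otimes> a\<close>.\<close>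

lemma co_tensor_map_left:
  assumes t: "t \<in> carrier (KT (i + 1) j)"
  shows "co j I (tensor_map R (K i) (obj X j) (bd (koszul R xs) (i + 1)) id t) =
     (\<Oplus>k\<in>D - I. signed A (sg I k) (xs ! k \<otimes> co j (insert k I) t))"
proof -
  \<comment> \<open>Finite sums in \<open>obj X j\<close> and in \<open>A\<close> again belong to
    different records: linearity is proved with the former, computation is done with the
    latter.\<close>
  have fs: "(\<Oplus>\<^bsub>obj X j\<^esub>k\<in>D - I. g k) = (\<Oplus>k\<in>D - I. g k)" if g0: "\<forall>k\<in>D - I. g k \<in> homog A j" for g
  proof -
    have g: "\<forall>k\<in>D - I. g k \<in> homog A j \<and> g k \<in> carrier A" using g0 homog_carr by blast
    have "(\<Oplus>\<^bsub>obj X j\<^esub>k\<in>S. g k) = (\<Oplus>k\<in>S. g k)" if "finite S" "S \<subseteq> D - I" for S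
      using that
    proof (induction S rule: finite_induct)
      case empty
      have "\<zero>\<^bsub>obj X j\<^esub> = \<zero>" by simp
      then show ?case by (simp only: X.O.M.finsum_empty A.finsum_empty)
    next
      case (insert a S)
      have c: "g \<in> S \<rightarrow> carrier (obj X j)" "g a \<in> carrier (obj X j)" "g \<in> S \<rightarrow> carrier A" "g a \<in> carrier A"
        using g insert.prems by auto
      show ?case using insert X.O.M.finsum_insert[OF insert.hyps c(1,2)] A.finsum_insert[OF insert.hyps c(3,4)] by simp
    qed
    then show ?thesis by this simp_all
  qed
  have lin: "linear_map R (KT (i + 1) j) (obj X j) (\<lambda>t. \<Oplus>\<^bsub>obj X j\<^esub>k\<in>D - I. signed A (sg I k) (xs ! k \<otimes> co j (insert k I) t))"
  proof (rule linear_map_sum[OF T_module X_module], simp, rule ballI)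
    fix k assume k: "k \<in> D - I"
    have xk: "xs ! k \<in> homog A 0" "xs ! k \<in> carrier A" using k xs_nth xs_carr by blast+
    have "linear_map R (obj X j) (obj X j) (\<lambda>a. signed A (sg I k) (xs ! k \<otimes> a))"
    proof (rule linear_mapI)
      fix a assume a: "a \<in> carrier (obj X j)"
      then have aj: "a \<in> homog A j" "a \<in> carrier A" using homog_carr by simp_all
      show "signed A (sg I k) (xs ! k \<otimes> a) \<in> carrier (obj X j)"
        using homogD(6)[OF homogD(4)[OF xk(1) aj(1)]] by simp
      show "signed A (sg I k) (xs ! k \<otimes> (a \<oplus>\<^bsub>obj X j\<^esub> b)) =
          signed A (sg I k) (xs ! k \<otimes> a) \<oplus>\<^bsub>obj X j\<^esub> signed A (sg I k) (xs ! k \<otimes> b)" if "b \<in> carrier (obj X j)" for b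
        using that aj xk homog_carr by (simp add: A.r_distr A.signed_add)
      show "signed A (sg I k) (xs ! k \<otimes> (r \<odot>\<^bsub>obj X j\<^esub> a)) = r \<odot>\<^bsub>obj X j\<^esub> signed A (sg I k) (xs ! k \<otimes> a)" if "r \<in> carrier R" for r
      proof -
        have r: "r \<in> homog A 0" "r \<in> carrier A" using that homog_carr by simp_all
        have "xs ! k \<otimes> (r \<otimes> a) = r \<otimes> (xs ! k \<otimes> a)"
          using deg0_comm[OF r(1) xk(1)] r xk aj by (simp add: A.m_assoc[symmetric])
        then show ?thesis using r xk aj by (simp add: smult_eq mult_signed)
      qed
    qed
    then show "linear_map R (KT (i + 1) j) (obj X j) (\<lambda>t. signed A (sg I k) (xs ! k \<otimes> co j (insert k I) t))"
      by (rule linear_map_comp[OF co_linear])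
  qed
  have "co j I (tensor_map R (K i) (obj X j) (bd (koszul R xs) (i + 1)) id t) =
     (\<Oplus>\<^bsub>obj X j\<^esub>k\<in>D - I. signed A (sg I k) (xs ! k \<otimes> co j (insert k I) t))"
  proof (rule tensor_product.tensor_linear_eq[OF TP X_module _ lin _ t,
        where f = "\<lambda>t. co j I (tensor_map R (K i) (obj X j) (bd (koszul R xs) (i + 1)) id t)"])
    show "linear_map R (KT (i + 1) j) (obj X j) (\<lambda>t. co j I (tensor_map R (K i) (obj X j) (bd (koszul R xs) (i + 1)) id t))"
      by (rule linear_map_comp[OF tensor_map_linear[OF TP TP bd_K_linear linear_map_id] co_linear])
    fix f a assume f: "f \<in> carrier (K (i + 1))" and a: "a \<in> carrier (obj X j)"
    have aj: "a \<in> homog A j" "a \<in> carrier A" using a homog_carr by simp_all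
    have bf: "bd (koszul R xs) (i + 1) f \<in> carrier (K i)" by (rule linear_mapD(1)[OF bd_K_linear f])
    have fc: "f L \<in> carrier A" for L using homog_carr[OF K_D(1)[OF f]] .
    have "co j I (tensor_map R (K i) (obj X j) (bd (koszul R xs) (i + 1)) id (pure_tensor R (K (i + 1)) (obj X j) f a)) =
        bd (koszul R xs) (i + 1) f I \<otimes> a"
      using tensor_map_pure[OF TP TP bd_K_linear linear_map_id f a] co_pure[OF bf aj(1)] by simp
    also have "\<dots> = (\<Oplus>k\<in>D - I. signed A (sg I k) (xs ! k \<otimes> f (insert k I)) \<otimes> a)"
      unfolding bd_K[OF f] by (rule A.finsum_ldistr) (use aj fc xs_carr in auto)
    also have "\<dots> = (\<Oplus>k\<in>D - I. signed A (sg I k) (xs ! k \<otimes> (f (insert k I) \<otimes> a)))"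
    proof (rule A.finsum_cong')
      fix k assume "k \<in> D - I"
      then show "signed A (sg I k) (xs ! k \<otimes> f (insert k I)) \<otimes> a = signed A (sg I k) (xs ! k \<otimes> (f (insert k I) \<otimes> a))"
        using xs_carr fc aj by (simp add: signed_def A.l_minus A.m_assoc)
    qed (use xs_carr fc aj in auto)
    also have "\<dots> = (\<Oplus>k\<in>D - I. signed A (sg I k) (xs ! k \<otimes> co j (insert k I) (pure_tensor R (K (i + 1)) (obj X j) f a)))"
      by (simp add: co_pure[OF f aj(1)])
    also have "\<dots> = (\<Oplus>\<^bsub>obj X j\<^esub>k\<in>D - I. signed A (sg I k) (xs ! k \<otimes> co j (insert k I) (pure_tensor R (K (i + 1)) (obj X j) f a)))"
    proof (rule fs[symmetric], rule ballI)
      fix k assume k: "k \<in> D - I"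
      have "f (insert k I) \<otimes> a \<in> homog A j" using homogD(4)[OF K_D(1)[OF f] aj(1)] .
      then show "signed A (sg I k) (xs ! k \<otimes> co j (insert k I) (pure_tensor R (K (i + 1)) (obj X j) f a)) \<in> homog A j"
        unfolding co_pure[OF f aj(1)] using homogD(4)[OF xs_nth[of k]] k homogD(6) by blast
    qed
    finally show "co j I (tensor_map R (K i) (obj X j) (bd (koszul R xs) (i + 1)) id (pure_tensor R (K (i + 1)) (obj X j) f a)) =
      (\<Oplus>\<^bsub>obj X j\<^esub>k\<in>D - I. signed A (sg I k) (xs ! k \<otimes> co j (insert k I) (pure_tensor R (K (i + 1)) (obj X j) f a)))" .
  qed
  also have "\<dots> = (\<Oplus>k\<in>D - I. signed A (sg I k) (xs ! k \<otimes> co j (insert k I) t))"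
    by (rule fs) (use homogD(6)[OF homogD(4)[OF xs_nth co_homog[OF t]]] in blast)
  finally show ?thesis .
qed

lemma d_X_linear: "linear_map R (obj X j) (obj X (j - 1)) (dgd A)"
  using X.bd_linear[of j] by simp

lemma co_tensor_map_right:
  assumes t: "t \<in> carrier (KT i j)"
  shows "co (j - 1) I (tensor_map R (K i) (obj X (j - 1)) id (dgd A) t) = dgd A (co j I t)"
proof (rule tensor_product.tensor_linear_eq[OF TP X_module _ _ _ t,
      where f = "\<lambda>t. co (j - 1) I (tensor_map R (K i) (obj X (j - 1)) id (dgd A) t)" and g = "\<lambda>t. dgd A (co j I t)"])
  show "linear_map R (KT i j) (obj X (j - 1)) (\<lambda>t. co (j - 1) I (tensor_map R (K i) (obj X (j - 1)) id (dgd A) t))"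
    by (rule linear_map_comp[OF tensor_map_linear[OF TP TP linear_map_id d_X_linear] co_linear])
  show "linear_map R (KT i j) (obj X (j - 1)) (\<lambda>t. dgd A (co j I t))"
    by (rule linear_map_comp[OF co_linear d_X_linear])
  fix f a assume f: "f \<in> carrier (K i)" and a: "a \<in> carrier (obj X j)"
  have aj: "a \<in> homog A j" using a by simp
  have "tensor_map R (K i) (obj X (j - 1)) id (dgd A) (pure_tensor R (K i) (obj X j) f a) = pure_tensor R (K i) (obj X (j - 1)) f (dgd A a)"
    using tensor_map_pure[OF TP TP linear_map_id d_X_linear f a] by simp
  then show "co (j - 1) I (tensor_map R (K i) (obj X (j - 1)) id (dgd A) (pure_tensor R (K i) (obj X j) f a)) =
      dgd A (co j I (pure_tensor R (K i) (obj X j) f a))"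
    using co_pure[OF f dg.d_homog[OF aj]] co_pure[OF f aj] d_smult[OF K_D(1)[OF f] aj] by simp
qed

lemma T_trivial:
  assumes "B i = {}" "t \<in> carrier (KT i j)"
  shows "t = \<zero>\<^bsub>KT i j\<^esub>"
proof -
  interpret TT: rmodule R "KT i j" by (intro rmodule.intro T_module)
  show ?thesis by (rule tensor_free_left.coord_inject[OF TF assms(2) TT.M.zero_closed]) (use assms(1) in simp)
qed

text \<open>Finite support is automatic: for \<open>i\<close> outside \<open>0..length xs\<close>
  the set \<open>B i\<close> is empty, and the tensor product with the free module on it is
  zero.\<close>

lemma Y_mem:
  assumes "\<And>i. z i \<in> carrier (KT i (n - i))"
  shows "z \<in> carrier (obj Y n)"
  unfolding obj_Y
proof (rule direct_sum_mem[where S = "int ` {..length xs}"])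
  fix i assume i: "i \<notin> int ` {..length xs}"
  have "B i = {}"
  proof (rule ccontr)
    assume "B i \<noteq> {}"
    then obtain I where "I \<subseteq> D" "int (card I) = i" unfolding B_def by blast
    moreover from this have "card I \<le> length xs" using card_mono[of D I] by simp
    ultimately show False using i by auto
  qed
  then show "z i = \<zero>\<^bsub>KT i (n - i)\<^esub>" using T_trivial assms by blast
qed (use assms in simp_all)

lemma Y_D: "z \<in> carrier (obj Y n) \<Longrightarrow> z i \<in> carrier (KT i (n - i))"
  unfolding obj_Y by (rule direct_sumD(1))

text \<open>The coefficient at \<open>I\<close> is found in the tensor component with index
  \<open>card I\<close>, whose first factor is free on the sets of that size.\<close>

definition \<Phi> :: "int \<Rightarrow> (int \<Rightarrow> ((nat set \<Rightarrow> 'a) \<times> 'a \<Rightarrow> 'a) set) \<Rightarrow> nat set \<Rightarrow> 'a" where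
  "\<Phi> n z I = (if I \<subseteq> D then co (n - int (card I)) I (z (int (card I))) else \<zero>)"

lemma bd_Y_parts:
  assumes z: "z \<in> carrier (obj Y n)"
  shows "tensor_map R (K i) (obj X (n - 1 - i)) (bd (koszul R xs) (i + 1)) id (z (i + 1)) \<in> carrier (KT i (n - 1 - i))"
    "tensor_map R (K i) (obj X (n - 1 - i)) id (dgd A) (z i) \<in> carrier (KT i (n - 1 - i))"
proof -
  have 1: "n - (i + 1) = n - 1 - i" "n - i - 1 = n - 1 - i" by simp_all
  have "z (i + 1) \<in> carrier (KT (i + 1) (n - 1 - i))" using Y_D[OF z, of "i + 1"] unfolding 1 .
  then show "tensor_map R (K i) (obj X (n - 1 - i)) (bd (koszul R xs) (i + 1)) id (z (i + 1)) \<in> carrier (KT i (n - 1 - i))"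
    by (rule linear_mapD(1)[OF tensor_map_linear[OF TP TP bd_K_linear linear_map_id]])
  show "tensor_map R (K i) (obj X (n - 1 - i)) id (dgd A) (z i) \<in> carrier (KT i (n - 1 - i))"
    using linear_mapD(1)[OF tensor_map_linear[OF TP TP linear_map_id d_X_linear] Y_D[OF z, of i]] unfolding 1 .
qed

text \<open>In each component the coordinates are a bijection onto families on \<open>B i\<close>,
  and the \<open>B i\<close> partition the subsets of \<open>D\<close>. The two halves of the tensor
  differential become \<open>kd\<close> and the signed \<open>dgd\<close> in coordinates.\<close>

lemma koszul_iso: "complex_iso R C Y \<Phi>"
proof (intro complex_iso.intro complex_iso_axioms.intro C_complex Y_module)
  fix n
  show "linear_map R (obj Y n) (obj C n) (\<Phi> n)"
  proof (rule linear_mapI)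
    fix z assume z: "z \<in> carrier (obj Y n)"
    show "\<Phi> n z \<in> carrier (obj C n)" unfolding C_mem \<Phi>_def using co_homog[OF Y_D[OF z]] by simp
    show "\<Phi> n (z \<oplus>\<^bsub>obj Y n\<^esub> w) = \<Phi> n z \<oplus>\<^bsub>obj C n\<^esub> \<Phi> n w" if w: "w \<in> carrier (obj Y n)" for w
    proof
      fix I
      show "\<Phi> n (z \<oplus>\<^bsub>obj Y n\<^esub> w) I = (\<Phi> n z \<oplus>\<^bsub>obj C n\<^esub> \<Phi> n w) I"
        using linear_mapD(2)[OF co_linear Y_D[OF z] Y_D[OF w]] unfolding \<Phi>_def obj_Y by (simp add: direct_sum_simps(2))
    qed
    show "\<Phi> n (r \<odot>\<^bsub>obj Y n\<^esub> z) = r \<odot>\<^bsub>obj C n\<^esub> \<Phi> n z" if r: "r \<in> carrier R" for r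
    proof
      fix I
      have "r \<odot> \<zero> = \<zero>" using r by simp
      then show "\<Phi> n (r \<odot>\<^bsub>obj Y n\<^esub> z) I = (r \<odot>\<^bsub>obj C n\<^esub> \<Phi> n z) I"
        using linear_mapD(3)[OF co_linear r Y_D[OF z]] unfolding \<Phi>_def obj_Y by (simp add: direct_sum_simps(4))
    qed
  qed
  show "z = w" if z: "z \<in> carrier (obj Y n)" and w: "w \<in> carrier (obj Y n)" and eq: "\<Phi> n z = \<Phi> n w" for z w
  proof
    fix i
    show "z i = w i"
    proof (rule tensor_free_left.coord_inject[OF TF Y_D[OF z] Y_D[OF w]])
      fix I assume "I \<in> B i"
      then have I: "I \<subseteq> D" "int (card I) = i" unfolding B_def by simp_all
      show "co (n - i) I (z i) = co (n - i) I (w i)" using fun_cong[OF eq, of I] I unfolding \<Phi>_def by simp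
    qed
  qed
  show "\<exists>z\<in>carrier (obj Y n). \<Phi> n z = c" if c: "c \<in> carrier (obj C n)" for c
  proof -
    have "\<exists>t. t \<in> carrier (KT i (n - i)) \<and> (\<forall>I\<in>B i. co (n - i) I t = c I)" for i
    proof -
      have "c I \<in> carrier (obj X (n - i))" if "I \<in> B i" for I
        using C_D(1)[OF c, of I] that unfolding B_def by auto
      then show ?thesis using tensor_free_left.coord_surj[OF TF, of i c "n - i"] by metis
    qed
    then obtain z where z: "\<forall>i. z i \<in> carrier (KT i (n - i)) \<and> (\<forall>I\<in>B i. co (n - i) I (z i) = c I)" by metis
    have "z \<in> carrier (obj Y n)" by (rule Y_mem) (use z in blast)
    moreover have "\<Phi> n z = c"
    proof
      fix I
      show "\<Phi> n z I = c I"
      proof (cases "I \<subseteq> D")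
        case True
        then have "I \<in> B (int (card I))" by (simp add: B_def)
        then show ?thesis using z True unfolding \<Phi>_def by simp
      next
        case False
        then show ?thesis using C_D(2)[OF c] unfolding \<Phi>_def by simp
      qed
    qed
    ultimately show ?thesis by blast
  qed
  fix z assume z: "z \<in> carrier (obj Y n)"
  note p = bd_Y_parts[OF z]
  have bz: "bd Y n z i \<in> carrier (KT i (n - 1 - i))" for i
  proof -
    interpret TT: rmodule R "KT i (n - 1 - i)" by (intro rmodule.intro T_module)
    show ?thesis unfolding bd_Y using p[of i] by simp
  qed
  show bY: "bd Y n z \<in> carrier (obj Y (n - 1))" by (rule Y_mem) (rule bz)
  show "\<Phi> (n - 1) (bd Y n z) = bd C n (\<Phi> n z)"
  proof
    fix I
    show "\<Phi> (n - 1) (bd Y n z) I = bd C n (\<Phi> n z) I"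
    proof (cases "I \<subseteq> D")
      case False
      have o: "\<Phi> n z (insert k I) = \<zero>" for k using False unfolding \<Phi>_def by auto
      have "kd (\<Phi> n z) I = \<zero>" unfolding kd_def
        by (rule A.add.finprod_one_eqI) (use o xs_carr in simp)
      moreover have "\<Phi> n z I = \<zero>" "\<Phi> (n - 1) (bd Y n z) I = \<zero>" using False unfolding \<Phi>_def by simp_all
      ultimately show ?thesis unfolding bd_C by simp
    next
      case True
      let ?i = "int (card I)"
      let ?j = "n - 1 - ?i"
      interpret TT: rmodule R "KT ?i ?j" by (intro rmodule.intro T_module)
      \<comment> \<open>Both halves of the differential end in the same component; its second index
        is brought to the common form \<open>?j\<close>.\<close>
      have j: "n - (?i + 1) = ?j" "n - ?i - 1 = ?j" "n - ?i = ?j + 1" by simp_all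
      have z1: "z (?i + 1) \<in> carrier (KT (?i + 1) ?j)" using Y_D[OF z, of "?i + 1"] unfolding j .
      let ?t1 = "tensor_map R (K ?i) (obj X ?j) (bd (koszul R xs) (?i + 1)) id (z (?i + 1))"
      let ?t2 = "tensor_map R (K ?i) (obj X ?j) id (dgd A) (z ?i)"
      have "\<Phi> (n - 1) (bd Y n z) I = co ?j I (?t1 \<oplus>\<^bsub>KT ?i ?j\<^esub> signed (KT ?i ?j) ?i ?t2)"
        using True unfolding \<Phi>_def bd_Y by simp
      also have "\<dots> = co ?j I ?t1 \<oplus> co ?j I (signed (KT ?i ?j) ?i ?t2)"
        using linear_mapD(2)[OF co_linear p(1)[of ?i] TT.M.signed_closed[OF p(2)[of ?i]]] by simp
      also have "co ?j I (signed (KT ?i ?j) ?i ?t2) = signed (obj X ?j) ?i (co ?j I ?t2)"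
        using linear_map_uminus[OF T_module X_module co_linear p(2)[of ?i]] by (simp add: signed_def)
      also have "signed (obj X ?j) ?i (co ?j I ?t2) = signed A ?i (co ?j I ?t2)"
      proof -
        have h: "co ?j I ?t2 \<in> homog A ?j" by (rule co_homog[OF p(2)])
        have "\<ominus> co ?j I ?t2 \<oplus>\<^bsub>obj X ?j\<^esub> co ?j I ?t2 = \<zero>\<^bsub>obj X ?j\<^esub>" using A.l_neg[OF homog_carr[OF h]] by simp
        then have "\<ominus>\<^bsub>obj X ?j\<^esub> co ?j I ?t2 = \<ominus> co ?j I ?t2"
          by (rule X.O.M.minus_equality) (use h homogD(5) in simp_all)
        then show ?thesis by (simp add: signed_def)
      qed
      also have "co ?j I ?t2 = dgd A (\<Phi> n z I)"
        using co_tensor_map_right[OF Y_D[OF z, of ?i], of I] True unfolding \<Phi>_def j(2) by simp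
      also have "co ?j I ?t1 = kd (\<Phi> n z) I"
        unfolding co_tensor_map_left[OF z1] kd_def
      proof (rule A.finsum_cong')
        fix k assume k: "k \<in> D - I"
        have ki: "insert k I \<subseteq> D" using True k by blast
        have "int (card (insert k I)) = ?i + 1" using card_ins[OF True k] by simp
        then have "\<Phi> n z (insert k I) = co ?j (insert k I) (z (?i + 1))" using ki unfolding \<Phi>_def by (simp add: algebra_simps)
        then show "signed A (sg I k) (xs ! k \<otimes> co ?j (insert k I) (z (?i + 1))) =
          signed A (sg I k) (xs ! k \<otimes> \<Phi> n z (insert k I))" by simp
      next
        have "\<Phi> n z L \<in> carrier A" for L unfolding \<Phi>_def using homog_carr[OF co_homog[OF Y_D[OF z]]] by simp
        then show "(\<lambda>k. signed A (sg I k) (xs ! k \<otimes> \<Phi> n z (insert k I))) \<in> D - I \<rightarrow> carrier A"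
          using xs_carr by auto
      qed simp
      finally show ?thesis unfolding bd_C .
    qed
  qed
qed

end

section \<open>Parameters\<close>

text \<open>Over a commutative ring, killing a generator means killing everything.\<close>

lemma (in rmodule) annihilator_cyclic:
  assumes u: "u \<in> carrier M" and gen: "\<forall>x\<in>carrier M. \<exists>r\<in>carrier R. x = r \<odot> u"
  shows "annihilator R M = {r \<in> carrier R. r \<odot> u = \<zero>}"
proof -
  have "r \<odot> x = \<zero>" if r: "r \<in> carrier R" "r \<odot> u = \<zero>" and x: "x \<in> carrier M" for r x
  proof -
    obtain s where s: "s \<in> carrier R" "x = s \<odot> u" using gen x by blast
    have "r \<odot> x = s \<odot> (r \<odot> u)" using s r(1) u R.m_comm[of r s] by (simp add: smult_assoc1[symmetric])
    then show ?thesis using r(2) s(1) by (simp add: smult_r_null)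
  qed
  then show ?thesis using u unfolding annihilator_def by auto
qed

context noetherian_local
begin

text \<open>\<open>M\<close> is a copy of \<open>R/?I\<close> and the quotient a copy of
  \<open>R/(?I + (X))\<close>. A prime \<open>P\<close> over both sets contains the conductor
  \<open>?K\<close> of \<open>u\<close> into \<open>?N\<close>, since \<open>P u\<close> is a
  submodule containing \<open>?N\<close>; conversely \<open>?K\<close> annihilates the quotient and
  has at most \<open>\<mm>\<close> above it.\<close>

lemma finite_length_cyclic_quot:
  fixes M :: "('a, 'm, 'y) module_scheme"
  assumes M: "module R M" and u: "u \<in> carrier M" and gen: "\<forall>x\<in>carrier M. \<exists>r\<in>carrier R. x = r \<odot>\<^bsub>M\<^esub> u"
    and X: "X \<subseteq> \<mm>" and I: "{r \<in> carrier R. r \<odot>\<^bsub>M\<^esub> u = \<zero>\<^bsub>M\<^esub>} \<subseteq> \<mm>"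
  shows "finite_length R (module_quot M (gen_submodule R M {x \<odot>\<^bsub>M\<^esub> y | x y. x \<in> X \<and> y \<in> carrier M})) \<longleftrightarrow>
    primes_over R ({r \<in> carrier R. r \<odot>\<^bsub>M\<^esub> u = \<zero>\<^bsub>M\<^esub>} \<union> X) = {\<mm>}" (is "finite_length R (module_quot M ?N) \<longleftrightarrow> primes_over R (?I \<union> X) = {\<mm>}")
proof -
  interpret M: rmodule R M by (intro rmodule.intro M)
  let ?G = "{x \<odot>\<^bsub>M\<^esub> y | x y. x \<in> X \<and> y \<in> carrier M}"
  have XR: "X \<subseteq> carrier R" using X primeD(2)[OF prime_max] by blast
  have G: "?G \<subseteq> carrier M" using XR M.smult_closed by blast
  have N: "submodule ?N R M" by (rule M.gen_submodule(1)[OF G])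
  note Nd = M.submoduleD[OF N]
  have mm: "\<mm> \<in> primes_over R (?I \<union> X)" using max_in_primes_over[of "?I \<union> X"] X I by simp
  let ?K = "{r \<in> carrier R. r \<odot>\<^bsub>M\<^esub> u \<in> ?N}"
  have K: "ideal ?K R"
  proof (rule ideal_of_closed)
    show "\<zero> \<in> ?K" using Nd(2) u by (simp add: M.smult_l_null)
    show "a \<oplus> b \<in> ?K" if "a \<in> ?K" "b \<in> ?K" for a b
      using that u Nd(3)[of "a \<odot>\<^bsub>M\<^esub> u" "b \<odot>\<^bsub>M\<^esub> u"] by (simp add: M.smult_l_distr)
    show "x \<otimes> a \<in> ?K" if "a \<in> ?K" "x \<in> carrier R" for a x
      using that u Nd(4)[of x "a \<odot>\<^bsub>M\<^esub> u"] by (simp add: M.smult_assoc1)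
  qed blast
  have IK: "?I \<union> X \<subseteq> ?K" using Nd(2) M.gen_submodule(2)[OF G] XR u by auto
  show ?thesis
  proof
    assume fl: "finite_length R (module_quot M ?N)"
    have "P = \<mm>" if P: "P \<in> primes_over R (?I \<union> X)" for P
    proof (rule finite_length_quotD[OF M N fl u])
      have Pp: "primeideal P R" "?I \<subseteq> P" "X \<subseteq> P" using P unfolding primes_over_def by auto
      show "primeideal P R" by (rule Pp(1))
      note Pd = idealD[OF primeD(1)[OF Pp(1)]]
      let ?L = "(\<lambda>p. p \<odot>\<^bsub>M\<^esub> u) ` P"
      have L: "submodule ?L R M"
      proof (rule M.submodule_of_closed)
        show "?L \<subseteq> carrier M" using Pd(1) u by auto
        have "\<zero> \<odot>\<^bsub>M\<^esub> u \<in> ?L" using Pd(2) by (rule imageI)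
        then show "\<zero>\<^bsub>M\<^esub> \<in> ?L" using u by (simp add: M.smult_l_null)
      next
        fix x y assume "x \<in> ?L" "y \<in> ?L"
        then obtain p q where pq: "p \<in> P" "x = p \<odot>\<^bsub>M\<^esub> u" "q \<in> P" "y = q \<odot>\<^bsub>M\<^esub> u" by (elim imageE)
        have "x \<oplus>\<^bsub>M\<^esub> y = (p \<oplus> q) \<odot>\<^bsub>M\<^esub> u" using pq Pd(1) u by (simp add: M.smult_l_distr subset_eq)
        then show "x \<oplus>\<^bsub>M\<^esub> y \<in> ?L" using Pd(3)[OF pq(1,3)] by simp
      next
        fix r x assume r: "r \<in> carrier R" and "x \<in> ?L"
        then obtain p where p: "p \<in> P" "x = p \<odot>\<^bsub>M\<^esub> u" by (elim imageE)
        have "r \<odot>\<^bsub>M\<^esub> x = (r \<otimes> p) \<odot>\<^bsub>M\<^esub> u" using p Pd(1) u r by (simp add: M.smult_assoc1 subset_eq)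
        then show "r \<odot>\<^bsub>M\<^esub> x \<in> ?L" using Pd(4)[OF p(1) r] by simp
      qed
      have "?G \<subseteq> ?L"
      proof
        fix z assume "z \<in> ?G"
        then obtain x y where xy: "x \<in> X" "y \<in> carrier M" "z = x \<odot>\<^bsub>M\<^esub> y" by blast
        obtain r where r: "r \<in> carrier R" "y = r \<odot>\<^bsub>M\<^esub> u" using gen xy(2) by blast
        have x: "x \<in> carrier R" "x \<in> P" using xy(1) XR Pp(3) by blast+
        have "z = (r \<otimes> x) \<odot>\<^bsub>M\<^esub> u" using xy(3) r x u m_comm[of r x] by (simp add: M.smult_assoc1)
        then show "z \<in> ?L" using Pd(4)[OF x(2) r(1)] by simp
      qed
      then have NL: "?N \<subseteq> ?L" by (rule M.gen_submodule(3)[OF G L])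
      show "?K \<subseteq> P"
      proof
        fix r assume "r \<in> ?K"
        then have r: "r \<in> carrier R" "r \<odot>\<^bsub>M\<^esub> u \<in> ?L" using NL by auto
        then obtain p where p: "p \<in> P" "r \<odot>\<^bsub>M\<^esub> u = p \<odot>\<^bsub>M\<^esub> u" by (elim imageE)
        have pR: "p \<in> carrier R" using p(1) Pd(1) by blast
        \<comment> \<open>From \<open>r u = p u\<close> it follows only that \<open>r - p\<close>
          kills \<open>u\<close>; since \<open>P\<close> contains \<open>?I\<close>, this still
          gives \<open>r \<in> P\<close>.\<close>
        have "(r \<ominus> p) \<odot>\<^bsub>M\<^esub> u = r \<odot>\<^bsub>M\<^esub> u \<ominus>\<^bsub>M\<^esub> p \<odot>\<^bsub>M\<^esub> u"
          using r(1) pR u by (simp add: minus_eq M.M.minus_eq M.smult_l_distr M.smult_l_minus)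
        also have "\<dots> = \<zero>\<^bsub>M\<^esub>" unfolding p(2) using pR u by (simp add: M.M.minus_eq M.M.r_neg)
        finally have "r \<ominus> p \<in> P" using Pp(2) r(1) pR by blast
        then have "r \<ominus> p \<oplus> p \<in> P" by (rule Pd(3)[OF _ p(1)])
        then show "r \<in> P" using r(1) pR by (simp add: minus_eq a_assoc l_neg)
      qed
    qed
    then have "\<forall>P\<in>primes_over R (?I \<union> X). P = \<mm>" by (intro ballI)
    then show "primes_over R (?I \<union> X) = {\<mm>}" using mm by blast
  next
    assume V: "primes_over R (?I \<union> X) = {\<mm>}"
    show "finite_length R (module_quot M ?N)"
    proof (rule finite_length_quotI[OF M N _ K])
      have "carrier M \<subseteq> L" if L: "submodule L R M" "{u} \<subseteq> L" for L
      proof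
        fix x assume "x \<in> carrier M"
        then obtain r where r: "r \<in> carrier R" "x = r \<odot>\<^bsub>M\<^esub> u" using gen by blast
        then show "x \<in> L" using M.submoduleD(4)[OF L(1) r(1)] L(2) by simp
      qed
      then show "fg_over R M ?N (carrier M)" unfolding fg_over_def using u by (intro exI[of _ "{u}"]) simp
      show "primes_over R ?K \<subseteq> {\<mm>}" using IK V unfolding primes_over_def by blast
      fix r x assume r: "r \<in> ?K" and "x \<in> carrier M"
      then obtain s where s: "s \<in> carrier R" "x = s \<odot>\<^bsub>M\<^esub> u" using gen by blast
      have "r \<odot>\<^bsub>M\<^esub> x = s \<odot>\<^bsub>M\<^esub> (r \<odot>\<^bsub>M\<^esub> u)" using s r u m_comm[of r s] by (simp add: M.smult_assoc1[symmetric])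
      then show "r \<odot>\<^bsub>M\<^esub> x \<in> ?N" using Nd(4)[OF s(1)] r by simp
    qed
  qed
qed

end

section \<open>The three kinds of parameters as conditions on primes\<close>

locale local_cyclic_complex = noetherian_local R \<mm> + cyclic_complex R X I u
  for R :: "('r, 'x) ring_scheme" (structure) and \<mm> :: "'r set" and X :: "('r, 'm) cplx" and I :: "'r set" and u :: 'm +
  assumes I_max: "I \<subseteq> \<mm>"
begin

lemma one_notin: "\<one> \<notin> I"
  using I_max primeD(3)[OF prime_max] by blast

text \<open>The infimum at \<open>\<mm>\<close> is 0, so being an anchor prime means that the
  localized dimension is 0; every prime lies in \<open>\<mm>\<close>, so that dimension counts
  chains of primes over \<open>I\<close>.\<close>

lemma max_anchor_iff: "\<mm> \<in> anchor_primes R X \<longleftrightarrow> primes_over R I = {\<mm>}"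
proof -
  have "{Q \<in> primes_over R I. Q \<subseteq> \<mm>} = primes_over R I"
    using prime_subset_max unfolding primes_over_def by blast
  then have "cdim (ring_at R \<mm>) (cplx_at R \<mm> X) = sup_chain_length (primes_over R I)"
    using cdim_at_eq[OF prime_max] by simp
  then show ?thesis
    using cinf_at_zero[OF max_in_primes_over[OF I_max]] cinf_zero[OF one_notin] prime_max dim_zero_iff[OF I_max]
    unfolding anchor_primes_def by simp
qed

text \<open>Finite length in degree 0 alone leaves only \<open>\<mm>\<close> above \<open>I\<close>,
  because that homology contains a copy of \<open>R/I\<close>. Conversely every homology module is
  finitely generated and killed by \<open>I\<close>.\<close>

lemma finite_length_homology_iff:
  assumes fg: "\<forall>i. fg_over R (obj X i) (boundaries X i) (cycles X i)"
  shows "(\<forall>i. finite_length R (homology X i)) \<longleftrightarrow> primes_over R I = {\<mm>}"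
proof
  assume "\<forall>i. finite_length R (homology X i)"
  then have fl: "finite_length R (module_quot (Z 0) (boundaries X 0))" unfolding homology_def by blast
  have "P = \<mm>" if P: "P \<in> primes_over R I" for P
  proof (rule finite_length_quotD[OF Z_module boundaries_Z fl, of u])
    show "u \<in> carrier (Z 0)" using u_closed zero_cycles by simp
    show "primeideal P R" using P unfolding primes_over_def by simp
    show "{r \<in> carrier R. r \<odot>\<^bsub>Z 0\<^esub> u \<in> boundaries X 0} \<subseteq> P"
      using P I_iff unfolding primes_over_def by auto
  qed
  then have "primes_over R I \<subseteq> {\<mm>}" by (intro subsetI) simp
  moreover have "{\<mm>} \<subseteq> primes_over R I" using max_in_primes_over[OF I_max] by simp
  ultimately show "primes_over R I = {\<mm>}" by (rule subset_antisym)
next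
  assume V: "primes_over R I = {\<mm>}"
  show "\<forall>i. finite_length R (homology X i)"
  proof
    fix i
    obtain S where S: "finite S" "S \<subseteq> cycles X i"
      "\<forall>L. submodule L R (obj X i) \<longrightarrow> boundaries X i \<subseteq> L \<longrightarrow> S \<subseteq> L \<longrightarrow> cycles X i \<subseteq> L"
      using fg[rule_format, of i] unfolding fg_over_def by (elim exE conjE) (rule that)
    interpret Z: rmodule R "Z i" by (intro rmodule.intro Z_module)
    show "finite_length R (homology X i)" unfolding homology_def
    proof (rule finite_length_quotI[OF Z_module boundaries_Z _ I_ideal])
      have "\<forall>L. submodule L R (Z i) \<longrightarrow> boundaries X i \<subseteq> L \<longrightarrow> S \<subseteq> L \<longrightarrow> carrier (Z i) \<subseteq> L"
      proof (intro allI impI)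
        fix L assume L: "submodule L R (Z i)" "boundaries X i \<subseteq> L" "S \<subseteq> L"
        have "L \<subseteq> cycles X i" using Z.submoduleD(1)[OF L(1)] by simp
        then have "submodule L R (obj X i)" using L(1) Z_submodule_iff by simp
        then show "carrier (Z i) \<subseteq> L" using S(3) L(2,3) by simp
      qed
      then show "fg_over R (Z i) (boundaries X i) (carrier (Z i))"
        unfolding fg_over_def using S(1,2) by (intro exI[of _ S] conjI) simp_all
      show "primes_over R I \<subseteq> {\<mm>}" using V by simp
      show "r \<odot>\<^bsub>Z i\<^esub> x \<in> boundaries X i" if "r \<in> I" "x \<in> carrier (Z i)" for r x
        using I_annihilates[OF that(1), of x i] that(2) by simp
    qed
  qed
qed

text \<open>If \<open>u\<close> generates degree 0, the homology there is a copy of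
  \<open>R/I\<close>, and both its dimension and the finite length condition are read off
  primes.\<close>

lemma module_sop_homology_iff:
  assumes gen: "\<forall>x\<in>carrier (obj X 0). \<exists>r\<in>carrier R. x = r \<odot>\<^bsub>obj X 0\<^esub> u" and xs: "set xs \<subseteq> \<mm>"
  shows "module_sop R \<mm> (homology X 0) xs \<longleftrightarrow>
    ereal (real (length xs)) = sup_chain_length (primes_over R I) \<and> primes_over R (I \<union> set xs) = {\<mm>}"
proof -
  let ?k = "\<lambda>x. boundaries X 0 +>\<^bsub>Z 0\<^esub> x"
  interpret H: rmodule R "homology X 0" by (intro rmodule.intro homology_module)
  have uc: "u \<in> cycles X 0" using u_closed zero_cycles by simp
  have ku: "?k u \<in> carrier (homology X 0)" unfolding homology_carrier using uc by (rule imageI)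
  have I_eq: "{r \<in> carrier R. r \<odot>\<^bsub>homology X 0\<^esub> ?k u = \<zero>\<^bsub>homology X 0\<^esub>} = I"
  proof -
    have "r \<odot>\<^bsub>homology X 0\<^esub> ?k u = \<zero>\<^bsub>homology X 0\<^esub> \<longleftrightarrow> r \<in> I" if r: "r \<in> carrier R" for r
      unfolding homology_smult[OF r uc]
      using homology_class_zero[of "r \<odot>\<^bsub>obj X 0\<^esub> u" 0] O.smult_closed[OF r u_closed] zero_cycles I_iff[OF r] by simp
    then show ?thesis using I_carr by blast
  qed
  have g: "\<forall>x\<in>carrier (homology X 0). \<exists>r\<in>carrier R. x = r \<odot>\<^bsub>homology X 0\<^esub> ?k u"
  proof
    fix x assume "x \<in> carrier (homology X 0)"
    then obtain y where y: "x = ?k y" "y \<in> cycles X 0" unfolding homology_carrier by (rule imageE)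
    then obtain r where "r \<in> carrier R" "y = r \<odot>\<^bsub>obj X 0\<^esub> u" using gen zero_cycles by auto
    then show "\<exists>r\<in>carrier R. x = r \<odot>\<^bsub>homology X 0\<^esub> ?k u" using homology_smult[OF _ uc] y(1) by auto
  qed
  have "module_dim R (homology X 0) = sup_chain_length (primes_over R I)"
    unfolding module_dim_def H.annihilator_cyclic[OF ku g] I_eq by (rule krull_dim_quot[OF I_ideal])
  then show ?thesis
    using finite_length_cyclic_quot[OF homology_module ku g xs] I_eq I_max xs unfolding module_sop_def by auto
qed

end

locale local_dg_algebra = dg_over_deg0 A + L: noetherian_local "deg0_ring A" \<mm>
  for A :: "('a, 'a) dg_alg" (structure) and \<mm> :: "'a set" +
  assumes homologically_finite: "homologically_finite R X" and J_max: "J \<subseteq> \<mm>"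
begin

lemma X_local: "local_cyclic_complex R \<mm> X J \<one>"
  by (intro local_cyclic_complex.intro local_cyclic_complex_axioms.intro X_cyclic L.noetherian_local_axioms J_max)

sublocale XL: local_cyclic_complex R \<mm> X J "\<one>" by (rule X_local)

lemma max_deg0: "\<mm> \<subseteq> homog A 0"
  using R.primeD(2)[OF L.prime_max] by simp

text \<open>Hides the coordinate model: from here on a Koszul complex is known only through finite
  generation of its homology and the primes over its ideal.\<close>

lemma koszul_local:
  assumes xs: "set xs \<subseteq> \<mm>"
  obtains I v where "local_cyclic_complex R \<mm> (koszul_on R xs X) I v"
    "primes_over R I = primes_over R (J \<union> set xs)"
    "\<forall>i. fg_over R (obj (koszul_on R xs X) i) (boundaries (koszul_on R xs X) i) (cycles (koszul_on R xs X) i)"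
proof -
  interpret K: koszul_model A xs
    by (intro koszul_model.intro koszul_model_axioms.intro dg_over_deg0_axioms subset_trans[OF xs max_deg0])
  interpret Y: complex_iso R K.C "koszul_on R xs X" K.\<Phi> by (rule K.koszul_iso)
  obtain v where v: "cyclic_complex R (koszul_on R xs X) K.JX v"
    using Y.Y_cyclic[OF K.C_cyclic] by (elim exE)
  have P: "primes_over R K.JX = primes_over R (J \<union> set xs)" by (rule K.primes_over_JX)
  have "\<mm> \<in> primes_over R K.JX" unfolding P by (rule L.max_in_primes_over) (use J_max xs in simp)
  then have "K.JX \<subseteq> \<mm>" unfolding primes_over_def by simp
  then have l: "local_cyclic_complex R \<mm> (koszul_on R xs X) K.JX v"
    by (intro local_cyclic_complex.intro local_cyclic_complex_axioms.intro v L.noetherian_local_axioms)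
  have "\<forall>m. fg_over R (obj X m) (boundaries X m) (cycles X m)"
    using X.homologically_finite_fg[OF homologically_finite] by (intro allI)
  then have "\<forall>i. fg_over R (obj (koszul_on R xs X) i) (boundaries (koszul_on R xs X) i) (cycles (koszul_on R xs X) i)"
    using Y.Y_fg[OF K.C_homology_fg[OF L.noetherian_ring_axioms]] by (intro allI)
  then show thesis by (rule that[OF l P])
qed

lemma length_seq_iff: "length_seq R \<mm> X xs \<longleftrightarrow> set xs \<subseteq> \<mm> \<and> primes_over R (J \<union> set xs) = {\<mm>}"
proof (cases "set xs \<subseteq> \<mm>")
  case True
  obtain I v where "local_cyclic_complex R \<mm> (koszul_on R xs X) I v"
    "primes_over R I = primes_over R (J \<union> set xs)"
    "\<forall>i. fg_over R (obj (koszul_on R xs X) i) (boundaries (koszul_on R xs X) i) (cycles (koszul_on R xs X) i)"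
    by (rule koszul_local[OF True])
  then show ?thesis
    using local_cyclic_complex.finite_length_homology_iff[of R \<mm> "koszul_on R xs X" I v] True
    unfolding length_seq_def by simp
qed (simp add: length_seq_def)

lemma cinf_X: "cinf X = 0"
  using XL.cinf_zero XL.one_notin by simp

lemma sop_iff:
  "sop R \<mm> X xs \<longleftrightarrow> set xs \<subseteq> \<mm> \<and> primes_over R (J \<union> set xs) = {\<mm>} \<and>
     ereal (real (length xs)) = sup_chain_length (primes_over R J)"
proof (cases "set xs \<subseteq> \<mm>")
  case True
  obtain I v where "local_cyclic_complex R \<mm> (koszul_on R xs X) I v"
    "primes_over R I = primes_over R (J \<union> set xs)"
    by (rule koszul_local[OF True])
  then show ?thesis
    using local_cyclic_complex.max_anchor_iff[of R \<mm> "koszul_on R xs X" I v] True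
    unfolding sop_def XL.cdim_eq cinf_X by simp
qed (simp add: sop_def)

lemma J_ideal: "ideal J R"
  by (rule XL.I_ideal)

text \<open>The lower bound is Krull's height theorem, the attained value comes from prime avoidance.\<close>
lemma ldim_eq: "ldim R \<mm> X = sup_chain_length (primes_over R J)"
proof -
  obtain n where n: "sup_chain_length (primes_over R J) = ereal (real n)"
    "\<And>k C. \<lbrakk>\<forall>i\<le>k. C i \<in> primes_over R J; \<forall>i<k. C i \<subset> C (Suc i)\<rbrakk> \<Longrightarrow> k \<le> n"
    by (rule L.dim_finite[OF J_ideal J_max]) (rule that, assumption, blast)
  obtain xs where xs: "set xs \<subseteq> \<mm>" "length xs \<le> n" "primes_over R (J \<union> set xs) = {\<mm>}"
    using L.exists_parameters[OF J_ideal J_max, of n] n(2) by metis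
  have "Inf {ereal (real (length xs)) | xs. length_seq R \<mm> X xs} = ereal (real n)"
  proof (rule antisym)
    \<comment> \<open>The sequence found is only known to have at most \<open>n\<close> entries,
      which is enough for this inequality.\<close>
    have "Inf {ereal (real (length xs)) | xs. length_seq R \<mm> X xs} \<le> ereal (real (length xs))"
      by (rule Inf_lower) (use xs length_seq_iff in blast)
    also have "\<dots> \<le> ereal (real n)" using xs(2) by simp
    finally show "Inf {ereal (real (length xs)) | xs. length_seq R \<mm> X xs} \<le> ereal (real n)" .
    show "ereal (real n) \<le> Inf {ereal (real (length xs)) | xs. length_seq R \<mm> X xs}"
    proof (rule Inf_greatest)
      fix y assume "y \<in> {ereal (real (length xs)) | xs. length_seq R \<mm> X xs}"
      then obtain ys where ys: "y = ereal (real (length ys))" "primes_over R (J \<union> set ys) = {\<mm>}"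
        unfolding length_seq_iff by blast
      have "sup_chain_length (primes_over R J) \<le> y"
      proof (rule sup_chain_length_le)
        fix k C assume C: "\<forall>i\<le>k. C i \<in> primes_over R J" "\<forall>i<k. C i \<subset> C (Suc i)"
        \<comment> \<open>A sequence may repeat entries; the bound by the number of distinct entries
          is weakened to a bound by the length.\<close>
        have "k \<le> card (set ys)" by (rule L.dim_le_card_parameters[OF J_ideal _ ys(2) C]) simp
        then show "ereal (real k) \<le> y" using card_length[of ys] ys(1) by simp
      qed
      then show "ereal (real n) \<le> y" using n(1) by simp
    qed
  qed
  then show ?thesis unfolding ldim_def cinf_X n(1) by simp
qed

lemma length_sop_iff:
  "length_sop R \<mm> X xs \<longleftrightarrow> set xs \<subseteq> \<mm> \<and> primes_over R (J \<union> set xs) = {\<mm>} \<and>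
     ereal (real (length xs)) = sup_chain_length (primes_over R J)"
  unfolding length_sop_def length_seq_iff ldim_eq cinf_X by simp

lemma module_sop_iff:
  assumes "set xs \<subseteq> \<mm>"
  shows "module_sop R \<mm> (homology X 0) xs \<longleftrightarrow> primes_over R (J \<union> set xs) = {\<mm>} \<and>
     ereal (real (length xs)) = sup_chain_length (primes_over R J)"
proof -
  have "\<forall>x\<in>carrier (obj X 0). \<exists>r\<in>carrier R. x = r \<odot>\<^bsub>obj X 0\<^esub> \<one>"
  proof
    fix x assume "x \<in> carrier (obj X 0)"
    then have x: "x \<in> homog A 0" by simp
    then have "x = x \<odot> \<one>" using smult_eq[OF x A.one_closed] A.r_one[OF homog_carr[OF x]] by simp
    then show "\<exists>r\<in>carrier R. x = r \<odot>\<^bsub>obj X 0\<^esub> \<one>" using x by (intro bexI[of _ x]) simp_all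
  qed
  then show ?thesis using XL.module_sop_homology_iff[OF _ assms] by blast
qed

end

section \<open>DG prime ideals\<close>

context dg_over_deg0
begin

text \<open>Both families are extended by zero to the union of their index sets; independence,
  applied to the differences, then compares them degree by degree.\<close>

lemma homog_unique:
  assumes S: "finite S" "\<forall>i\<in>S. f i \<in> homog A i" and K: "finite K" "\<forall>i\<in>K. g i \<in> homog A i"
    and eq: "(\<Oplus>i\<in>S. f i) = (\<Oplus>i\<in>K. g i)"
  shows "(if i \<in> S then f i else \<zero>) = (if i \<in> K then g i else \<zero>)"
proof (cases "i \<in> S \<union> K")
  case True
  let ?f = "\<lambda>i. if i \<in> S then f i else \<zero>" and ?g = "\<lambda>i. if i \<in> K then g i else \<zero>"
  have h: "?f i \<in> homog A i" "?g i \<in> homog A i" for i using S(2) K(2) homogD(2) by simp_all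
  have c: "?f i \<in> carrier A" "?g i \<in> carrier A" for i using h homog_carr by blast+
  have fin: "finite (S \<union> K)" using S(1) K(1) by simp
  have ef: "(\<Oplus>i\<in>S. f i) = (\<Oplus>i\<in>S \<union> K. ?f i)"
    by (rule A.add.finprod_mono_neutral_cong_left) (use fin c in auto)
  have eg: "(\<Oplus>i\<in>K. g i) = (\<Oplus>i\<in>S \<union> K. ?g i)"
    by (rule A.add.finprod_mono_neutral_cong_left) (use fin c in auto)
  have "(\<Oplus>i\<in>S \<union> K. ?f i \<oplus> (\<ominus> \<one>) \<otimes> ?g i) = (\<Oplus>i\<in>S \<union> K. ?f i) \<oplus> (\<Oplus>i\<in>S \<union> K. (\<ominus> \<one>) \<otimes> ?g i)"
    by (rule A.finsum_addf) (use c in auto)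
  also have "(\<Oplus>i\<in>S \<union> K. (\<ominus> \<one>) \<otimes> ?g i) = (\<ominus> \<one>) \<otimes> (\<Oplus>i\<in>S \<union> K. ?g i)"
    by (rule A.finsum_rdistr[OF fin, symmetric]) (use c in auto)
  also have "(\<Oplus>i\<in>S \<union> K. ?f i) \<oplus> (\<ominus> \<one>) \<otimes> (\<Oplus>i\<in>S \<union> K. ?g i) = \<zero>"
  proof -
    have "(\<Oplus>i\<in>S \<union> K. ?g i) \<in> carrier A" by (rule A.finsum_closed) (use c in auto)
    then show ?thesis using eq ef eg by (simp add: A.l_minus A.r_neg)
  qed
  finally have z: "(\<Oplus>i\<in>S \<union> K. ?f i \<oplus> (\<ominus> \<one>) \<otimes> ?g i) = \<zero>" .
  have "?f i \<oplus> (\<ominus> \<one>) \<otimes> ?g i = \<zero>"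
    by (rule dg.homog_independent[OF fin _ z True])
      (intro ballI homogD(3) homogD(4) h homogD(5) dg.homog_one)
  then have "?f i \<ominus> ?g i = \<zero>" using c[of i] by (simp only: A.l_minus A.one_closed A.l_one A.minus_eq)
  then show ?thesis by (rule iffD1[OF A.r_right_minus_eq[OF c]])
qed simp

text \<open>Sums with at most one term in each degree, the normal form that
  \<open>homog_unique\<close> compares.\<close>

definition graded_span :: "(int \<Rightarrow> 'a set) \<Rightarrow> 'a set" where
  "graded_span G = {a. \<exists>J f. finite J \<and> (\<forall>i\<in>J. f i \<in> G i) \<and> a = (\<Oplus>i\<in>J. f i)}"

lemma graded_span_incl: "\<lbrakk>\<forall>i. G i \<subseteq> homog A i; x \<in> G i\<rbrakk> \<Longrightarrow> x \<in> graded_span G"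
proof -
  assume G: "\<forall>i. G i \<subseteq> homog A i" and x: "x \<in> G i"
  then have "x \<in> carrier A" using homog_carr by blast
  then show "x \<in> graded_span G" unfolding graded_span_def using x
    by (intro CollectI exI[of _ "{i}"] exI[of _ "\<lambda>_. x"]) simp
qed

lemma graded_span_closed: "\<forall>i. G i \<subseteq> homog A i \<Longrightarrow> graded_span G \<subseteq> carrier A"
proof
  fix a assume G: "\<forall>i. G i \<subseteq> homog A i" and "a \<in> graded_span G"
  then obtain J f where J: "\<forall>i\<in>J. f i \<in> G i" "a = (\<Oplus>i\<in>J. f i)"
    unfolding graded_span_def by blast
  have "f \<in> J \<rightarrow> carrier A" using J(1) G homogD(1) by fast
  then show "a \<in> carrier A" unfolding J(2) by (rule A.finsum_closed)
qed

lemma graded_span_induct: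
  assumes G: "\<forall>i. G i \<subseteq> homog A i" and a: "a \<in> graded_span G"
    and H: "H \<subseteq> carrier A" "\<zero> \<in> H" "\<forall>x\<in>H. \<forall>y\<in>H. x \<oplus> y \<in> H" "\<forall>i. G i \<subseteq> H"
  shows "a \<in> H"
proof -
  obtain J f where J: "finite J" "\<forall>i\<in>J. f i \<in> G i" "a = (\<Oplus>i\<in>J. f i)"
    using a unfolding graded_span_def by blast
  have "\<forall>i\<in>J. f i \<in> H" using J(2) H(4) by blast
  then show ?thesis unfolding J(3) by (rule A.finsum_mem[OF J(1) H(2,3,1)])
qed

lemma graded_span_add:
  assumes G: "\<forall>i. G i \<subseteq> homog A i" and G0: "\<forall>i. \<zero> \<in> G i" and Ga: "\<forall>i. \<forall>x\<in>G i. \<forall>y\<in>G i. x \<oplus> y \<in> G i"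
    and a: "a \<in> graded_span G" and b: "b \<in> graded_span G"
  shows "a \<oplus> b \<in> graded_span G"
proof -
  obtain J f where J: "finite J" "\<forall>i\<in>J. f i \<in> G i" "a = (\<Oplus>i\<in>J. f i)"
    using a unfolding graded_span_def by blast
  obtain K g where K: "finite K" "\<forall>i\<in>K. g i \<in> G i" "b = (\<Oplus>i\<in>K. g i)"
    using b unfolding graded_span_def by blast
  let ?f = "\<lambda>i. if i \<in> J then f i else \<zero>" and ?g = "\<lambda>i. if i \<in> K then g i else \<zero>"
  have h: "?f i \<in> G i" "?g i \<in> G i" for i using J(2) K(2) G0 by simp_all
  have c: "?f i \<in> carrier A" "?g i \<in> carrier A" for i using h G homog_carr by blast+
  have fin: "finite (J \<union> K)" using J(1) K(1) by simp
  have ef: "a = (\<Oplus>i\<in>J \<union> K. ?f i)" unfolding J(3)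
    by (rule A.add.finprod_mono_neutral_cong_left) (use fin c in auto)
  have eg: "b = (\<Oplus>i\<in>J \<union> K. ?g i)" unfolding K(3)
    by (rule A.add.finprod_mono_neutral_cong_left) (use fin c in auto)
  have "a \<oplus> b = (\<Oplus>i\<in>J \<union> K. ?f i \<oplus> ?g i)" unfolding ef eg
    by (rule A.finsum_addf[symmetric]) (use c in auto)
  moreover have "\<forall>i\<in>J \<union> K. ?f i \<oplus> ?g i \<in> G i" using Ga h by blast
  ultimately show ?thesis unfolding graded_span_def using fin
    by (intro CollectI exI[of _ "J \<union> K"] exI[of _ "\<lambda>i. ?f i \<oplus> ?g i"] conjI)
qed

lemma graded_span_homog: "graded_span (homog A) = carrier A"
proof
  show "graded_span (homog A) \<subseteq> carrier A" by (rule graded_span_closed) simp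
  show "carrier A \<subseteq> graded_span (homog A)"
    using dg.homog_span unfolding graded_span_def by blast
qed

end

section \<open>The DG prime over a prime of degree zero\<close>

locale deg0_prime = dg_over_deg0 +
  fixes p assumes prime: "primeideal p R" and J_p: "J \<subseteq> p"
begin

text \<open>The components of \<open>p \<oplus> A_+\<close>; those in negative degrees are zero by
  \<open>homog_neg\<close>.\<close>

definition G :: "int \<Rightarrow> 'a set" where "G i = (if i = 0 then p else homog A i)"
definition E :: "'a set" where "E = graded_span G"

lemmas p_ideal = R.idealD[OF R.primeD(1)[OF prime], simplified]

lemma G_homog: "\<forall>i. G i \<subseteq> homog A i"
  using p_ideal(1) by (simp add: G_def)

lemma G_zero: "\<zero> \<in> G i"
  using p_ideal(2) homogD(2) by (simp add: G_def)

lemma E_closed: "E \<subseteq> carrier A"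
  unfolding E_def by (rule graded_span_closed[OF G_homog])

lemma G_E: "G i \<subseteq> E"
  unfolding E_def using graded_span_incl[OF G_homog] by blast

lemma E_zero: "\<zero> \<in> E"
  using G_zero G_E by blast

lemma E_add: "\<lbrakk>a \<in> E; b \<in> E\<rbrakk> \<Longrightarrow> a \<oplus> b \<in> E"
  unfolding E_def
proof (rule graded_span_add[OF G_homog])
  show "\<forall>i. \<forall>x\<in>G i. \<forall>y\<in>G i. x \<oplus> y \<in> G i" using p_ideal(3) homogD(3) by (simp add: G_def)
qed (use G_zero in auto)

lemma homog_mult_G:
  assumes x: "x \<in> homog A j" and b: "b \<in> G i"
  shows "x \<otimes> b \<in> E \<and> b \<otimes> x \<in> E"
proof -
  have bh: "b \<in> homog A i" using b G_homog by blast
  note c = homog_carr[OF x] homog_carr[OF bh]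
  \<comment> \<open>For nonnegative degrees that are not both 0 the product has nonzero degree,
    where \<open>G\<close> is the full component.\<close>
  consider "i < 0" | "j < 0" | "i = 0" "j = 0" | "0 \<le> i" "0 \<le> j" "i + j \<noteq> 0" by linarith
  then show ?thesis
  proof cases
    case 1
    then have "b = \<zero>" using bh dg.homog_neg by blast
    then show ?thesis using c E_zero by simp
  next
    case 2
    then have "x = \<zero>" using x dg.homog_neg by blast
    then show ?thesis using c E_zero by simp
  next
    case 3
    then have h: "b \<in> p" "x \<in> homog A 0" using b x by (simp_all add: G_def)
    have "x \<otimes> b \<in> p" by (rule p_ideal(4)[OF h])
    moreover have "b \<otimes> x = x \<otimes> b" by (rule deg0_comm[OF h(2) bh])
    ultimately show ?thesis using G_E[of 0] by (auto simp: G_def)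
  next
    case 4
    then have "x \<otimes> b \<in> G (j + i)" "b \<otimes> x \<in> G (i + j)"
      using dg.homog_mult[OF x bh] dg.homog_mult[OF bh x] by (simp_all add: G_def)
    then show ?thesis using G_E by blast
  qed
qed

lemma E_mult:
  assumes x: "x \<in> carrier A" and b: "b \<in> E"
  shows "x \<otimes> b \<in> E" "b \<otimes> x \<in> E"
proof -
  have 1: "x \<otimes> b \<in> E \<and> b \<otimes> x \<in> E" if x: "x \<in> homog A j" and b: "b \<in> E" for x j b
  proof -
    have xc: "x \<in> carrier A" by (rule homog_carr[OF x])
    have "b \<in> {b \<in> carrier A. x \<otimes> b \<in> E \<and> b \<otimes> x \<in> E}"
    proof (rule graded_span_induct[OF G_homog b[unfolded E_def]])
      show "\<forall>i. G i \<subseteq> {b \<in> carrier A. x \<otimes> b \<in> E \<and> b \<otimes> x \<in> E}"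
        using homog_mult_G[OF x] G_E E_closed by blast
    qed (use xc E_zero E_add in \<open>auto simp: A.l_distr A.r_distr\<close>)
    then show ?thesis by simp
  qed
  have bc: "b \<in> carrier A" using b E_closed by blast
  have "x \<in> {x \<in> carrier A. x \<otimes> b \<in> E \<and> b \<otimes> x \<in> E}"
  proof (rule graded_span_induct[OF _ x[folded graded_span_homog]])
    show "\<forall>i. homog A i \<subseteq> {x \<in> carrier A. x \<otimes> b \<in> E \<and> b \<otimes> x \<in> E}"
      using 1[OF _ b] homog_carr by blast
  qed (use bc E_zero E_add in \<open>auto simp: A.l_distr A.r_distr\<close>)
  then show "x \<otimes> b \<in> E" "b \<otimes> x \<in> E" by simp_all
qed

lemma E_minus: "b \<in> E \<Longrightarrow> \<ominus> b \<in> E"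
  using E_mult(1)[of "\<ominus> \<one>" b] E_closed by (simp add: A.l_minus subset_eq)

lemma E_ideal: "ideal E A"
proof (rule idealI)
  show "ring A" by (rule A.ring_axioms)
  show "subgroup E (add_monoid A)"
    by (rule subgroup.intro)
      (use E_closed E_add E_zero E_minus in \<open>auto simp: a_inv_def[symmetric]\<close>)
qed (use E_mult in auto)

lemma E_deg0: "E \<inter> homog A 0 = p"
proof
  show "p \<subseteq> E \<inter> homog A 0" using G_E[of 0] G_homog p_ideal(1) by (simp add: G_def)
  show "E \<inter> homog A 0 \<subseteq> p"
  proof
    fix r assume r: "r \<in> E \<inter> homog A 0"
    then obtain J f where J: "finite J" "\<forall>i\<in>J. f i \<in> G i" "r = (\<Oplus>i\<in>J. f i)"
      unfolding E_def graded_span_def by blast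
    \<comment> \<open>\<open>r\<close> is its own decomposition, concentrated in degree 0;
      uniqueness identifies it with the component \<open>f 0\<close>, which lies in
      \<open>p\<close>.\<close>
    have eq: "(\<Oplus>i\<in>J. f i) = (\<Oplus>i\<in>{0::int}. r)" using homog_carr[of r 0] r by (simp add: J(3)[symmetric])
    have "(if 0 \<in> J then f 0 else \<zero>) = r"
      using homog_unique[OF J(1) _ _ _ eq, of 0] J(2) G_homog r by (auto simp: subset_eq)
    moreover have "f 0 \<in> p" if "0 \<in> J" using bspec[OF J(2) that] by (simp add: G_def)
    ultimately show "r \<in> p" using p_ideal(2) by (cases "0 \<in> J") simp_all
  qed
qed

lemma E_decompose:
  assumes "a \<in> carrier A"
  shows "\<exists>r\<in>homog A 0. \<exists>b\<in>E. a = r \<oplus> b"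
proof -
  have "a \<in> {a \<in> carrier A. \<exists>r\<in>homog A 0. \<exists>b\<in>E. a = r \<oplus> b}" (is "a \<in> ?H")
  proof (rule graded_span_induct[OF _ assms[folded graded_span_homog]])
    show "\<zero> \<in> ?H" using homogD(2) E_zero by force
    show "\<forall>x\<in>?H. \<forall>y\<in>?H. x \<oplus> y \<in> ?H"
    proof (intro ballI)
      fix x y assume "x \<in> ?H" "y \<in> ?H"
      then obtain r b s c where h: "r \<in> homog A 0" "b \<in> E" "x = r \<oplus> b" "s \<in> homog A 0" "c \<in> E" "y = s \<oplus> c"
        by blast
      have cc: "r \<in> carrier A" "s \<in> carrier A" "b \<in> carrier A" "c \<in> carrier A" using h homog_carr E_closed by blast+
      have "x \<oplus> y = (r \<oplus> s) \<oplus> (b \<oplus> c)" using h(3,6) cc by (simp add: A.a_ac)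
      then show "x \<oplus> y \<in> ?H" using homogD(3)[OF h(1,4)] E_add[OF h(2,5)] cc h(3,6)
        by (intro CollectI conjI bexI[of _ "r \<oplus> s"] bexI[of _ "b \<oplus> c"]) simp_all
    qed
    show "\<forall>i. homog A i \<subseteq> ?H"
    proof (intro allI subsetI)
      fix i x assume x: "x \<in> homog A i"
      have xc: "x \<in> carrier A" by (rule homog_carr[OF x])
      show "x \<in> ?H"
      proof (cases "i = 0")
        case True
        then have "x \<in> homog A 0" "x = x \<oplus> \<zero>" using x xc by simp_all
        then show ?thesis using E_zero xc by blast
      next
        case False
        then have "x \<in> E" "x = \<zero> \<oplus> x" using x xc G_E[of i] by (auto simp: G_def)
        then show ?thesis using homogD(2)[of 0] xc by blast
      qed
    qed
  qed auto
  then show ?thesis by simp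
qed

lemma E_dg_ideal: "dg_ideal E A"
  unfolding dg_ideal_def
proof (intro conjI E_ideal ballI)
  fix a assume "a \<in> E"
  then obtain J f where J: "finite J" "\<forall>i\<in>J. f i \<in> G i" "a = (\<Oplus>i\<in>J. f i)"
    unfolding E_def graded_span_def by blast
  moreover have "\<forall>i\<in>J. f i \<in> E \<inter> homog A i" using J(2) G_E G_homog by blast
  ultimately show "\<exists>J f. finite J \<and> (\<forall>i\<in>J. f i \<in> E \<inter> homog A i) \<and> a = (\<Oplus>i\<in>J. f i)" by blast
next
  have "a \<in> {a \<in> carrier A. dgd A a \<in> E}" if a: "a \<in> E" for a
  proof (rule graded_span_induct[OF G_homog a[unfolded E_def]])
    show "\<forall>i. G i \<subseteq> {a \<in> carrier A. dgd A a \<in> E}"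
    proof (intro allI subsetI)
      fix i x assume x: "x \<in> G i"
      then have xh: "x \<in> homog A i" using G_homog by blast
      have dx: "dgd A x \<in> homog A (i - 1)" by (rule dg.d_homog[OF xh])
      have "dgd A x \<in> E"
      \<comment> \<open>The differential can leave \<open>G\<close> only by landing in degree 0,
        that is from degree 1, and there its values lie in \<open>J\<close>.\<close>
      proof (cases "i - 1 = 0")
        case True
        then have "dgd A x \<in> J" using xh unfolding J_def by simp
        then show ?thesis using J_p G_E[of 0] by (auto simp: G_def)
      next
        case False
        then show ?thesis using dx G_E[of "i - 1"] by (auto simp: G_def)
      qed
      then show "x \<in> {a \<in> carrier A. dgd A a \<in> E}" using homog_carr[OF xh] by simp
    qed
    show "\<forall>x\<in>{a \<in> carrier A. dgd A a \<in> E}. \<forall>y\<in>{a \<in> carrier A. dgd A a \<in> E}. x \<oplus> y \<in> {a \<in> carrier A. dgd A a \<in> E}"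
      using E_add by (simp add: dg.d_add)
  qed (use E_zero in auto)
  then show "dgd A ` E \<subseteq> E" by (intro subsetI) (elim imageE, simp)
qed

text \<open>\<open>A/E\<close> is a copy of \<open>R/p\<close>: modulo \<open>E\<close> both factors
  have representatives of degree 0, and the product of these lies in
  \<open>E \<inter> homog A 0 = p\<close>.\<close>

lemma E_dg_prime: "dg_prime_ideal E A"
  unfolding dg_prime_ideal_def
proof (intro conjI E_dg_ideal ballI impI)
  have "\<one> \<notin> E" using E_deg0 R.primeD(3)[OF prime] dg.homog_one by auto
  then show "E \<noteq> carrier A" by auto
  fix a a' assume a: "a \<in> carrier A" "a' \<in> carrier A" and ab: "a \<otimes> a' \<in> E"
  obtain r b where r: "r \<in> homog A 0" "b \<in> E" "a = r \<oplus> b" using E_decompose[OF a(1)] by blast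
  obtain s c where s: "s \<in> homog A 0" "c \<in> E" "a' = s \<oplus> c" using E_decompose[OF a(2)] by blast
  have cc: "r \<in> carrier A" "s \<in> carrier A" "b \<in> carrier A" "c \<in> carrier A" using r s homog_carr E_closed by blast+
  let ?e = "r \<otimes> c \<oplus> b \<otimes> a'"
  have e: "?e \<in> E" "?e \<in> carrier A" using E_add E_mult(1)[OF cc(1) s(2)] E_mult(2)[OF a(2) r(2)] cc a by simp_all
  have "a \<otimes> a' = r \<otimes> s \<oplus> ?e"
  proof -
    have "a \<otimes> a' = r \<otimes> a' \<oplus> b \<otimes> a'" unfolding r(3) using cc a by (simp add: A.l_distr)
    also have "r \<otimes> a' = r \<otimes> s \<oplus> r \<otimes> c" unfolding s(3) using cc by (simp add: A.r_distr)
    finally show ?thesis using cc a by (simp add: A.a_assoc)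
  qed
  then have "r \<otimes> s = a \<otimes> a' \<oplus> \<ominus> ?e" using cc e(2) by (simp add: A.a_assoc A.r_neg)
  then have "r \<otimes> s \<in> E" using E_add[OF ab E_minus[OF e(1)]] by simp
  then have "r \<otimes> s \<in> p" using E_deg0 homogD(4)[OF r(1) s(1)] by blast
  then have "r \<in> p \<or> s \<in> p" using R.primeD(4)[OF prime, of r s] r s by simp
  then have "r \<in> E \<or> s \<in> E" using E_deg0 by blast
  then show "a \<in> E \<or> a' \<in> E" using E_add r s by blast
qed

end

section \<open>Elements of positive degree in DG primes\<close>

context dg_over_deg0
begin

lemma dg_primeD:
  assumes "dg_prime_ideal P A"
  shows "P \<subseteq> carrier A" "\<zero> \<in> P" "\<forall>a\<in>P. \<forall>b\<in>P. a \<oplus> b \<in> P"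
    "\<forall>a\<in>P. \<forall>x\<in>carrier A. x \<otimes> a \<in> P \<and> a \<otimes> x \<in> P" "\<one> \<notin> P"
    "\<lbrakk>a \<in> carrier A; b \<in> carrier A; a \<otimes> b \<in> P\<rbrakk> \<Longrightarrow> a \<in> P \<or> b \<in> P"
    "a \<in> P \<Longrightarrow> \<exists>S f. finite S \<and> (\<forall>i\<in>S. f i \<in> P \<inter> homog A i) \<and> a = (\<Oplus> i \<in> S. f i)"
    "a \<in> P \<Longrightarrow> dgd A a \<in> P"
proof -
  have i: "ideal P A" and n: "P \<noteq> carrier A" using assms unfolding dg_prime_ideal_def dg_ideal_def by blast+
  interpret P: ideal P A by (rule i)
  show "P \<subseteq> carrier A" "\<zero> \<in> P" "\<forall>a\<in>P. \<forall>b\<in>P. a \<oplus> b \<in> P" by auto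
  show "\<forall>a\<in>P. \<forall>x\<in>carrier A. x \<otimes> a \<in> P \<and> a \<otimes> x \<in> P" using P.I_l_closed P.I_r_closed by simp
  show "\<one> \<notin> P" using P.one_imp_carrier n by blast
qed (use assms in \<open>unfold dg_prime_ideal_def dg_ideal_def, blast+\<close>)

lemma dg_prime_minus: "\<lbrakk>dg_prime_ideal P A; a \<in> P\<rbrakk> \<Longrightarrow> \<ominus> a \<in> P"
  using dg_primeD(1,4)[of P] A.l_minus[of "\<one>" a] by force

lemma dg_prime_pow:
  assumes P: "dg_prime_ideal P A" and a: "a \<in> carrier A"
  shows "a [^] (n::nat) \<in> P \<Longrightarrow> a \<in> P"
proof (induction n)
  case 0
  then show ?case using dg_primeD(5)[OF P] by simp
next
  case (Suc n)
  then show ?case using dg_primeD(6)[OF P A.nat_pow_closed[OF a, of n] a] by auto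
qed

lemma homog_pow: "a \<in> homog A i \<Longrightarrow> a [^] (n::nat) \<in> homog A (int n * i)"
proof (induction n)
  case 0
  then show ?case using dg.homog_one by simp
next
  case (Suc n)
  then show ?case using dg.homog_mult[of "a [^] n" "int n * i" a i] by (simp add: algebra_simps)
qed

lemma bounded_pos_in_dg_prime:
  assumes "dg_bounded A" and P: "dg_prime_ideal P A" and i: "0 < i" and a: "a \<in> homog A i"
  shows "a \<in> P"
proof -
  obtain n where n: "\<forall>i>n. homog A i = {\<zero>}" using assms(1) unfolding dg_bounded_def by blast
  \<comment> \<open>As \<open>i\<close> is at least 1, the power \<open>a [^] k\<close> has degree
    at least \<open>k\<close>, which exceeds \<open>n\<close>, and is therefore zero.\<close>
  define k where "k = nat (n + 1)"
  have "int k * 1 \<le> int k * i" using i by (intro mult_left_mono) auto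
  moreover have "int k > n" unfolding k_def by simp
  ultimately have "int k * i > n" by linarith
  then have "a [^] k = \<zero>" using homog_pow[OF a, of k] n by blast
  then show ?thesis using dg_prime_pow[OF P homog_carr[OF a], of k] dg_primeD(2)[OF P] by simp
qed

text \<open>Generators of odd degree square to zero, hence lie in \<open>P\<close>; so every element of \<open>A\<close> is
  congruent modulo \<open>P\<close> to one of degree zero.\<close>
lemma odd_generated_pos_in_dg_prime:
  assumes "generated_in_odd_degrees A" and P: "dg_prime_ideal P A" and i: "0 < i" and a: "a \<in> homog A i"
  shows "a \<in> P"
proof -
  obtain S where S: "S \<subseteq> \<Union>(homog A ` {i. odd i})" "generate_ring A (homog A 0 \<union> S) = carrier A"
    using assms(1) unfolding generated_in_odd_degrees_def by blast
  note Pd = dg_primeD[OF P]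
  have Pc: "p \<in> carrier A" if "p \<in> P" for p using that Pd(1) by blast
  have "\<exists>r p. r \<in> homog A 0 \<and> p \<in> P \<and> x = r \<oplus> p" if "x \<in> generate_ring A (homog A 0 \<union> S)" for x
    using that
  proof (induction rule: generate_ring.induct)
    case one
    then show ?case using dg.homog_one Pd(2) A.r_zero[OF A.one_closed] by metis
  next
    case (incl h)
    show ?case
    proof (cases "h \<in> homog A 0")
      case True
      then show ?thesis using Pd(2) A.r_zero[OF homog_carr[OF True]] by metis
    next
      case False
      then obtain j where j: "odd j" "h \<in> homog A j" using incl S(1) by blast
      have "h \<otimes> h \<in> P" using dg.odd_square[OF j] Pd(2) by simp
      then have "h \<in> P" using Pd(6)[OF homog_carr[OF j(2)] homog_carr[OF j(2)]] by blast
      then show ?thesis using homogD(2)[of 0] A.l_zero[OF homog_carr[OF j(2)]] by metis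
    qed
  next
    case (a_inv h)
    then obtain r p where h: "r \<in> homog A 0" "p \<in> P" "h = r \<oplus> p" by blast
    have "\<ominus> h = \<ominus> r \<oplus> \<ominus> p" unfolding h(3) using homog_carr[OF h(1)] Pc[OF h(2)] by (rule A.minus_add)
    then show ?case using homogD(5)[OF h(1)] dg_prime_minus[OF P h(2)] by blast
  next
    case (eng_add x y)
    obtain r p where x: "r \<in> homog A 0" "p \<in> P" "x = r \<oplus> p" using eng_add.IH(1) by blast
    obtain s q where y: "s \<in> homog A 0" "q \<in> P" "y = s \<oplus> q" using eng_add.IH(2) by blast
    have "x \<oplus> y = (r \<oplus> s) \<oplus> (p \<oplus> q)"
      unfolding x(3) y(3) using homog_carr[OF x(1)] homog_carr[OF y(1)] Pc[OF x(2)] Pc[OF y(2)] by (simp add: A.a_ac)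
    moreover have "p \<oplus> q \<in> P" using Pd(3) x(2) y(2) by blast
    ultimately show ?case using homogD(3)[OF x(1) y(1)] by blast
  next
    case (eng_mult x y)
    obtain r p where x: "r \<in> homog A 0" "p \<in> P" "x = r \<oplus> p" using eng_mult.IH(1) by blast
    obtain s q where y: "s \<in> homog A 0" "q \<in> P" "y = s \<oplus> q" using eng_mult.IH(2) by blast
    note c = homog_carr[OF x(1)] homog_carr[OF y(1)] Pc[OF x(2)] Pc[OF y(2)]
    have yc: "y \<in> carrier A" using c y(3) by simp
    have "x \<otimes> y = r \<otimes> y \<oplus> p \<otimes> y" unfolding x(3) using c yc by (simp add: A.l_distr)
    also have "r \<otimes> y = r \<otimes> s \<oplus> r \<otimes> q" unfolding y(3) using c by (simp add: A.r_distr)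
    finally have "x \<otimes> y = r \<otimes> s \<oplus> (r \<otimes> q \<oplus> p \<otimes> y)" using c yc by (simp add: A.a_assoc)
    moreover have "r \<otimes> q \<oplus> p \<otimes> y \<in> P" using Pd(3,4) x(2) y(2) c yc by blast
    ultimately show ?case using homogD(4)[OF x(1) y(1)] by blast
  qed
  then obtain r p where rp: "r \<in> homog A 0" "p \<in> P" "a = r \<oplus> p" using S(2) homog_carr[OF a] by blast
  note c = homog_carr[OF rp(1)] Pc[OF rp(2)] homog_carr[OF a]
  obtain T f where T: "finite T" "\<forall>i\<in>T. f i \<in> P \<inter> homog A i" "p = (\<Oplus> i \<in> T. f i)" using Pd(7)[OF rp(2)] by blast
  \<comment> \<open>The element \<open>p\<close> of \<open>P\<close> equals \<open>a - r\<close>.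
    Comparing its decomposition inside \<open>P\<close> with the one into \<open>\<ominus> r\<close>
    in degree 0 and \<open>a\<close> in degree \<open>i\<close> shows that \<open>a\<close> is one
    of the components in \<open>P\<close>, or zero.\<close>
  define g where "g j = (if j = 0 then \<ominus> r else a)" for j :: int
  have g: "\<forall>j\<in>{0, i}. g j \<in> homog A j" using i a homogD(5)[OF rp(1)] unfolding g_def by auto
  have "(\<Oplus>j\<in>{0, i}. g j) = \<ominus> r \<oplus> a" using i c unfolding g_def by simp
  also have "\<dots> = p" unfolding rp(3) using c by (simp add: A.r_neg1)
  finally have "(\<Oplus> i \<in> T. f i) = (\<Oplus>j\<in>{0, i}. g j)" using T(3) by simp
  then have "(if i \<in> T then f i else \<zero>) = (if i \<in> {0, i} then g i else \<zero>)"
    by (intro homog_unique) (use T g in auto)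
  then have "a = (if i \<in> T then f i else \<zero>)" using i unfolding g_def by simp
  then show ?thesis using T(2) Pd(2) by auto
qed

lemma dg_dim_eq:
  assumes "generated_in_odd_degrees A \<or> dg_bounded A"
  shows "dg_dim A = sup_chain_length (primes_over R J)"
proof -
  have pos: "\<forall>i>0. homog A i \<subseteq> P" if "dg_prime_ideal P A" for P
    using assms bounded_pos_in_dg_prime[OF _ that] odd_generated_pos_in_dg_prime[OF _ that] by blast
  have deg0: "P \<inter> homog A 0 \<in> primes_over R J" if P: "dg_prime_ideal P A" for P
  proof -
    note Pd = dg_primeD[OF P]
    have "primeideal (P \<inter> homog A 0) R"
    proof (intro R.primeideal_of_closed R.ideal_of_closed)
      show "\<one>\<^bsub>R\<^esub> \<notin> P \<inter> homog A 0" using Pd(5) by simp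
      show "a \<in> P \<inter> homog A 0 \<or> b \<in> P \<inter> homog A 0"
        if "a \<otimes>\<^bsub>R\<^esub> b \<in> P \<inter> homog A 0" "a \<in> carrier R" "b \<in> carrier R" for a b
        using Pd(6)[of a b] that homog_carr by simp
      show "a \<oplus>\<^bsub>R\<^esub> b \<in> P \<inter> homog A 0" if "a \<in> P \<inter> homog A 0" "b \<in> P \<inter> homog A 0" for a b
        using Pd(3) homogD(3) that by simp
      show "x \<otimes>\<^bsub>R\<^esub> a \<in> P \<inter> homog A 0" if "a \<in> P \<inter> homog A 0" "x \<in> carrier R" for x a
        using Pd(4) homogD(4) that homog_carr by simp
    qed (use Pd(2) homogD(2) in simp_all)
    moreover have "J \<subseteq> P"
    proof
      fix x assume "x \<in> J"
      then obtain a where a: "a \<in> homog A 1" "x = dgd A a" unfolding J_def by blast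
      have "a \<in> P" using pos[OF P, rule_format, of 1] a(1) by auto
      then show "x \<in> P" using Pd(8) a(2) by simp
    qed
    ultimately show ?thesis unfolding primes_over_def using J_closed by simp
  qed
  \<comment> \<open>A DG prime contains all positive degrees, so it is determined by its part of
    degree 0; this makes restriction to degree 0 strictly monotone.\<close>
  have le: "Q \<subseteq> P" if P: "dg_prime_ideal P A" and Q: "dg_prime_ideal Q A" and QP: "Q \<inter> homog A 0 \<subseteq> P" for P Q
  proof
    fix q assume "q \<in> Q"
    then obtain T f where T: "finite T" "\<forall>i\<in>T. f i \<in> Q \<inter> homog A i" "q = (\<Oplus> i \<in> T. f i)" using dg_primeD(7)[OF Q] by blast
    note Pd = dg_primeD[OF P]
    have "f i \<in> P" if i: "i \<in> T" for i
    proof -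
      have fi: "f i \<in> Q" "f i \<in> homog A i" using T(2) i by auto
      consider "i < 0" | "i = 0" | "0 < i" by linarith
      then show ?thesis
      proof cases
        case 1
        then show ?thesis using fi(2) dg.homog_neg Pd(2) by auto
      next
        case 2
        then show ?thesis using fi QP by auto
      next
        case 3
        then show ?thesis using fi(2) pos[OF P] by blast
      qed
    qed
    then have "\<forall>i\<in>T. f i \<in> P" by (intro ballI)
    then show "q \<in> P" unfolding T(3) by (rule A.finsum_mem[OF T(1) Pd(2,3,1)])
  qed
  have ext: "deg0_prime A p" if "p \<in> primes_over R J" for p
    using that unfolding primes_over_def
    by (intro deg0_prime.intro deg0_prime_axioms.intro dg_over_deg0_axioms) simp_all
  show ?thesis unfolding dg_dim_def
  proof (rule antisym)
    show "sup_chain_length {P. dg_prime_ideal P A} \<le> sup_chain_length (primes_over R J)"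
    proof (rule sup_chain_length_map[where f = "\<lambda>P. P \<inter> homog A 0"])
      show "P \<inter> homog A 0 \<in> primes_over R J" if "P \<in> {P. dg_prime_ideal P A}" for P
        using that deg0 by simp
      show "P \<inter> homog A 0 \<subset> Q \<inter> homog A 0" if P: "P \<in> {P. dg_prime_ideal P A}" and Q: "Q \<in> {P. dg_prime_ideal P A}" and s: "P \<subset> Q" for P Q
      proof -
        have "\<not> Q \<inter> homog A 0 \<subseteq> P" using le[of P Q] P Q s by auto
        then show ?thesis using s by blast
      qed
    qed
    show "sup_chain_length (primes_over R J) \<le> sup_chain_length {P. dg_prime_ideal P A}"
    proof (rule sup_chain_length_map[where f = "deg0_prime.E A"])
      show "deg0_prime.E A p \<in> {P. dg_prime_ideal P A}" if "p \<in> primes_over R J" for p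
        using deg0_prime.E_dg_prime[OF ext[OF that]] by simp
      show "deg0_prime.E A p \<subset> deg0_prime.E A q" if p: "p \<in> primes_over R J" and q: "q \<in> primes_over R J" and s: "p \<subset> q" for p q
      proof -
        interpret p: deg0_prime A p by (rule ext[OF p])
        interpret q: deg0_prime A q by (rule ext[OF q])
        have "q.E \<inter> homog A 0 = q" "p.E \<inter> homog A 0 = p" by (rule q.E_deg0, rule p.E_deg0)
        moreover have "p.E \<subseteq> q.E"
        proof
          fix a assume "a \<in> p.E"
          then obtain T f where T: "finite T" "\<forall>i\<in>T. f i \<in> p.G i" "a = (\<Oplus>i\<in>T. f i)"
            unfolding p.E_def graded_span_def by blast
          have "p.G i \<subseteq> q.G i" for i using s by (auto simp: p.G_def q.G_def)
          then have "\<forall>i\<in>T. f i \<in> q.G i" using T(2) by blast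
          then show "a \<in> q.E" unfolding q.E_def graded_span_def using T(1,3) by blast
        qed
        ultimately show ?thesis using s by blast
      qed
    qed
  qed
qed

end

theorem theorem1p3:
  fixes A :: "('a, 'a) dg_alg" and \<mm> :: "'a set"
  assumes "dg_algebra (deg0_ring A) A"
    and "\<forall>r\<in>carrier (deg0_ring A). \<forall>a\<in>carrier A. r \<odot>\<^bsub>A\<^esub> a = r \<otimes>\<^bsub>A\<^esub> a"
    and "noetherian_ring (deg0_ring A)" and "local_ring (deg0_ring A) \<mm>"
    and "homologically_finite (deg0_ring A) (dg_cplx A)"
    and "dg_local (deg0_ring A) \<mm> A"
  shows "(\<forall>xs. set xs \<subseteq> \<mm> \<longrightarrow>
           (sop (deg0_ring A) \<mm> (dg_cplx A) xs \<longleftrightarrow>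
              module_sop (deg0_ring A) \<mm> (homology (dg_cplx A) 0) xs) \<and>
           (module_sop (deg0_ring A) \<mm> (homology (dg_cplx A) 0) xs \<longleftrightarrow>
              length_sop (deg0_ring A) \<mm> (dg_cplx A) xs)) \<and>
         (ldim (deg0_ring A) \<mm> (dg_cplx A) = cdim (deg0_ring A) (dg_cplx A) \<and>
          cdim (deg0_ring A) (dg_cplx A) = krull_dim (dg_H0 A)) \<and>
         (generated_in_odd_degrees A \<or> dg_bounded A \<longrightarrow>
           dg_dim A = ldim (deg0_ring A) \<mm> (dg_cplx A) \<and>
           ldim (deg0_ring A) \<mm> (dg_cplx A) = cdim (deg0_ring A) (dg_cplx A) \<and>
           cdim (deg0_ring A) (dg_cplx A) = krull_dim (dg_H0 A))"
proof -
  interpret dg_over_deg0 A by (rule dg_over_deg0.intro[OF assms(1,2)])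
  interpret L: noetherian_local R \<mm>
    by (intro noetherian_local.intro noetherian_local_axioms.intro noetherian_cring.intro assms(3,4) R.is_cring)
  have H0: "dg_H0 A = R Quot J" unfolding dg_H0_def J_def by simp
  interpret XC: cyclic_complex R X J "\<one>\<^bsub>A\<^esub>" by (rule X_cyclic)
  have Ji: "ideal J R" by (rule XC.I_ideal)
  \<comment> \<open>Locality of \<open>H_0(A)\<close> enters through the existence of a maximal
    ideal: the zero ring has none, so \<open>J\<close> is proper and lies in
    \<open>\<mm>\<close>.\<close>
  obtain \<nn> where "local_ring (R Quot J) \<nn>" using assms(6) unfolding dg_local_def H0 by blast
  then have nn: "maximalideal \<nn> (R Quot J)" unfolding local_ring_def by blast
  have "\<one>\<^bsub>R\<^esub> \<notin> J"
  proof
    assume "\<one>\<^bsub>R\<^esub> \<in> J"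
    then have J: "J = carrier R" by (rule ideal.one_imp_carrier[OF Ji])
    have "carrier (R Quot J) = {J}"
    proof -
      have "J +>\<^bsub>R\<^esub> x = J" if "x \<in> carrier R" for x
        using R.a_coset_join2[OF that ideal.axioms(1)[OF Ji, THEN additive_subgroup.a_subgroup]] that J by simp
      then show ?thesis using R.zero_closed unfolding FactRing_def A_RCOSETS_def' by auto
    qed
    moreover have "\<nn> \<subseteq> carrier (R Quot J)" "\<nn> \<noteq> {}"
      using additive_subgroup.a_subset[OF ideal.axioms(1)[OF maximalideal.axioms(1)[OF nn]]]
        additive_subgroup.zero_closed[OF ideal.axioms(1)[OF maximalideal.axioms(1)[OF nn]]] by blast+
    ultimately have "carrier (R Quot J) = \<nn>" by (simp add: subset_singleton_iff)
    then show False by (rule notE[OF maximalideal.I_notcarr[OF nn]])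
  qed
  then have "J \<subseteq> \<mm>" by (rule L.proper_subset_max[OF Ji])
  then interpret local_dg_algebra A \<mm>
    by (intro local_dg_algebra.intro local_dg_algebra_axioms.intro dg_over_deg0_axioms L.noetherian_local_axioms assms(5))
  have dims: "ldim R \<mm> X = sup_chain_length (primes_over R J)" "cdim R X = sup_chain_length (primes_over R J)"
    "krull_dim (dg_H0 A) = sup_chain_length (primes_over R J)"
    by (rule ldim_eq, rule XC.cdim_eq, unfold H0, rule R.krull_dim_quot[OF Ji])
  show ?thesis unfolding dims
  proof (intro conjI allI impI refl)
    fix xs assume xs: "set xs \<subseteq> \<mm>"
    show "sop R \<mm> X xs \<longleftrightarrow> module_sop R \<mm> (homology X 0) xs"
      unfolding sop_iff module_sop_iff[OF xs] using xs by simp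
    show "module_sop R \<mm> (homology X 0) xs \<longleftrightarrow> length_sop R \<mm> X xs"
      unfolding length_sop_iff module_sop_iff[OF xs] using xs by simp
  qed (rule dg_dim_eq)
qed

end
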